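(* Let $\mathcal{C}$ be a $\mathrm{Hom}$-finite $k$-linear $2$-Calabi-Yau triangulated category with split idempotents ($k$ algebraically closed) and with a cluster-tilting object $T=T_1\oplus\dots\oplus T_n$, the $T_i$ being pairwise non-isomorphic indecomposables, and let $G=\mathrm{Hom}_{\mathcal{C}}(T,?):\mathcal{C}\to\mathrm{mod}\,\mathrm{End}_{\mathcal{C}}(T)$. For each object $M$ of $\mathcal{C}$, let $(m_1,\dots,m_n)$ be the dimension vector of $GM$ and let $1\le i\le n$. Then $$-[\mathrm{coind}_T(M):T_i]+\langle S_i,e\rangle_a\ge-m_i$$ for each submodule $N$ of $GM$, where $e$ is the dimension vector of $N$. Thus the exponent of $x_i$ in the denominator of $X^T_M$ is less than or equal to $m_i$.
   Context: $2$-Calabi-Yau: there are linear forms $t_X:\mathcal{C}(X,\Sigma^2X)\to k$ such that the forms $\langle f,g\rangle=t_X(f\circ g)$ on $\mathcal{C}(Y,\Sigma^2X)\times\mathcal{C}(X,Y)$ are non-degenerate and $\langle\Sigma^pf,g\rangle=(-1)^{pq}\langle\Sigma^qg,f\rangle$ for $f\in\mathcal{C}(Y,\Sigma^qX)$, $g\in\mathcal{C}(X,\Sigma^pY)$, $p+q=2$; $\Sigma$ is the suspension. A cluster-tilting object is a basic object $T$ (summands of multiplicity one) with $\mathcal{C}(T,\Sigma T)=0$ such that every $X$ with $\mathcal{C}(T,\Sigma X)=0$ lies in $\mathrm{add}(T)$. $\mathrm{mod}$ denotes finite-dimensional right modules. $S_i$ is the simple top of the indecomposable projective $GT_i$; dimension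 vectors are taken with respect to $S_1,\dots,S_n$. For $M\in\mathcal{C}$ there is a triangle $M\to\Sigma^2T^0_M\to\Sigma^2T^1_M\to\Sigma M$ with $T^0_M,T^1_M\in\mathrm{add}(T)$; $\mathrm{coind}_T(M)=[T^0_M]-[T^1_M]\in K_0(\mathrm{add}\,T)$, and $[\,\cdot:T_i]$ is the coefficient of $[T_i]$. For finite-dimensional right $\mathrm{End}_{\mathcal{C}}(T)$-modules, $\langle L,N\rangle=\dim\mathrm{Hom}(L,N)-\dim\mathrm{Ext}^1(L,N)$ and $\langle L,N\rangle_a=\langle L,N\rangle-\langle N,L\rangle$, which descends to a bilinear form on $K_0(\mathrm{mod}\,\mathrm{End}_{\mathcal{C}}(T))$. The Laurent polynomial $$X^T_M=\prod_{i=1}^nx_i^{-[\mathrm{coind}_T(M):T_i]}\sum_e\chi\big(Gr_e(GM)\big)\prod_{i=1}^nx_i^{\langle S_i,e\rangle_a}$$ is Palu's cluster character; $Gr_e(L)$ is the variety of submodules of $L$ of class $e$ and $\chi$ the Euler characteristic (topological if $k=\mathbb{C}$, $l$-adic in general). *)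

theory Defs
  imports
    "HOL-Homology.Homology"
    "HOL-Computational_Algebra.Polynomial"
    "HOL-Number_Theory.Cong"
    "HOL-Library.Function_Algebras"
    "HOL-Library.Poly_Mapping"
begin

section \<open>Linear algebra inside an ambient vector space\<close>

text \<open>
  All vector spaces below are subspaces of an ambient vector space, which is a type together with
  a scalar multiplication \<open>sc\<close>.
\<close>

definition linear_on_sub ::
    "('k \<Rightarrow> 'a::ab_group_add \<Rightarrow> 'a) \<Rightarrow> ('k \<Rightarrow> 'b::ab_group_add \<Rightarrow> 'b) \<Rightarrow> 'a set \<Rightarrow> ('a \<Rightarrow> 'b) \<Rightarrow> bool" where
  "linear_on_sub sc sc' A f \<longleftrightarrow>
     (\<forall>x\<in>A. \<forall>y\<in>A. f (x + y) = f x + f y) \<and> (\<forall>c. \<forall>x\<in>A. f (sc c x) = sc' c (f x))"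

definition finite_dim_sub :: "('k::field \<Rightarrow> 'a::ab_group_add \<Rightarrow> 'a) \<Rightarrow> 'a set \<Rightarrow> bool" where
  "finite_dim_sub sc A \<longleftrightarrow>
     module.subspace sc A \<and> (\<exists>B. finite B \<and> B \<subseteq> A \<and> module.span sc B = A)"


section \<open>Linear categories\<close>

text \<open>
  A (small) \<open>k\<close>-linear category with object type \<open>'o\<close>.  The morphism spaces are subspaces of one
  vector space \<open>'v\<close>.  This is no restriction: every \<open>k\<close>-linear category has this form with \<open>'v\<close> the
  direct sum of all morphism spaces.  Composition (written in the usual order, \<open>g \<star> f\<close> being
  \<open>g\<close> after \<open>f\<close>) is only specified on composable pairs.
\<close>

record ('k, 'o, 'v) lincat =
  smul :: "'k \<Rightarrow> 'v \<Rightarrow> 'v"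
  homs :: "'o \<Rightarrow> 'o \<Rightarrow> 'v set"
  ident :: "'o \<Rightarrow> 'v"
  compo :: "'v \<Rightarrow> 'v \<Rightarrow> 'v"  (infixl "\<star>\<index>" 70)

text \<open>\<open>susp\<close> and \<open>suspm\<close> are the suspension on objects and morphisms; \<open>(X, Y, Z, u, v, w)\<close> in
  \<open>triangles\<close> is the distinguished triangle \<open>X \<rightarrow> Y \<rightarrow> Z \<rightarrow> \<Sigma>X\<close> with morphisms \<open>u, v, w\<close>.\<close>

record ('k, 'o, 'v) tricat = "('k, 'o, 'v) lincat" +
  susp :: "'o \<Rightarrow> 'o"
  suspm :: "'v \<Rightarrow> 'v"
  triangles :: "('o \<times> 'o \<times> 'o \<times> 'v \<times> 'v \<times> 'v) set"

definition zero_obj :: "('k, 'o, 'v::ab_group_add, 'm) lincat_scheme \<Rightarrow> 'o \<Rightarrow> bool" where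
  "zero_obj C X \<longleftrightarrow> ident C X = 0"

definition iso_mor :: "('k, 'o, 'v, 'm) lincat_scheme \<Rightarrow> 'o \<Rightarrow> 'o \<Rightarrow> 'v \<Rightarrow> bool" where
  "iso_mor C X Y f \<longleftrightarrow> f \<in> homs C X Y \<and>
     (\<exists>g\<in>homs C Y X. g \<star>\<^bsub>C\<^esub> f = ident C X \<and> f \<star>\<^bsub>C\<^esub> g = ident C Y)"

definition isomorphic :: "('k, 'o, 'v, 'm) lincat_scheme \<Rightarrow> 'o \<Rightarrow> 'o \<Rightarrow> bool" where
  "isomorphic C X Y \<longleftrightarrow> (\<exists>f. iso_mor C X Y f)"

definition is_dsum ::
    "('k, 'o, 'v::ab_group_add, 'm) lincat_scheme \<Rightarrow> 'i set \<Rightarrow> ('i \<Rightarrow> 'o) \<Rightarrow> 'o \<Rightarrow> bool" where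
  "is_dsum C I F X \<longleftrightarrow> finite I \<and>
     (\<exists>inj prj.
        (\<forall>i\<in>I. inj i \<in> homs C (F i) X \<and> prj i \<in> homs C X (F i)) \<and>
        (\<forall>i\<in>I. \<forall>j\<in>I. prj i \<star>\<^bsub>C\<^esub> inj j = (if i = j then ident C (F i) else 0)) \<and>
        (\<Sum>i\<in>I. inj i \<star>\<^bsub>C\<^esub> prj i) = ident C X)"

abbreviation is_biproduct ::
    "('k, 'o, 'v::ab_group_add, 'm) lincat_scheme \<Rightarrow> 'o \<Rightarrow> 'o \<Rightarrow> 'o \<Rightarrow> bool" where
  "is_biproduct C X Y Z \<equiv> is_dsum C (UNIV :: bool set) (\<lambda>b. if b then X else Y) Z"

definition summand :: "('k, 'o, 'v::ab_group_add, 'm) lincat_scheme \<Rightarrow> 'o \<Rightarrow> 'o \<Rightarrow> bool" where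
  "summand C X W \<longleftrightarrow> (\<exists>Y. is_biproduct C X Y W)"

definition indecomposable :: "('k, 'o, 'v::ab_group_add, 'm) lincat_scheme \<Rightarrow> 'o \<Rightarrow> bool" where
  "indecomposable C X \<longleftrightarrow> \<not> zero_obj C X \<and>
     (\<forall>Y Z. is_biproduct C Y Z X \<longrightarrow> zero_obj C Y \<or> zero_obj C Z)"

definition split_idempotents :: "('k, 'o, 'v, 'm) lincat_scheme \<Rightarrow> bool" where
  "split_idempotents C \<longleftrightarrow>
     (\<forall>X. \<forall>e\<in>homs C X X. e \<star>\<^bsub>C\<^esub> e = e \<longrightarrow>
        (\<exists>Y. \<exists>r\<in>homs C X Y. \<exists>s\<in>homs C Y X. s \<star>\<^bsub>C\<^esub> r = e \<and> r \<star>\<^bsub>C\<^esub> s = ident C Y))"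

definition hom_finite :: "('k::field, 'o, 'v::ab_group_add, 'm) lincat_scheme \<Rightarrow> bool" where
  "hom_finite C \<longleftrightarrow> (\<forall>X Y. finite_dim_sub (smul C) (homs C X Y))"

locale linear_category =
  fixes C :: "('k::field, 'o, 'v::ab_group_add, 'm) lincat_scheme" (structure)
  assumes smul_vector_space: "vector_space (smul C)"
    and homs_subspace: "module.subspace (smul C) (homs C X Y)"
    and ident_in_homs: "ident C X \<in> homs C X X"
    and compo_in_homs: "\<lbrakk>g \<in> homs C Y Z; f \<in> homs C X Y\<rbrakk> \<Longrightarrow> g \<star> f \<in> homs C X Z"
    and compo_assoc:
      "\<lbrakk>h \<in> homs C Z W; g \<in> homs C Y Z; f \<in> homs C X Y\<rbrakk> \<Longrightarrow> (h \<star> g) \<star> f = h \<star> (g \<star> f)"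
    and ident_left: "f \<in> homs C X Y \<Longrightarrow> ident C Y \<star> f = f"
    and ident_right: "f \<in> homs C X Y \<Longrightarrow> f \<star> ident C X = f"
    and compo_linear_left:
      "f \<in> homs C X Y \<Longrightarrow> linear_on_sub (smul C) (smul C) (homs C Y Z) (\<lambda>g. g \<star> f)"
    and compo_linear_right:
      "g \<in> homs C Y Z \<Longrightarrow> linear_on_sub (smul C) (smul C) (homs C X Y) (\<lambda>f. g \<star> f)"

locale additive_category = linear_category +
  assumes zero_obj_exists: "\<exists>X. zero_obj C X"
    and biproduct_exists: "\<exists>Z. is_biproduct C X Y Z"


section \<open>Triangulated categories\<close>

text \<open>The suspension is a \<open>k\<close>-linear auto-equivalence (not necessarily an automorphism).\<close>

locale triangulated_category = additive_category C
  for C :: "('k::field, 'o, 'v::ab_group_add, 'm) tricat_scheme" (structure) +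
  assumes suspm_ident: "suspm C (ident C X) = ident C (susp C X)"
    and suspm_compo:
      "\<lbrakk>g \<in> homs C Y Z; f \<in> homs C X Y\<rbrakk> \<Longrightarrow> suspm C (g \<star> f) = suspm C g \<star> suspm C f"
    and suspm_linear: "linear_on_sub (smul C) (smul C) (homs C X Y) (suspm C)"
    and suspm_bij: "bij_betw (suspm C) (homs C X Y) (homs C (susp C X) (susp C Y))"
    and susp_ess_surj: "\<exists>X. isomorphic C Y (susp C X)"
    and triangle_mors: "(X, Y, Z, u, v, w) \<in> triangles C \<Longrightarrow>
      u \<in> homs C X Y \<and> v \<in> homs C Y Z \<and> w \<in> homs C Z (susp C X)"
    and triangle_iso:
      "\<lbrakk>(X, Y, Z, u, v, w) \<in> triangles C;
        u' \<in> homs C X' Y'; v' \<in> homs C Y' Z'; w' \<in> homs C Z' (susp C X');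
        iso_mor C X X' a; iso_mor C Y Y' b; iso_mor C Z Z' c;
        b \<star> u = u' \<star> a; c \<star> v = v' \<star> b; suspm C a \<star> w = w' \<star> c\<rbrakk>
       \<Longrightarrow> (X', Y', Z', u', v', w') \<in> triangles C"
    and triangle_ident: "zero_obj C Z \<Longrightarrow> (X, X, Z, ident C X, 0, 0) \<in> triangles C"
    and triangle_exists: "u \<in> homs C X Y \<Longrightarrow> \<exists>Z v w. (X, Y, Z, u, v, w) \<in> triangles C"
    and triangle_rotate:
      "\<lbrakk>u \<in> homs C X Y; v \<in> homs C Y Z; w \<in> homs C Z (susp C X)\<rbrakk>
       \<Longrightarrow> (X, Y, Z, u, v, w) \<in> triangles C
           \<longleftrightarrow> (Y, Z, susp C X, v, w, - suspm C u) \<in> triangles C"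
    and triangle_fill:
      "\<lbrakk>(X, Y, Z, u, v, w) \<in> triangles C; (X', Y', Z', u', v', w') \<in> triangles C;
        a \<in> homs C X X'; b \<in> homs C Y Y'; b \<star> u = u' \<star> a\<rbrakk>
       \<Longrightarrow> \<exists>c\<in>homs C Z Z'. c \<star> v = v' \<star> b \<and> suspm C a \<star> w = w' \<star> c"
    and octahedral:
      "\<lbrakk>(X, Y, Z', u, j, k) \<in> triangles C; (Y, Z, X', v, l, i) \<in> triangles C;
        (X, Z, Y', v \<star> u, p, q) \<in> triangles C\<rbrakk>
       \<Longrightarrow> \<exists>f g. (Z', Y', X', f, g, suspm C j \<star> i) \<in> triangles C \<and>
             p \<star> v = f \<star> j \<and> q \<star> f = k \<and> g \<star> p = l \<and> i \<star> g = suspm C u \<star> q"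

text \<open>
  The symmetry condition is stated for natural numbers \<open>p + q = 2\<close>.  The instances with a negative
  exponent follow from \<open>p = q = 1\<close>, which gives \<open>t\<^bsub>\<Sigma>Y\<^esub>(\<Sigma>h) = - t\<^bsub>Y\<^esub>(h)\<close> (take \<open>X = \<Sigma>Y\<close> and \<open>g\<close> the
  identity).
\<close>

definition two_calabi_yau :: "('k::field, 'o, 'v::ab_group_add, 'm) tricat_scheme \<Rightarrow> bool" where
  "two_calabi_yau C \<longleftrightarrow> (\<exists>t :: 'o \<Rightarrow> 'v \<Rightarrow> 'k.
     (\<forall>X. linear_on_sub (smul C) (*) (homs C X ((susp C ^^ 2) X)) (t X)) \<and>
     (\<forall>X Y. \<forall>f\<in>homs C Y ((susp C ^^ 2) X).
        (\<forall>g\<in>homs C X Y. t X (f \<star>\<^bsub>C\<^esub> g) = 0) \<longrightarrow> f = 0) \<and>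
     (\<forall>X Y. \<forall>g\<in>homs C X Y.
        (\<forall>f\<in>homs C Y ((susp C ^^ 2) X). t X (f \<star>\<^bsub>C\<^esub> g) = 0) \<longrightarrow> g = 0) \<and>
     (\<forall>X Y p q. p + q = 2 \<longrightarrow>
        (\<forall>f\<in>homs C Y ((susp C ^^ q) X). \<forall>g\<in>homs C X ((susp C ^^ p) Y).
           t X ((suspm C ^^ p) f \<star>\<^bsub>C\<^esub> g) = (-1) ^ (p * q) * t Y ((suspm C ^^ q) g \<star>\<^bsub>C\<^esub> f))))"

definition in_add :: "('k, 'o, 'v::ab_group_add, 'm) lincat_scheme \<Rightarrow> 'o \<Rightarrow> 'o \<Rightarrow> bool" where
  "in_add C T X \<longleftrightarrow> (\<exists>(r::nat) W. is_dsum C {..<r} (\<lambda>_. T) W \<and> summand C X W)"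

definition basic_obj :: "('k, 'o, 'v::ab_group_add, 'm) lincat_scheme \<Rightarrow> 'o \<Rightarrow> bool" where
  "basic_obj C T \<longleftrightarrow>
     (\<forall>Y W. indecomposable C Y \<and> is_biproduct C Y Y W \<longrightarrow> \<not> summand C W T)"

definition cluster_tilting :: "('k, 'o, 'v::ab_group_add, 'm) tricat_scheme \<Rightarrow> 'o \<Rightarrow> bool" where
  "cluster_tilting C T \<longleftrightarrow> basic_obj C T \<and> homs C T (susp C T) = {0} \<and>
     (\<forall>X. homs C T (susp C X) = {0} \<longrightarrow> in_add C T X)"

text \<open>
  For \<open>X\<close> in \<open>add T\<close> with \<open>T\<close> the sum of the indecomposables \<open>Ti j\<close>, the group \<open>K\<^sub>0(add T)\<close> is free
  on the classes of the \<open>Ti j\<close>, and \<open>[X] = \<Sum>\<^sub>j a\<^sub>j [Ti j]\<close> means that \<open>X\<close> is a direct sum of \<open>a\<^sub>j\<close>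
  copies of each \<open>Ti j\<close>.
\<close>

definition add_class ::
    "('k, 'o, 'v::ab_group_add, 'm) lincat_scheme \<Rightarrow> ('n::finite \<Rightarrow> 'o) \<Rightarrow> 'o \<Rightarrow> ('n \<Rightarrow> nat) \<Rightarrow> bool" where
  "add_class C Ti X a \<longleftrightarrow> is_dsum C {(j, r). r < a j} (\<lambda>(j, r). Ti j) X"

text \<open>\<open>coind C Ti M j\<close> is \<open>[coind\<^sub>T(M) : Ti j]\<close>; it does not depend on the chosen triangle.\<close>

definition coind ::
    "('k, 'o, 'v::ab_group_add, 'm) tricat_scheme \<Rightarrow> ('n::finite \<Rightarrow> 'o) \<Rightarrow> 'o \<Rightarrow> 'n \<Rightarrow> int" where
  "coind C Ti M j = (THE c. \<exists>T0 T1 u v w a b.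
      (M, (susp C ^^ 2) T0, (susp C ^^ 2) T1, u, v, w) \<in> triangles C \<and>
      add_class C Ti T0 a \<and> add_class C Ti T1 b \<and> c = int (a j) - int (b j))"


section \<open>Finite-dimensional right modules over an endomorphism algebra\<close>

text \<open>
  A right module over \<open>End(T)\<close> is given by a subspace \<open>mcar\<close> of the ambient space \<open>'v\<close> and an action
  \<open>mact x a\<close>, only specified for \<open>x\<close> in \<open>mcar\<close> and \<open>a\<close> in \<open>End(T)\<close>.
\<close>

record 'v rmod =
  mcar :: "'v set"
  mact :: "'v \<Rightarrow> 'v \<Rightarrow> 'v"

definition right_module ::
    "('k::field, 'o, 'v::ab_group_add, 'm) lincat_scheme \<Rightarrow> 'o \<Rightarrow> 'v rmod \<Rightarrow> bool" where
  "right_module C T L \<longleftrightarrow> finite_dim_sub (smul C) (mcar L) \<and>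
     (\<forall>x\<in>mcar L. \<forall>a\<in>homs C T T. mact L x a \<in> mcar L) \<and>
     (\<forall>a\<in>homs C T T. linear_on_sub (smul C) (smul C) (mcar L) (\<lambda>x. mact L x a)) \<and>
     (\<forall>x\<in>mcar L. linear_on_sub (smul C) (smul C) (homs C T T) (\<lambda>a. mact L x a)) \<and>
     (\<forall>x\<in>mcar L. mact L x (ident C T) = x) \<and>
     (\<forall>x\<in>mcar L. \<forall>a\<in>homs C T T. \<forall>b\<in>homs C T T. mact L (mact L x a) b = mact L x (a \<star>\<^bsub>C\<^esub> b))"

definition functor_G :: "('k, 'o, 'v, 'm) lincat_scheme \<Rightarrow> 'o \<Rightarrow> 'o \<Rightarrow> 'v rmod" where
  "functor_G C T M = \<lparr>mcar = homs C T M, mact = (\<lambda>f a. f \<star>\<^bsub>C\<^esub> a)\<rparr>"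

definition submodule ::
    "('k::field, 'o, 'v::ab_group_add, 'm) lincat_scheme \<Rightarrow> 'o \<Rightarrow> 'v rmod \<Rightarrow> 'v set \<Rightarrow> bool" where
  "submodule C T L N \<longleftrightarrow> module.subspace (smul C) N \<and> N \<subseteq> mcar L \<and>
     (\<forall>x\<in>N. \<forall>a\<in>homs C T T. mact L x a \<in> N)"

definition restr_mod :: "'v rmod \<Rightarrow> 'v set \<Rightarrow> 'v rmod" where
  "restr_mod L N = L\<lparr>mcar := N\<rparr>"

text \<open>Maps are normalised to vanish outside the source, so that they form a vector space.\<close>

definition mod_hom ::
    "('k::field, 'o, 'v::ab_group_add, 'm) lincat_scheme \<Rightarrow> 'o \<Rightarrow> 'v rmod \<Rightarrow> 'v rmod \<Rightarrow> ('v \<Rightarrow> 'v) set" where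
  "mod_hom C T L N = {f. linear_on_sub (smul C) (smul C) (mcar L) f \<and> f ` mcar L \<subseteq> mcar N \<and>
     (\<forall>x\<in>mcar L. \<forall>a\<in>homs C T T. f (mact L x a) = mact N (f x) a) \<and> (\<forall>x. x \<notin> mcar L \<longrightarrow> f x = 0)}"

text \<open>
  \<open>quotient_iso C T L K S\<close>: the quotient of \<open>L\<close> by its submodule \<open>K\<close> is isomorphic to \<open>S\<close>.
\<close>

definition quotient_iso ::
    "('k::field, 'o, 'v::ab_group_add, 'm) lincat_scheme \<Rightarrow> 'o \<Rightarrow> 'v rmod \<Rightarrow> 'v set \<Rightarrow> 'v rmod \<Rightarrow> bool" where
  "quotient_iso C T L K S \<longleftrightarrow>
     (\<exists>f\<in>mod_hom C T L S. f ` mcar L = mcar S \<and> {x \<in> mcar L. f x = 0} = K)"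

definition maximal_submodule ::
    "('k::field, 'o, 'v::ab_group_add, 'm) lincat_scheme \<Rightarrow> 'o \<Rightarrow> 'v rmod \<Rightarrow> 'v set \<Rightarrow> bool" where
  "maximal_submodule C T L K \<longleftrightarrow> submodule C T L K \<and> K \<noteq> mcar L \<and>
     (\<forall>K'. submodule C T L K' \<and> K \<subseteq> K' \<longrightarrow> K' = K \<or> K' = mcar L)"

definition rad_mod ::
    "('k::field, 'o, 'v::ab_group_add, 'm) lincat_scheme \<Rightarrow> 'o \<Rightarrow> 'v rmod \<Rightarrow> 'v set" where
  "rad_mod C T L = mcar L \<inter> \<Inter> {K. maximal_submodule C T L K}"

definition is_top ::
    "('k::field, 'o, 'v::ab_group_add, 'm) lincat_scheme \<Rightarrow> 'o \<Rightarrow> 'v rmod \<Rightarrow> 'v rmod \<Rightarrow> bool" where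
  "is_top C T S L \<longleftrightarrow> right_module C T S \<and> quotient_iso C T L (rad_mod C T L) S"

text \<open>
  The dimension vector of \<open>L\<close> with respect to simple modules \<open>S j\<close> consists of the multiplicities of
  the \<open>S j\<close> as factors in a composition series \<open>0 = F 0 \<subset> \<dots> \<subset> F r = L\<close>, i.e. of the coordinates of
  the class of \<open>L\<close> in \<open>K\<^sub>0(mod End(T))\<close> in the basis formed by the classes of the \<open>S j\<close>.
\<close>

definition comp_series ::
    "('k::field, 'o, 'v::ab_group_add, 'm) lincat_scheme \<Rightarrow> 'o \<Rightarrow> 'v rmod \<Rightarrow> nat \<Rightarrow> (nat \<Rightarrow> 'v set) \<Rightarrow> bool" where
  "comp_series C T L r F \<longleftrightarrow> F 0 = {0} \<and> F r = mcar L \<and> (\<forall>t\<le>r. submodule C T L (F t)) \<and>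
     (\<forall>t<r. maximal_submodule C T (restr_mod L (F (Suc t))) (F t))"

definition dim_vec ::
    "('k::field, 'o, 'v::ab_group_add, 'm) lincat_scheme \<Rightarrow> 'o \<Rightarrow> ('n \<Rightarrow> 'v rmod) \<Rightarrow> 'v rmod \<Rightarrow> 'n \<Rightarrow> nat" where
  "dim_vec C T S L j = (THE m. \<exists>r F. comp_series C T L r F \<and>
      m = card {t. t < r \<and> quotient_iso C T (restr_mod L (F (Suc t))) (F t) (S j)})"

definition dim_hom ::
    "('k::field, 'o, 'v::ab_group_add, 'm) lincat_scheme \<Rightarrow> 'o \<Rightarrow> 'v rmod \<Rightarrow> 'v rmod \<Rightarrow> nat" where
  "dim_hom C T L N = vector_space.dim (\<lambda>c f x. smul C c (f x)) (mod_hom C T L N)"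

text \<open>
  \<open>Ext\<^sup>1(L, N)\<close> classifies extensions of \<open>L\<close> by \<open>N\<close>.  After splitting an extension as a vector
  space, its module structure on \<open>N \<times> L\<close> is \<open>(n, x) \<cdot> a = (n a + c x a, x a)\<close>, where associativity of the
  action is the cocycle condition on the bilinear map \<open>c\<close>; changing the splitting by a linear map
  \<open>h : L \<rightarrow> N\<close> changes \<open>c\<close> by \<open>(x, a) \<mapsto> h(x) a - h(x a)\<close>.  So \<open>Ext\<^sup>1(L, N)\<close> is the quotient of
  \<open>ext_cocycles\<close> by \<open>ext_coboundaries\<close>.
\<close>

definition ext_cocycles ::
    "('k::field, 'o, 'v::ab_group_add, 'm) lincat_scheme \<Rightarrow> 'o \<Rightarrow> 'v rmod \<Rightarrow> 'v rmod \<Rightarrow> ('v \<Rightarrow> 'v \<Rightarrow> 'v) set" where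
  "ext_cocycles C T L N = {c.
     (\<forall>x\<in>mcar L. \<forall>a\<in>homs C T T. c x a \<in> mcar N) \<and>
     (\<forall>a\<in>homs C T T. linear_on_sub (smul C) (smul C) (mcar L) (\<lambda>x. c x a)) \<and>
     (\<forall>x\<in>mcar L. linear_on_sub (smul C) (smul C) (homs C T T) (\<lambda>a. c x a)) \<and>
     (\<forall>x\<in>mcar L. \<forall>a\<in>homs C T T. \<forall>b\<in>homs C T T.
        c x (a \<star>\<^bsub>C\<^esub> b) = mact N (c x a) b + c (mact L x a) b) \<and>
     (\<forall>x a. x \<notin> mcar L \<or> a \<notin> homs C T T \<longrightarrow> c x a = 0)}"

definition ext_coboundaries ::
    "('k::field, 'o, 'v::ab_group_add, 'm) lincat_scheme \<Rightarrow> 'o \<Rightarrow> 'v rmod \<Rightarrow> 'v rmod \<Rightarrow> ('v \<Rightarrow> 'v \<Rightarrow> 'v) set" where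
  "ext_coboundaries C T L N = {c. \<exists>h.
     linear_on_sub (smul C) (smul C) (mcar L) h \<and> h ` mcar L \<subseteq> mcar N \<and>
     c = (\<lambda>x a. if x \<in> mcar L \<and> a \<in> homs C T T then mact N (h x) a - h (mact L x a) else 0)}"

definition dim_ext1 ::
    "('k::field, 'o, 'v::ab_group_add, 'm) lincat_scheme \<Rightarrow> 'o \<Rightarrow> 'v rmod \<Rightarrow> 'v rmod \<Rightarrow> int" where
  "dim_ext1 C T L N =
     int (vector_space.dim (\<lambda>k c x a. smul C k (c x a)) (ext_cocycles C T L N)) -
     int (vector_space.dim (\<lambda>k c x a. smul C k (c x a)) (ext_coboundaries C T L N))"

definition euler_form ::
    "('k::field, 'o, 'v::ab_group_add, 'm) lincat_scheme \<Rightarrow> 'o \<Rightarrow> 'v rmod \<Rightarrow> 'v rmod \<Rightarrow> int" where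
  "euler_form C T L N = int (dim_hom C T L N) - dim_ext1 C T L N"

definition euler_form_a ::
    "('k::field, 'o, 'v::ab_group_add, 'm) lincat_scheme \<Rightarrow> 'o \<Rightarrow> 'v rmod \<Rightarrow> 'v rmod \<Rightarrow> int" where
  "euler_form_a C T L N = euler_form C T L N - euler_form C T N L"

text \<open>
  \<open>\<langle>S\<^sub>i, e\<rangle>\<^sub>a\<close> for a class \<open>e = \<Sum>\<^sub>j e\<^sub>j [S\<^sub>j]\<close> in \<open>K\<^sub>0(mod End(T))\<close>: the bilinear form on this free
  group that has the value \<open>\<langle>S\<^sub>i, S\<^sub>j\<rangle>\<^sub>a\<close> at the basis elements \<open>[S\<^sub>i], [S\<^sub>j]\<close>.
\<close>

definition euler_form_K0 ::
    "('k::field, 'o, 'v::ab_group_add, 'm) lincat_scheme \<Rightarrow> 'o \<Rightarrow> ('n::finite \<Rightarrow> 'v rmod) \<Rightarrow> 'n \<Rightarrow> ('n \<Rightarrow> nat) \<Rightarrow> int" where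
  "euler_form_K0 C T S i e = (\<Sum>j\<in>UNIV. int (e j) * euler_form_a C T (S i) (S j))"


section \<open>Spaces with functions; Grassmannians of submodules\<close>

text \<open>
  A variety over an algebraically closed field is given by its set of (closed) points, its Zariski
  open subsets and the regular functions on each open subset (of a function in \<open>regfuns Y V\<close> only
  the values on \<open>V\<close> are relevant).
\<close>

record ('p, 'k) fspace =
  pts :: "'p set"
  opens :: "'p set set"
  regfuns :: "'p set \<Rightarrow> ('p \<Rightarrow> 'k) set"

inductive_set polyfuns :: "('p \<Rightarrow> 'k::comm_ring_1) set \<Rightarrow> ('p \<Rightarrow> 'k) set"
  for G :: "('p \<Rightarrow> 'k) set" where
  gen: "g \<in> G \<Longrightarrow> g \<in> polyfuns G"
| const: "(\<lambda>_. c) \<in> polyfuns G"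
| add: "\<lbrakk>f \<in> polyfuns G; g \<in> polyfuns G\<rbrakk> \<Longrightarrow> (\<lambda>x. f x + g x) \<in> polyfuns G"
| mult: "\<lbrakk>f \<in> polyfuns G; g \<in> polyfuns G\<rbrakk> \<Longrightarrow> (\<lambda>x. f x * g x) \<in> polyfuns G"

text \<open>
  Let \<open>Gr\<close> be a locally closed set of \<open>d\<close>-dimensional subspaces of a finite-dimensional vector
  space.  Its frames (ordered bases of the subspaces) form a locally closed subset of an affine
  space, with the coordinates of the basis vectors as coordinate functions, and taking the span
  is a principal \<open>GL\<^sub>d\<close>-bundle onto \<open>Gr\<close>.  Hence a subset of \<open>Gr\<close> is open, and a function on it
  regular, if and only if its pullback to the frames is.
\<close>

definition frames :: "('k::field \<Rightarrow> 'v::ab_group_add \<Rightarrow> 'v) \<Rightarrow> 'v set set \<Rightarrow> 'v list set" where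
  "frames sc Gr =
     {bs. distinct bs \<and> \<not> module.dependent sc (set bs) \<and> module.span sc (set bs) \<in> Gr}"

definition frame_polys :: "('k::field \<Rightarrow> 'v::ab_group_add \<Rightarrow> 'v) \<Rightarrow> ('v list \<Rightarrow> 'k) set" where
  "frame_polys sc = polyfuns
     {(\<lambda>bs. if r < length bs then \<phi> (bs ! r) else 0) | r \<phi>. Vector_Spaces.linear sc (*) \<phi>}"

definition grass_space ::
    "('k::field \<Rightarrow> 'v::ab_group_add \<Rightarrow> 'v) \<Rightarrow> 'v set set \<Rightarrow> ('v set, 'k) fspace" where
  "grass_space sc Gr = \<lparr>pts = Gr,
     opens = {V. V \<subseteq> Gr \<and> (\<forall>bs\<in>frames sc V. \<exists>p\<in>frame_polys sc. p bs \<noteq> 0 \<and>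
        (\<forall>bs'\<in>frames sc Gr. p bs' \<noteq> 0 \<longrightarrow> module.span sc (set bs') \<in> V))},
     regfuns = (\<lambda>V. {f. \<forall>bs\<in>frames sc V. \<exists>p\<in>frame_polys sc. \<exists>q\<in>frame_polys sc. q bs \<noteq> 0 \<and>
        (\<forall>bs'\<in>frames sc V. q bs' \<noteq> 0 \<longrightarrow> f (module.span sc (set bs')) = p bs' / q bs')})\<rparr>"

definition submod_grass ::
    "('k::field, 'o, 'v::ab_group_add, 'm) lincat_scheme \<Rightarrow> 'o \<Rightarrow> ('n \<Rightarrow> 'v rmod) \<Rightarrow> 'v rmod \<Rightarrow> ('n \<Rightarrow> nat) \<Rightarrow> 'v set set" where
  "submod_grass C T S L e = {N. submodule C T L N \<and> dim_vec C T S (restr_mod L N) = e}"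


section \<open>The topological Euler characteristic\<close>

text \<open>The analytic topology, for an identification \<open>\<sigma>\<close> of the ground field with the complex numbers:
  the coarsest one in which Zariski open sets are open and regular functions are continuous.\<close>

definition analytic_topology :: "('k \<Rightarrow> complex) \<Rightarrow> ('p, 'k) fspace \<Rightarrow> 'p topology" where
  "analytic_topology \<sigma> Y = topology_generated_by
     {{x \<in> V. \<sigma> (f x) \<in> W} | V f W. V \<in> opens Y \<and> f \<in> regfuns Y V \<and> open W}"

definition ab_rank :: "('a, 'b) monoid_scheme \<Rightarrow> nat" where
  "ab_rank H = Sup {r. \<exists>g\<in>{..<r} \<rightarrow> carrier H. \<forall>a :: nat \<Rightarrow> int.
     finprod H (\<lambda>j. g j [^]\<^bsub>H\<^esub> a j) {..<r} = \<one>\<^bsub>H\<^esub> \<longrightarrow> (\<forall>j<r. a j = 0)}"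

definition betti :: "'p topology \<Rightarrow> nat \<Rightarrow> nat" where
  "betti X p = ab_rank (homology_group (int p) X)"

definition top_euler :: "('k \<Rightarrow> complex) \<Rightarrow> ('p, 'k) fspace \<Rightarrow> int" where
  "top_euler \<sigma> Y = (\<Sum>p | betti (analytic_topology \<sigma> Y) p \<noteq> 0.
     (-1) ^ p * int (betti (analytic_topology \<sigma> Y) p))"


section \<open>The \<open>l\<close>-adic Euler characteristic\<close>

text \<open>
  \<open>H\<^sup>p(Y, \<rat>\<^sub>l)\<close> is the tensor product with \<open>\<rat>\<^sub>l\<close> of the inverse limit over \<open>n\<close> of the \'etale cohomology
  groups \<open>H\<^sup>p(Y, \<int>/l\<^sup>n)\<close>.  For a quasi-projective variety \<open>Y\<close> (such as a closed subvariety of a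
  Grassmannian) the latter are \v{C}ech cohomology groups, by a theorem of M. Artin.

  Every \'etale covering of \<open>Y\<close> is refined by a finite one whose members are of the form
  \<open>{(x, y). x \<in> V, F x y = 0, F' x y \<noteq> 0, H x y \<noteq> 0}\<close>, projected to \<open>V\<close>, for an open subset \<open>V\<close> of \<open>Y\<close> and
  polynomials \<open>F, H\<close> in one variable with regular functions on \<open>V\<close> as coefficients (\'etale morphisms
  are locally standard \'etale).  Such a member is represented by the triple \<open>(V, F, H)\<close>.
\<close>

type_synonym ('p, 'k) chart = "'p set \<times> ('p \<Rightarrow> 'k poly) \<times> ('p \<Rightarrow> 'k poly)"

definition regular_poly :: "('p, 'k::field) fspace \<Rightarrow> 'p set \<Rightarrow> ('p \<Rightarrow> 'k poly) \<Rightarrow> bool" where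
  "regular_poly Y V F \<longleftrightarrow> (\<exists>d. \<forall>x\<in>V. degree (F x) \<le> d) \<and> (\<forall>r. (\<lambda>x. coeff (F x) r) \<in> regfuns Y V)"

fun is_chart :: "('p, 'k::field) fspace \<Rightarrow> ('p, 'k) chart \<Rightarrow> bool" where
  "is_chart Y (V, F, H) \<longleftrightarrow> V \<in> opens Y \<and> regular_poly Y V F \<and> regular_poly Y V H"

fun chart_fibre :: "('p, 'k::field) chart \<Rightarrow> 'p \<Rightarrow> 'k set" where
  "chart_fibre (V, F, H) x =
     {y. x \<in> V \<and> poly (F x) y = 0 \<and> poly (pderiv (F x)) y \<noteq> 0 \<and> poly (H x) y \<noteq> 0}"

definition etale_cover :: "('p, 'k::field) fspace \<Rightarrow> ('p, 'k) chart set \<Rightarrow> bool" where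
  "etale_cover Y \<U> \<longleftrightarrow> finite \<U> \<and> (\<forall>a\<in>\<U>. is_chart Y a) \<and>
     (\<forall>x\<in>pts Y. \<exists>a\<in>\<U>. chart_fibre a x \<noteq> {})"

text \<open>
  \<open>simplices \<U> x p\<close> is the fibre over \<open>x\<close> of the \<open>(p+1)\<close>-fold fibre product over \<open>Y\<close> of the disjoint
  union of the members of \<open>\<U>\<close> with itself.
\<close>

definition cover_fibre :: "('p, 'k::field) chart set \<Rightarrow> 'p \<Rightarrow> (('p, 'k) chart \<times> 'k) set" where
  "cover_fibre \<U> x = (SIGMA a:\<U>. chart_fibre a x)"

definition simplices :: "('p, 'k::field) chart set \<Rightarrow> 'p \<Rightarrow> nat \<Rightarrow> (('p, 'k) chart \<times> 'k) list set" where
  "simplices \<U> x p = {zs. length zs = Suc p \<and> set zs \<subseteq> cover_fibre \<U> x}"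

text \<open>
  Polynomials in \<open>r\<close> variables with regular functions on \<open>V\<close> as coefficients.  Their non-vanishing
  sets, for varying \<open>V\<close>, are a base of the Zariski topology on a product of \<open>Y\<close> with affine \<open>r\<close>-space.
\<close>

definition rel_polys :: "('p, 'k::field) fspace \<Rightarrow> 'p set \<Rightarrow> nat \<Rightarrow> ('p \<times> 'k list \<Rightarrow> 'k) set" where
  "rel_polys Y V r = polyfuns
     ({(\<lambda>(x, ys). f x) | f. f \<in> regfuns Y V} \<union> {(\<lambda>(x, ys). ys ! j) | j. j < r})"

type_synonym ('p, 'k) cochain = "'p \<Rightarrow> (('p, 'k) chart \<times> 'k) list \<Rightarrow> int"

text \<open>
  A \v{C}ech \<open>p\<close>-cochain with values in \<open>\<int>/m\<close> is a Zariski-locally constant function on the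
  \<open>(p+1)\<close>-fold fibre product.  Elements of \<open>\<int>/m\<close> are represented by integers.
\<close>

definition is_cochain ::
    "('p, 'k::field) fspace \<Rightarrow> nat \<Rightarrow> ('p, 'k) chart set \<Rightarrow> nat \<Rightarrow> ('p, 'k) cochain \<Rightarrow> bool" where
  "is_cochain Y m \<U> p c \<longleftrightarrow> (\<forall>x\<in>pts Y. \<forall>zs\<in>simplices \<U> x p.
     \<exists>V\<in>opens Y. \<exists>q\<in>rel_polys Y V (Suc p). x \<in> V \<and> q (x, map snd zs) \<noteq> 0 \<and>
       (\<forall>x'\<in>V. \<forall>zs'\<in>simplices \<U> x' p. map fst zs' = map fst zs \<and> q (x', map snd zs') \<noteq> 0 \<longrightarrow>
          [c x' zs' = c x zs] (mod int m)))"

definition cech_d :: "('p, 'k) cochain \<Rightarrow> ('p, 'k) cochain" where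
  "cech_d c x zs = (\<Sum>j<length zs. (-1) ^ j * c x (take j zs @ drop (Suc j) zs))"

definition is_cocycle ::
    "('p, 'k::field) fspace \<Rightarrow> nat \<Rightarrow> ('p, 'k) chart set \<Rightarrow> nat \<Rightarrow> ('p, 'k) cochain \<Rightarrow> bool" where
  "is_cocycle Y m \<U> p c \<longleftrightarrow> is_cochain Y m \<U> p c \<and>
     (\<forall>x\<in>pts Y. \<forall>zs\<in>simplices \<U> x (Suc p). [cech_d c x zs = 0] (mod int m))"

definition is_coboundary ::
    "('p, 'k::field) fspace \<Rightarrow> nat \<Rightarrow> ('p, 'k) chart set \<Rightarrow> nat \<Rightarrow> ('p, 'k) cochain \<Rightarrow> bool" where
  "is_coboundary Y m \<U> p c \<longleftrightarrow>
     (if p = 0 then (\<forall>x\<in>pts Y. \<forall>zs\<in>simplices \<U> x 0. [c x zs = 0] (mod int m))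
      else (\<exists>b. is_cochain Y m \<U> (p - 1) b \<and>
             (\<forall>x\<in>pts Y. \<forall>zs\<in>simplices \<U> x p. [c x zs = cech_d b x zs] (mod int m))))"

text \<open>
  \<open>\<rho>\<close> is a morphism over \<open>Y\<close> from the disjoint union of the members of \<open>\<W>\<close> to that of \<open>\<U>\<close>: locally,
  it maps into a fixed member of \<open>\<U>\<close>, with second coordinate a quotient of polynomials.
\<close>

definition refines ::
    "('p, 'k::field) fspace \<Rightarrow> ('p, 'k) chart set \<Rightarrow> ('p, 'k) chart set \<Rightarrow>
     ('p \<Rightarrow> ('p, 'k) chart \<times> 'k \<Rightarrow> ('p, 'k) chart \<times> 'k) \<Rightarrow> bool" where
  "refines Y \<W> \<U> \<rho> \<longleftrightarrow> (\<forall>x\<in>pts Y. \<forall>(a, y)\<in>cover_fibre \<W> x.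
     \<rho> x (a, y) \<in> cover_fibre \<U> x \<and>
     (\<exists>V\<in>opens Y. \<exists>s\<in>rel_polys Y V 1. \<exists>q\<in>rel_polys Y V 1. x \<in> V \<and> q (x, [y]) \<noteq> 0 \<and>
        (\<forall>x'\<in>V. \<forall>y'\<in>chart_fibre a x'. q (x', [y']) \<noteq> 0 \<longrightarrow>
           \<rho> x' (a, y') = (fst (\<rho> x (a, y)), s (x', [y']) / q (x', [y'])))))"

text \<open>
  A class in \<open>H\<^sup>p(Y, \<int>/m)\<close>, the direct limit over all coverings, is represented by a covering together
  with a cocycle.  \<open>null_comb Y m p r \<alpha> \<xi>\<close>: the linear combination with coefficients \<open>\<alpha> j\<close> of the
  classes of \<open>\<xi> j\<close>, \<open>j < r\<close>, is zero.
\<close>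

definition null_comb ::
    "('p, 'k::field) fspace \<Rightarrow> nat \<Rightarrow> nat \<Rightarrow> nat \<Rightarrow> (nat \<Rightarrow> int) \<Rightarrow>
     (nat \<Rightarrow> ('p, 'k) chart set \<times> ('p, 'k) cochain) \<Rightarrow> bool" where
  "null_comb Y m p r \<alpha> \<xi> \<longleftrightarrow>
     (\<exists>\<W> \<rho>. etale_cover Y \<W> \<and> (\<forall>j<r. refines Y \<W> (fst (\<xi> j)) (\<rho> j)) \<and>
        is_coboundary Y m \<W> p (\<lambda>x zs. \<Sum>j<r. \<alpha> j * snd (\<xi> j) x (map (\<rho> j x) zs)))"

text \<open>Representatives of the elements of the inverse limit of the groups \<open>H\<^sup>p(Y, \<int>/l\<^sup>n)\<close>.\<close>

definition ladic_class ::
    "('p, 'k::field) fspace \<Rightarrow> nat \<Rightarrow> nat \<Rightarrow> (nat \<Rightarrow> ('p, 'k) chart set \<times> ('p, 'k) cochain) \<Rightarrow> bool" where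
  "ladic_class Y l p \<xi> \<longleftrightarrow>
     (\<forall>n. etale_cover Y (fst (\<xi> n)) \<and> is_cocycle Y (l ^ n) (fst (\<xi> n)) p (snd (\<xi> n)) \<and>
          null_comb Y (l ^ n) p 2 (\<lambda>j. if j = 0 then 1 else -1) (\<lambda>j. \<xi> (n + j)))"

text \<open>An \<open>l\<close>-adic integer is represented by a sequence of integers modulo \<open>l\<^sup>n\<close>.\<close>

definition ladic_int :: "nat \<Rightarrow> (nat \<Rightarrow> int) \<Rightarrow> bool" where
  "ladic_int l a \<longleftrightarrow> (\<forall>n. [a (Suc n) = a n] (mod int (l ^ n)))"

text \<open>
  The dimension of \<open>H\<^sup>p(Y, \<rat>\<^sub>l)\<close> is the maximal number of elements of the inverse limit that are linearly
  independent over \<open>\<int>\<^sub>l\<close>.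
\<close>

definition ladic_betti :: "nat \<Rightarrow> ('p, 'k::field) fspace \<Rightarrow> nat \<Rightarrow> nat" where
  "ladic_betti l Y p = Sup {r. \<exists>\<xi>. (\<forall>j<r. ladic_class Y l p (\<xi> j)) \<and>
     (\<forall>a. (\<forall>j<r. ladic_int l (a j)) \<and>
          (\<forall>n. null_comb Y (l ^ n) p r (\<lambda>j. a j n) (\<lambda>j. \<xi> j n)) \<longrightarrow>
          (\<forall>j<r. \<forall>n. [a j n = 0] (mod int (l ^ n))))}"

definition ladic_euler :: "nat \<Rightarrow> ('p, 'k::field) fspace \<Rightarrow> int" where
  "ladic_euler l Y = (\<Sum>p | ladic_betti l Y p \<noteq> 0. (-1) ^ p * int (ladic_betti l Y p))"


section \<open>The cluster character\<close>

text \<open>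
  Laurent polynomials in the variables \<open>x\<^sub>j\<close>, \<open>j :: 'n\<close>, with integer coefficients are finitely supported
  functions on the group of exponents \<open>'n \<Rightarrow> int\<close>, multiplied by convolution.
\<close>

type_synonym 'n laurent = "('n \<Rightarrow> int) \<Rightarrow>\<^sub>0 int"

text \<open>Palu's cluster character \<open>X\<^sup>T\<^sub>M\<close>, for a given Euler characteristic \<open>eul\<close>.\<close>

definition cluster_char ::
    "(('v set, 'k) fspace \<Rightarrow> int) \<Rightarrow> ('k::field, 'o, 'v::ab_group_add, 'm) tricat_scheme \<Rightarrow> 'o \<Rightarrow>
     ('n::finite \<Rightarrow> 'o) \<Rightarrow> ('n \<Rightarrow> 'v rmod) \<Rightarrow> 'o \<Rightarrow> 'n laurent" where
  "cluster_char eul C T Ti S M =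
     Poly_Mapping.single (\<lambda>i. - coind C Ti M i) 1 *
     (\<Sum>e | submod_grass C T S (functor_G C T M) e \<noteq> {}.
        Poly_Mapping.single (\<lambda>i. euler_form_K0 C T S i e)
          (eul (grass_space (smul C) (submod_grass C T S (functor_G C T M) e))))"

text \<open>The exponent of \<open>x\<^sub>i\<close> in the denominator of \<open>P\<close>, written as a reduced fraction of polynomials.\<close>

definition denom_exponent :: "'n laurent \<Rightarrow> 'n \<Rightarrow> nat" where
  "denom_exponent P i = (LEAST d. \<forall>a\<in>Poly_Mapping.keys P. 0 \<le> a i + int d)"

definition complex_iso :: "('k::field \<Rightarrow> complex) \<Rightarrow> bool" where
  "complex_iso \<sigma> \<longleftrightarrow> bij \<sigma> \<and> (\<forall>x y. \<sigma> (x + y) = \<sigma> x + \<sigma> y) \<and> (\<forall>x y. \<sigma> (x * y) = \<sigma> x * \<sigma> y)"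

end

theory Submission
  imports Defs
begin

text \<open>
  Two triangles \<open>U \<rightarrow> B' \<rightarrow> T\<^sub>i \<rightarrow> \<Sigma>U\<close> and \<open>T\<^sub>i \<rightarrow> B \<rightarrow> U \<rightarrow> \<Sigma>T\<^sub>i\<close>, with maps \<open>\<beta>\<close>, \<open>d\<close>, \<open>p\<close> and \<open>s\<close>, \<open>\<gamma>\<close>, \<open>\<epsilon>\<close>,
  control everything: \<open>d\<close> and \<open>s\<close> are approximations of the radical of \<open>add(T)\<close> at \<open>T\<^sub>i\<close>, and \<open>B\<close>, \<open>B'\<close>
  lie in \<open>add(T)\<close>. Calabi-Yau duality gives
  \<open>[coind M : T\<^sub>i] = dim p\<^sup>*Hom(\<Sigma>U, M) - dim \<epsilon>\<^sup>*Hom(\<Sigma>T\<^sub>i, M)\<close>, and the long exact sequences of the two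
  triangles turn this into \<open>[coind M : T\<^sub>i] \<le> m\<^sub>i - dim ker ((\<beta>\<gamma>)\<^sup>* : Hom(B', M) \<rightarrow> Hom(B, M))\<close>.
  On the other hand \<open>\<langle>S\<^sub>i, S\<^sub>j\<rangle>\<^sub>a\<close> is the multiplicity of \<open>T\<^sub>j\<close> in \<open>B\<close> minus that in \<open>B'\<close>, so
  \<open>\<langle>S\<^sub>i, e\<rangle>\<^sub>a = dim N(B) - dim N(B')\<close> for the extension of \<open>N\<close> to a subfunctor of \<open>Hom(?, M)\<close> on \<open>add(T)\<close>.
  As \<open>(\<beta>\<gamma>)\<^sup>*\<close> maps \<open>N(B')\<close> to \<open>N(B)\<close>, this difference is at least \<open>-dim ker (\<beta>\<gamma>)\<^sup>*\<close>.
\<close>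

section \<open>Finite-dimensional subspaces\<close>

text \<open>The quiver of End(T) may have loops and 2-cycles, and this shapes the construction. The
  usual exchange triangles approximate T_i by the other summands and lose the loops; here the
  radical is approximated with j = i allowed. Then Hom(T, \<Sigma>U) is the simple module S_i, and
  by duality Hom(\<Sigma>U, \<Sigma>^2 A) counts the copies of T_i in an object A of add(T): that is
  how a coindex becomes a difference of ranks. The two triangles must share U for the composite B ->
  U -> B' to exist. This is arranged by taking for \<open>\<epsilon>\<close> a class dual to
  \<open>p\<close>, and it then has to be proved that B lies in add(T) and that \<open>s\<close> is
  an approximation. No approximation is chosen minimal, so the multiplicities of T_j in B' and B may
  exceed dim Ext^1(S_i, S_j) and dim Ext^1(S_j, S_i). The excess is the same on both sides and
  disappears from the antisymmetrised form. On the module side, dimension vectors are turned into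
  dimensions of components of Hom(T, M), and Ext^1 between simples into the dual of rad modulo
  rad^2, by way of derivations of End(T) into the field.\<close>

lemma linear_on_sub_add:
  "\<lbrakk>linear_on_sub s1 s2 A f; x \<in> A; y \<in> A\<rbrakk> \<Longrightarrow> f (x + y) = f x + f y"
  by (auto simp: linear_on_sub_def)

lemma linear_on_sub_scale:
  "\<lbrakk>linear_on_sub s1 s2 A f; x \<in> A\<rbrakk> \<Longrightarrow> f (s1 c x) = s2 c (f x)"
  by (auto simp: linear_on_sub_def)

lemma linear_on_sub_subset:
  "\<lbrakk>linear_on_sub s1 s2 A f; B \<subseteq> A\<rbrakk> \<Longrightarrow> linear_on_sub s1 s2 B f"
  unfolding linear_on_sub_def by blast

context vector_space
begin

lemma finite_dim_sub_subspace: "finite_dim_sub scale A \<Longrightarrow> subspace A"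
  by (simp add: finite_dim_sub_def)

text \<open>The ambient space may be infinite-dimensional, so the basis comes from a maximal
  independent subset of \<open>A\<close> containing \<open>I\<close>; its finiteness follows from
  the exchange bound against the finite generating set of \<open>A\<close>.\<close>

lemma finite_dim_sub_basis:
  assumes "finite_dim_sub scale A" "I \<subseteq> A" "independent I"
  obtains B where "I \<subseteq> B" "finite B" "B \<subseteq> A" "independent B" "span B = A" "card B = dim A"
proof -
  obtain G where G: "finite G" "G \<subseteq> A" "span G = A" and A: "subspace A"
    using assms(1) by (auto simp: finite_dim_sub_def)
  obtain B where B: "I \<subseteq> B" "B \<subseteq> A" "independent B" "A \<subseteq> span B"
    using maximal_independent_subset_extend[OF assms(2,3)] by blast
  have "span B = A" using B A by (simp add: span_subspace)
  moreover have "finite B"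
    using independent_span_bound[OF G(1) B(3)] B(2) G(3) by simp
  ultimately show thesis using that B basis_card_eq_dim[OF B(2,4,3)] by blast
qed

lemma finite_dim_sub_basis_empty:
  assumes "finite_dim_sub scale A"
  obtains B where "finite B" "B \<subseteq> A" "independent B" "span B = A" "card B = dim A"
  by (rule finite_dim_sub_basis[OF assms empty_subsetI independent_empty]) (rule that)

lemma finite_dim_subI: "\<lbrakk>finite B; A = span B\<rbrakk> \<Longrightarrow> finite_dim_sub scale A"
  using span_superset by (auto simp: finite_dim_sub_def)

lemma finite_dim_sub_subset:
  assumes "finite_dim_sub scale A" "subspace U" "U \<subseteq> A"
  shows "finite_dim_sub scale U"
proof -
  obtain B where B: "B \<subseteq> U" "independent B" "U \<subseteq> span B"
    using maximal_independent_subset by blast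
  obtain B' where "B \<subseteq> B'" "finite B'" "B' \<subseteq> A" "independent B'" "span B' = A" "card B' = dim A"
    by (rule finite_dim_sub_basis[OF assms(1) subset_trans[OF B(1) assms(3)] B(2)])
  then show ?thesis using B assms(2) finite_dim_subI[of B U] finite_subset
    by (metis span_subspace)
qed

lemma finite_dim_sub_dim_mono:
  assumes "finite_dim_sub scale A" "subspace U" "U \<subseteq> A"
  shows "dim U \<le> dim A"
proof -
  obtain B where B: "finite B" "B \<subseteq> U" "independent B" "span B = U" "card B = dim U"
    by (rule finite_dim_sub_basis_empty[OF finite_dim_sub_subset[OF assms]])
  obtain B' where "B \<subseteq> B'" "finite B'" "B' \<subseteq> A" "independent B'" "span B' = A" "card B' = dim A"
    by (rule finite_dim_sub_basis[OF assms(1) subset_trans[OF B(2) assms(3)] B(3)])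
  then show ?thesis using B(5) card_mono by metis
qed

lemma finite_dim_sub_dim_eq:
  assumes "finite_dim_sub scale A" "subspace U" "U \<subseteq> A" "dim A \<le> dim U"
  shows "U = A"
proof -
  obtain B where B: "finite B" "B \<subseteq> U" "independent B" "span B = U" "card B = dim U"
    by (rule finite_dim_sub_basis_empty[OF finite_dim_sub_subset[OF assms(1-3)]])
  obtain B' where "B \<subseteq> B'" "finite B'" "B' \<subseteq> A" "independent B'" "span B' = A" "card B' = dim A"
    by (rule finite_dim_sub_basis[OF assms(1) subset_trans[OF B(2) assms(3)] B(3)])
  then show ?thesis using B assms(4) card_seteq by metis
qed

lemma dim_zero_sub [simp]: "dim {0} = 0"
  using dim_eq_card_independent[of "{}"] dim_span[of "{}"] by (simp add: independent_empty)

lemma dim_span_single: "x \<noteq> 0 \<Longrightarrow> dim (range (\<lambda>c. scale c x)) = 1"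
  using dim_eq_card_independent[of "{x}"] dim_span[of "{x}"] by (simp add: span_singleton)

end

context vector_space_pair
begin

text \<open>Nothing is known of \<open>f\<close> outside \<open>A\<close>. Extending its values on a
  basis of \<open>A\<close> gives a map that is linear everywhere, and so makes the theory of linear
  maps available to maps specified on a subspace only.\<close>

lemma linear_on_sub_linear:
  assumes "vs1.subspace A" "linear_on_sub s1 s2 A f"
  obtains g where "Vector_Spaces.linear s1 s2 g" "\<And>x. x \<in> A \<Longrightarrow> g x = f x"
proof -
  obtain B where B: "B \<subseteq> A" "vs1.independent B" "A \<subseteq> vs1.span B"
    using vs1.maximal_independent_subset by blast
  let ?g = "construct B f"
  have lin: "Vector_Spaces.linear s1 s2 ?g" by (rule linear_construct[OF B(2)])
  have A: "vs1.span B = A" using B assms(1) by (simp add: vs1.span_subspace)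
  have 0: "f 0 = 0"
    using linear_on_sub_scale[OF assms(2) vs1.subspace_0[OF assms(1)], of 0]
    by (simp add: vs1.scale_zero_left)
  have "x \<in> A \<and> ?g x = f x" if "x \<in> vs1.span B" for x
    using that
  proof (induction rule: vs1.span_induct_alt)
    case base
    then show ?case using 0 linear_0[OF lin] vs1.subspace_0[OF assms(1)] by simp
  next
    case (step c x y)
    then have x: "x \<in> A" "s1 c x \<in> A" using B(1) vs1.subspace_scale[OF assms(1)] by auto
    then have "f (s1 c x + y) = s2 c (f x) + f y"
      using step linear_on_sub_add[OF assms(2), of "s1 c x" y] linear_on_sub_scale[OF assms(2)]
      by simp
    then show ?case
      using x step construct_basis[OF B(2)] linear_add[OF lin] linear_scale[OF lin]
        vs1.subspace_add[OF assms(1)] by simp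
  qed
  then show thesis using that lin A by blast
qed

lemma linear_on_sub_0:
  assumes "vs1.subspace A" "linear_on_sub s1 s2 A f"
  shows "f 0 = 0"
  using linear_on_sub_linear[OF assms] linear_0 vs1.subspace_0[OF assms(1)] by metis

lemma linear_on_sub_diff:
  assumes "vs1.subspace A" "linear_on_sub s1 s2 A f" "x \<in> A" "y \<in> A"
  shows "f (x - y) = f x - f y"
  using linear_on_sub_linear[OF assms(1,2)] linear_diff vs1.subspace_diff[OF assms(1)] assms(3,4)
  by metis

lemma linear_on_sub_sum:
  assumes "vs1.subspace A" "linear_on_sub s1 s2 A f" "\<And>i. i \<in> I \<Longrightarrow> g i \<in> A"
  shows "f (\<Sum>i\<in>I. g i) = (\<Sum>i\<in>I. f (g i))"
proof -
  obtain h where h: "Vector_Spaces.linear s1 s2 h" "\<And>x. x \<in> A \<Longrightarrow> h x = f x"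
    using linear_on_sub_linear[OF assms(1,2)] by blast
  have "f (\<Sum>i\<in>I. g i) = h (\<Sum>i\<in>I. g i)"
    using h(2)[OF vs1.subspace_sum[OF assms(1), of I g]] assms(3) by simp
  also have "\<dots> = (\<Sum>i\<in>I. f (g i))"
    unfolding linear_sum[OF h(1)] by (rule sum.cong) (simp_all add: h(2) assms(3))
  finally show ?thesis .
qed

lemma linear_on_sub_vimage_subspace:
  assumes "vs1.subspace A" "linear_on_sub s1 s2 A f" "vs2.subspace U"
  shows "vs1.subspace {x \<in> A. f x \<in> U}"
proof -
  obtain g where g: "Vector_Spaces.linear s1 s2 g" "\<And>x. x \<in> A \<Longrightarrow> g x = f x"
    using linear_on_sub_linear[OF assms(1,2)] by blast
  have "{x \<in> A. f x \<in> U} = A \<inter> {x. g x \<in> U}" using g(2) by auto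
  then show ?thesis
    using vs1.subspace_inter[OF assms(1) linear_subspace_linear_preimage[OF g(1) assms(3)]] by simp
qed

lemma linear_on_sub_image_subspace:
  assumes "vs1.subspace A" "linear_on_sub s1 s2 A f"
  shows "vs2.subspace (f ` A)"
proof -
  obtain g where g: "Vector_Spaces.linear s1 s2 g" "\<And>x. x \<in> A \<Longrightarrow> g x = f x"
    using linear_on_sub_linear[OF assms(1,2)] by blast
  have "f ` A = g ` A" using g(2) by auto
  then show ?thesis using linear_subspace_image[OF g(1) assms(1)] by simp
qed

text \<open>A basis \<open>D\<close> of the kernel is extended to a basis \<open>B\<close> of
  \<open>A\<close>; the vectors of \<open>B - D\<close> are mapped injectively onto a basis of the
  image.\<close>

lemma rank_nullity:
  assumes "finite_dim_sub s1 A" "linear_on_sub s1 s2 A f"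
  shows "finite_dim_sub s2 (f ` A)"
    and "vs1.dim A = vs1.dim {x \<in> A. f x = 0} + vs2.dim (f ` A)"
proof -
  have A: "vs1.subspace A" using assms(1) by (rule vs1.finite_dim_sub_subspace)
  obtain g where g: "Vector_Spaces.linear s1 s2 g" "\<And>x. x \<in> A \<Longrightarrow> g x = f x"
    using linear_on_sub_linear[OF A assms(2)] by blast
  let ?K = "{x \<in> A. g x = 0}"
  have K: "vs1.subspace ?K" "?K \<subseteq> A"
    using vs1.subspace_inter[OF A linear_subspace_kernel[OF g(1)]] by (auto simp: Int_def)
  obtain D where D: "finite D" "D \<subseteq> ?K" "vs1.independent D" "vs1.span D = ?K" "card D = vs1.dim ?K"
    by (rule vs1.finite_dim_sub_basis_empty[OF vs1.finite_dim_sub_subset[OF assms(1) K]])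
  obtain B where B: "D \<subseteq> B" "finite B" "B \<subseteq> A" "vs1.independent B" "vs1.span B = A" "card B = vs1.dim A"
    by (rule vs1.finite_dim_sub_basis[OF assms(1) subset_trans[OF D(2) K(2)] D(3)])
  have indep: "vs1.independent (B - D)" using vs1.independent_mono[OF B(4)] by blast
  have inj: "inj_on g (vs1.span (B - D))"
  proof -
    have "x = 0" if x: "x \<in> vs1.span (B - D)" "g x = 0" for x
    proof -
      have "x \<in> vs1.span D" using x vs1.span_mono[of "B - D" B] B(5) D(4) by auto
      then obtain u where u: "x = (\<Sum>b\<in>D. s1 (u b) b)" using vs1.span_finite[OF D(1)] by auto
      obtain v where v: "x = (\<Sum>b\<in>B - D. s1 (v b) b)" using x(1) vs1.span_finite[of "B - D"] B(2) by auto
      \<comment> \<open>The expansions of \<open>x\<close> over \<open>D\<close> and over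
        \<open>B - D\<close>, subtracted, are one linear relation on \<open>B\<close>; independence
        of \<open>B\<close> makes all coefficients vanish.\<close>
      let ?w = "\<lambda>b. if b \<in> D then u b else - v b"
      have "(\<Sum>b\<in>B. s1 (?w b) b) = (\<Sum>b\<in>B - D. s1 (?w b) b) + (\<Sum>b\<in>D. s1 (?w b) b)"
        using B(1,2) by (simp add: sum.subset_diff)
      also have "\<dots> = - x + x" unfolding u[symmetric]
        using u v by (simp add: sum_negf vs1.scale_minus_left)
      finally have "(\<Sum>b\<in>B. s1 (?w b) b) = 0" by simp
      then have "?w b = 0" if "b \<in> B" for b
        by (rule vs1.independentD[OF B(4,2) subset_refl _ that])
      then have "\<forall>b\<in>D. u b = 0" using B(1) by (metis subsetD)
      then show ?thesis using u by (simp add: vs1.scale_zero_left)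
    qed
    then show ?thesis
      using linear_inj_on_iff_eq_0[OF g(1), of "vs1.span (B - D)"] by simp
  qed
  have "f ` A = g ` vs1.span B" using g(2) B(5) by auto
  also have "\<dots> = vs2.span (g ` B)" using linear_span_image[OF g(1)] by simp
  also have "\<dots> = vs2.span (g ` (B - D))"
  proof (rule vs2.span_eq[THEN iffD2], intro conjI image_subsetI)
    fix b assume "b \<in> B"
    show "g b \<in> vs2.span (g ` (B - D))"
    proof (cases "b \<in> D")
      case True
      then show ?thesis using D(2) vs2.span_zero by auto
    next
      case False
      then show ?thesis using \<open>b \<in> B\<close> by (simp add: vs2.span_base)
    qed
  qed (auto intro: vs2.span_base)
  finally have im: "f ` A = vs2.span (g ` (B - D))" .
  show "finite_dim_sub s2 (f ` A)"
    using vs2.finite_dim_subI[OF _ im] B(2) by simp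
  have "vs2.dim (f ` A) = card (g ` (B - D))"
    unfolding im using vs2.dim_span_eq_card_independent
      linear_independent_injective_image[OF g(1) indep inj] by simp
  also have "\<dots> = card (B - D)"
    using card_image inj inj_on_subset vs1.span_superset by metis
  also have "\<dots> = vs1.dim A - vs1.dim ?K" by (simp only: card_Diff_subset[OF D(1) B(1)] B(6) D(5))
  moreover have "vs1.dim ?K \<le> vs1.dim A" using vs1.finite_dim_sub_dim_mono[OF assms(1) K] .
  moreover have "?K = {x \<in> A. f x = 0}" using g(2) by auto
  ultimately show "vs1.dim A = vs1.dim {x \<in> A. f x = 0} + vs2.dim (f ` A)" by simp
qed

lemma dim_inj_image:
  assumes "finite_dim_sub s1 A" "linear_on_sub s1 s2 A f" "\<And>x. \<lbrakk>x \<in> A; f x = 0\<rbrakk> \<Longrightarrow> x = 0"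
  shows "vs2.dim (f ` A) = vs1.dim A"
proof -
  have "{x \<in> A. f x = 0} = {0}"
    using assms(3) linear_on_sub_0[OF _ assms(2)] vs1.finite_dim_sub_subspace[OF assms(1)]
      vs1.subspace_0 by blast
  then show ?thesis using rank_nullity(2)[OF assms(1,2)] by simp
qed

text \<open>Restricted to the preimage of \<open>U\<close>, the map keeps its whole kernel, because
  \<open>U\<close> contains 0, and has image exactly \<open>U\<close>. In effect the preimage has
  the same codimension in \<open>A\<close> as \<open>U\<close> has in the image.\<close>

lemma dim_vimage:
  assumes "finite_dim_sub s1 A" "linear_on_sub s1 s2 A f" "vs2.subspace U" "U \<subseteq> f ` A"
  shows "vs1.dim A + vs2.dim U = vs1.dim {x \<in> A. f x \<in> U} + vs2.dim (f ` A)"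
proof -
  let ?V = "{x \<in> A. f x \<in> U}"
  have A: "vs1.subspace A" by (rule vs1.finite_dim_sub_subspace[OF assms(1)])
  have V: "finite_dim_sub s1 ?V"
    by (rule vs1.finite_dim_sub_subset[OF assms(1) linear_on_sub_vimage_subspace[OF A assms(2,3)]])
      simp
  have lin: "linear_on_sub s1 s2 ?V f" by (rule linear_on_sub_subset[OF assms(2)]) simp
  have "f ` ?V = U" using assms(4) by auto
  moreover have "{x \<in> ?V. f x = 0} = {x \<in> A. f x = 0}" using vs2.subspace_0[OF assms(3)] by auto
  ultimately show ?thesis using rank_nullity(2)[OF V lin] rank_nullity(2)[OF assms(1,2)] by simp
qed

end

lemma sum_apply: "(\<Sum>i\<in>I. f i) x = (\<Sum>i\<in>I. f i x)"
  by (induction I rule: infinite_finite_induct) auto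

lemma vector_space_field: "vector_space ((*) :: 'k::field \<Rightarrow> 'k \<Rightarrow> 'k)"
  by unfold_locales (auto simp: algebra_simps)

lemma vector_space_fun:
  assumes "vector_space s"
  shows "vector_space (\<lambda>c f x. s c (f x))"
proof -
  interpret vector_space s by fact
  show ?thesis
    by unfold_locales (auto simp: fun_eq_iff scale_right_distrib scale_left_distrib)
qed

text \<open>A basis of \<open>U\<close> is extended by \<open>a\<close>, and the values 0 and 1 are
  prescribed. This later produces a derivation that detects a radical map outside the square of the
  radical.\<close>

lemma (in vector_space) separating_functional:
  assumes "subspace A" "subspace U" "U \<subseteq> A" "a \<in> A" "a \<notin> U"
  obtains \<phi> where "linear_on_sub scale (*) A \<phi>" "\<And>u. u \<in> U \<Longrightarrow> \<phi> u = 0" "\<phi> a = 1"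
proof -
  interpret vector_space_pair scale "(*)"
    using vector_space_field by (simp add: vector_space_pair_def vector_space_axioms)
  obtain B where B: "B \<subseteq> U" "independent B" "U \<subseteq> span B"
    using maximal_independent_subset by blast
  have "span B = U" using B assms(2) by (simp add: span_subspace)
  then have ind: "independent (insert a B)" using independent_insertI B(2) assms(5) by simp
  let ?g = "construct (insert a B) (\<lambda>b. if b = a then 1 else 0)"
  have lin: "Vector_Spaces.linear scale (*) ?g" by (rule linear_construct[OF ind])
  have a: "?g a = 1" using construct_basis[OF ind] by simp
  have "?g b = 0" if "b \<in> B" for b using construct_basis[OF ind] that B(1) assms(5) by auto
  then have "?g u = 0" if "u \<in> span B" for u
    using linear_eq_0_on_span[OF lin] that by blast
  then have "?g u = 0" if "u \<in> U" for u using that B(3) by blast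
  moreover have "linear_on_sub scale (*) A ?g"
    by (auto simp: linear_on_sub_def linear_add[OF lin] linear_scale[OF lin])
  ultimately show thesis using that a by blast
qed

section \<open>Ranks of bilinear pairings\<close>

context vector_space_pair
begin

text \<open>After a basis of the left radical is extended to a basis of \<open>V\<close>, an element
  of \<open>W\<close> lies in the right radical as soon as it pairs to zero with the added vectors.
  Their number therefore bounds the codimension of the right radical; the reverse inequality is the
  same statement with the arguments exchanged.\<close>

lemma pairing_dim_le:
  assumes "finite_dim_sub s1 V" "finite_dim_sub s2 W"
    and "\<And>w. w \<in> W \<Longrightarrow> linear_on_sub s1 (*) V (\<lambda>v. \<gamma> v w)"
    and "\<And>v. v \<in> V \<Longrightarrow> linear_on_sub s2 (*) W (\<gamma> v)"
  shows "vs2.dim W + vs1.dim {v \<in> V. \<forall>w\<in>W. \<gamma> v w = 0} \<le>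
    vs2.dim {w \<in> W. \<forall>v\<in>V. \<gamma> v w = 0} + vs1.dim V"
proof -
  let ?L = "{v \<in> V. \<forall>w\<in>W. \<gamma> v w = 0}" and ?R = "{w \<in> W. \<forall>v\<in>V. \<gamma> v w = 0}"
  have V: "vs1.subspace V" by (rule vs1.finite_dim_sub_subspace[OF assms(1)])
  have LV: "?L \<subseteq> V" by blast
  have L: "vs1.subspace ?L"
  proof (rule vs1.subspaceI)
    interpret p: vector_space_pair s1 "(*)"
      using vector_space_field by (simp add: vector_space_pair_def vs1.vector_space_axioms)
    show "0 \<in> ?L" using vs1.subspace_0[OF V] p.linear_on_sub_0[OF V assms(3)] by simp
  qed (auto simp: vs1.subspace_add[OF V] vs1.subspace_scale[OF V]
        linear_on_sub_add[OF assms(3)] linear_on_sub_scale[OF assms(3)])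
  obtain D where D: "finite D" "D \<subseteq> ?L" "vs1.independent D" "vs1.span D = ?L" "card D = vs1.dim ?L"
    by (rule vs1.finite_dim_sub_basis_empty[OF vs1.finite_dim_sub_subset[OF assms(1) L LV]])
  have "D \<subseteq> V" using D(2) by auto
  obtain B where B: "D \<subseteq> B" "finite B" "B \<subseteq> V" "vs1.independent B" "vs1.span B = V" "card B = vs1.dim V"
    by (rule vs1.finite_dim_sub_basis[OF assms(1) \<open>D \<subseteq> V\<close> D(3)])
  let ?E = "B - D" and ?sc = "\<lambda>(c::'a) (f::'b \<Rightarrow> 'a) x. c * f x"
  \<comment> \<open>Values of \<open>w\<close> on the added basis vectors only, put to zero
    elsewhere so that all \<open>F w\<close> lie in a finite-dimensional space of functions.\<close>
  define F where "F = (\<lambda>w v. if v \<in> B - D then \<gamma> v w else 0)"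
  interpret f: vector_space ?sc by (rule vector_space_fun[OF vector_space_field])
  interpret q: vector_space_pair s2 ?sc by unfold_locales
  have lin: "linear_on_sub s2 ?sc W F"
    using assms(4) B(3) by (auto simp: linear_on_sub_def F_def fun_eq_iff)
  have ker: "{w \<in> W. F w = 0} = ?R"
  proof (intro equalityI subsetI)
    fix w assume w: "w \<in> {w \<in> W. F w = 0}"
    interpret p: vector_space_pair s1 "(*)"
      using vector_space_field by (simp add: vector_space_pair_def vs1.vector_space_axioms)
    have wW: "w \<in> W" using w by simp
    obtain g where g: "Vector_Spaces.linear s1 (*) g" "\<And>x. x \<in> V \<Longrightarrow> g x = \<gamma> x w"
      using p.linear_on_sub_linear[OF V assms(3)[OF wW]] by blast
    have "g b = 0" if "b \<in> B" for b
    proof (cases "b \<in> D")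
      case True
      then show ?thesis using D(2) g(2) \<open>D \<subseteq> V\<close> wW by auto
    next
      case False
      then have "F w b = \<gamma> b w" using that by (simp add: F_def)
      then show ?thesis using g(2) that B(3) w by (metis (mono_tags, lifting) mem_Collect_eq subsetD zero_fun_def)
    qed
    then have "g v = 0" if "v \<in> V" for v using p.linear_eq_0_on_span[OF g(1)] that B(5) by blast
    then show "w \<in> ?R" using g(2) wW by simp
  next
    fix w assume "w \<in> ?R"
    then show "w \<in> {w \<in> W. F w = 0}" using B(3) by (auto simp: F_def fun_eq_iff)
  qed
  define \<Delta> where "\<Delta> = (\<lambda>b v. if v = b then 1 else (0::'a)) ` ?E"
  have "F w \<in> f.span \<Delta>" for w
  proof -
    have "F w = (\<Sum>b\<in>?E. ?sc (\<gamma> b w) (\<lambda>v. if v = b then 1 else 0))"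
    proof
      fix v
      have "(\<Sum>b\<in>?E. ?sc (\<gamma> b w) (\<lambda>v. if v = b then 1 else 0)) v
          = (\<Sum>b\<in>?E. if v = b then \<gamma> b w else 0)"
        by (subst sum_apply) (intro sum.cong; auto)
      also have "\<dots> = F w v" using B(2) by (simp add: F_def sum.delta')
      finally show "F w v = (\<Sum>b\<in>?E. ?sc (\<gamma> b w) (\<lambda>v. if v = b then 1 else 0)) v" by simp
    qed
    also have "\<dots> \<in> f.span \<Delta>"
      by (intro f.span_sum f.span_scale f.span_base) (auto simp: \<Delta>_def)
    finally show ?thesis .
  qed
  then have "f.dim (F ` W) \<le> card \<Delta>"
    using f.dim_le_card[of "F ` W" \<Delta>] B(2) by (auto simp: \<Delta>_def)
  also have "\<dots> \<le> card ?E" unfolding \<Delta>_def by (rule card_image_le) (use B(2) in auto)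
  also have "\<dots> = vs1.dim V - vs1.dim ?L" by (simp only: card_Diff_subset[OF D(1) B(1)] B(6) D(5))
  finally have "f.dim (F ` W) \<le> vs1.dim V - vs1.dim ?L" .
  moreover have "vs1.dim ?L \<le> vs1.dim V"
    using vs1.finite_dim_sub_dim_mono[OF assms(1) L] by blast
  ultimately show ?thesis
    using q.rank_nullity(2)[OF assms(2) lin] ker by simp
qed

text \<open>Both radicals of a pairing have the rank as codimension.\<close>

lemma pairing_dim:
  assumes "finite_dim_sub s1 V" "finite_dim_sub s2 W"
    and "\<And>w. w \<in> W \<Longrightarrow> linear_on_sub s1 (*) V (\<lambda>v. \<gamma> v w)"
    and "\<And>v. v \<in> V \<Longrightarrow> linear_on_sub s2 (*) W (\<gamma> v)"
  shows "vs2.dim W + vs1.dim {v \<in> V. \<forall>w\<in>W. \<gamma> v w = 0} =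
    vs2.dim {w \<in> W. \<forall>v\<in>V. \<gamma> v w = 0} + vs1.dim V"
proof (rule antisym[OF pairing_dim_le[OF assms]])
  interpret q: vector_space_pair s2 s1 by unfold_locales
  show "vs2.dim {w \<in> W. \<forall>v\<in>V. \<gamma> v w = 0} + vs1.dim V \<le>
    vs2.dim W + vs1.dim {v \<in> V. \<forall>w\<in>W. \<gamma> v w = 0}"
    using q.pairing_dim_le[of W V "\<lambda>w v. \<gamma> v w"] assms by simp
qed

end

context vector_space
begin

text \<open>Splitting off one index \<open>q\<close>: \<open>\<phi> q\<close> maps \<open>W\<close>
  onto \<open>U q\<close>, and its kernel is decomposed by the remaining indices. The maps are
  arbitrary rather than inclusions, so that one lemma serves Hom spaces in either variable, their
  radicals and the values of subfunctors.\<close>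

lemma dim_direct_sum:
  assumes "finite I" "finite_dim_sub scale W"
    and "\<And>p. p \<in> I \<Longrightarrow> subspace (U p)"
    and "\<And>p. p \<in> I \<Longrightarrow> linear_on_sub scale scale W (\<phi> p) \<and> \<phi> p ` W \<subseteq> U p"
    and "\<And>p. p \<in> I \<Longrightarrow> linear_on_sub scale scale (U p) (\<psi> p) \<and> \<psi> p ` U p \<subseteq> W"
    and "\<And>p q x. \<lbrakk>p \<in> I; q \<in> I; x \<in> U q\<rbrakk> \<Longrightarrow> \<phi> p (\<psi> q x) = (if p = q then x else 0)"
    and "\<And>x. x \<in> W \<Longrightarrow> (\<Sum>p\<in>I. \<psi> p (\<phi> p x)) = x"
  shows "dim W = (\<Sum>p\<in>I. dim (U p))"
  using assms
proof (induction I arbitrary: W rule: finite_induct)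
  case empty
  then have "W = {0}" using finite_dim_sub_subspace[OF empty(1)] subspace_0
    by (metis (full_types) equalityI insert_subset empty_subsetI singletonI subsetI sum.empty)
  then show ?case by simp
next
  case (insert q I)
  interpret p: vector_space_pair scale scale by unfold_locales
  let ?W = "{x \<in> W. \<phi> q x = 0}"
  have W: "subspace W" by (rule finite_dim_sub_subspace[OF insert.prems(1)])
  have lin: "linear_on_sub scale scale W (\<phi> q)" using insert.prems(3) by simp
  have sub: "subspace ?W"
    using p.linear_on_sub_vimage_subspace[OF W lin subspace_single_0] by simp
  have fin: "finite_dim_sub scale ?W"
    using finite_dim_sub_subset[OF insert.prems(1) sub] by blast
  have 0: "\<psi> r 0 = 0" if "r \<in> insert q I" for r
    using p.linear_on_sub_0[OF insert.prems(2)] insert.prems(4) that by simp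
  have "dim ?W = (\<Sum>p\<in>I. dim (U p))"
  proof (rule insert.IH[OF fin])
    fix r assume r: "r \<in> I"
    show "subspace (U r)" using insert.prems(2) r by simp
    show "linear_on_sub scale scale ?W (\<phi> r) \<and> \<phi> r ` ?W \<subseteq> U r"
      using insert.prems(3)[of r] r linear_on_sub_subset[of scale scale W "\<phi> r" ?W] by auto
    have "q \<noteq> r" using r insert.hyps(2) by auto
    then show "linear_on_sub scale scale (U r) (\<psi> r) \<and> \<psi> r ` U r \<subseteq> ?W"
      using insert.prems(4)[of r] insert.prems(5)[of q r] r by (simp add: image_subset_iff)
  next
    fix r s x assume "r \<in> I" "s \<in> I" "x \<in> U s"
    then show "\<phi> r (\<psi> s x) = (if r = s then x else 0)" using insert.prems(5) by simp
  next
    fix x assume "x \<in> ?W"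
    then show "(\<Sum>p\<in>I. \<psi> p (\<phi> p x)) = x"
      using insert.prems(6)[of x] insert.hyps 0[of q] by simp
  qed
  moreover have "\<phi> q ` W = U q"
  proof (intro equalityI subsetI)
    fix x assume "x \<in> U q"
    then show "x \<in> \<phi> q ` W" using insert.prems(4)[of q] insert.prems(5)[of q q x]
      by (simp add: image_subset_iff) (metis imageI)
  qed (use insert.prems(3) in auto)
  ultimately show ?case
    using p.rank_nullity(2)[OF insert.prems(1) lin] insert.hyps by simp
qed

end

section \<open>Calculus in linear categories\<close>

sublocale linear_category \<subseteq> vs: vector_space "smul C"
  by (rule smul_vector_space)

sublocale linear_category \<subseteq> vp: vector_space_pair "smul C" "smul C"
  by unfold_locales

sublocale linear_category \<subseteq> vk: vector_space_pair "smul C" "(*) :: 'k \<Rightarrow> 'k \<Rightarrow> 'k"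
  by (simp add: vector_space_pair_def smul_vector_space vector_space_field)

context linear_category
begin

lemma zero_in_homs [simp]: "0 \<in> homs C X Y"
  by (rule vs.subspace_0[OF homs_subspace])

lemma add_in_homs: "\<lbrakk>f \<in> homs C X Y; g \<in> homs C X Y\<rbrakk> \<Longrightarrow> f + g \<in> homs C X Y"
  by (rule vs.subspace_add[OF homs_subspace])

lemma diff_in_homs: "\<lbrakk>f \<in> homs C X Y; g \<in> homs C X Y\<rbrakk> \<Longrightarrow> f - g \<in> homs C X Y"
  by (rule vs.subspace_diff[OF homs_subspace])

lemma minus_in_homs: "f \<in> homs C X Y \<Longrightarrow> - f \<in> homs C X Y"
  by (rule vs.subspace_neg[OF homs_subspace])

lemma smul_in_homs: "f \<in> homs C X Y \<Longrightarrow> smul C c f \<in> homs C X Y"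
  by (rule vs.subspace_scale[OF homs_subspace])

lemma sum_in_homs: "(\<And>i. i \<in> I \<Longrightarrow> f i \<in> homs C X Y) \<Longrightarrow> (\<Sum>i\<in>I. f i) \<in> homs C X Y"
  by (rule vs.subspace_sum[OF homs_subspace])

lemma compo_add_left:
  "\<lbrakk>f \<in> homs C X Y; g \<in> homs C Y Z; h \<in> homs C Y Z\<rbrakk> \<Longrightarrow> (g + h) \<star> f = g \<star> f + h \<star> f"
  using linear_on_sub_add[OF compo_linear_left] by blast

lemma compo_add_right:
  "\<lbrakk>g \<in> homs C Y Z; f \<in> homs C X Y; h \<in> homs C X Y\<rbrakk> \<Longrightarrow> g \<star> (f + h) = g \<star> f + g \<star> h"
  using linear_on_sub_add[OF compo_linear_right] by blast

lemma compo_smul_left: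
  "\<lbrakk>f \<in> homs C X Y; g \<in> homs C Y Z\<rbrakk> \<Longrightarrow> smul C c g \<star> f = smul C c (g \<star> f)"
  using linear_on_sub_scale[OF compo_linear_left] by blast

lemma compo_smul_right:
  "\<lbrakk>g \<in> homs C Y Z; f \<in> homs C X Y\<rbrakk> \<Longrightarrow> g \<star> smul C c f = smul C c (g \<star> f)"
  using linear_on_sub_scale[OF compo_linear_right] by blast

lemma compo_zero_left: "f \<in> homs C X Y \<Longrightarrow> 0 \<star> f = 0"
  using vp.linear_on_sub_0[OF homs_subspace compo_linear_left] .

lemma compo_zero_right: "g \<in> homs C Y Z \<Longrightarrow> g \<star> 0 = 0"
  using vp.linear_on_sub_0[OF homs_subspace compo_linear_right] .

lemma compo_diff_left:
  "\<lbrakk>f \<in> homs C X Y; g \<in> homs C Y Z; h \<in> homs C Y Z\<rbrakk> \<Longrightarrow> (g - h) \<star> f = g \<star> f - h \<star> f"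
  using vp.linear_on_sub_diff[OF homs_subspace compo_linear_left] by blast

lemma compo_diff_right:
  "\<lbrakk>g \<in> homs C Y Z; f \<in> homs C X Y; h \<in> homs C X Y\<rbrakk> \<Longrightarrow> g \<star> (f - h) = g \<star> f - g \<star> h"
  using vp.linear_on_sub_diff[OF homs_subspace compo_linear_right] by blast

lemma compo_minus_left: "\<lbrakk>f \<in> homs C X Y; g \<in> homs C Y Z\<rbrakk> \<Longrightarrow> (- g) \<star> f = - (g \<star> f)"
  using compo_diff_left[of f X Y 0 Z g] compo_zero_left by simp

lemma compo_minus_right: "\<lbrakk>g \<in> homs C Y Z; f \<in> homs C X Y\<rbrakk> \<Longrightarrow> g \<star> (- f) = - (g \<star> f)"
  using compo_diff_right[of g Y Z 0 X f] compo_zero_right by simp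

lemma compo_sum_left:
  "\<lbrakk>f \<in> homs C X Y; \<And>i. i \<in> I \<Longrightarrow> g i \<in> homs C Y Z\<rbrakk> \<Longrightarrow> (\<Sum>i\<in>I. g i) \<star> f = (\<Sum>i\<in>I. g i \<star> f)"
  using vp.linear_on_sub_sum[OF homs_subspace compo_linear_left] .

lemma compo_sum_right:
  "\<lbrakk>g \<in> homs C Y Z; \<And>i. i \<in> I \<Longrightarrow> f i \<in> homs C X Y\<rbrakk> \<Longrightarrow> g \<star> (\<Sum>i\<in>I. f i) = (\<Sum>i\<in>I. g \<star> f i)"
  using vp.linear_on_sub_sum[OF homs_subspace compo_linear_right] .

lemma homs_zero_target: "\<lbrakk>zero_obj C Y; f \<in> homs C X Y\<rbrakk> \<Longrightarrow> f = 0"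
  using ident_left[of f X Y] compo_zero_left[of f X Y] by (simp add: zero_obj_def)

lemma iso_morE:
  assumes "iso_mor C X Y f"
  obtains g where "f \<in> homs C X Y" "g \<in> homs C Y X" "g \<star> f = ident C X" "f \<star> g = ident C Y"
  using assms unfolding iso_mor_def by blast

lemma iso_mor_ident: "iso_mor C X X (ident C X)"
  unfolding iso_mor_def using ident_in_homs ident_left by blast

subsection \<open>Direct sums\<close>

text \<open>The structure maps that \<open>is_dsum\<close> hides behind an existential quantifier;
  once named, they can be transported along the suspension and used to form components of
  morphisms.\<close>

definition dsum_maps :: "'i set \<Rightarrow> ('i \<Rightarrow> 'o) \<Rightarrow> 'o \<Rightarrow> ('i \<Rightarrow> 'v) \<Rightarrow> ('i \<Rightarrow> 'v) \<Rightarrow> bool" where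
  "dsum_maps I F X emb prj \<longleftrightarrow> finite I \<and>
     (\<forall>i\<in>I. emb i \<in> homs C (F i) X \<and> prj i \<in> homs C X (F i)) \<and>
     (\<forall>i\<in>I. \<forall>j\<in>I. prj i \<star> emb j = (if i = j then ident C (F i) else 0)) \<and>
     (\<Sum>i\<in>I. emb i \<star> prj i) = ident C X"

lemma is_dsum_iff: "is_dsum C I F X \<longleftrightarrow> (\<exists>emb prj. dsum_maps I F X emb prj)"
  by (auto simp: is_dsum_def dsum_maps_def)

lemma dsum_maps_in_homs:
  assumes "dsum_maps I F X emb prj" "i \<in> I"
  shows "emb i \<in> homs C (F i) X" "prj i \<in> homs C X (F i)"
  using assms by (auto simp: dsum_maps_def)

lemma dsum_maps_prj_inj:
  "\<lbrakk>dsum_maps I F X emb prj; i \<in> I; j \<in> I\<rbrakk> \<Longrightarrow> prj i \<star> emb j = (if i = j then ident C (F i) else 0)"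
  by (auto simp: dsum_maps_def)

lemma dsum_maps_finite: "dsum_maps I F X emb prj \<Longrightarrow> finite I"
  by (auto simp: dsum_maps_def)

lemma dsum_decomp_source:
  assumes "dsum_maps I F X emb prj" "f \<in> homs C X Y"
  shows "(\<Sum>i\<in>I. (f \<star> emb i) \<star> prj i) = f"
proof -
  note h = dsum_maps_in_homs[OF assms(1)]
  have "(\<Sum>i\<in>I. (f \<star> emb i) \<star> prj i) = (\<Sum>i\<in>I. f \<star> (emb i \<star> prj i))"
    by (rule sum.cong[OF refl]) (rule compo_assoc[OF assms(2) h])
  also have "\<dots> = f \<star> (\<Sum>i\<in>I. emb i \<star> prj i)"
    by (rule compo_sum_right[OF assms(2), symmetric]) (auto intro: h compo_in_homs)
  also have "\<dots> = f" using assms ident_right by (simp add: dsum_maps_def)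
  finally show ?thesis .
qed

lemma dsum_decomp_target:
  assumes "dsum_maps I F X emb prj" "f \<in> homs C Y X"
  shows "(\<Sum>i\<in>I. emb i \<star> (prj i \<star> f)) = f"
proof -
  note h = dsum_maps_in_homs[OF assms(1)]
  have "(\<Sum>i\<in>I. emb i \<star> (prj i \<star> f)) = (\<Sum>i\<in>I. (emb i \<star> prj i) \<star> f)"
    by (rule sum.cong[OF refl]) (rule compo_assoc[OF h assms(2), symmetric])
  also have "\<dots> = (\<Sum>i\<in>I. emb i \<star> prj i) \<star> f"
    by (rule compo_sum_left[OF assms(2), symmetric]) (auto intro: h compo_in_homs)
  also have "\<dots> = f" using assms ident_left by (simp add: dsum_maps_def)
  finally show ?thesis .
qed

lemma prj_compo_inj:
  assumes "dsum_maps I F X emb prj" "i \<in> I" "j \<in> I" "f \<in> homs C Y (F j)"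
  shows "prj i \<star> (emb j \<star> f) = (if i = j then f else 0)"
proof -
  note h = dsum_maps_in_homs[OF assms(1)]
  have "prj i \<star> (emb j \<star> f) = (prj i \<star> emb j) \<star> f"
    by (rule compo_assoc[symmetric]) (use assms h in auto)
  then show ?thesis
    using assms ident_left[OF assms(4)] compo_zero_left[OF assms(4)]
    by (simp add: dsum_maps_prj_inj[OF assms(1)])
qed

lemma compo_prj_inj:
  assumes "dsum_maps I F X emb prj" "i \<in> I" "j \<in> I" "f \<in> homs C (F i) Y"
  shows "(f \<star> prj i) \<star> emb j = (if i = j then f else 0)"
proof -
  note h = dsum_maps_in_homs[OF assms(1)]
  have "(f \<star> prj i) \<star> emb j = f \<star> (prj i \<star> emb j)"
    by (rule compo_assoc[OF assms(4)]) (use assms h in auto)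
  then show ?thesis
    using assms ident_right[OF assms(4)] compo_zero_right[OF assms(4)]
    by (cases "i = j") (simp_all add: dsum_maps_prj_inj[OF assms(1)])
qed

lemma is_dsum_empty: "is_dsum C {} F X \<longleftrightarrow> zero_obj C X"
  by (auto simp: is_dsum_def zero_obj_def)

lemma is_dsum_insert:
  assumes "is_biproduct C (F a) X Z" "is_dsum C I F X" "a \<notin> I"
  shows "is_dsum C (insert a I) F Z"
proof -
  obtain j q where jq: "dsum_maps (UNIV::bool set) (\<lambda>b. if b then F a else X) Z j q"
    using assms(1) is_dsum_iff by blast
  obtain emb prj where ip: "dsum_maps I F X emb prj"
    using assms(2) is_dsum_iff by blast
  note h = dsum_maps_in_homs[OF jq UNIV_I, of True, simplified]
    dsum_maps_in_homs[OF jq UNIV_I, of False, simplified]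
  note h' = dsum_maps_in_homs[OF ip]
  let ?j = "\<lambda>i. if i = a then j True else j False \<star> emb i"
  let ?q = "\<lambda>i. if i = a then q True else prj i \<star> q False"
  have qj: "q b \<star> j b' = (if b = b' then ident C (if b then F a else X) else 0)" for b b'
    using dsum_maps_prj_inj[OF jq] by simp
  have c1: "q False \<star> (j False \<star> emb i) = emb i" if "i \<in> I" for i
    using compo_assoc[OF h(4,3) h'(1)[OF that]] qj[of False False] ident_left[OF h'(1)[OF that]] by simp
  have c2: "q True \<star> (j False \<star> emb i) = 0" if "i \<in> I" for i
    using compo_assoc[OF h(2,3) h'(1)[OF that]] qj[of True False] compo_zero_left[OF h'(1)[OF that]] by simp
  have c3: "(prj i \<star> q False) \<star> j True = 0" if "i \<in> I" for i
    using compo_assoc[OF h'(2)[OF that] h(4,1)] qj[of False True] compo_zero_right[OF h'(2)[OF that]] by simp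
  have c4: "(prj i \<star> q False) \<star> (j False \<star> emb k) = prj i \<star> emb k" if "i \<in> I" "k \<in> I" for i k
    using compo_assoc[OF h'(2)[OF that(1)] h(4) compo_in_homs[OF h(3) h'(1)[OF that(2)]]] c1[OF that(2)]
    by simp
  have "(\<Sum>i\<in>I. (j False \<star> emb i) \<star> (prj i \<star> q False)) = j False \<star> q False"
  proof -
    have "(\<Sum>i\<in>I. (j False \<star> emb i) \<star> (prj i \<star> q False)) = (\<Sum>i\<in>I. ((j False \<star> emb i) \<star> prj i) \<star> q False)"
      by (intro sum.cong refl compo_assoc[symmetric]) (auto intro!: compo_in_homs h h')
    also have "\<dots> = (\<Sum>i\<in>I. (j False \<star> emb i) \<star> prj i) \<star> q False"
      by (rule compo_sum_left[OF h(4), symmetric]) (auto intro!: compo_in_homs h h')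
    finally show ?thesis by (simp add: dsum_decomp_source[OF ip h(3)])
  qed
  moreover have "(\<Sum>i\<in>I. ?j i \<star> ?q i) = (\<Sum>i\<in>I. (j False \<star> emb i) \<star> (prj i \<star> q False))"
    by (rule sum.cong[OF refl]) (use assms(3) in auto)
  ultimately have "(\<Sum>i\<in>insert a I. ?j i \<star> ?q i) = j True \<star> q True + j False \<star> q False"
    using sum.insert[OF dsum_maps_finite[OF ip] assms(3), of "\<lambda>i. ?j i \<star> ?q i"] by simp
  also have "\<dots> = ident C Z" using jq by (simp add: dsum_maps_def UNIV_bool add.commute)
  finally have "dsum_maps (insert a I) F Z ?j ?q"
    unfolding dsum_maps_def using assms(3) dsum_maps_finite[OF ip]
      dsum_maps_prj_inj[OF ip] c2 c3 c4 qj[of True True]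
    by (auto intro!: compo_in_homs h h')
  then show ?thesis using is_dsum_iff by blast
qed

text \<open>The idempotent \<open>ident C X - g \<star> f\<close> is split. It annihilates
  \<open>f\<close> and \<open>g\<close> on the appropriate sides, and this passes to its splitting
  maps \<open>r\<close> and \<open>s\<close>.\<close>

lemma idempotent_complement:
  assumes "split_idempotents C" "f \<in> homs C X Y" "g \<in> homs C Y X" "f \<star> g = ident C Y"
  obtains Z r s where "is_biproduct C Y Z X" "r \<in> homs C X Z" "s \<in> homs C Z X"
    "s \<star> r = ident C X - g \<star> f" "r \<star> s = ident C Z" "f \<star> s = 0" "r \<star> g = 0"
proof -
  let ?e = "ident C X - g \<star> f"
  note gf = compo_in_homs[OF assms(3,2)]
  have e: "?e \<in> homs C X X" using gf ident_in_homs diff_in_homs by blast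
  have fe: "f \<star> ?e = 0"
    using compo_diff_right[OF assms(2) ident_in_homs gf] ident_right[OF assms(2)]
      compo_assoc[OF assms(2,3,2)] assms(4) ident_left[OF assms(2)] by simp
  have eg: "?e \<star> g = 0"
    using compo_diff_left[OF assms(3) ident_in_homs gf] ident_left[OF assms(3)]
      compo_assoc[OF assms(3,2,3)] assms(4) ident_right[OF assms(3)] by simp
  have "?e \<star> ?e = ?e"
    using compo_diff_left[OF e ident_in_homs gf] ident_left[OF e] compo_assoc[OF assms(3,2) e] fe
      compo_zero_right[OF assms(3)] by simp
  then obtain Z r s where rs: "r \<in> homs C X Z" "s \<in> homs C Z X" "s \<star> r = ?e" "r \<star> s = ident C Z"
    using assms(1) e unfolding split_idempotents_def by blast
  have "?e \<star> s = s"
    using compo_assoc[OF rs(2,1,2)] rs(3,4) ident_right[OF rs(2)] by simp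
  then have fs: "f \<star> s = 0"
    using compo_assoc[OF assms(2) e rs(2)] fe compo_zero_left[OF rs(2)] by simp
  have "r \<star> ?e = r"
    using compo_assoc[OF rs(1,2,1)] rs(3,4) ident_left[OF rs(1)] by simp
  then have rg: "r \<star> g = 0"
    using compo_assoc[OF rs(1) e assms(3)] eg compo_zero_right[OF rs(1)] by simp
  have "dsum_maps (UNIV::bool set) (\<lambda>b. if b then Y else Z) X
      (\<lambda>b. if b then g else s) (\<lambda>b. if b then f else r)"
    unfolding dsum_maps_def using assms rs fs rg by (auto simp: UNIV_bool)
  then have "is_biproduct C Y Z X" using is_dsum_iff by blast
  then show thesis using that rs fs rg by blast
qed

end

lemma (in additive_category) dsum_exists:
  assumes "finite I"
  shows "\<exists>X. is_dsum C I F X"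
  using assms
proof (induction I rule: finite_induct)
  case empty
  then show ?case using zero_obj_exists is_dsum_empty by blast
next
  case (insert a I)
  then show ?case using is_dsum_insert[of F a] biproduct_exists by blast
qed

section \<open>Exact sequences from triangles\<close>

context triangulated_category
begin

lemma suspm_in_homs: "f \<in> homs C X Y \<Longrightarrow> suspm C f \<in> homs C (susp C X) (susp C Y)"
  using suspm_bij bij_betw_apply by metis

lemma suspm_surj:
  assumes "g \<in> homs C (susp C X) (susp C Y)"
  obtains f where "f \<in> homs C X Y" "g = suspm C f"
  using assms suspm_bij[of X Y] unfolding bij_betw_def by blast

lemma suspm_inj: "\<lbrakk>suspm C f = suspm C g; f \<in> homs C X Y; g \<in> homs C X Y\<rbrakk> \<Longrightarrow> f = g"
  using suspm_bij[of X Y] unfolding bij_betw_def by (meson inj_onD)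

lemma suspm_0 [simp]: "suspm C 0 = 0"
  by (rule vp.linear_on_sub_0[OF homs_subspace suspm_linear])

lemma suspm_diff: "\<lbrakk>f \<in> homs C X Y; g \<in> homs C X Y\<rbrakk> \<Longrightarrow> suspm C (f - g) = suspm C f - suspm C g"
  using vp.linear_on_sub_diff[OF homs_subspace suspm_linear] by blast

lemma suspm_minus: "f \<in> homs C X Y \<Longrightarrow> suspm C (- f) = - suspm C f"
  using suspm_diff[of 0 X Y f] by simp

lemma suspm_smul: "f \<in> homs C X Y \<Longrightarrow> suspm C (smul C c f) = smul C c (suspm C f)"
  using linear_on_sub_scale[OF suspm_linear] by blast

lemma suspm_eq_0: "\<lbrakk>suspm C f = 0; f \<in> homs C X Y\<rbrakk> \<Longrightarrow> f = 0"
  using suspm_inj[of f 0 X Y] by simp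

lemma suspm_sum: "(\<And>i. i \<in> I \<Longrightarrow> f i \<in> homs C X Y) \<Longrightarrow> suspm C (\<Sum>i\<in>I. f i) = (\<Sum>i\<in>I. suspm C (f i))"
  using vp.linear_on_sub_sum[OF homs_subspace suspm_linear] .

lemma zero_obj_susp: "zero_obj C X \<Longrightarrow> zero_obj C (susp C X)"
  using suspm_ident[of X] by (simp add: zero_obj_def)

lemma dsum_maps_susp:
  assumes "dsum_maps I F X emb prj"
  shows "dsum_maps I (\<lambda>i. susp C (F i)) (susp C X) (\<lambda>i. suspm C (emb i)) (\<lambda>i. suspm C (prj i))"
proof -
  note h = dsum_maps_in_homs[OF assms]
  have 1: "suspm C (emb i) \<star> suspm C (prj i) = suspm C (emb i \<star> prj i)" if "i \<in> I" for i
    using suspm_compo[OF h[OF that]] by simp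
  have 2: "suspm C (prj i) \<star> suspm C (emb j) = suspm C (prj i \<star> emb j)" if "i \<in> I" "j \<in> I" for i j
    using suspm_compo[OF h(2)[OF that(1)] h(1)[OF that(2)]] by simp
  have "(\<Sum>i\<in>I. suspm C (emb i) \<star> suspm C (prj i)) = (\<Sum>i\<in>I. suspm C (emb i \<star> prj i))"
    using 1 by (rule sum.cong[OF refl])
  also have "\<dots> = suspm C (\<Sum>i\<in>I. emb i \<star> prj i)"
    by (rule suspm_sum[symmetric]) (auto intro: compo_in_homs h)
  finally have "(\<Sum>i\<in>I. suspm C (emb i) \<star> suspm C (prj i)) = ident C (susp C X)"
    using assms suspm_ident by (simp add: dsum_maps_def)
  then show ?thesis
    using assms 2 suspm_ident by (auto simp: dsum_maps_def suspm_in_homs)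
qed

lemma triangle_in_homs:
  assumes "(X, Y, Z, u, v, w) \<in> triangles C"
  shows "u \<in> homs C X Y" "v \<in> homs C Y Z" "w \<in> homs C Z (susp C X)"
  using triangle_mors[OF assms] by auto

lemma triangle_rotateD:
  "(X, Y, Z, u, v, w) \<in> triangles C \<Longrightarrow> (Y, Z, susp C X, v, w, - suspm C u) \<in> triangles C"
  using triangle_rotate triangle_mors by metis

text \<open>The triangle X -> X -> 0 maps to the given one by the identity and \<open>u\<close>; the
  fill-in shows that \<open>v \<star> u\<close> factors through a zero object.\<close>

lemma triangle_compo_zero:
  assumes "(X, Y, Z, u, v, w) \<in> triangles C"
  shows "v \<star> u = 0"
proof -
  obtain Z0 where Z0: "zero_obj C Z0" using zero_obj_exists by blast
  note h = triangle_in_homs[OF assms]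
  obtain c where "c \<in> homs C Z0 Z" "c \<star> 0 = v \<star> u"
    using triangle_fill[OF triangle_ident[OF Z0] assms ident_in_homs h(1) refl] by blast
  then show ?thesis using compo_zero_right by simp
qed

lemma triangle_compo_zero':
  "(X, Y, Z, u, v, w) \<in> triangles C \<Longrightarrow> w \<star> v = 0"
  by (rule triangle_compo_zero[OF triangle_rotateD])

lemma triangle_compo_zero'':
  assumes "(X, Y, Z, u, v, w) \<in> triangles C"
  shows "suspm C u \<star> w = 0"
  using triangle_compo_zero[OF triangle_rotateD[OF triangle_rotateD[OF assms]]]
    compo_minus_left[OF triangle_in_homs(3)[OF assms] suspm_in_homs[OF triangle_in_homs(1)[OF assms]]]
  by simp

text \<open>Exactness of Hom(W, ?) at \<open>Y\<close>. The given triangle is compared with a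
  rotation of the trivial triangle on \<open>W\<close>; the axiom fills in only a third morphism, so
  the lift appears suspended and is brought back because the suspension is bijective on
  morphisms.\<close>

lemma lift_first:
  assumes "(X, Y, Z, u, v, w) \<in> triangles C" "g \<in> homs C W Y" "v \<star> g = 0"
  obtains h where "h \<in> homs C W X" "u \<star> h = g"
proof -
  obtain Z0 where Z0: "zero_obj C Z0" using zero_obj_exists by blast
  note t = triangle_in_homs[OF assms(1)]
  have tri: "(W, Z0, susp C W, 0, 0, - suspm C (ident C W)) \<in> triangles C"
    by (rule triangle_rotateD[OF triangle_ident[OF Z0]])
  have "0 \<star> 0 = v \<star> g" using assms(3) compo_zero_left[of 0 W Z0] by simp
  then obtain c where c: "c \<in> homs C (susp C W) (susp C X)"
      "suspm C g \<star> (- suspm C (ident C W)) = (- suspm C u) \<star> c"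
    using triangle_fill[OF tri triangle_rotateD[OF assms(1)] assms(2) zero_in_homs] by blast
  obtain h where h: "h \<in> homs C W X" "c = suspm C h" using suspm_surj[OF c(1)] .
  have "suspm C g = suspm C (u \<star> h)"
    using c h suspm_ident compo_minus_right[OF suspm_in_homs[OF assms(2)] ident_in_homs]
      ident_right[OF suspm_in_homs[OF assms(2)]] compo_minus_left[OF c(1) suspm_in_homs[OF t(1)]]
      suspm_compo[OF t(1) h(1)] by simp
  then have "u \<star> h = g" using suspm_inj assms(2) compo_in_homs[OF t(1) h(1)] by metis
  then show thesis using that h by blast
qed

lemma lift_second:
  assumes "(X, Y, Z, u, v, w) \<in> triangles C" "g \<in> homs C W Z" "w \<star> g = 0"
  obtains h where "h \<in> homs C W Y" "v \<star> h = g"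
  using lift_first[OF triangle_rotateD[OF assms(1)] assms(2,3)] .

lemma lift_third:
  assumes "(X, Y, Z, u, v, w) \<in> triangles C" "g \<in> homs C W (susp C X)" "suspm C u \<star> g = 0"
  obtains h where "h \<in> homs C W Z" "w \<star> h = g"
proof -
  have "(- suspm C u) \<star> g = 0"
    using compo_minus_left[OF assms(2) suspm_in_homs[OF triangle_in_homs(1)[OF assms(1)]]] assms(3)
    by simp
  from lift_second[OF triangle_rotateD[OF assms(1)] assms(2) this] show thesis using that .
qed

text \<open>Comparison with 0 -> W -> W, itself obtained from the trivial triangle on
  \<open>W\<close> by undoing a rotation.\<close>

lemma extend_second:
  assumes "(X, Y, Z, u, v, w) \<in> triangles C" "g \<in> homs C Y W" "g \<star> u = 0"
  obtains h where "h \<in> homs C Z W" "h \<star> v = g"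
proof -
  obtain Z0 where Z0: "zero_obj C Z0" using zero_obj_exists by blast
  have "(W, W, susp C Z0, ident C W, 0, - suspm C 0) \<in> triangles C"
    using triangle_ident[OF zero_obj_susp[OF Z0]] by simp
  then have tri: "(Z0, W, W, 0, ident C W, 0) \<in> triangles C"
    using triangle_rotate ident_in_homs zero_in_homs by blast
  have "g \<star> u = 0 \<star> 0" using assms(3) compo_zero_left[of 0 X Z0] by simp
  then obtain c where "c \<in> homs C Z W" "c \<star> v = ident C W \<star> g"
    using triangle_fill[OF assms(1) tri zero_in_homs assms(2)] by blast
  then show thesis using that ident_left[OF assms(2)] by simp
qed

lemma extend_third:
  assumes "(X, Y, Z, u, v, w) \<in> triangles C" "g \<in> homs C Z W" "g \<star> v = 0"
  obtains h where "h \<in> homs C (susp C X) W" "h \<star> w = g"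
  using extend_second[OF triangle_rotateD[OF assms(1)] assms(2,3)] .

lemma extend_first:
  assumes "(X, Y, Z, u, v, w) \<in> triangles C" "g \<in> homs C X W" "suspm C g \<star> w = 0"
  obtains h where "h \<in> homs C Y W" "h \<star> u = g"
proof -
  note t = triangle_in_homs[OF assms(1)]
  obtain c where c: "c \<in> homs C (susp C Y) (susp C W)" "c \<star> (- suspm C u) = suspm C g"
    using extend_third[OF triangle_rotateD[OF assms(1)] suspm_in_homs[OF assms(2)] assms(3)] .
  obtain h where h: "h \<in> homs C Y W" "c = suspm C h" using suspm_surj[OF c(1)] .
  \<comment> \<open>Rotation has put a sign on \<open>suspm C u\<close>, so the extension is
    \<open>- h\<close>.\<close>
  have "suspm C ((- h) \<star> u) = suspm C g"
    using c h compo_minus_right[OF c(1) suspm_in_homs[OF t(1)]] suspm_compo[OF h(1) t(1)]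
      compo_minus_left[OF t(1) h(1)] suspm_minus[OF compo_in_homs[OF h(1) t(1)]] by simp
  then have "(- h) \<star> u = g"
    using suspm_inj assms(2) compo_in_homs[OF minus_in_homs[OF h(1)] t(1)] by metis
  then show thesis using that minus_in_homs[OF h(1)] by blast
qed

lemma triangle_replace_third:
  assumes "(X, Y, Z, u, v, w) \<in> triangles C" "isomorphic C Z Z'"
  obtains v' w' where "(X, Y, Z', u, v', w') \<in> triangles C"
proof -
  note t = triangle_in_homs[OF assms(1)]
  obtain c where c: "iso_mor C Z Z' c" using assms(2) by (auto simp: isomorphic_def)
  obtain c' where c': "c \<in> homs C Z Z'" "c' \<in> homs C Z' Z" "c' \<star> c = ident C Z" "c \<star> c' = ident C Z'"
    using iso_morE[OF c] .
  have "suspm C (ident C X) \<star> w = (w \<star> c') \<star> c"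
    using suspm_ident ident_left[OF t(3)] compo_assoc[OF t(3) c'(2,1)] c'(3) ident_right[OF t(3)] by simp
  moreover have "ident C Y \<star> u = u \<star> ident C X" using t(1) ident_left ident_right by simp
  moreover have "c \<star> v = (c \<star> v) \<star> ident C Y" using ident_right[OF compo_in_homs[OF c'(1) t(2)]] by simp
  ultimately have "(X, Y, Z', u, c \<star> v, w \<star> c') \<in> triangles C"
    using triangle_iso[OF assms(1) t(1) compo_in_homs[OF c'(1) t(2)] compo_in_homs[OF t(3) c'(2)]
        iso_mor_ident iso_mor_ident c] by simp
  then show thesis using that by blast
qed

text \<open>The suspension is only essentially surjective on objects: the cone of \<open>v\<close>
  has to be replaced by an isomorphic object of the form \<Sigma>X before the triangle can be
  rotated back.\<close>

lemma triangle_from_second: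
  assumes "v \<in> homs C Y Z"
  obtains X u w where "(X, Y, Z, u, v, w) \<in> triangles C"
proof -
  obtain W f g where t: "(Y, Z, W, v, f, g) \<in> triangles C" using triangle_exists[OF assms] by blast
  obtain X where "isomorphic C W (susp C X)" using susp_ess_surj by blast
  then obtain w u' where t': "(Y, Z, susp C X, v, w, u') \<in> triangles C"
    using triangle_replace_third[OF t] by blast
  obtain u where u: "u \<in> homs C X Y" "u' = suspm C u"
    using suspm_surj triangle_in_homs(3)[OF t'] by blast
  have "suspm C (- u) = - suspm C u" by (rule suspm_minus[OF u(1)])
  then have "(Y, Z, susp C X, v, w, - suspm C (- u)) \<in> triangles C" using t' u by simp
  then have "(X, Y, Z, - u, v, w) \<in> triangles C"
    using triangle_rotate[OF minus_in_homs[OF u(1)] assms triangle_in_homs(2)[OF t']] by simp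
  then show thesis using that by blast
qed

lemma triangle_rotate_back:
  assumes "(Y, Z, susp C X, v, w, u') \<in> triangles C"
  obtains u where "(X, Y, Z, u, v, w) \<in> triangles C" "u' = - suspm C u"
proof -
  note t = triangle_in_homs[OF assms]
  obtain u where u: "u \<in> homs C X Y" "u' = suspm C u" using suspm_surj[OF t(3)] .
  have *: "u' = - suspm C (- u)" using u suspm_minus by simp
  then have "(X, Y, Z, - u, v, w) \<in> triangles C"
    using triangle_rotate[OF minus_in_homs[OF u(1)] t(1,2)] assms by simp
  then show thesis using that * by blast
qed

lemma triangle_from_third:
  assumes "w \<in> homs C Z (susp C X)"
  obtains Y u v where "(X, Y, Z, u, v, w) \<in> triangles C"
  using triangle_from_second[OF assms] triangle_rotate_back by metis

end

section \<open>Endomorphisms of indecomposable objects\<close>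

lemma (in linear_category) iso_morI:
  assumes "f \<in> homs C X Y" "g \<in> homs C Y X" "h \<in> homs C Y X"
    and "g \<star> f = ident C X" "f \<star> h = ident C Y"
  shows "iso_mor C X Y f"
proof -
  have "g = h"
    using compo_assoc[OF assms(2,1,3)] assms ident_right[OF assms(2)] ident_left[OF assms(3)] by simp
  then show ?thesis using assms unfolding iso_mor_def by blast
qed

locale hom_finite_category = linear_category C
  for C :: "('k::alg_closed_field, 'o, 'v::ab_group_add, 'm) lincat_scheme" (structure) +
  assumes hom_finite: "hom_finite C"
    and split_idempotents: "split_idempotents C"
begin

lemma fin_homs: "finite_dim_sub (smul C) (homs C X Y)"
  using hom_finite by (simp add: hom_finite_def)

section \<open>Powers and polynomials of an endomorphism\<close>

definition epow :: "'o \<Rightarrow> 'v \<Rightarrow> nat \<Rightarrow> 'v" where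
  "epow X f n = ((\<lambda>g. f \<star> g) ^^ n) (ident C X)"

lemma epow_0: "epow X f 0 = ident C X"
  by (simp add: epow_def)

lemma epow_Suc: "epow X f (Suc n) = f \<star> epow X f n"
  by (simp add: epow_def)

lemma epow_in_homs: "f \<in> homs C X X \<Longrightarrow> epow X f n \<in> homs C X X"
  by (induction n) (auto simp: epow_0 epow_Suc ident_in_homs intro: compo_in_homs)

lemma epow_add: "f \<in> homs C X X \<Longrightarrow> epow X f (m + n) = epow X f m \<star> epow X f n"
proof (induction m)
  case 0
  then show ?case using ident_left[OF epow_in_homs] by (simp add: epow_0)
next
  case (Suc m)
  then show ?case using compo_assoc[OF Suc.prems epow_in_homs epow_in_homs] by (simp add: epow_Suc)
qed

text \<open>An index of least dimension works, since a subspace whose dimension is not smaller is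
  the whole space.\<close>

lemma antimono_subspaces_stabilize:
  assumes "finite_dim_sub (smul C) A" "\<And>n. vs.subspace (U n)" "\<And>n. U n \<subseteq> A"
    and "\<And>m n. m \<le> n \<Longrightarrow> U n \<subseteq> U m"
  shows "\<exists>n. \<forall>m\<ge>n. U m = U (n :: nat)"
proof -
  obtain n where n: "\<And>m. vs.dim (U n) \<le> vs.dim (U m)"
    using ex_has_least_nat[of "\<lambda>_. True" 0 "\<lambda>n. vs.dim (U n)"] by auto
  have "U m = U n" if "n \<le> m" for m
    by (rule vs.finite_dim_sub_dim_eq[OF vs.finite_dim_sub_subset[OF assms(1-3)]])
      (use assms n that in auto)
  then show ?thesis by blast
qed

text \<open>Fitting's lemma inside End(X). The right ideals and the left ideals generated by the
  powers of \<open>f\<close> both become stationary, which gives a power g with g = g^2 h = h' g^2.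
  Then \<open>g \<star> h\<close> is idempotent, and its two possible values mean that
  \<open>f\<close> is nilpotent or invertible.\<close>

lemma fitting:
  assumes "f \<in> homs C X X"
    and idem: "\<And>e. \<lbrakk>e \<in> homs C X X; e \<star> e = e\<rbrakk> \<Longrightarrow> e = 0 \<or> e = ident C X"
  shows "iso_mor C X X f \<or> (\<exists>n. epow X f n = 0)"
proof -
  let ?E = "homs C X X"
  note p = epow_in_homs[OF assms(1)]
  have "\<exists>n. \<forall>m\<ge>n. (\<lambda>g. epow X f m \<star> g) ` ?E = (\<lambda>g. epow X f n \<star> g) ` ?E"
  proof (rule antimono_subspaces_stabilize[OF fin_homs])
    fix m n :: nat assume "m \<le> n"
    then have "epow X f n = epow X f m \<star> epow X f (n - m)"
      using epow_add[OF assms(1), of m "n - m"] by simp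
    then have "epow X f n \<star> g = epow X f m \<star> (epow X f (n - m) \<star> g)" if "g \<in> ?E" for g
      using compo_assoc[OF p p that] by simp
    then show "(\<lambda>g. epow X f n \<star> g) ` ?E \<subseteq> (\<lambda>g. epow X f m \<star> g) ` ?E"
      using compo_in_homs[OF p] by auto
  qed (use vp.linear_on_sub_image_subspace[OF homs_subspace compo_linear_right[OF p]]
      compo_in_homs[OF p] in auto)
  then obtain n1 where n1: "\<And>m. n1 \<le> m \<Longrightarrow> (\<lambda>g. epow X f m \<star> g) ` ?E = (\<lambda>g. epow X f n1 \<star> g) ` ?E"
    by auto
  have "\<exists>n. \<forall>m\<ge>n. (\<lambda>g. g \<star> epow X f m) ` ?E = (\<lambda>g. g \<star> epow X f n) ` ?E"
  proof (rule antimono_subspaces_stabilize[OF fin_homs])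
    fix m n :: nat assume "m \<le> n"
    then have "epow X f n = epow X f (n - m) \<star> epow X f m"
      using epow_add[OF assms(1), of "n - m" m] by simp
    then have "g \<star> epow X f n = (g \<star> epow X f (n - m)) \<star> epow X f m" if "g \<in> ?E" for g
      using compo_assoc[OF that p p] by simp
    then show "(\<lambda>g. g \<star> epow X f n) ` ?E \<subseteq> (\<lambda>g. g \<star> epow X f m) ` ?E"
      using compo_in_homs[OF _ p] by auto
  qed (use vp.linear_on_sub_image_subspace[OF homs_subspace compo_linear_left[OF p]]
      compo_in_homs[OF _ p] in auto)
  then obtain n2 where n2: "\<And>m. n2 \<le> m \<Longrightarrow> (\<lambda>g. g \<star> epow X f m) ` ?E = (\<lambda>g. g \<star> epow X f n2) ` ?E"
    by auto
  \<comment> \<open>Stabilisation holds from the maximum on; the successor leaves a factor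
    \<open>f\<close> that can be split off \<open>g\<close> on either side when inverses of
    \<open>f\<close> are formed.\<close>
  define N where "N = Suc (max n1 n2)"
  define g where "g = epow X f N"
  have g: "g \<in> ?E" using p by (simp add: g_def)
  have g2: "g \<star> g = epow X f (N + N)" using epow_add[OF assms(1)] by (simp add: g_def)
  have "g \<in> (\<lambda>h. g \<star> h) ` ?E" using ident_right[OF g] ident_in_homs by force
  then have "g \<in> (\<lambda>h. epow X f (N + N) \<star> h) ` ?E"
    using n1[of N] n1[of "N + N"] by (simp add: g_def N_def)
  then obtain h where h: "h \<in> ?E" "g = (g \<star> g) \<star> h" by (auto simp: g2)
  have "g \<in> (\<lambda>h. h \<star> g) ` ?E" using ident_left[OF g] ident_in_homs by force
  then have "g \<in> (\<lambda>h. h \<star> epow X f (N + N)) ` ?E"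
    using n2[of N] n2[of "N + N"] by (simp add: g_def N_def)
  then obtain h' where h': "h' \<in> ?E" "g = h' \<star> (g \<star> g)" by (auto simp: g2)
  have gg: "g \<star> g \<in> ?E" using g compo_in_homs by blast
  have gh: "g \<star> h \<in> ?E" and hg: "h' \<star> g \<in> ?E" using g h(1) h'(1) compo_in_homs by blast+
  have ghg: "h' \<star> g = g \<star> h"
  proof -
    have "g \<star> h = (h' \<star> (g \<star> g)) \<star> h" using h'(2) by simp
    also have "\<dots> = h' \<star> ((g \<star> g) \<star> h)" by (rule compo_assoc[OF h'(1) gg h(1)])
    finally show ?thesis using h(2) by simp
  qed
  have "(g \<star> h) \<star> (g \<star> h) = (h' \<star> g) \<star> (g \<star> h)" using ghg by simp
  also have "\<dots> = h' \<star> (g \<star> (g \<star> h))" by (rule compo_assoc[OF h'(1) g gh])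
  also have "g \<star> (g \<star> h) = g" using compo_assoc[OF g g h(1)] h(2) by simp
  finally have "(g \<star> h) \<star> (g \<star> h) = g \<star> h" using ghg by simp
  then consider "g \<star> h = 0" | "g \<star> h = ident C X" using idem[OF gh] by blast
  then show ?thesis
  proof cases
    case 1
    then have "g = 0" using compo_assoc[OF g g h(1)] h(2) compo_zero_right[OF g] by simp
    then show ?thesis by (auto simp: g_def)
  next
    case 2
    let ?q = "epow X f (max n1 n2)"
    have "f \<star> (?q \<star> h) = ident C X"
      using compo_assoc[OF assms(1) p h(1)] 2 by (simp add: g_def N_def epow_Suc)
    moreover have "epow X f 1 = f" using ident_right[OF assms(1)] by (simp add: epow_0 epow_Suc)
    then have "g = ?q \<star> f" using epow_add[OF assms(1), of "max n1 n2" 1] by (simp add: g_def N_def)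
    then have "(h' \<star> ?q) \<star> f = ident C X" using compo_assoc[OF h'(1) p assms(1)] 2 ghg by simp
    ultimately have "iso_mor C X X f"
      using iso_morI[OF assms(1) compo_in_homs[OF h'(1) p] compo_in_homs[OF p h(1)]] by blast
    then show ?thesis ..
  qed
qed

text \<open>Horner's scheme for p(f). Composition is specified only on End(X), a subset of the
  ambient type, so the value is formed there by hand.\<close>

definition epoly :: "'o \<Rightarrow> 'v \<Rightarrow> 'k poly \<Rightarrow> 'v" where
  "epoly X f p = fold_coeffs (\<lambda>a g. smul C a (ident C X) + f \<star> g) p 0"

context
  fixes X :: 'o and f :: 'v
  assumes f: "f \<in> homs C X X"
begin

lemma epoly_0: "epoly X f 0 = 0"
  by (simp add: epoly_def)

lemma epoly_pCons: "epoly X f (pCons a p) = smul C a (ident C X) + f \<star> epoly X f p"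
  using compo_zero_right[OF f] by (cases "a = 0 \<and> p = 0") (auto simp: epoly_def)

lemma epoly_in_homs: "epoly X f p \<in> homs C X X"
proof (induction p)
  case (pCons a p)
  then show ?case
    using add_in_homs[OF smul_in_homs[OF ident_in_homs] compo_in_homs[OF f]]
    by (simp add: epoly_pCons)
qed (simp add: epoly_0)

lemma epoly_add: "epoly X f (p + q) = epoly X f p + epoly X f q"
proof (induction p q rule: poly_induct2)
  case (pCons a p b q)
  then show ?case
    using compo_add_right[OF f epoly_in_homs epoly_in_homs]
    by (simp add: epoly_pCons vs.scale_left_distrib algebra_simps)
qed (simp add: epoly_0)

lemma epoly_smult: "epoly X f (smult c p) = smul C c (epoly X f p)"
proof (induction p)
  case (pCons a p)
  then show ?case
    using compo_smul_right[OF f epoly_in_homs]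
    by (simp add: epoly_pCons vs.scale_right_distrib)
qed (simp add: epoly_0)

lemma epoly_monom: "epoly X f (monom c n) = smul C c (epow X f n)"
proof (induction n)
  case 0
  then show ?case using compo_zero_right[OF f] by (simp add: monom_0 epoly_pCons epoly_0 epow_0)
next
  case (Suc n)
  then show ?case using compo_smul_right[OF f epow_in_homs[OF f]]
    by (simp add: monom_Suc epoly_pCons epow_Suc)
qed

lemma epoly_sum: "epoly X f (\<Sum>i\<in>I. p i) = (\<Sum>i\<in>I. epoly X f (p i))"
  by (induction I rule: infinite_finite_induct) (simp_all add: epoly_0 epoly_add)

text \<open>Otherwise the powers of \<open>f\<close> up to the size of a spanning set of End(X) are
  distinct and linearly independent, which is one vector too many.\<close>

lemma epoly_annihilator: "\<exists>p. p \<noteq> 0 \<and> epoly X f p = 0"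
proof (rule ccontr)
  assume "\<not> ?thesis"
  then have ne: "p = 0" if "epoly X f p = 0" for p using that by blast
  obtain B where B: "finite B" "vs.span B = homs C X X"
    using fin_homs[of X X] unfolding finite_dim_sub_def by blast
  let ?I = "{..card B}" and ?S = "epow X f ` {..card B}"
  have inj: "inj_on (epow X f) ?I"
  proof (rule inj_onI)
    fix r s assume "epow X f r = epow X f s"
    then have "epoly X f (monom 1 r + smult (- 1) (monom 1 s)) = 0"
      unfolding epoly_add epoly_smult epoly_monom by simp
    then have "monom 1 r + smult (- 1) (monom 1 s) = (0 :: 'k poly)" by (rule ne)
    then have "coeff (monom 1 r) r = (coeff (monom 1 s) r :: 'k)" by simp
    then show "r = s" by (auto split: if_splits)
  qed
  have "vs.independent ?S"
  proof (rule vs.independent_if_scalars_zero)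
    fix c x assume c: "(\<Sum>x\<in>?S. smul C (c x) x) = 0" and x: "x \<in> ?S"
    have "epoly X f (\<Sum>r\<le>card B. monom (c (epow X f r)) r) = 0"
      unfolding epoly_sum epoly_monom using c by (simp add: sum.reindex[OF inj])
    then have *: "(\<Sum>r\<le>card B. monom (c (epow X f r)) r) = 0" by (rule ne)
    obtain r where r: "r \<le> card B" "x = epow X f r" using x by auto
    have "coeff (\<Sum>r\<le>card B. monom (c (epow X f r)) r) r = c (epow X f r)"
      using r by (simp add: coeff_sum)
    then show "c x = 0" using * r by simp
  qed simp
  moreover have "?S \<subseteq> vs.span B" using epow_in_homs[OF f] B(2) by auto
  ultimately have "card ?S \<le> card B" using vs.independent_span_bound[OF B(1)] by blast
  then show False by (simp add: card_image[OF inj])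
qed

text \<open>Let p be an annihilating polynomial of least degree and c a root, which exists since the
  field is algebraically closed. With p = (x - c) q, the nonzero q(f) is killed by f - c, which
  therefore has no inverse.\<close>

lemma eigenvalue:
  assumes "ident C X \<noteq> 0"
  shows "\<exists>c. \<not> iso_mor C X X (f - smul C c (ident C X))"
proof -
  obtain p where p: "p \<noteq> 0" "epoly X f p = 0"
    and min: "\<And>q. \<lbrakk>q \<noteq> 0; epoly X f q = 0\<rbrakk> \<Longrightarrow> degree p \<le> degree q"
    using ex_has_least_nat[of "\<lambda>p. p \<noteq> 0 \<and> epoly X f p = 0" _ degree] epoly_annihilator by metis
  have "degree p > 0"
  proof (rule ccontr)
    assume "\<not> degree p > 0"
    then obtain a where "p = [:a:]" using degree_eq_zeroE by blast
    then show False
      using p assms compo_zero_right[OF f] by (simp add: epoly_pCons epoly_0)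
  qed
  then obtain c where "poly p c = 0" using alg_closed_imp_poly_has_root by blast
  then obtain q where q: "p = [:- c, 1:] * q" unfolding poly_eq_0_iff_dvd by (rule dvdE)
  then have "q \<noteq> 0" "degree q < degree p"
    using p(1) by (auto simp: degree_mult_eq simp del: mult_pCons_left)
  then have ne: "epoly X f q \<noteq> 0" using min by fastforce
  let ?g = "f - smul C c (ident C X)"
  have pq: "p = smult (- c) q + pCons 0 q" using q by simp
  have "smul C (- c) (epoly X f q) + (smul C 0 (ident C X) + f \<star> epoly X f q) = 0"
    using p(2) unfolding pq epoly_add epoly_smult epoly_pCons .
  then have "?g \<star> epoly X f q = 0"
    using compo_diff_left[OF epoly_in_homs f smul_in_homs[OF ident_in_homs]]
      compo_smul_left[OF epoly_in_homs ident_in_homs] ident_left[OF epoly_in_homs]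
    by simp
  moreover have "epoly X f q = v \<star> (?g \<star> epoly X f q)"
    if "v \<in> homs C X X" "v \<star> ?g = ident C X" for v
    using compo_assoc[OF that(1) diff_in_homs[OF f smul_in_homs[OF ident_in_homs]] epoly_in_homs]
      that(2) ident_left[OF epoly_in_homs] by metis
  ultimately have "\<not> iso_mor C X X ?g"
    using ne compo_zero_right unfolding iso_mor_def by metis
  then show ?thesis ..
qed

end

section \<open>Local endomorphism rings of indecomposable objects\<close>

lemma indecomposable_ident: "indecomposable C X \<Longrightarrow> ident C X \<noteq> 0"
  by (simp add: indecomposable_def zero_obj_def)

text \<open>Splitting \<open>e\<close> and 1 - \<open>e\<close> writes \<open>X\<close> as a
  biproduct, one half of which is a zero object.\<close>

lemma indecomposable_idempotent:
  assumes "indecomposable C X" "e \<in> homs C X X" "e \<star> e = e"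
  shows "e = 0 \<or> e = ident C X"
proof -
  obtain Y r s where rs: "r \<in> homs C X Y" "s \<in> homs C Y X" "s \<star> r = e" "r \<star> s = ident C Y"
    using split_idempotents assms(2,3) unfolding split_idempotents_def by blast
  obtain Z r' s' where Z: "is_biproduct C Y Z X" "r' \<in> homs C X Z" "s' \<in> homs C Z X"
      "s' \<star> r' = ident C X - s \<star> r"
    using idempotent_complement[OF split_idempotents rs(1,2,4)] by blast
  from Z(1) assms(1) consider "zero_obj C Y" | "zero_obj C Z" unfolding indecomposable_def by blast
  then show ?thesis
  proof cases
    case 1
    then show ?thesis using homs_zero_target rs compo_zero_right by metis
  next
    case 2
    then have "s' \<star> r' = 0" using homs_zero_target Z(2,3) compo_zero_right by metis
    then show ?thesis using Z(4) rs(3) by simp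
  qed
qed

text \<open>The idempotent \<open>f \<star> g\<close> of the indecomposable \<open>Y\<close> cannot
  be 0, as \<open>g \<star> f\<close> is the nonzero identity of \<open>X\<close>.\<close>

lemma split_mono_iso:
  assumes "indecomposable C Y" "ident C X \<noteq> 0" "f \<in> homs C X Y" "g \<in> homs C Y X"
    and "g \<star> f = ident C X"
  shows "f \<star> g = ident C Y"
proof -
  have fg: "f \<star> g \<in> homs C Y Y" using assms compo_in_homs by blast
  have gfg: "g \<star> (f \<star> g) = g"
    using compo_assoc[OF assms(4,3,4)] assms(5) ident_left[OF assms(4)] by simp
  then have "(f \<star> g) \<star> (f \<star> g) = f \<star> g" using compo_assoc[OF assms(3,4) fg] by simp
  then consider "f \<star> g = 0" | "f \<star> g = ident C Y"
    using indecomposable_idempotent[OF assms(1) fg] by blast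
  then show ?thesis
  proof cases
    case 1
    then have "g = 0" using gfg compo_zero_right[OF assms(4)] by simp
    then show ?thesis using assms(2,3,5) compo_zero_left by metis
  qed
qed

lemma iso_mor_compo_right:
  assumes "indecomposable C Y" "ident C X \<noteq> 0" "f \<in> homs C X Y" "g \<in> homs C Y X"
    and "iso_mor C X X (g \<star> f)"
  shows "iso_mor C X Y f"
proof -
  have gf: "g \<star> f \<in> homs C X X" using assms compo_in_homs by blast
  obtain u where u: "u \<in> homs C X X" "u \<star> (g \<star> f) = ident C X" using iso_morE[OF assms(5)] .
  then have *: "(u \<star> g) \<star> f = ident C X" using compo_assoc[OF u(1) assms(4,3)] by simp
  have ug: "u \<star> g \<in> homs C Y X" using u assms compo_in_homs by blast
  show ?thesis
    using split_mono_iso[OF assms(1-3) ug *] * ug assms(3) unfolding iso_mor_def by blast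
qed

context
  fixes X :: 'o
  assumes X: "indecomposable C X"
begin

lemma iso_mor_compoD:
  assumes "f \<in> homs C X X" "g \<in> homs C X X" "iso_mor C X X (g \<star> f)"
  shows "iso_mor C X X f" "iso_mor C X X g"
proof -
  note X0 = indecomposable_ident[OF X]
  show "iso_mor C X X f" by (rule iso_mor_compo_right[OF X X0 assms])
  obtain u where u: "u \<in> homs C X X" "(g \<star> f) \<star> u = ident C X" using iso_morE[OF assms(3)] .
  have fu: "f \<star> u \<in> homs C X X" using compo_in_homs[OF assms(1) u(1)] .
  have *: "g \<star> (f \<star> u) = ident C X" using compo_assoc[OF assms(2,1) u(1)] u(2) by simp
  show "iso_mor C X X g"
    using split_mono_iso[OF X X0 fu assms(2) *] * fu assms(2) unfolding iso_mor_def by blast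
qed

text \<open>By Fitting's lemma \<open>f\<close> is nilpotent, and the geometric series is a right
  inverse of 1 - \<open>f\<close>; for an indecomposable object a one-sided inverse
  suffices.\<close>

lemma not_iso_ident_minus:
  assumes "f \<in> homs C X X" "\<not> iso_mor C X X f"
  shows "iso_mor C X X (ident C X - f)"
proof -
  obtain n where n: "epow X f n = 0"
    using fitting[OF assms(1) indecomposable_idempotent[OF X]] assms(2) by blast
  note id = ident_in_homs[of X]
  note p = epow_in_homs[OF assms(1)]
  have d: "ident C X - f \<in> homs C X X" using diff_in_homs[OF id assms(1)] .
  have "\<exists>s\<in>homs C X X. (ident C X - f) \<star> s = ident C X - epow X f n" for n
  proof (induction n)
    case 0
    show ?case using compo_zero_right[OF d] by (auto intro!: bexI[of _ 0] simp: epow_0)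
  next
    case (Suc n)
    then obtain s where s: "s \<in> homs C X X" "(ident C X - f) \<star> s = ident C X - epow X f n" by blast
    have "(ident C X - f) \<star> (s + epow X f n) = ident C X - epow X f (Suc n)"
      using compo_add_right[OF d s(1) p] s(2) compo_diff_left[OF p id assms(1)] ident_left[OF p]
      by (simp add: epow_Suc)
    then show ?case using add_in_homs[OF s(1) p] by blast
  qed
  from this[of n] obtain s where s: "s \<in> homs C X X" "(ident C X - f) \<star> s = ident C X"
    using n by auto
  then have "iso_mor C X X ((ident C X - f) \<star> s)" using iso_mor_ident by simp
  then show ?thesis using iso_mor_compoD(2)[OF s(1) d] by blast
qed

text \<open>Locality of End(X): if \<open>u\<close> inverts the sum, then \<open>u \<star> g\<close>
  is 1 - \<open>u \<star> f\<close>, hence invertible, against the assumption on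
  \<open>g\<close>.\<close>

lemma not_iso_add:
  assumes "f \<in> homs C X X" "g \<in> homs C X X" "\<not> iso_mor C X X f" "\<not> iso_mor C X X g"
  shows "\<not> iso_mor C X X (f + g)"
proof
  assume "iso_mor C X X (f + g)"
  then obtain u where u: "u \<in> homs C X X" "u \<star> (f + g) = ident C X" by (rule iso_morE)
  have "u \<star> g = ident C X - u \<star> f"
    using compo_add_right[OF u(1) assms(1,2)] u(2) by (simp add: algebra_simps)
  moreover have "\<not> iso_mor C X X (u \<star> f)" using iso_mor_compoD(1)[OF assms(1) u(1)] assms(3) by blast
  ultimately have "iso_mor C X X (u \<star> g)"
    using not_iso_ident_minus[OF compo_in_homs[OF u(1) assms(1)]] by simp
  then show False using iso_mor_compoD(1)[OF assms(2) u(1)] assms(4) by blast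
qed

lemma iso_mor_smul_ident: "iso_mor C X X (smul C c (ident C X)) \<longleftrightarrow> c \<noteq> 0"
proof
  assume "iso_mor C X X (smul C c (ident C X))"
  then obtain g where g: "g \<in> homs C X X" "g \<star> smul C c (ident C X) = ident C X" by (rule iso_morE)
  show "c \<noteq> 0"
  proof
    assume "c = 0"
    then show False using g compo_zero_right[OF g(1)] indecomposable_ident[OF X] by simp
  qed
next
  assume c: "c \<noteq> 0"
  note id = ident_in_homs[of X]
  have "smul C c (ident C X) \<star> smul C (inverse c) (ident C X) = ident C X"
    "smul C (inverse c) (ident C X) \<star> smul C c (ident C X) = ident C X"
    using compo_smul_left[OF smul_in_homs[OF id] id] compo_smul_right[OF id id] ident_left[OF id] c
    by simp_all
  then show "iso_mor C X X (smul C c (ident C X))"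
    unfolding iso_mor_def using smul_in_homs[OF id] by blast
qed

end

text \<open>The residue character of the local ring \<open>End(X)\<close>, for \<open>X\<close> indecomposable.\<close>

definition chi :: "'o \<Rightarrow> 'v \<Rightarrow> 'k" where
  "chi X f = (THE c. \<not> iso_mor C X X (f - smul C c (ident C X)))"

context
  fixes X :: 'o
  assumes X: "indecomposable C X"
begin

text \<open>Uniqueness of the residue: two different values would exhibit a nonzero multiple of the
  identity as a sum of two non-isomorphisms.\<close>

lemma chi_eqI:
  assumes "f \<in> homs C X X" "\<not> iso_mor C X X (f - smul C c (ident C X))"
  shows "chi X f = c"
  unfolding chi_def
proof (rule the_equality)
  fix c' assume c': "\<not> iso_mor C X X (f - smul C c' (ident C X))"
  note id = smul_in_homs[OF ident_in_homs[of X]]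
  have m: "\<not> iso_mor C X X ((- ident C X) \<star> (f - smul C c (ident C X)))"
    using iso_mor_compoD(1)[OF X diff_in_homs[OF assms(1) id] minus_in_homs[OF ident_in_homs]]
      assms(2) by blast
  have e: "(- ident C X) \<star> (f - smul C c (ident C X)) = smul C c (ident C X) - f"
    using compo_minus_left[OF diff_in_homs[OF assms(1) id] ident_in_homs]
      ident_left[OF diff_in_homs[OF assms(1) id]] by simp
  have "\<not> iso_mor C X X ((smul C c (ident C X) - f) + (f - smul C c' (ident C X)))"
    by (rule not_iso_add[OF X diff_in_homs[OF id assms(1)] diff_in_homs[OF assms(1) id] _ c'])
      (use m e in simp)
  then have "\<not> iso_mor C X X (smul C (c - c') (ident C X))" by (simp add: vs.scale_left_diff_distrib)
  then show "c' = c" using iso_mor_smul_ident[OF X] by simp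
qed (rule assms(2))

lemma chi_residue: "f \<in> homs C X X \<Longrightarrow> \<not> iso_mor C X X (f - smul C (chi X f) (ident C X))"
  using eigenvalue[OF _ indecomposable_ident[OF X]] chi_eqI by metis

lemma chi_eq_0_iff: "f \<in> homs C X X \<Longrightarrow> chi X f = 0 \<longleftrightarrow> \<not> iso_mor C X X f"
  using chi_residue[of f] chi_eqI[of f 0] by auto

lemma chi_zero: "chi X 0 = 0"
  using iso_mor_smul_ident[OF X, of 0] chi_eq_0_iff[of 0] by simp

lemma chi_ident: "chi X (ident C X) = 1"
  using iso_mor_smul_ident[OF X, of 0] by (intro chi_eqI ident_in_homs) simp

lemma chi_add:
  assumes "f \<in> homs C X X" "g \<in> homs C X X"
  shows "chi X (f + g) = chi X f + chi X g"
proof (rule chi_eqI[OF add_in_homs[OF assms]])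
  note id = smul_in_homs[OF ident_in_homs[of X]]
  have e: "f + g - smul C (chi X f + chi X g) (ident C X) =
    (f - smul C (chi X f) (ident C X)) + (g - smul C (chi X g) (ident C X))"
    by (simp add: vs.scale_left_distrib)
  show "\<not> iso_mor C X X (f + g - smul C (chi X f + chi X g) (ident C X))"
    unfolding e using not_iso_add[OF X diff_in_homs[OF assms(1) id] diff_in_homs[OF assms(2) id]]
      chi_residue assms by blast
qed

lemma chi_compo:
  assumes "f \<in> homs C X X" "g \<in> homs C X X"
  shows "chi X (g \<star> f) = chi X g * chi X f"
proof (rule chi_eqI[OF compo_in_homs[OF assms(2,1)]])
  note id = smul_in_homs[OF ident_in_homs[of X]]
  let ?f = "f - smul C (chi X f) (ident C X)" and ?g = "g - smul C (chi X g) (ident C X)"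
  have h: "?f \<in> homs C X X" "?g \<in> homs C X X" using diff_in_homs id assms by blast+
  \<comment> \<open>Each term on the right contains a non-invertible factor, and a sum of two
    non-invertible endomorphisms is non-invertible.\<close>
  have e: "g \<star> f - smul C (chi X g * chi X f) (ident C X) = g \<star> ?f + smul C (chi X f) (ident C X) \<star> ?g"
    using compo_diff_right[OF assms(2,1) id] compo_smul_right[OF assms(2) ident_in_homs]
      ident_right[OF assms(2)] compo_smul_left[OF h(2) ident_in_homs] ident_left[OF h(2)]
    by (simp add: vs.scale_right_diff_distrib mult.commute)
  have "\<not> iso_mor C X X (g \<star> ?f)"
    using iso_mor_compoD(1)[OF X h(1) assms(2)] chi_residue[OF assms(1)] by blast
  moreover have "\<not> iso_mor C X X (smul C (chi X f) (ident C X) \<star> ?g)"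
    using iso_mor_compoD(1)[OF X h(2) id] chi_residue[OF assms(2)] by blast
  ultimately show "\<not> iso_mor C X X (g \<star> f - smul C (chi X g * chi X f) (ident C X))"
    unfolding e using not_iso_add[OF X compo_in_homs[OF assms(2) h(1)] compo_in_homs[OF id h(2)]] by blast
qed

lemma chi_smul:
  assumes "f \<in> homs C X X"
  shows "chi X (smul C c f) = c * chi X f"
proof -
  have "chi X (smul C c (ident C X)) = c"
    using iso_mor_smul_ident[OF X, of 0] by (intro chi_eqI smul_in_homs ident_in_homs) simp
  moreover have "smul C c f = smul C c (ident C X) \<star> f"
    using compo_smul_left[OF assms ident_in_homs] ident_left[OF assms] by simp
  ultimately show ?thesis using chi_compo[OF assms smul_in_homs[OF ident_in_homs]] by simp
qed

lemma chi_linear: "linear_on_sub (smul C) (*) (homs C X X) (chi X)"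
  by (simp add: linear_on_sub_def chi_add chi_smul)

lemma chi_decomp:
  assumes "f \<in> homs C X X"
  shows "chi X (f - smul C (chi X f) (ident C X)) = 0"
  using chi_eq_0_iff[OF diff_in_homs[OF assms smul_in_homs[OF ident_in_homs]]] chi_residue[OF assms]
  by blast

text \<open>Were \<open>g \<star> f\<close> invertible, \<open>f\<close> would be a split
  monomorphism into an indecomposable and hence an isomorphism.\<close>

lemma chi_through_other:
  assumes "indecomposable C Y" "\<not> isomorphic C X Y" "f \<in> homs C X Y" "g \<in> homs C Y X"
  shows "chi X (g \<star> f) = 0"
  using iso_mor_compo_right[OF assms(1) indecomposable_ident[OF X] assms(3,4)] assms(2)
    chi_eq_0_iff[OF compo_in_homs[OF assms(4,3)]] by (auto simp: isomorphic_def)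

end

section \<open>Decomposition into indecomposables\<close>

text \<open>The last hypothesis says that each \<open>h p\<close> is radical. Adding one term
  \<open>g q \<star> h q\<close> to a sum already treated, with right inverse \<open>u\<close>,
  amounts to inverting 1 - g h' for h' = \<open>h q \<star> u\<close>, and this is done from an
  inverse of 1 - h' g by the identity (1 - g h')^-1 = 1 + g (1 - h' g)^-1 h'.\<close>

lemma quasi_regular:
  assumes "finite I" "\<And>p. p \<in> I \<Longrightarrow> g p \<in> homs C (F p) W" "\<And>p. p \<in> I \<Longrightarrow> h p \<in> homs C W (F p)"
    and "\<And>p k. \<lbrakk>p \<in> I; k \<in> homs C (F p) W\<rbrakk> \<Longrightarrow> iso_mor C (F p) (F p) (ident C (F p) - h p \<star> k)"
  shows "\<exists>u\<in>homs C W W. (ident C W - (\<Sum>p\<in>I. g p \<star> h p)) \<star> u = ident C W"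
  using assms
proof (induction I rule: finite_induct)
  case empty
  then show ?case using ident_in_homs ident_left by auto
next
  case (insert q I)
  let ?s = "\<Sum>p\<in>I. g p \<star> h p"
  note idW = ident_in_homs[of W]
  have s: "?s \<in> homs C W W" by (rule sum_in_homs, rule compo_in_homs[OF insert.prems(1,2)]) simp_all
  obtain u where u: "u \<in> homs C W W" "(ident C W - ?s) \<star> u = ident C W"
  proof -
    have "\<exists>u\<in>homs C W W. (ident C W - ?s) \<star> u = ident C W"
      by (rule insert.IH; rule insert.prems; simp)
    then show thesis using that by blast
  qed
  have g: "g q \<in> homs C (F q) W" and h: "h q \<in> homs C W (F q)" using insert.prems by auto
  let ?h = "h q \<star> u"
  have h': "?h \<in> homs C W (F q)" using compo_in_homs[OF h u(1)] .
  note idF = ident_in_homs[of "F q"]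
  have hg: "?h \<star> g q \<in> homs C (F q) (F q)" using compo_in_homs[OF h' g] .
  have "?h \<star> g q = h q \<star> (u \<star> g q)" by (rule compo_assoc[OF h u(1) g])
  then have "iso_mor C (F q) (F q) (ident C (F q) - ?h \<star> g q)"
    using insert.prems(3)[of q "u \<star> g q"] compo_in_homs[OF u(1) g] by simp
  then obtain v where v: "v \<in> homs C (F q) (F q)" "(ident C (F q) - ?h \<star> g q) \<star> v = ident C (F q)"
    by (rule iso_morE)
  have vhg: "v = ident C (F q) + (?h \<star> g q) \<star> v"
    using v(2) compo_diff_left[OF v(1) idF hg] ident_left[OF v(1)] by (simp add: algebra_simps)
  let ?w = "g q \<star> (v \<star> ?h)"
  have vh: "v \<star> ?h \<in> homs C W (F q)" using compo_in_homs[OF v(1) h'] .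
  have w: "?w \<in> homs C W W" using compo_in_homs[OF g vh] .
  have gh: "g q \<star> ?h \<in> homs C W W" using compo_in_homs[OF g h'] .
  have "?w = g q \<star> ((ident C (F q) + (?h \<star> g q) \<star> v) \<star> ?h)" using vhg by simp
  also have "\<dots> = g q \<star> (?h + ((?h \<star> g q) \<star> v) \<star> ?h)"
    using compo_add_left[OF h' idF compo_in_homs[OF hg v(1)]] ident_left[OF h'] by simp
  also have "\<dots> = g q \<star> ?h + g q \<star> (((?h \<star> g q) \<star> v) \<star> ?h)"
    by (rule compo_add_right[OF g h' compo_in_homs[OF compo_in_homs[OF hg v(1)] h']])
  also have "((?h \<star> g q) \<star> v) \<star> ?h = ?h \<star> (g q \<star> (v \<star> ?h))"
    using compo_assoc[OF hg v(1) h'] compo_assoc[OF h' g vh] by simp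
  also have "g q \<star> (?h \<star> (g q \<star> (v \<star> ?h))) = (g q \<star> ?h) \<star> ?w"
    using compo_assoc[OF g h' w] by simp
  finally have ww: "?w = g q \<star> ?h + (g q \<star> ?h) \<star> ?w" .
  let ?u = "u \<star> (ident C W + ?w)"
  have iw: "ident C W + ?w \<in> homs C W W" using add_in_homs[OF idW w] .
  have u': "?u \<in> homs C W W" using compo_in_homs[OF u(1) iw] .
  have "(\<Sum>p\<in>insert q I. g p \<star> h p) = g q \<star> h q + ?s" using insert.hyps by simp
  then have "(ident C W - (\<Sum>p\<in>insert q I. g p \<star> h p)) \<star> ?u = ((ident C W - ?s) - g q \<star> h q) \<star> ?u"
    by (simp add: algebra_simps)
  also have "\<dots> = (ident C W - ?s) \<star> ?u - (g q \<star> h q) \<star> ?u"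
    by (rule compo_diff_left[OF u' diff_in_homs[OF idW s] compo_in_homs[OF g h]])
  also have "(ident C W - ?s) \<star> ?u = ident C W + ?w"
    using compo_assoc[OF diff_in_homs[OF idW s] u(1) iw] u(2) ident_left[OF iw] by simp
  also have "(g q \<star> h q) \<star> ?u = (g q \<star> ?h) \<star> (ident C W + ?w)"
    using compo_assoc[OF g h u'] compo_assoc[OF h u(1) iw] compo_assoc[OF g h' iw] by simp
  also have "\<dots> = g q \<star> ?h + (g q \<star> ?h) \<star> ?w"
    using compo_add_right[OF gh idW w] ident_right[OF gh] by simp
  finally have "(ident C W - (\<Sum>p\<in>insert q I. g p \<star> h p)) \<star> ?u = ident C W" using ww by simp
  then show ?case using u' by blast
qed

text \<open>If no \<open>h p \<star> k\<close> were invertible, \<open>quasi_regular\<close> would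
  give a right inverse of 1 minus the given sum, that is of 0.\<close>

lemma indecomposable_summand:
  assumes "finite I" "\<And>p. p \<in> I \<Longrightarrow> indecomposable C (F p)" "ident C X \<noteq> 0"
    and "\<And>p. p \<in> I \<Longrightarrow> g p \<in> homs C (F p) X" "\<And>p. p \<in> I \<Longrightarrow> h p \<in> homs C X (F p)"
    and "(\<Sum>p\<in>I. g p \<star> h p) = ident C X"
  shows "\<exists>p\<in>I. \<exists>k\<in>homs C (F p) X. h p \<star> k = ident C (F p)"
proof -
  have "\<exists>p\<in>I. \<exists>k\<in>homs C (F p) X. iso_mor C (F p) (F p) (h p \<star> k)"
  proof (rule ccontr)
    assume *: "\<not> ?thesis"
    have "\<exists>u\<in>homs C X X. (ident C X - (\<Sum>p\<in>I. g p \<star> h p)) \<star> u = ident C X"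
    proof (rule quasi_regular[OF assms(1,4,5)])
      fix p k assume "p \<in> I" "k \<in> homs C (F p) X"
      then show "iso_mor C (F p) (F p) (ident C (F p) - h p \<star> k)"
        using * not_iso_ident_minus[OF assms(2) compo_in_homs[OF assms(5)]] by blast
    qed
    then show False using assms(3,6) compo_zero_left by auto
  qed
  then obtain p k where pk: "p \<in> I" "k \<in> homs C (F p) X" "iso_mor C (F p) (F p) (h p \<star> k)" by blast
  obtain v where v: "v \<in> homs C (F p) (F p)" "(h p \<star> k) \<star> v = ident C (F p)"
    using iso_morE[OF pk(3)] .
  then have "h p \<star> (k \<star> v) = ident C (F p)" using compo_assoc[OF assms(5)[OF pk(1)] pk(2) v(1)] by simp
  then show ?thesis using pk(1) compo_in_homs[OF pk(2) v(1)] by blast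
qed

text \<open>A factorisation of the identity through finitely many \<open>Ti\<close> passes to the
  complement \<open>Z\<close> of a split-off copy, so copies are removed one at a time, by induction
  on the dimension of End(X).\<close>

lemma add_class_of_factorization:
  fixes Ti :: "'n::finite \<Rightarrow> 'o"
  assumes Ti: "\<And>j. indecomposable C (Ti j)"
    and "finite I" "\<And>p. p \<in> I \<Longrightarrow> g p \<in> homs C (Ti (c p)) X" "\<And>p. p \<in> I \<Longrightarrow> h p \<in> homs C X (Ti (c p))"
    and "(\<Sum>p\<in>I. g p \<star> h p) = ident C X"
  shows "\<exists>a. add_class C Ti X a"
  using assms(3-5)
proof (induction "vs.dim (homs C X X)" arbitrary: X g h rule: less_induct)
  case less
  show ?case
  proof (cases "zero_obj C X")
    case True
    then have "add_class C Ti X (\<lambda>_. 0)" by (simp add: add_class_def is_dsum_empty)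
    then show ?thesis by blast
  next
    case False
    then have X0: "ident C X \<noteq> 0" by (simp add: zero_obj_def)
    obtain p k where p: "p \<in> I" and k: "k \<in> homs C (Ti (c p)) X" "h p \<star> k = ident C (Ti (c p))"
      using indecomposable_summand[where F = "\<lambda>p. Ti (c p)" and I = I and g = g and h = h and X = X,
          OF assms(2) Ti X0 less.prems] by blast
    note hp = less.prems(2)[OF p]
    obtain Z r s where Z: "is_biproduct C (Ti (c p)) Z X" "r \<in> homs C X Z" "s \<in> homs C Z X"
        "s \<star> r = ident C X - k \<star> h p" "r \<star> s = ident C Z" "h p \<star> s = 0"
      using idempotent_complement[OF split_idempotents hp k] by blast
    let ?f = "\<lambda>y. s \<star> (y \<star> r)"
    have rsy: "r \<star> (s \<star> y) = y" if "y \<in> homs C W Z" for y W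
      using compo_assoc[OF Z(2,3) that] Z(5) ident_left[OF that] by simp
    have yrs: "(y \<star> r) \<star> s = y" if "y \<in> homs C Z W" for y W
      using compo_assoc[OF that Z(2,3)] Z(5) ident_right[OF that] by simp
    have lin: "linear_on_sub (smul C) (smul C) (homs C Z Z) ?f"
      unfolding linear_on_sub_def
      using compo_add_left[OF Z(2)] compo_add_right[OF Z(3)] compo_smul_left[OF Z(2)]
        compo_smul_right[OF Z(3)] compo_in_homs[OF _ Z(2)] by metis
    have inj: "y = 0" if "y \<in> homs C Z Z" "?f y = 0" for y
    proof -
      have yr: "y \<star> r \<in> homs C X Z" using compo_in_homs[OF that(1) Z(2)] .
      have "y \<star> r = 0" using rsy[OF yr] that(2) compo_zero_right[OF Z(2)] by simp
      then show ?thesis using yrs[OF that(1)] compo_zero_left[OF Z(3)] by simp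
    qed
    have sub: "?f ` homs C Z Z \<subseteq> homs C X X"
      by (intro image_subsetI compo_in_homs[OF Z(3)] compo_in_homs[OF _ Z(2)])
    \<comment> \<open>Sending \<open>y\<close> to \<open>s \<star> (y \<star> r)\<close> embeds
      End(Z) in End(X) and misses the identity: \<open>h p\<close> kills \<open>s\<close>, while
      \<open>h p\<close> itself is not zero.\<close>
    have "vs.dim (homs C Z Z) < vs.dim (homs C X X)"
    proof (rule ccontr)
      assume "\<not> ?thesis"
      then have "vs.dim (homs C X X) \<le> vs.dim (?f ` homs C Z Z)"
        using vp.dim_inj_image[OF fin_homs lin inj] by simp
      then have "?f ` homs C Z Z = homs C X X"
        by (rule vs.finite_dim_sub_dim_eq[OF fin_homs
              vp.linear_on_sub_image_subspace[OF homs_subspace lin] sub])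
      then obtain y where y: "y \<in> homs C Z Z" "ident C X = ?f y" using ident_in_homs by blast
      have "h p = h p \<star> ?f y" using ident_right[OF hp] y(2) by simp
      also have "\<dots> = 0"
        using compo_assoc[OF hp Z(3) compo_in_homs[OF y(1) Z(2)]] Z(6)
          compo_zero_left[OF compo_in_homs[OF y(1) Z(2)]] by simp
      finally have "ident C (Ti (c p)) = 0" using k compo_zero_left[OF k(1)] by simp
      then show False using indecomposable_ident[OF Ti] by blast
    qed
    moreover have "(\<Sum>q\<in>I. (r \<star> g q) \<star> (h q \<star> s)) = ident C Z"
    proof -
      have "(\<Sum>q\<in>I. (r \<star> g q) \<star> (h q \<star> s)) = (\<Sum>q\<in>I. r \<star> ((g q \<star> h q) \<star> s))"
      proof (rule sum.cong[OF refl])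
        fix q assume q: "q \<in> I"
        note gq = less.prems(1)[OF q] and hq = less.prems(2)[OF q]
        show "(r \<star> g q) \<star> (h q \<star> s) = r \<star> ((g q \<star> h q) \<star> s)"
          using compo_assoc[OF Z(2) gq compo_in_homs[OF hq Z(3)]] compo_assoc[OF gq hq Z(3)] by simp
      qed
      also have "\<dots> = r \<star> (\<Sum>q\<in>I. (g q \<star> h q) \<star> s)"
        by (rule compo_sum_right[OF Z(2), symmetric], rule compo_in_homs[OF compo_in_homs[OF less.prems(1,2)] Z(3)]) simp_all
      also have "(\<Sum>q\<in>I. (g q \<star> h q) \<star> s) = (\<Sum>q\<in>I. g q \<star> h q) \<star> s"
        by (rule compo_sum_left[OF Z(3), symmetric], rule compo_in_homs[OF less.prems(1,2)]) simp_all
      finally show ?thesis using less.prems(3) ident_left[OF Z(3)] Z(5) by simp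
    qed
    ultimately obtain a where a: "add_class C Ti Z a"
      using less.hyps[of Z "\<lambda>q. r \<star> g q" "\<lambda>q. h q \<star> s"]
        compo_in_homs[OF Z(2) less.prems(1)] compo_in_homs[OF less.prems(2) Z(3)] by blast
    \<comment> \<open>The split-off copy takes the next free number among the copies of
      \<open>Ti (c p)\<close>.\<close>
    let ?a = "a(c p := Suc (a (c p)))"
    have "{(j, r). r < ?a j} = insert (c p, a (c p)) {(j, r). r < a j}" by (auto split: if_splits)
    moreover have "is_dsum C (insert (c p, a (c p)) {(j, r). r < a j}) (\<lambda>(j, r). Ti j) X"
      by (rule is_dsum_insert[of _ _ Z]) (use Z(1) a in \<open>auto simp: add_class_def\<close>)
    ultimately have "add_class C Ti X ?a" by (simp add: add_class_def)
    then show ?thesis by blast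
  qed
qed

text \<open>The identity of \<open>X\<close> factors through a sum of copies of \<open>T\<close>; in
  the index set the pair (i, j) stands for the j-th summand of the i-th copy.\<close>

lemma add_class_of_in_add:
  fixes Ti :: "'n::finite \<Rightarrow> 'o"
  assumes Ti: "\<And>j. indecomposable C (Ti j)" and T: "is_dsum C UNIV Ti T" and X: "in_add C T X"
  shows "\<exists>a. add_class C Ti X a"
proof -
  obtain n :: nat and W Y where W: "is_dsum C {..<n} (\<lambda>_. T) W" and Y: "is_biproduct C X Y W"
    using X by (auto simp: in_add_def summand_def)
  obtain e q where eq: "dsum_maps (UNIV :: bool set) (\<lambda>b. if b then X else Y) W e q"
    using Y is_dsum_iff by blast
  obtain em pr where W: "dsum_maps {..<n} (\<lambda>_. T) W em pr" using W is_dsum_iff by blast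
  obtain \<iota> \<pi> where T: "dsum_maps UNIV Ti T \<iota> \<pi>" using T is_dsum_iff by blast
  have e: "e True \<in> homs C X W" and q: "q True \<in> homs C W X"
    using dsum_maps_in_homs[OF eq UNIV_I, of True] by simp_all
  have qe: "q True \<star> e True = ident C X" using dsum_maps_prj_inj[OF eq UNIV_I UNIV_I, of True True] by simp
  note h = dsum_maps_in_homs[OF W] dsum_maps_in_homs[OF T UNIV_I]
  let ?g = "\<lambda>(i, j). (q True \<star> em i) \<star> \<iota> j" and ?h = "\<lambda>(i, j). \<pi> j \<star> (pr i \<star> e True)"
  have qem: "q True \<star> em i \<in> homs C T X" and pre: "pr i \<star> e True \<in> homs C X T" if "i < n" for i
    using that h e q compo_in_homs by (metis lessThan_iff)+
  have "(\<Sum>p\<in>{..<n} \<times> UNIV. ?g p \<star> ?h p) = (\<Sum>i<n. \<Sum>j\<in>UNIV. ?g (i, j) \<star> ?h (i, j))"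
    by (simp add: sum.cartesian_product')
  also have "\<dots> = (\<Sum>i<n. (q True \<star> em i) \<star> (pr i \<star> e True))"
  proof (rule sum.cong[OF refl])
    fix i assume "i \<in> {..<n}"
    then have i: "i < n" by simp
    have "(\<Sum>j\<in>UNIV. ?g (i, j) \<star> ?h (i, j)) = (\<Sum>j\<in>UNIV. (q True \<star> em i) \<star> (\<iota> j \<star> (\<pi> j \<star> (pr i \<star> e True))))"
      unfolding prod.case
      by (rule sum.cong[OF refl]) (rule compo_assoc[OF qem[OF i] h(3) compo_in_homs[OF h(4) pre[OF i]]])
    also have "\<dots> = (q True \<star> em i) \<star> (\<Sum>j\<in>UNIV. \<iota> j \<star> (\<pi> j \<star> (pr i \<star> e True)))"
      by (rule compo_sum_right[OF qem[OF i], symmetric]) (rule compo_in_homs[OF h(3) compo_in_homs[OF h(4) pre[OF i]]])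
    also have "\<dots> = (q True \<star> em i) \<star> (pr i \<star> e True)" using dsum_decomp_target[OF T pre[OF i]] by simp
    finally show "(\<Sum>j\<in>UNIV. ?g (i, j) \<star> ?h (i, j)) = (q True \<star> em i) \<star> (pr i \<star> e True)" .
  qed
  also have "\<dots> = (\<Sum>i<n. q True \<star> (em i \<star> (pr i \<star> e True)))"
    by (rule sum.cong[OF refl]) (rule compo_assoc[OF q h(1) pre], simp_all)
  also have "\<dots> = q True \<star> (\<Sum>i<n. em i \<star> (pr i \<star> e True))"
    by (rule compo_sum_right[OF q, symmetric]) (rule compo_in_homs[OF h(1) pre], simp_all)
  also have "\<dots> = ident C X" using dsum_decomp_target[OF W e] qe by simp
  finally have sum: "(\<Sum>p\<in>{..<n} \<times> UNIV. ?g p \<star> ?h p) = ident C X" .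
  show ?thesis
  proof (rule add_class_of_factorization[OF Ti _ _ _ sum])
    fix p :: "nat \<times> 'n" assume "p \<in> {..<n} \<times> UNIV"
    then obtain i j where p: "p = (i, j)" "i < n" by auto
    show "?g p \<in> homs C (Ti (snd p)) X" "?h p \<in> homs C X (Ti (snd p))"
      using p compo_in_homs[OF qem h(3)] compo_in_homs[OF h(4) pre] by simp_all
  qed simp
qed

end

section \<open>Cluster-tilting objects and their exchange triangles\<close>

context linear_category
begin

lemma dsum_source_zero:
  assumes "dsum_maps I F X emb prj" "f \<in> homs C X Y" "\<And>i. i \<in> I \<Longrightarrow> homs C (F i) Y = {0}"
  shows "f = 0"
proof -
  have "(f \<star> emb i) \<star> prj i = 0" if "i \<in> I" for i
    using assms(3)[OF that] compo_in_homs[OF assms(2) dsum_maps_in_homs(1)[OF assms(1) that]]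
      compo_zero_left[OF dsum_maps_in_homs(2)[OF assms(1) that]] by auto
  then show ?thesis using dsum_decomp_source[OF assms(1,2)] by simp
qed

lemma dsum_target_zero:
  assumes "dsum_maps I F X emb prj" "f \<in> homs C Y X" "\<And>i. i \<in> I \<Longrightarrow> homs C Y (F i) = {0}"
  shows "f = 0"
proof -
  have "emb i \<star> (prj i \<star> f) = 0" if "i \<in> I" for i
    using assms(3)[OF that] compo_in_homs[OF dsum_maps_in_homs(2)[OF assms(1) that] assms(2)]
      compo_zero_right[OF dsum_maps_in_homs(1)[OF assms(1) that]] by auto
  then show ?thesis using dsum_decomp_target[OF assms(1,2)] by simp
qed

end

text \<open>The Calabi-Yau structure enters through the trace forms \<open>t\<close> and their
  non-degeneracy on both sides. The structure maps of \<open>T\<close> are fixed once, since the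
  idempotents \<open>\<iota> j \<star> \<pi> j\<close> of End(T) are used throughout.\<close>

locale tilting_category = triangulated_category C + hom_finite_category C
  for C :: "('k::alg_closed_field, 'o, 'v::ab_group_add, 'm) tricat_scheme" (structure) +
  fixes T :: 'o and Ti :: "'n::finite \<Rightarrow> 'o" and \<iota> \<pi> :: "'n \<Rightarrow> 'v" and t :: "'o \<Rightarrow> 'v \<Rightarrow> 'k"
  assumes T_dsum: "dsum_maps UNIV Ti T \<iota> \<pi>"
    and Ti_indecomposable: "indecomposable C (Ti j)"
    and Ti_not_isomorphic: "j \<noteq> l \<Longrightarrow> \<not> isomorphic C (Ti j) (Ti l)"
    and T_rigid: "homs C T (susp C T) = {0}"
    and T_tilting: "homs C T (susp C X) = {0} \<Longrightarrow> in_add C T X"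
    and t_linear: "linear_on_sub (smul C) (*) (homs C X (susp C (susp C X))) (t X)"
    and t_nondegenerate_left:
      "\<lbrakk>f \<in> homs C Y (susp C (susp C X)); \<And>g. g \<in> homs C X Y \<Longrightarrow> t X (f \<star> g) = 0\<rbrakk> \<Longrightarrow> f = 0"
    and t_nondegenerate_right:
      "\<lbrakk>g \<in> homs C X Y; \<And>f. f \<in> homs C Y (susp C (susp C X)) \<Longrightarrow> t X (f \<star> g) = 0\<rbrakk> \<Longrightarrow> g = 0"
begin

lemma iota_in_homs: "\<iota> j \<in> homs C (Ti j) T" and pi_in_homs: "\<pi> j \<in> homs C T (Ti j)"
  using dsum_maps_in_homs[OF T_dsum] by simp_all

abbreviation addT :: "'o \<Rightarrow> bool" where
  "addT X \<equiv> \<exists>a. add_class C Ti X a"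

lemma add_classE:
  assumes "add_class C Ti X a"
  obtains emb prj where "dsum_maps {(j, r). r < a j} (\<lambda>p. Ti (fst p)) X emb prj"
proof -
  have "(\<lambda>(j, r). Ti j) = (\<lambda>p :: 'n \<times> nat. Ti (fst p))" by auto
  then show thesis using assms that is_dsum_iff unfolding add_class_def by metis
qed

lemma add_class_I:
  assumes "dsum_maps {(j, r). r < a j} (\<lambda>p. Ti (fst p)) X emb prj"
  shows "add_class C Ti X a"
proof -
  have "(\<lambda>(j, r). Ti j) = (\<lambda>p :: 'n \<times> nat. Ti (fst p))" by auto
  then show ?thesis using assms is_dsum_iff unfolding add_class_def by metis
qed

lemma finite_mult_index: "finite {(j :: 'n, r). r < (a j :: nat)}"
proof -
  have "{(j, r). r < a j} = (SIGMA j:UNIV. {..<a j})" by auto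
  then show ?thesis by simp
qed

lemma sum_mult_index:
  fixes h :: "'n \<Rightarrow> 'r::comm_semiring_1"
  shows "(\<Sum>p\<in>{(j, r). r < a j}. h (fst p)) = (\<Sum>j\<in>UNIV. of_nat (a j) * h j)"
proof -
  have "{(j, r). r < a j} = (SIGMA j:UNIV. {..<a j})" by auto
  then have "(\<Sum>p\<in>{(j, r). r < a j}. h (fst p)) = (\<Sum>p\<in>(SIGMA j:UNIV. {..<a j}). h (fst p))"
    by simp
  also have "\<dots> = (\<Sum>j\<in>UNIV. \<Sum>r<a j. h j)"
    by (subst sum.Sigma) (auto intro!: sum.cong)
  finally show ?thesis by simp
qed

lemma addT_Ti: "addT (Ti j)"
proof -
  let ?a = "\<lambda>l. if l = j then 1 else 0 :: nat"
  have "{(l, r). r < ?a l} = {(j, 0)}" by (auto split: if_splits)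
  then have "add_class C Ti (Ti j) ?a"
    by (intro add_class_I[of _ _ "\<lambda>_. ident C (Ti j)" "\<lambda>_. ident C (Ti j)"])
      (simp add: dsum_maps_def ident_in_homs ident_left[OF ident_in_homs])
  then show ?thesis by blast
qed

lemma Ti_susp_Ti: "f \<in> homs C (Ti j) (susp C (Ti l)) \<Longrightarrow> f = 0"
proof -
  assume f: "f \<in> homs C (Ti j) (susp C (Ti l))"
  note S = dsum_maps_susp[OF T_dsum]
  note Sh = dsum_maps_in_homs[OF S UNIV_I]
  have g: "suspm C (\<iota> l) \<star> f \<in> homs C (Ti j) (susp C T)" using compo_in_homs[OF Sh(1) f] .
  then have "(suspm C (\<iota> l) \<star> f) \<star> \<pi> j \<in> homs C T (susp C T)" using compo_in_homs pi_in_homs by blast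
  then have "(suspm C (\<iota> l) \<star> f) \<star> \<pi> j = 0" using T_rigid by simp
  then have "suspm C (\<iota> l) \<star> f = 0"
    using compo_prj_inj[OF T_dsum UNIV_I UNIV_I g] compo_zero_left[OF iota_in_homs[of j]] by simp
  then show "f = 0"
    using prj_compo_inj[OF S UNIV_I UNIV_I f] compo_zero_right[OF Sh(2)[of l]] by simp
qed

lemma addT_rigid:
  assumes "addT A" "addT B" "f \<in> homs C A (susp C B)"
  shows "f = 0"
proof -
  obtain a b where ab: "add_class C Ti A a" "add_class C Ti B b" using assms(1,2) by blast
  obtain emb prj where A: "dsum_maps {(j, r). r < a j} (\<lambda>p. Ti (fst p)) A emb prj"
    by (rule add_classE[OF ab(1)])
  obtain emb' prj' where B: "dsum_maps {(j, r). r < b j} (\<lambda>p. Ti (fst p)) B emb' prj'"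
    by (rule add_classE[OF ab(2)])
  show ?thesis
  proof (rule dsum_source_zero[OF A assms(3)])
    fix i :: "'n \<times> nat"
    have "g = 0" if "g \<in> homs C (Ti (fst i)) (susp C B)" for g
      by (rule dsum_target_zero[OF dsum_maps_susp[OF B] that]) (use Ti_susp_Ti in auto)
    then show "homs C (Ti (fst i)) (susp C B) = {0}" by auto
  qed
qed

lemma addT_rigid_susp:
  assumes "addT A" "addT B" "f \<in> homs C (susp C A) (susp C (susp C B))"
  shows "f = 0"
  using suspm_surj[OF assms(3)] addT_rigid[OF assms(1,2)] suspm_0 by metis

text \<open>The form in which maximality of \<open>T\<close> is used: for the cone in the
  coresolution and for the middle term \<open>B\<close>, membership in add(T) is proved by testing
  maps out of the \<open>Ti\<close>.\<close>

lemma addT_I: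
  assumes "\<And>j f. f \<in> homs C (Ti j) (susp C X) \<Longrightarrow> f = 0"
  shows "addT X"
proof -
  have "f = 0" if "f \<in> homs C T (susp C X)" for f
    by (rule dsum_source_zero[OF T_dsum that]) (use assms in auto)
  then have "homs C T (susp C X) = {0}" by auto
  then have "in_add C T X" by (rule T_tilting)
  moreover have "is_dsum C UNIV Ti T" using T_dsum is_dsum_iff by blast
  ultimately show ?thesis using add_class_of_in_add Ti_indecomposable by blast
qed

text \<open>The radical of the category add(T). The \<open>Ti\<close> are pairwise non-isomorphic,
  so off the diagonal every map is radical, and on the diagonal the radical is the kernel of the
  residue character.\<close>

definition rad :: "'n \<Rightarrow> 'n \<Rightarrow> 'v set" where
  "rad j l = {f \<in> homs C (Ti j) (Ti l). j = l \<longrightarrow> chi (Ti j) f = 0}"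

lemma rad_in_homs: "f \<in> rad j l \<Longrightarrow> f \<in> homs C (Ti j) (Ti l)"
  by (simp add: rad_def)

lemma rad_subset: "rad j l \<subseteq> homs C (Ti j) (Ti l)"
  by (auto simp: rad_def)

lemma rad_compo_left:
  assumes "f \<in> rad j l" "g \<in> homs C (Ti l) (Ti m)"
  shows "g \<star> f \<in> rad j m"
proof -
  have f: "f \<in> homs C (Ti j) (Ti l)" using assms(1) by (simp add: rad_def)
  have "chi (Ti j) (g \<star> f) = 0" if "j = m"
  proof (cases "j = l")
    case True
    then show ?thesis
      using chi_compo[OF Ti_indecomposable, of f l g] f assms that by (simp add: rad_def)
  next
    case False
    then show ?thesis
      using chi_through_other[OF Ti_indecomposable Ti_indecomposable Ti_not_isomorphic[OF False] f]
        assms(2) that by simp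
  qed
  then show ?thesis using compo_in_homs[OF assms(2) f] by (simp add: rad_def)
qed

lemma rad_compo_right:
  assumes "f \<in> homs C (Ti j) (Ti l)" "g \<in> rad l m"
  shows "g \<star> f \<in> rad j m"
proof -
  have g: "g \<in> homs C (Ti l) (Ti m)" using assms(2) by (simp add: rad_def)
  have "chi (Ti j) (g \<star> f) = 0" if "j = m"
  proof (cases "j = l")
    case True
    then show ?thesis
      using chi_compo[OF Ti_indecomposable, of f l g] g assms that by (simp add: rad_def)
  next
    case False
    then show ?thesis
      using chi_through_other[OF Ti_indecomposable Ti_indecomposable Ti_not_isomorphic[OF False] assms(1)]
        g that by simp
  qed
  then show ?thesis using compo_in_homs[OF g assms(1)] by (simp add: rad_def)
qed

lemma rad_subspace: "vs.subspace (rad j l)"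
proof (cases "j = l")
  case True
  then have eq: "rad j l = {f \<in> homs C (Ti j) (Ti j). chi (Ti j) f \<in> {0}}" by (simp add: rad_def)
  show ?thesis
    unfolding eq by (rule vk.linear_on_sub_vimage_subspace[OF homs_subspace
          chi_linear[OF Ti_indecomposable] vk.vs2.subspace_single_0])
next
  case False
  then show ?thesis using homs_subspace by (simp add: rad_def)
qed

lemma rad_fin: "finite_dim_sub (smul C) (rad j l)"
  by (rule vs.finite_dim_sub_subset[OF fin_homs rad_subspace]) (auto simp: rad_def)

lemma chi_decomp_Ti:
  assumes "f \<in> homs C (Ti j) (Ti j)"
  obtains g where "g \<in> rad j j" "f = smul C (chi (Ti j) f) (ident C (Ti j)) + g"
proof -
  let ?g = "f - smul C (chi (Ti j) f) (ident C (Ti j))"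
  have "?g \<in> rad j j"
    using chi_decomp[OF Ti_indecomposable assms] diff_in_homs[OF assms smul_in_homs[OF ident_in_homs]]
    by (simp add: rad_def)
  then show thesis using that[of ?g] by simp
qed

section \<open>Approximations by add(T)\<close>

lemma spanning_family:
  assumes "finite_dim_sub (smul C) A"
  obtains e :: "nat \<Rightarrow> 'v" and n where "\<And>r. r < n \<Longrightarrow> e r \<in> A"
    "\<And>x. x \<in> A \<Longrightarrow> \<exists>c. x = (\<Sum>r<n. smul C (c r) (e r))"
proof -
  obtain D where D: "finite D" "D \<subseteq> A" "vs.span D = A"
    using assms unfolding finite_dim_sub_def by blast
  obtain e where e: "bij_betw e {..<card D} D"
    using ex_bij_betw_nat_finite[OF D(1)] by (auto simp: lessThan_atLeast0)
  have "e r \<in> A" if "r < card D" for r using e D(2) that by (auto simp: bij_betw_def)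
  moreover have "\<exists>c. x = (\<Sum>r<card D. smul C (c r) (e r))" if "x \<in> A" for x
  proof -
    have "x \<in> range (\<lambda>u. \<Sum>v\<in>D. smul C (u v) v)"
      using that D(3) vs.span_finite[OF D(1)] by simp
    then obtain u where "x = (\<Sum>v\<in>D. smul C (u v) v)" by blast
    also have "\<dots> = (\<Sum>r<card D. smul C (u (e r)) (e r))"
      by (rule sum.reindex_bij_betw[OF e, symmetric])
    finally show ?thesis by (rule exI[of _ "\<lambda>r. u (e r)"])
  qed
  ultimately show thesis using that by blast
qed

lemma spanning_families:
  assumes "\<And>j. finite_dim_sub (smul C) (A j)"
  shows "\<exists>(e :: 'n \<Rightarrow> nat \<Rightarrow> 'v) n. (\<forall>j. \<forall>r<n j. e j r \<in> A j) \<and>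
    (\<forall>j. \<forall>x\<in>A j. \<exists>c. x = (\<Sum>r<n j. smul C (c r) (e j r)))"
proof -
  define P where "P j e n \<longleftrightarrow> (\<forall>r < n. e r \<in> A j) \<and> (\<forall>x\<in>A j. \<exists>c. x = (\<Sum>r<n. smul C (c r) (e r)))"
    for j e and n :: nat
  have "\<exists>e n. P j e n" for j
  proof -
    obtain e :: "nat \<Rightarrow> 'v" and n where "\<And>r. r < n \<Longrightarrow> e r \<in> A j"
      "\<And>x. x \<in> A j \<Longrightarrow> \<exists>c. x = (\<Sum>r<n. smul C (c r) (e r))"
      by (rule spanning_family[OF assms[of j]]) (rule that)
    then have "P j e n" by (simp add: P_def)
    then show ?thesis by blast
  qed
  then obtain e n where "\<And>j. P j (e j) (n j)" by metis
  then show ?thesis unfolding P_def by blast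
qed

text \<open>One copy of \<open>Ti j\<close> is taken for each member of a spanning family of
  \<open>U j\<close>. The spaces \<open>U j\<close> form a subfunctor of Hom(?, Y), so the image
  cannot leave them. The result is in general not minimal; the surplus is compensated in
  \<open>multiplicity_difference\<close>.\<close>

lemma right_approximation:
  assumes U: "\<And>j. finite_dim_sub (smul C) (U j)" "\<And>j. U j \<subseteq> homs C (Ti j) Y"
    and closed: "\<And>j l f g. \<lbrakk>f \<in> homs C (Ti j) (Ti l); g \<in> U l\<rbrakk> \<Longrightarrow> g \<star> f \<in> U j"
  obtains B b d where "add_class C Ti B b" "d \<in> homs C B Y"
    "\<And>j. (\<lambda>g. d \<star> g) ` homs C (Ti j) B = U j"
proof -
  obtain e and n :: "'n \<Rightarrow> nat" where en: "(\<forall>j. \<forall>r<n j. e j r \<in> U j) \<and>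
      (\<forall>j. \<forall>x\<in>U j. \<exists>c. x = (\<Sum>r<n j. smul C (c r) (e j r)))"
    using spanning_families[of U, OF U(1)] by blast
  note e = en[THEN conjunct1, rule_format] en[THEN conjunct2, rule_format]
  let ?I = "{(j, r). r < n j}"
  obtain B where B: "is_dsum C ?I (\<lambda>(j, r). Ti j) B" using dsum_exists[OF finite_mult_index] by blast
  then have add: "add_class C Ti B n" by (simp add: add_class_def)
  obtain emb prj where D: "dsum_maps ?I (\<lambda>p. Ti (fst p)) B emb prj" using add_classE[OF add] .
  note h = dsum_maps_in_homs[OF D]
  have eU: "e (fst p) (snd p) \<in> U (fst p)" if "p \<in> ?I" for p using that e(1) by auto
  then have eh: "e (fst p) (snd p) \<in> homs C (Ti (fst p)) Y" if "p \<in> ?I" for p using that U(2) by blast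
  define d where "d = (\<Sum>p\<in>?I. e (fst p) (snd p) \<star> prj p)"
  have d: "d \<in> homs C B Y" unfolding d_def by (rule sum_in_homs) (rule compo_in_homs[OF eh h(2)])
  have demb: "d \<star> emb q = e (fst q) (snd q)" if q: "q \<in> ?I" for q
  proof -
    have "d \<star> emb q = (\<Sum>p\<in>?I. (e (fst p) (snd p) \<star> prj p) \<star> emb q)"
      unfolding d_def by (rule compo_sum_left[OF h(1)[OF q]]) (rule compo_in_homs[OF eh h(2)])
    also have "\<dots> = (\<Sum>p\<in>?I. if p = q then e (fst p) (snd p) else 0)"
      by (rule sum.cong[OF refl]) (rule compo_prj_inj[OF D _ q eh])
    also have "\<dots> = e (fst q) (snd q)" using q finite_mult_index by (simp add: sum.delta')
    finally show ?thesis .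
  qed
  have "(\<lambda>g. d \<star> g) ` homs C (Ti j) B = U j" for j
  proof (intro equalityI subsetI)
    fix x assume "x \<in> (\<lambda>g. d \<star> g) ` homs C (Ti j) B"
    then obtain g where g: "g \<in> homs C (Ti j) B" "x = d \<star> g" by blast
    have pg: "prj p \<star> g \<in> homs C (Ti j) (Ti (fst p))" if "p \<in> ?I" for p
      using compo_in_homs[OF h(2)[OF that] g(1)] .
    have "x = d \<star> (\<Sum>p\<in>?I. emb p \<star> (prj p \<star> g))" using dsum_decomp_target[OF D g(1)] g(2) by simp
    also have "\<dots> = (\<Sum>p\<in>?I. d \<star> (emb p \<star> (prj p \<star> g)))"
      by (rule compo_sum_right[OF d]) (rule compo_in_homs[OF h(1) pg])
    also have "\<dots> = (\<Sum>p\<in>?I. e (fst p) (snd p) \<star> (prj p \<star> g))"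
    proof (rule sum.cong[OF refl])
      fix p assume p: "p \<in> ?I"
      show "d \<star> (emb p \<star> (prj p \<star> g)) = e (fst p) (snd p) \<star> (prj p \<star> g)"
        using compo_assoc[OF d h(1)[OF p] pg[OF p]] demb[OF p] by simp
    qed
    also have "\<dots> \<in> U j"
      by (rule vs.subspace_sum[OF vs.finite_dim_sub_subspace[OF U(1)]]) (rule closed[OF pg eU])
    finally show "x \<in> U j" .
  next
    fix x assume "x \<in> U j"
    then obtain c where c: "x = (\<Sum>r<n j. smul C (c r) (e j r))" using e(2) by blast
    have hj: "emb (j, r) \<in> homs C (Ti j) B" "d \<star> emb (j, r) = e j r" if "r \<in> {..<n j}" for r
      using h(1)[of "(j, r)"] demb[of "(j, r)"] that by auto
    have "x = (\<Sum>r<n j. d \<star> smul C (c r) (emb (j, r)))"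
      unfolding c by (rule sum.cong[OF refl]) (simp add: compo_smul_right[OF d hj(1)] hj(2))
    also have "\<dots> = d \<star> (\<Sum>r<n j. smul C (c r) (emb (j, r)))"
      by (rule compo_sum_right[OF d, symmetric]) (rule smul_in_homs[OF hj(1)])
    finally have "x = d \<star> (\<Sum>r<n j. smul C (c r) (emb (j, r)))" .
    moreover have "(\<Sum>r<n j. smul C (c r) (emb (j, r))) \<in> homs C (Ti j) B"
      by (rule sum_in_homs) (rule smul_in_homs[OF hj(1)])
    ultimately show "x \<in> (\<lambda>g. d \<star> g) ` homs C (Ti j) B" by blast
  qed
  then show thesis using that add d by blast
qed

text \<open>The dual construction after two suspensions: one copy of \<Sigma>^2 T_j for every member
  of a spanning family of Hom(M, \<Sigma>^2 T_j).\<close>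

lemma left_approximation_susp2:
  obtains A a u where "add_class C Ti A a" "u \<in> homs C M (susp C (susp C A))"
    "\<And>j f. f \<in> homs C M (susp C (susp C (Ti j))) \<Longrightarrow>
       \<exists>h\<in>homs C (susp C (susp C A)) (susp C (susp C (Ti j))). h \<star> u = f"
proof -
  let ?S = "\<lambda>X. susp C (susp C X)"
  obtain e and n :: "'n \<Rightarrow> nat" where en: "(\<forall>j. \<forall>r<n j. e j r \<in> homs C M (?S (Ti j))) \<and>
      (\<forall>j. \<forall>x\<in>homs C M (?S (Ti j)). \<exists>c. x = (\<Sum>r<n j. smul C (c r) (e j r)))"
    using spanning_families[of "\<lambda>j. homs C M (?S (Ti j))", OF fin_homs] by blast
  note e = en[THEN conjunct1, rule_format] en[THEN conjunct2, rule_format]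
  let ?I = "{(j, r). r < n j}"
  obtain A where A: "is_dsum C ?I (\<lambda>(j, r). Ti j) A" using dsum_exists[OF finite_mult_index] by blast
  then have add: "add_class C Ti A n" by (simp add: add_class_def)
  obtain emb0 prj0 where D0: "dsum_maps ?I (\<lambda>p. Ti (fst p)) A emb0 prj0" using add_classE[OF add] .
  obtain emb prj where D: "dsum_maps ?I (\<lambda>p. ?S (Ti (fst p))) (?S A) emb prj"
    using dsum_maps_susp[OF dsum_maps_susp[OF D0]] by blast
  note h = dsum_maps_in_homs[OF D]
  have eh: "e (fst p) (snd p) \<in> homs C M (?S (Ti (fst p)))" if "p \<in> ?I" for p using that e(1) by auto
  define u where "u = (\<Sum>p\<in>?I. emb p \<star> e (fst p) (snd p))"
  have u: "u \<in> homs C M (?S A)" unfolding u_def by (rule sum_in_homs) (rule compo_in_homs[OF h(1) eh])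
  have prju: "prj q \<star> u = e (fst q) (snd q)" if q: "q \<in> ?I" for q
  proof -
    have "prj q \<star> u = (\<Sum>p\<in>?I. prj q \<star> (emb p \<star> e (fst p) (snd p)))"
      unfolding u_def by (rule compo_sum_right[OF h(2)[OF q]]) (rule compo_in_homs[OF h(1) eh])
    also have "\<dots> = (\<Sum>p\<in>?I. if q = p then e (fst p) (snd p) else 0)"
      by (rule sum.cong[OF refl]) (rule prj_compo_inj[OF D q _ eh])
    also have "\<dots> = e (fst q) (snd q)" using q finite_mult_index by (simp add: sum.delta)
    finally show ?thesis .
  qed
  have "\<exists>h\<in>homs C (?S A) (?S (Ti j)). h \<star> u = x" if x: "x \<in> homs C M (?S (Ti j))" for j x
  proof -
    obtain c where c: "x = (\<Sum>r<n j. smul C (c r) (e j r))" using e(2)[OF x] by blast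
    have hj: "prj (j, r) \<in> homs C (?S A) (?S (Ti j))" "prj (j, r) \<star> u = e j r" if "r \<in> {..<n j}" for r
      using h(2)[of "(j, r)"] prju[of "(j, r)"] that by auto
    have "x = (\<Sum>r<n j. smul C (c r) (prj (j, r)) \<star> u)"
      unfolding c by (rule sum.cong[OF refl]) (simp add: compo_smul_left[OF u hj(1)] hj(2))
    also have "\<dots> = (\<Sum>r<n j. smul C (c r) (prj (j, r))) \<star> u"
      by (rule compo_sum_left[OF u, symmetric]) (rule smul_in_homs[OF hj(1)])
    finally have "x = (\<Sum>r<n j. smul C (c r) (prj (j, r))) \<star> u" .
    moreover have "(\<Sum>r<n j. smul C (c r) (prj (j, r))) \<in> homs C (?S A) (?S (Ti j))"
      by (rule sum_in_homs) (rule smul_in_homs[OF hj(1)])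
    ultimately show ?thesis by blast
  qed
  then show thesis using that add u by blast
qed

text \<open>For a left \<open>add(\<Sigma>\<^sup>2T)\<close>-approximation \<open>u\<close> of \<open>M\<close>, the cone is \<open>\<Sigma>\<^sup>2Z\<close> with \<open>Hom(\<Sigma>Z, \<Sigma>\<^sup>2T) = 0\<close>,
  hence \<open>Hom(T, \<Sigma>Z) = 0\<close> by the Calabi-Yau duality.\<close>

lemma coresolution_exists:
  obtains A B u v w a b where "(M, susp C (susp C A), susp C (susp C B), u, v, w) \<in> triangles C"
    "add_class C Ti A a" "add_class C Ti B b"
proof -
  let ?S = "\<lambda>X. susp C (susp C X)"
  obtain A a u where A: "add_class C Ti A a" and u: "u \<in> homs C M (?S A)"
    and app: "\<And>j f. f \<in> homs C M (?S (Ti j)) \<Longrightarrow> \<exists>h\<in>homs C (?S A) (?S (Ti j)). h \<star> u = f"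
    using left_approximation_susp2 by metis
  obtain W v0 w0 where t0: "(M, ?S A, W, u, v0, w0) \<in> triangles C" using triangle_exists[OF u] by blast
  obtain W' where W': "isomorphic C W (susp C W')" using susp_ess_surj by blast
  obtain Z where Z: "isomorphic C W' (susp C Z)" using susp_ess_surj by blast
  \<comment> \<open>Essential surjectivity is used twice to write the cone as a double suspension;
    the inner isomorphism has to be suspended first.\<close>
  have "isomorphic C (susp C W') (?S Z)"
  proof -
    obtain c c' where c: "c \<in> homs C W' (susp C Z)" "c' \<in> homs C (susp C Z) W'"
        "c' \<star> c = ident C W'" "c \<star> c' = ident C (susp C Z)"
      using Z by (auto simp: isomorphic_def iso_mor_def)
    have "iso_mor C (susp C W') (?S Z) (suspm C c)"
      using suspm_in_homs[OF c(1)] suspm_in_homs[OF c(2)] suspm_compo[OF c(2,1)]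
        suspm_compo[OF c(1,2)] c(3,4) suspm_ident unfolding iso_mor_def by metis
    then show ?thesis by (auto simp: isomorphic_def)
  qed
  then obtain v w where tri: "(M, ?S A, ?S Z, u, v, w) \<in> triangles C"
    using triangle_replace_third[OF t0 W'] triangle_replace_third by metis
  note th = triangle_in_homs[OF tri]
  have "addT Z"
  proof (rule addT_I)
    fix j g assume g: "g \<in> homs C (Ti j) (susp C Z)"
    have "f = 0" if f: "f \<in> homs C (susp C Z) (?S (Ti j))" for f
    proof -
      note Sf = suspm_in_homs[OF f]
      \<comment> \<open>Once this holds by rigidity, \<Sigma>f factors over \<open>w\<close>; the
        approximation property lets the other factor pass through \<Sigma>u, and \<Sigma>u after
        \<open>w\<close> is zero.\<close>
      have "suspm C f \<star> v = 0"
      proof -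
        have "suspm C f \<star> v \<in> homs C (?S A) (susp C (?S (Ti j)))" using compo_in_homs[OF Sf th(2)] .
        then obtain y where y: "y \<in> homs C (susp C A) (?S (Ti j))" "suspm C f \<star> v = suspm C y"
          by (rule suspm_surj)
        have "addT A" using A by blast
        then have "y = 0" by (rule addT_rigid_susp[OF _ addT_Ti y(1)])
        then show ?thesis using y(2) by simp
      qed
      then obtain h where h: "h \<in> homs C (susp C M) (susp C (?S (Ti j)))" "h \<star> w = suspm C f"
        using extend_third[OF tri Sf] by blast
      obtain h0 where h0: "h0 \<in> homs C M (?S (Ti j))" "h = suspm C h0" using suspm_surj[OF h(1)] .
      obtain h1 where h1: "h1 \<in> homs C (?S A) (?S (Ti j))" "h1 \<star> u = h0" using app[OF h0(1)] by blast
      have "suspm C f = suspm C h1 \<star> (suspm C u \<star> w)"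
        using h h0 h1 suspm_compo[OF h1(1) u]
          compo_assoc[OF suspm_in_homs[OF h1(1)] suspm_in_homs[OF u] th(3)] by simp
      also have "\<dots> = 0"
        using triangle_compo_zero''[OF tri] compo_zero_right[OF suspm_in_homs[OF h1(1)]] by simp
      finally show ?thesis using suspm_eq_0 f by blast
    qed
    then show "g = 0"
      using t_nondegenerate_right[OF g] compo_zero_left[OF g] vk.linear_on_sub_0[OF homs_subspace t_linear]
      by metis
  qed
  then obtain b where "add_class C Ti Z b" ..
  then show thesis using that tri A by blast
qed

end

subsection \<open>The sink map of \<open>T\<^sub>i\<close> and its cone\<close>

text \<open>By rigidity the functor Hom(T, ?) sends \<Sigma>U to Hom(T, T_i) modulo the image of
  \<open>d\<close>. That image is the radical with j = i included, so \<Sigma>U realises the simple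
  top of Hom(T, T_i) even if there are loops at i.\<close>

locale sink_triangle = tilting_category C T Ti \<iota> \<pi> t
  for C :: "('k::alg_closed_field, 'o, 'v::ab_group_add, 'm) tricat_scheme" (structure)
    and T :: 'o and Ti :: "'n::finite \<Rightarrow> 'o" and \<iota> \<pi> t +
  fixes i :: 'n and B' :: 'o and b' :: "'n \<Rightarrow> nat" and U :: 'o and \<beta> d p :: 'v
  assumes sink_triangle: "(U, B', Ti i, \<beta>, d, p) \<in> triangles C"
    and B'_add: "add_class C Ti B' b'"
    and sink_image: "(\<lambda>g. d \<star> g) ` homs C (Ti j) B' = rad j i"
begin

lemma sink_in_homs:
  "\<beta> \<in> homs C U B'" "d \<in> homs C B' (Ti i)" "p \<in> homs C (Ti i) (susp C U)"
  using triangle_in_homs[OF sink_triangle] by auto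

lemma p_rad_zero:
  assumes "f \<in> rad j i"
  shows "p \<star> f = 0"
proof -
  obtain g where g: "g \<in> homs C (Ti j) B'" "f = d \<star> g" using assms sink_image by blast
  have "p \<star> f = (p \<star> d) \<star> g" using compo_assoc[OF sink_in_homs(3,2) g(1)] g(2) by simp
  then show ?thesis using triangle_compo_zero'[OF sink_triangle] compo_zero_left[OF g(1)] by simp
qed

text \<open>If \<open>p\<close> were zero, \<open>d\<close> would be a split epimorphism and the
  identity of T_i would be radical.\<close>

lemma p_nonzero: "p \<noteq> 0"
proof
  assume "p = 0"
  then have "p \<star> ident C (Ti i) = 0" using compo_zero_left[OF ident_in_homs] by simp
  from lift_second[OF sink_triangle ident_in_homs this]
  obtain g where g: "g \<in> homs C (Ti i) B'" "d \<star> g = ident C (Ti i)" .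
  have "d \<star> g \<in> rad i i" using sink_image[of i] g(1) by auto
  then show False using chi_ident[OF Ti_indecomposable, of i] g(2) by (simp add: rad_def)
qed

lemma homs_Ti_susp_U:
  assumes "h \<in> homs C (Ti j) (susp C U)"
  obtains k where "k \<in> homs C (Ti j) (Ti i)" "h = p \<star> k"
proof -
  have "suspm C \<beta> \<star> h \<in> homs C (Ti j) (susp C B')"
    using compo_in_homs[OF suspm_in_homs[OF sink_in_homs(1)] assms] .
  then have "suspm C \<beta> \<star> h = 0" using addT_rigid[OF addT_Ti] B'_add by blast
  then show thesis using lift_third[OF sink_triangle assms] that by metis
qed

lemma homs_Ti_susp_U_other: "\<lbrakk>j \<noteq> i; h \<in> homs C (Ti j) (susp C U)\<rbrakk> \<Longrightarrow> h = 0"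
  using homs_Ti_susp_U[of h j] p_rad_zero[of _ j] by (metis (mono_tags, lifting) mem_Collect_eq rad_def)

lemma homs_Ti_susp_U_same: "h \<in> homs C (Ti i) (susp C U) \<Longrightarrow> \<exists>c. h = smul C c p"
proof -
  assume "h \<in> homs C (Ti i) (susp C U)"
  then obtain k where k: "k \<in> homs C (Ti i) (Ti i)" "h = p \<star> k" by (rule homs_Ti_susp_U)
  obtain g where g: "g \<in> rad i i" "k = smul C (chi (Ti i) k) (ident C (Ti i)) + g"
    using chi_decomp_Ti[OF k(1)] .
  have "h = p \<star> (smul C (chi (Ti i) k) (ident C (Ti i)) + g)" using k(2) g(2) by simp
  also have "\<dots> = smul C (chi (Ti i) k) p"
    using compo_add_right[OF sink_in_homs(3) smul_in_homs[OF ident_in_homs] rad_in_homs[OF g(1)]]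
      p_rad_zero[OF g(1)] compo_smul_right[OF sink_in_homs(3) ident_in_homs] ident_right[OF sink_in_homs(3)]
    by simp
  finally show ?thesis by blast
qed

lemma dim_homs_Ti_susp_U: "vs.dim (homs C (Ti j) (susp C U)) = (if j = i then 1 else 0)"
proof (cases "j = i")
  case True
  have "homs C (Ti i) (susp C U) = range (\<lambda>c. smul C c p)"
    using homs_Ti_susp_U_same smul_in_homs[OF sink_in_homs(3)] by auto
  then show ?thesis using True vs.dim_span_single[OF p_nonzero] by simp
next
  case False
  then have "homs C (Ti j) (susp C U) = {0}" using homs_Ti_susp_U_other by auto
  then show ?thesis using False by simp
qed

text \<open>Calabi-Yau duality in dimensions: both radicals of the trace pairing with Hom(T_j,
  \<Sigma>U) vanish.\<close>

lemma dim_homs_susp_U_Ti: "vs.dim (homs C (susp C U) (susp C (susp C (Ti j)))) = (if j = i then 1 else 0)"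
proof -
  let ?V = "homs C (susp C U) (susp C (susp C (Ti j)))" and ?W = "homs C (Ti j) (susp C U)"
  have "vs.dim ?W + vs.dim {v \<in> ?V. \<forall>w\<in>?W. t (Ti j) (v \<star> w) = 0} =
      vs.dim {w \<in> ?W. \<forall>v\<in>?V. t (Ti j) (v \<star> w) = 0} + vs.dim ?V"
  proof (rule vp.pairing_dim[OF fin_homs fin_homs])
    fix w assume w: "w \<in> ?W"
    show "linear_on_sub (smul C) (*) ?V (\<lambda>v. t (Ti j) (v \<star> w))"
      unfolding linear_on_sub_def
      using compo_add_left[OF w] compo_smul_left[OF w] compo_in_homs[OF _ w]
        linear_on_sub_add[OF t_linear] linear_on_sub_scale[OF t_linear] by metis
  next
    fix v assume v: "v \<in> ?V"
    show "linear_on_sub (smul C) (*) ?W (\<lambda>w. t (Ti j) (v \<star> w))"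
      unfolding linear_on_sub_def
      using compo_add_right[OF v] compo_smul_right[OF v] compo_in_homs[OF v]
        linear_on_sub_add[OF t_linear] linear_on_sub_scale[OF t_linear] by metis
  qed
  moreover have "{v \<in> ?V. \<forall>w\<in>?W. t (Ti j) (v \<star> w) = 0} = {0}"
    using t_nondegenerate_left[of _ "susp C U" "Ti j"] compo_zero_left
      vk.linear_on_sub_0[OF homs_subspace t_linear] by auto
  moreover have "{w \<in> ?W. \<forall>v\<in>?V. t (Ti j) (v \<star> w) = 0} = {0}"
    using t_nondegenerate_right[of _ "Ti j" "susp C U"] compo_zero_right
      vk.linear_on_sub_0[OF homs_subspace t_linear] by auto
  ultimately show ?thesis using dim_homs_Ti_susp_U[of j] by simp
qed

text \<open>Additivity turns \<Sigma>U into a counter of copies of T_i in objects of add(T). The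
  coindex is read off by applying Hom(\<Sigma>U, ?) to the triangle of \<open>M\<close>.\<close>

lemma dim_homs_susp_U_add:
  assumes "add_class C Ti A a"
  shows "vs.dim (homs C (susp C U) (susp C (susp C A))) = a i"
proof -
  let ?S = "\<lambda>X. susp C (susp C X)"
  let ?I = "{(j, r). r < a j}"
  obtain emb0 prj0 where D0: "dsum_maps ?I (\<lambda>p. Ti (fst p)) A emb0 prj0" using add_classE[OF assms] .
  obtain emb prj where D: "dsum_maps ?I (\<lambda>p. ?S (Ti (fst p))) (?S A) emb prj"
    using dsum_maps_susp[OF dsum_maps_susp[OF D0]] by blast
  note h = dsum_maps_in_homs[OF D]
  have "vs.dim (homs C (susp C U) (?S A)) = (\<Sum>q\<in>?I. vs.dim (homs C (susp C U) (?S (Ti (fst q)))))"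
  proof (rule vs.dim_direct_sum[OF finite_mult_index fin_homs homs_subspace,
        where \<phi> = "\<lambda>q x. prj q \<star> x" and \<psi> = "\<lambda>q x. emb q \<star> x"])
    fix q assume q: "q \<in> ?I"
    show "linear_on_sub (smul C) (smul C) (homs C (susp C U) (?S A)) (\<lambda>x. prj q \<star> x) \<and>
        (\<lambda>x. prj q \<star> x) ` homs C (susp C U) (?S A) \<subseteq> homs C (susp C U) (?S (Ti (fst q)))"
      using compo_linear_right[OF h(2)[OF q]] compo_in_homs[OF h(2)[OF q]] by blast
    show "linear_on_sub (smul C) (smul C) (homs C (susp C U) (?S (Ti (fst q)))) (\<lambda>x. emb q \<star> x) \<and>
        (\<lambda>x. emb q \<star> x) ` homs C (susp C U) (?S (Ti (fst q))) \<subseteq> homs C (susp C U) (?S A)"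
      using compo_linear_right[OF h(1)[OF q]] compo_in_homs[OF h(1)[OF q]] by blast
  next
    fix q r x assume "q \<in> ?I" "r \<in> ?I" "x \<in> homs C (susp C U) (?S (Ti (fst r)))"
    then show "prj q \<star> (emb r \<star> x) = (if q = r then x else 0)" using prj_compo_inj[OF D] by blast
  next
    fix x assume "x \<in> homs C (susp C U) (?S A)"
    then show "(\<Sum>q\<in>?I. emb q \<star> (prj q \<star> x)) = x" by (rule dsum_decomp_target[OF D])
  qed
  also have "\<dots> = (\<Sum>q\<in>?I. if fst q = i then 1 else 0)" by (simp add: dim_homs_susp_U_Ti)
  also have "\<dots> = (\<Sum>j\<in>UNIV. of_nat (a j) * (if j = i then 1 else 0))"
    using sum_mult_index[where a = a and h = "\<lambda>j. if j = i then 1 else 0 :: nat"] .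
  also have "\<dots> = (\<Sum>j\<in>UNIV. if j = i then a j else 0)" by (rule sum.cong) auto
  also have "\<dots> = a i" by simp
  finally show ?thesis .
qed

end

lemma (in tilting_category) sink_triangle_exists:
  "\<exists>B' b' U \<beta> d p. sink_triangle C T Ti \<iota> \<pi> t i B' b' U \<beta> d p"
proof -
  obtain B' b' d where B: "add_class C Ti B' b'" "d \<in> homs C B' (Ti i)"
    "\<And>j. (\<lambda>g. d \<star> g) ` homs C (Ti j) B' = rad j i"
    by (rule right_approximation[of "\<lambda>j. rad j i" "Ti i", OF rad_fin rad_subset],
        erule (1) rad_compo_right, rule that)
  obtain U \<beta> p where "(U, B', Ti i, \<beta>, d, p) \<in> triangles C" using triangle_from_second[OF B(2)] .
  then have "sink_triangle C T Ti \<iota> \<pi> t i B' b' U \<beta> d p"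
    using B tilting_category_axioms by (simp add: sink_triangle_def sink_triangle_axioms_def)
  then show ?thesis by blast
qed

text \<open>With the same \<open>U\<close> on the right, the second triangle joins the first to T_i
  -> B -> B' -> T_i, the middle map being \<open>\<beta> \<star> \<gamma>\<close>. The lemmas
  \<open>sink_kernel\<close> and \<open>source_kernel\<close> give exactness at B' for Hom(T_j, ?)
  and at B for Hom(?, T_j).\<close>

locale exchange_triangles = sink_triangle C T Ti \<iota> \<pi> t i B' b' U \<beta> d p
  for C :: "('k::alg_closed_field, 'o, 'v::ab_group_add, 'm) tricat_scheme" (structure)
    and T :: 'o and Ti :: "'n::finite \<Rightarrow> 'o" and \<iota> \<pi> t i B' b' U \<beta> d p +
  fixes B :: 'o and b :: "'n \<Rightarrow> nat" and s \<gamma> \<epsilon> :: 'v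
  assumes source_triangle: "(Ti i, B, U, s, \<gamma>, \<epsilon>) \<in> triangles C"
    and B_add: "add_class C Ti B b"
    and susp_\<epsilon>_p: "suspm C \<epsilon> \<star> p \<noteq> 0"

text \<open>The connecting map \<open>\<epsilon>\<close> is chosen not to vanish against \<open>p\<close> under the Calabi-Yau pairing; this
  forces \<open>Hom(T, \<Sigma>B) = 0\<close>, so that both triangles share the object \<open>U\<close>.\<close>

lemma (in sink_triangle) exchange_triangles_exist:
  "\<exists>B b s \<gamma> \<epsilon>. exchange_triangles C T Ti \<iota> \<pi> t i B' b' U \<beta> d p B b s \<gamma> \<epsilon>"
proof -
  note p = sink_in_homs(3)
  obtain f where f: "f \<in> homs C (susp C U) (susp C (susp C (Ti i)))" "t (Ti i) (f \<star> p) \<noteq> 0"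
    using t_nondegenerate_right[OF p] p_nonzero by blast
  obtain \<epsilon> where \<epsilon>: "\<epsilon> \<in> homs C U (susp C (Ti i))" "f = suspm C \<epsilon>" using suspm_surj[OF f(1)] .
  have \<epsilon>p: "suspm C \<epsilon> \<star> p \<noteq> 0"
    using f(2) \<epsilon>(2) vk.linear_on_sub_0[OF homs_subspace t_linear] by metis
  obtain B s \<gamma> where tri: "(Ti i, B, U, s, \<gamma>, \<epsilon>) \<in> triangles C" using triangle_from_third[OF \<epsilon>(1)] .
  note th = triangle_in_homs[OF tri]
  have "addT B"
  proof (rule addT_I)
    fix j g assume g: "g \<in> homs C (Ti j) (susp C B)"
    let ?h = "suspm C \<gamma> \<star> g"
    have h: "?h \<in> homs C (Ti j) (susp C U)" using compo_in_homs[OF suspm_in_homs[OF th(2)] g] .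
    have "suspm C \<epsilon> \<star> ?h = suspm C (\<epsilon> \<star> \<gamma>) \<star> g"
      using compo_assoc[OF suspm_in_homs[OF th(3)] suspm_in_homs[OF th(2)] g] suspm_compo[OF th(3,2)]
      by simp
    then have eh: "suspm C \<epsilon> \<star> ?h = 0"
      using triangle_compo_zero'[OF tri] compo_zero_left[OF g] by simp
    \<comment> \<open>A map from T_j to \<Sigma>U is zero or, for j = i, a multiple of
      \<open>p\<close>; composing with \<Sigma>\<epsilon> annihilates \<open>?h\<close> but not
      \<open>p\<close>.\<close>
    have "?h = 0"
    proof (cases "j = i")
      case True
      then obtain c where c: "?h = smul C c p" using homs_Ti_susp_U_same h by blast
      then have "smul C c (suspm C \<epsilon> \<star> p) = 0"
        using eh compo_smul_right[OF suspm_in_homs[OF \<epsilon>(1)] p] by simp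
      then show ?thesis using c \<epsilon>p by simp
    next
      case False
      then show ?thesis using homs_Ti_susp_U_other h by blast
    qed
    then obtain k where k: "k \<in> homs C (Ti j) (susp C (Ti i))" "(- suspm C s) \<star> k = g"
      using lift_third[OF triangle_rotateD[OF tri] g] by blast
    then show "g = 0"
      using Ti_susp_Ti[OF k(1)] compo_zero_right[OF minus_in_homs[OF suspm_in_homs[OF th(1)]]] by simp
  qed
  then obtain b where "add_class C Ti B b" ..
  then have "exchange_triangles C T Ti \<iota> \<pi> t i B' b' U \<beta> d p B b s \<gamma> \<epsilon>"
    using tri \<epsilon>p sink_triangle_axioms
    by (simp add: exchange_triangles_def exchange_triangles_axioms_def)
  then show ?thesis by blast
qed

context exchange_triangles
begin

lemma source_in_homs:
  "s \<in> homs C (Ti i) B" "\<gamma> \<in> homs C B U" "\<epsilon> \<in> homs C U (susp C (Ti i))"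
  using triangle_in_homs[OF source_triangle] by auto

lemma \<beta>\<gamma>_in_homs: "\<beta> \<star> \<gamma> \<in> homs C B B'"
  using compo_in_homs[OF sink_in_homs(1) source_in_homs(2)] .

lemma d_\<beta>\<gamma>: "d \<star> (\<beta> \<star> \<gamma>) = 0"
  using compo_assoc[OF sink_in_homs(2,1) source_in_homs(2)] triangle_compo_zero[OF sink_triangle]
    compo_zero_left[OF source_in_homs(2)] by simp

lemma \<beta>\<gamma>_s: "(\<beta> \<star> \<gamma>) \<star> s = 0"
  using compo_assoc[OF sink_in_homs(1) source_in_homs(2,1)] triangle_compo_zero[OF source_triangle]
    compo_zero_right[OF sink_in_homs(1)] by simp

text \<open>The factor through \<open>U\<close> lifts to \<open>B\<close> because its obstruction
  lies in Hom(T_j, \<Sigma>T_i) = 0.\<close>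

lemma sink_kernel:
  assumes "g \<in> homs C (Ti j) B'" "d \<star> g = 0"
  shows "\<exists>k\<in>homs C (Ti j) B. (\<beta> \<star> \<gamma>) \<star> k = g"
proof -
  obtain x where x: "x \<in> homs C (Ti j) U" "\<beta> \<star> x = g" using lift_first[OF sink_triangle assms] .
  have "\<epsilon> \<star> x = 0" using Ti_susp_Ti compo_in_homs[OF source_in_homs(3) x(1)] by blast
  from lift_second[OF source_triangle x(1) this]
  obtain k where k: "k \<in> homs C (Ti j) B" "\<gamma> \<star> k = x" .
  then show ?thesis using compo_assoc[OF sink_in_homs(1) source_in_homs(2) k(1)] x(2) by auto
qed

text \<open>Dually, extending the factor from \<open>U\<close> to \<open>B'\<close> is obstructed in
  Hom(T_i, \<Sigma>T_j) = 0.\<close>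

lemma source_kernel:
  assumes "k \<in> homs C B (Ti j)" "k \<star> s = 0"
  shows "\<exists>k'\<in>homs C B' (Ti j). k' \<star> (\<beta> \<star> \<gamma>) = k"
proof -
  obtain x where x: "x \<in> homs C U (Ti j)" "x \<star> \<gamma> = k" using extend_second[OF source_triangle assms] .
  have "suspm C x \<star> p = 0"
    using Ti_susp_Ti compo_in_homs[OF suspm_in_homs[OF x(1)] sink_in_homs(3)] by blast
  from extend_first[OF sink_triangle x(1) this]
  obtain k' where k': "k' \<in> homs C B' (Ti j)" "k' \<star> \<beta> = x" .
  then show ?thesis using compo_assoc[OF k'(1) sink_in_homs(1) source_in_homs(2)] x(2) by auto
qed

lemma susp_\<epsilon>_nonzero: "suspm C \<epsilon> \<noteq> 0"
  using susp_\<epsilon>_p compo_zero_left[OF sink_in_homs(3)] by auto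

lemma homs_susp_U_susp2_Ti:
  assumes "f \<in> homs C (susp C U) (susp C (susp C (Ti i)))"
  shows "\<exists>c. f = smul C c (suspm C \<epsilon>)"
proof -
  let ?R = "range (\<lambda>c. smul C c (suspm C \<epsilon>))" and ?H = "homs C (susp C U) (susp C (susp C (Ti i)))"
  have R: "?R = vs.span {suspm C \<epsilon>}" by (simp add: vs.span_singleton)
  have "?R = ?H"
  proof (rule vs.finite_dim_sub_dim_eq[OF fin_homs])
    show "vs.subspace ?R" by (simp add: R)
    show "?R \<subseteq> ?H" using smul_in_homs[OF suspm_in_homs[OF source_in_homs(3)]] by blast
    show "vs.dim ?H \<le> vs.dim ?R"
      using vs.dim_span_single[OF susp_\<epsilon>_nonzero] dim_homs_susp_U_Ti[of i] by simp
  qed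
  then show ?thesis using assms by blast
qed

text \<open>End(T_i) acts on the one-dimensional Hom(\<Sigma>U, \<Sigma>^2 T_i), so \<open>g\<close>
  acts on it as a scalar c. If c were not zero, g - c would be invertible, \<open>g\<close> being
  radical, and yet annihilate \<Sigma>\<epsilon>.\<close>

lemma source_rad:
  assumes "g \<in> rad i i"
  shows "suspm C (suspm C g) \<star> suspm C \<epsilon> = 0"
proof -
  let ?S = "\<lambda>f. suspm C (suspm C f)"
  have g: "g \<in> homs C (Ti i) (Ti i)" "chi (Ti i) g = 0" using assms by (auto simp: rad_def)
  note id = ident_in_homs[of "Ti i"] and E = suspm_in_homs[OF source_in_homs(3)]
  have S: "?S f \<in> homs C (susp C (susp C (Ti i))) (susp C (susp C (Ti i)))"
    if "f \<in> homs C (Ti i) (Ti i)" for f using suspm_in_homs[OF suspm_in_homs[OF that]] .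
  obtain c where c: "?S g \<star> suspm C \<epsilon> = smul C c (suspm C \<epsilon>)"
    using homs_susp_U_susp2_Ti[OF compo_in_homs[OF S[OF g(1)] E]] by blast
  have "c = 0"
  proof (rule ccontr)
    assume "c \<noteq> 0"
    let ?u = "g - smul C c (ident C (Ti i))"
    have u: "?u \<in> homs C (Ti i) (Ti i)" using diff_in_homs[OF g(1) smul_in_homs[OF id]] .
    have "chi (Ti i) ?u = - c"
      using vk.linear_on_sub_diff[OF homs_subspace chi_linear[OF Ti_indecomposable] g(1) smul_in_homs[OF id]]
        chi_smul[OF Ti_indecomposable id] chi_ident[OF Ti_indecomposable] g(2) by simp
    then have "iso_mor C (Ti i) (Ti i) ?u"
      using chi_eq_0_iff[OF Ti_indecomposable u] \<open>c \<noteq> 0\<close> by auto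
    then obtain v where v: "v \<in> homs C (Ti i) (Ti i)" "v \<star> ?u = ident C (Ti i)" by (rule iso_morE)
    have "?S ?u = ?S g - smul C c (ident C (susp C (susp C (Ti i))))"
      using suspm_diff[OF g(1) smul_in_homs[OF id]] suspm_smul[OF id]
        suspm_diff[OF suspm_in_homs[OF g(1)] smul_in_homs[OF ident_in_homs]]
        suspm_smul[OF ident_in_homs] suspm_ident by simp
    then have "?S ?u \<star> suspm C \<epsilon> = 0"
      using compo_diff_left[OF E S[OF g(1)] smul_in_homs[OF ident_in_homs]]
        compo_smul_left[OF E ident_in_homs] ident_left[OF E] c by simp
    moreover have "?S v \<star> ?S ?u = ident C (susp C (susp C (Ti i)))"
      using suspm_compo[OF v(1) u] suspm_compo[OF suspm_in_homs[OF v(1)] suspm_in_homs[OF u]] v(2)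
        suspm_ident by metis
    ultimately have "suspm C \<epsilon> = 0"
      using compo_assoc[OF S[OF v(1)] S[OF u] E] ident_left[OF E] compo_zero_right[OF S[OF v(1)]] by simp
    then show False using susp_\<epsilon>_nonzero by simp
  qed
  then show ?thesis using c by simp
qed

text \<open>Every composite with \<open>s\<close> is radical because \<open>s\<close> is not a split
  monomorphism, \<open>\<epsilon>\<close> being nonzero. Conversely a radical \<open>g\<close>
  extends along \<open>s\<close> once \<Sigma>g after \<open>\<epsilon>\<close> vanishes: for j = i
  this is \<open>source_rad\<close>, otherwise duality applies since Hom(T_j, \<Sigma>U) =
  0.\<close>

lemma source_image: "(\<lambda>k. k \<star> s) ` homs C B (Ti j) = rad i j"
proof (intro equalityI subsetI)
  fix x assume "x \<in> (\<lambda>k. k \<star> s) ` homs C B (Ti j)"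
  then obtain k where k: "k \<in> homs C B (Ti j)" "x = k \<star> s" by blast
  have x: "x \<in> homs C (Ti i) (Ti j)" using compo_in_homs[OF k(1) source_in_homs(1)] k(2) by simp
  have "chi (Ti i) x = 0" if "i = j"
  proof (rule ccontr)
    assume "chi (Ti i) x \<noteq> 0"
    then have "iso_mor C (Ti i) (Ti i) x" using chi_eq_0_iff[OF Ti_indecomposable] x that by blast
    then obtain v where v: "v \<in> homs C (Ti i) (Ti i)" "v \<star> x = ident C (Ti i)" by (rule iso_morE)
    have vk: "v \<star> k \<in> homs C B (Ti i)" using compo_in_homs[OF v(1)] k(1) that by simp
    have "(v \<star> k) \<star> s = ident C (Ti i)"
      using compo_assoc[OF v(1) _ source_in_homs(1), of k] k that v(2) by simp
    then have "suspm C (v \<star> k) \<star> suspm C s = ident C (susp C (Ti i))"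
      using suspm_compo[OF vk source_in_homs(1)] suspm_ident by simp
    then have "\<epsilon> = suspm C (v \<star> k) \<star> (suspm C s \<star> \<epsilon>)"
      using compo_assoc[OF suspm_in_homs[OF vk] suspm_in_homs[OF source_in_homs(1)] source_in_homs(3)]
        ident_left[OF source_in_homs(3)] by simp
    then have "\<epsilon> = 0"
      using triangle_compo_zero''[OF source_triangle] compo_zero_right[OF suspm_in_homs[OF vk]] by simp
    then show False using susp_\<epsilon>_nonzero by simp
  qed
  then show "x \<in> rad i j" using x by (simp add: rad_def)
next
  fix g assume g: "g \<in> rad i j"
  note gh = rad_in_homs[OF g]
  let ?z = "suspm C g \<star> \<epsilon>"
  have z: "?z \<in> homs C U (susp C (Ti j))" using compo_in_homs[OF suspm_in_homs[OF gh] source_in_homs(3)] .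
  have "suspm C ?z = 0"
  proof (cases "j = i")
    case True
    then show ?thesis
      using source_rad g suspm_compo[OF suspm_in_homs[OF gh] source_in_homs(3)] by simp
  next
    case False
    then have "t (Ti j) (suspm C ?z \<star> h) = 0" if "h \<in> homs C (Ti j) (susp C U)" for h
      using homs_Ti_susp_U_other[OF False that] compo_zero_right[OF suspm_in_homs[OF z]]
        vk.linear_on_sub_0[OF homs_subspace t_linear] by simp
    then show ?thesis using t_nondegenerate_left[OF suspm_in_homs[OF z]] by blast
  qed
  then have "?z = 0" by (rule suspm_eq_0[OF _ z])
  from extend_first[OF source_triangle gh this]
  obtain h where "h \<in> homs C B (Ti j)" "h \<star> s = g" .
  then show "g \<in> (\<lambda>k. k \<star> s) ` homs C B (Ti j)" by blast
qed

subsection \<open>The coindex\<close>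

text \<open>The right-hand side does not mention the triangle of \<open>M\<close>, so that the coindex is well defined.\<close>

lemma coindex_triangle:
  assumes tri: "(M, susp C (susp C A0), susp C (susp C A1), u, v, w) \<in> triangles C"
    and A0: "add_class C Ti A0 a0" and A1: "add_class C Ti A1 a1"
  shows "int (a0 i) - int (a1 i) = int (vs.dim ((\<lambda>x. x \<star> p) ` homs C (susp C U) M))
    - int (vs.dim ((\<lambda>y. y \<star> \<epsilon>) ` homs C (susp C (Ti i)) M))"
proof -
  let ?S = "\<lambda>X. susp C (susp C X)" and ?V = "susp C U"
  note h = triangle_in_homs[OF tri]
  obtain u0 where tri0: "(susp C A1, M, ?S A0, u0, u, v) \<in> triangles C" and w: "w = - suspm C u0"
    using triangle_rotate_back[OF tri] .
  note u0 = triangle_in_homs(1)[OF tri0]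
  have ad: "addT A0" "addT A1" "addT B" "addT B'" using A0 A1 B_add B'_add by blast+
  \<comment> \<open>If u x = 0, then \<open>x\<close> factors through \<Sigma>A1, and Hom(T_i,
    \<Sigma>A1) = 0; if x p = 0, then \<open>x\<close> factors through \<Sigma>B', and
    Hom(\<Sigma>B', \<Sigma>^2 A0) = 0. So composition with \<open>u\<close> and with
    \<open>p\<close> have the same rank.\<close>
  have comm_ker: "{x \<in> homs C ?V M. u \<star> x = 0} = {x \<in> homs C ?V M. x \<star> p = 0}"
  proof (intro Collect_cong conj_cong refl iffI)
    fix x assume x: "x \<in> homs C ?V M" "u \<star> x = 0"
    obtain z where z: "z \<in> homs C ?V (susp C A1)" "u0 \<star> z = x" using lift_first[OF tri0 x] .
    have "z \<star> p = 0" using addT_rigid[OF addT_Ti ad(2) compo_in_homs[OF z(1) sink_in_homs(3)]] .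
    then show "x \<star> p = 0"
      using compo_assoc[OF u0 z(1) sink_in_homs(3)] z(2) compo_zero_right[OF u0] by simp
  next
    fix x assume x: "x \<in> homs C ?V M" "x \<star> p = 0"
    obtain x' where x': "x' \<in> homs C (susp C B') M" "x' \<star> (- suspm C \<beta>) = x"
      using extend_third[OF triangle_rotateD[OF sink_triangle] x] .
    have "u \<star> x' = 0" using addT_rigid_susp[OF ad(4,1) compo_in_homs[OF h(1) x'(1)]] .
    then show "u \<star> x = 0"
      using compo_assoc[OF h(1) x'(1) minus_in_homs[OF suspm_in_homs[OF sink_in_homs(1)]]] x'(2)
        compo_zero_left[OF minus_in_homs[OF suspm_in_homs[OF sink_in_homs(1)]]] by simp
  qed
  have "vs.dim (homs C ?V M) = vs.dim {x \<in> homs C ?V M. u \<star> x = 0} + vs.dim ((\<lambda>x. u \<star> x) ` homs C ?V M)"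
    by (rule vp.rank_nullity(2)[OF fin_homs compo_linear_right[OF h(1)]])
  moreover have "vs.dim (homs C ?V M) = vs.dim {x \<in> homs C ?V M. x \<star> p = 0} + vs.dim ((\<lambda>x. x \<star> p) ` homs C ?V M)"
    by (rule vp.rank_nullity(2)[OF fin_homs compo_linear_left[OF sink_in_homs(3)]])
  ultimately have dim_u: "vs.dim ((\<lambda>x. u \<star> x) ` homs C ?V M) = vs.dim ((\<lambda>x. x \<star> p) ` homs C ?V M)"
    using comm_ker by simp
  have "{x \<in> homs C ?V (?S A0). v \<star> x = 0} = (\<lambda>x. u \<star> x) ` homs C ?V M"
  proof (intro equalityI subsetI)
    fix x assume "x \<in> {x \<in> homs C ?V (?S A0). v \<star> x = 0}"
    then show "x \<in> (\<lambda>x. u \<star> x) ` homs C ?V M" using lift_first[OF tri] by blast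
  next
    fix x assume "x \<in> (\<lambda>x. u \<star> x) ` homs C ?V M"
    then obtain y where y: "y \<in> homs C ?V M" "x = u \<star> y" by blast
    then show "x \<in> {x \<in> homs C ?V (?S A0). v \<star> x = 0}"
      using compo_in_homs[OF h(1) y(1)] compo_assoc[OF h(2,1) y(1)] triangle_compo_zero[OF tri]
        compo_zero_left[OF y(1)] by simp
  qed
  \<comment> \<open>Exactness splits the dimension of Hom(\<Sigma>U, \<Sigma>^2 A0) into the ranks
    of composition with \<open>u\<close> and with \<open>v\<close>. The second rank recurs in
    \<open>dim_A1\<close> and cancels in the difference.\<close>
  then have dim_A0: "a0 i = vs.dim ((\<lambda>x. x \<star> p) ` homs C ?V M)
      + vs.dim ((\<lambda>x. v \<star> x) ` homs C ?V (?S A0))"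
    using vp.rank_nullity(2)[OF fin_homs compo_linear_right[OF h(2)], of ?V] dim_u
      dim_homs_susp_U_add[OF A0] by simp
  have "{x \<in> homs C ?V (?S A1). w \<star> x = 0} = (\<lambda>x. v \<star> x) ` homs C ?V (?S A0)"
  proof (intro equalityI subsetI)
    fix x assume "x \<in> {x \<in> homs C ?V (?S A1). w \<star> x = 0}"
    then show "x \<in> (\<lambda>x. v \<star> x) ` homs C ?V (?S A0)" using lift_second[OF tri] by blast
  next
    fix x assume "x \<in> (\<lambda>x. v \<star> x) ` homs C ?V (?S A0)"
    then obtain y where y: "y \<in> homs C ?V (?S A0)" "x = v \<star> y" by blast
    then show "x \<in> {x \<in> homs C ?V (?S A1). w \<star> x = 0}"
      using compo_in_homs[OF h(2) y(1)] compo_assoc[OF h(3,2) y(1)] triangle_compo_zero'[OF tri]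
        compo_zero_left[OF y(1)] by simp
  qed
  then have dim_A1: "a1 i = vs.dim ((\<lambda>x. v \<star> x) ` homs C ?V (?S A0))
      + vs.dim ((\<lambda>x. w \<star> x) ` homs C ?V (?S A1))"
    using vp.rank_nullity(2)[OF fin_homs compo_linear_right[OF h(3)], of ?V]
      dim_homs_susp_U_add[OF A1] by simp
  let ?Y = "(\<lambda>y. y \<star> \<epsilon>) ` homs C (susp C (Ti i)) M"
  have Y: "?Y \<subseteq> homs C U M" using compo_in_homs[OF _ source_in_homs(3)] by blast
  have lin: "linear_on_sub (smul C) (smul C) ?Y (suspm C)"
    by (rule linear_on_sub_subset[OF suspm_linear Y])
  have finY: "finite_dim_sub (smul C) ?Y"
    by (rule vp.rank_nullity(1)[OF fin_homs compo_linear_left[OF source_in_homs(3)]])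
  \<comment> \<open>By rigidity maps U -> \<Sigma>A1 factor through \<open>\<epsilon>\<close>, and
    maps \<Sigma>T_i -> M factor through \<open>u0\<close>; both sides therefore consist of the
    suspended composites U -> \<Sigma>T_i -> \<Sigma>A1 -> M, up to sign.\<close>
  have "(\<lambda>x. w \<star> x) ` homs C ?V (?S A1) = suspm C ` ?Y"
  proof (intro equalityI subsetI)
    fix x assume "x \<in> (\<lambda>x. w \<star> x) ` homs C ?V (?S A1)"
    then obtain x' where x': "x' \<in> homs C ?V (?S A1)" "x = w \<star> x'" by blast
    obtain z where z: "z \<in> homs C U (susp C A1)" "x' = suspm C z" using suspm_surj[OF x'(1)] .
    have "z \<star> \<gamma> = 0" using addT_rigid[OF ad(3,2) compo_in_homs[OF z(1) source_in_homs(2)]] .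
    from extend_third[OF source_triangle z(1) this]
    obtain y where y: "y \<in> homs C (susp C (Ti i)) (susp C A1)" "y \<star> \<epsilon> = z" .
    have uy: "u0 \<star> y \<in> homs C (susp C (Ti i)) M" using compo_in_homs[OF u0 y(1)] .
    have "x = - suspm C (u0 \<star> z)"
      using x'(2) z(2) w compo_minus_left[OF suspm_in_homs[OF z(1)] suspm_in_homs[OF u0]]
        suspm_compo[OF u0 z(1)] by simp
    also have "\<dots> = suspm C ((- (u0 \<star> y)) \<star> \<epsilon>)"
      using compo_assoc[OF u0 y(1) source_in_homs(3)] y(2)
        compo_minus_left[OF source_in_homs(3) uy] suspm_minus[OF compo_in_homs[OF u0 z(1)]] by simp
    finally show "x \<in> suspm C ` ?Y" using minus_in_homs[OF uy] by blast
  next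
    fix x assume "x \<in> suspm C ` ?Y"
    then obtain y where y: "y \<in> homs C (susp C (Ti i)) M" "x = suspm C (y \<star> \<epsilon>)" by blast
    have "u \<star> y = 0" using addT_rigid_susp[OF addT_Ti ad(1) compo_in_homs[OF h(1) y(1)]] .
    from lift_first[OF tri0 y(1) this]
    obtain z where z: "z \<in> homs C (susp C (Ti i)) (susp C A1)" "u0 \<star> z = y" .
    have ze: "z \<star> \<epsilon> \<in> homs C U (susp C A1)" using compo_in_homs[OF z(1) source_in_homs(3)] .
    have "x = suspm C u0 \<star> suspm C (z \<star> \<epsilon>)"
      using y(2) z(2) compo_assoc[OF u0 z(1) source_in_homs(3)] suspm_compo[OF u0 ze] by simp
    also have "\<dots> = w \<star> (- suspm C (z \<star> \<epsilon>))"
      using w compo_minus_right[OF h(3) suspm_in_homs[OF ze]]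
        compo_minus_left[OF suspm_in_homs[OF ze] suspm_in_homs[OF u0]] by simp
    finally show "x \<in> (\<lambda>x. w \<star> x) ` homs C ?V (?S A1)"
      using minus_in_homs[OF suspm_in_homs[OF ze]] by blast
  qed
  moreover have "vs.dim (suspm C ` ?Y) = vs.dim ?Y"
    by (rule vp.dim_inj_image[OF finY lin]) (use suspm_eq_0 Y in blast)
  ultimately show ?thesis using dim_A0 dim_A1 by simp
qed

lemma coind_formula:
  "coind C Ti M i = int (vs.dim ((\<lambda>x. x \<star> p) ` homs C (susp C U) M))
    - int (vs.dim ((\<lambda>y. y \<star> \<epsilon>) ` homs C (susp C (Ti i)) M))"
proof -
  have 2: "(susp C ^^ 2) X = susp C (susp C X)" for X by (simp add: numeral_2_eq_2)
  obtain A0 A1 u v w a0 a1 where tri: "(M, susp C (susp C A0), susp C (susp C A1), u, v, w) \<in> triangles C"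
    and a: "add_class C Ti A0 a0" "add_class C Ti A1 a1"
    using coresolution_exists by blast
  show ?thesis
    unfolding coind_def 2
  proof (rule the_equality)
    show "\<exists>T0 T1 u v w a b. (M, susp C (susp C T0), susp C (susp C T1), u, v, w) \<in> triangles C \<and>
        add_class C Ti T0 a \<and> add_class C Ti T1 b \<and>
        int (vs.dim ((\<lambda>x. x \<star> p) ` homs C (susp C U) M))
          - int (vs.dim ((\<lambda>y. y \<star> \<epsilon>) ` homs C (susp C (Ti i)) M)) = int (a i) - int (b i)"
      using tri a coindex_triangle[OF tri a] by metis
  next
    fix c assume "\<exists>T0 T1 u v w a b. (M, susp C (susp C T0), susp C (susp C T1), u, v, w) \<in> triangles C \<and>
        add_class C Ti T0 a \<and> add_class C Ti T1 b \<and> c = int (a i) - int (b i)"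
    then show "c = int (vs.dim ((\<lambda>x. x \<star> p) ` homs C (susp C U) M))
        - int (vs.dim ((\<lambda>y. y \<star> \<epsilon>) ` homs C (susp C (Ti i)) M))"
      using coindex_triangle by blast
  qed
qed

text \<open>Composition with \<open>\<beta>\<close> sends the kernel in question into the image of
  composition with \<open>\<epsilon>\<close>, and what it kills are the maps that come from T_i
  through \<open>d\<close>. Exactness at Hom(T_i, M) expresses m_i as the same \<open>d\<close>-part
  plus the \<open>p\<close>-part of \<open>coind_formula\<close>.\<close>

lemma coind_le:
  "coind C Ti M i + int (vs.dim {g \<in> homs C B' M. g \<star> (\<beta> \<star> \<gamma>) = 0}) \<le> int (vs.dim (homs C (Ti i) M))"
proof -
  let ?K = "{g \<in> homs C B' M. g \<star> (\<beta> \<star> \<gamma>) = 0}"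
  let ?Y = "(\<lambda>y. y \<star> \<epsilon>) ` homs C (susp C (Ti i)) M"
  note h = sink_in_homs source_in_homs
  have K: "finite_dim_sub (smul C) ?K"
  proof (rule vs.finite_dim_sub_subset[OF fin_homs])
    have eq: "?K = {g \<in> homs C B' M. g \<star> (\<beta> \<star> \<gamma>) \<in> {0}}" by simp
    show "vs.subspace ?K"
      unfolding eq by (rule vp.linear_on_sub_vimage_subspace[OF homs_subspace
            compo_linear_left[OF \<beta>\<gamma>_in_homs] vs.subspace_single_0])
  qed blast
  have lin: "linear_on_sub (smul C) (smul C) ?K (\<lambda>g. g \<star> \<beta>)"
    by (rule linear_on_sub_subset[OF compo_linear_left[OF h(1)]]) blast
  have ker: "{g \<in> ?K. g \<star> \<beta> = 0} = (\<lambda>x. x \<star> d) ` homs C (Ti i) M"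
  proof (intro equalityI subsetI)
    fix g assume "g \<in> {g \<in> ?K. g \<star> \<beta> = 0}"
    then show "g \<in> (\<lambda>x. x \<star> d) ` homs C (Ti i) M" using extend_second[OF sink_triangle] by blast
  next
    fix g assume "g \<in> (\<lambda>x. x \<star> d) ` homs C (Ti i) M"
    then obtain x where x: "x \<in> homs C (Ti i) M" "g = x \<star> d" by blast
    have g: "g \<in> homs C B' M" using compo_in_homs[OF x(1) h(2)] x(2) by simp
    have "g \<star> \<beta> = 0"
      using compo_assoc[OF x(1) h(2,1)] triangle_compo_zero[OF sink_triangle] compo_zero_right[OF x(1)] x(2)
      by simp
    moreover from this have "g \<star> (\<beta> \<star> \<gamma>) = 0"
      using compo_assoc[OF g h(1) h(5)] compo_zero_left[OF h(5)] by simp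
    ultimately show "g \<in> {g \<in> ?K. g \<star> \<beta> = 0}" using g by simp
  qed
  have finY: "finite_dim_sub (smul C) ?Y"
    by (rule vp.rank_nullity(1)[OF fin_homs compo_linear_left[OF h(6)]])
  have im: "(\<lambda>g. g \<star> \<beta>) ` ?K \<subseteq> ?Y"
  proof (rule image_subsetI)
    fix g assume "g \<in> ?K"
    then have g: "g \<in> homs C B' M" "(g \<star> \<beta>) \<star> \<gamma> = 0" using compo_assoc[OF _ h(1) h(5)] by auto
    from extend_third[OF source_triangle compo_in_homs[OF g(1) h(1)] g(2)]
    obtain y where "y \<in> homs C (susp C (Ti i)) M" "y \<star> \<epsilon> = g \<star> \<beta>" .
    then show "g \<star> \<beta> \<in> ?Y" by (metis imageI)
  qed
  have "vs.dim ((\<lambda>g. g \<star> \<beta>) ` ?K) \<le> vs.dim ?Y"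
    by (rule vs.finite_dim_sub_dim_mono[OF finY vs.finite_dim_sub_subspace[OF vp.rank_nullity(1)[OF K lin]] im])
  then have "vs.dim ?K \<le> vs.dim ((\<lambda>x. x \<star> d) ` homs C (Ti i) M) + vs.dim ?Y"
    using vp.rank_nullity(2)[OF K lin] ker by simp
  moreover have "{x \<in> homs C (Ti i) M. x \<star> d = 0} = (\<lambda>x. x \<star> p) ` homs C (susp C U) M"
  proof (intro equalityI subsetI)
    fix x assume "x \<in> {x \<in> homs C (Ti i) M. x \<star> d = 0}"
    then show "x \<in> (\<lambda>x. x \<star> p) ` homs C (susp C U) M" using extend_third[OF sink_triangle] by blast
  next
    fix x assume "x \<in> (\<lambda>x. x \<star> p) ` homs C (susp C U) M"
    then obtain y where y: "y \<in> homs C (susp C U) M" "x = y \<star> p" by blast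
    then show "x \<in> {x \<in> homs C (Ti i) M. x \<star> d = 0}"
      using compo_in_homs[OF y(1) h(3)] compo_assoc[OF y(1) h(3,2)] triangle_compo_zero'[OF sink_triangle]
        compo_zero_right[OF y(1)] by simp
  qed
  then have "vs.dim (homs C (Ti i) M) =
      vs.dim ((\<lambda>x. x \<star> p) ` homs C (susp C U) M) + vs.dim ((\<lambda>x. x \<star> d) ` homs C (Ti i) M)"
    using vp.rank_nullity(2)[OF fin_homs compo_linear_left[OF h(2)]] by simp
  ultimately show ?thesis unfolding coind_formula by simp
qed

end

subsection \<open>Submodules of \<open>GM\<close>\<close>

text \<open>A submodule \<open>N\<close> of \<open>GM = Hom(T, M)\<close> extends to a subfunctor of \<open>Hom(?, M)\<close> on \<open>add(T)\<close>; its value at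
  \<open>X\<close> is \<open>sub_value N M X\<close>.\<close>

context tilting_category
begin

text \<open>The summand of \<open>N\<close> cut out by the idempotent
  \<open>\<iota> j \<star> \<pi> j\<close>, viewed inside Hom(T_j, M): composition with
  \<open>\<pi> j\<close> identifies the two.\<close>

definition sub_comp :: "'v set \<Rightarrow> 'o \<Rightarrow> 'n \<Rightarrow> 'v set" where
  "sub_comp N M j = {x \<in> homs C (Ti j) M. x \<star> \<pi> j \<in> N}"

definition sub_value :: "'v set \<Rightarrow> 'o \<Rightarrow> 'o \<Rightarrow> 'v set" where
  "sub_value N M X = {x \<in> homs C X M. \<forall>j. \<forall>g\<in>homs C (Ti j) X. x \<star> g \<in> sub_comp N M j}"

lemma submodule_G_iff:
  "submodule C T (functor_G C T M) N \<longleftrightarrow> vs.subspace N \<and> N \<subseteq> homs C T M \<and>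
     (\<forall>x\<in>N. \<forall>a\<in>homs C T T. x \<star> a \<in> N)"
  by (simp add: submodule_def functor_G_def)

context
  fixes M :: 'o and N :: "'v set"
  assumes N: "submodule C T (functor_G C T M) N"
begin

lemma sub_comp_subspace: "vs.subspace (sub_comp N M j)"
  unfolding sub_comp_def
  using vp.linear_on_sub_vimage_subspace[OF homs_subspace compo_linear_left[OF pi_in_homs]] N
  by (simp add: submodule_G_iff)

lemma sub_comp_fin: "finite_dim_sub (smul C) (sub_comp N M j)"
  by (rule vs.finite_dim_sub_subset[OF fin_homs sub_comp_subspace]) (auto simp: sub_comp_def)

lemma sub_comp_compo:
  assumes "x \<in> sub_comp N M l" "g \<in> homs C (Ti j) (Ti l)"
  shows "x \<star> g \<in> sub_comp N M j"
proof -
  have x: "x \<in> homs C (Ti l) M" "x \<star> \<pi> l \<in> N" using assms(1) by (auto simp: sub_comp_def)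
  have g\<pi>: "g \<star> \<pi> j \<in> homs C T (Ti l)" using compo_in_homs[OF assms(2) pi_in_homs] .
  have a: "\<iota> l \<star> (g \<star> \<pi> j) \<in> homs C T T" using compo_in_homs[OF iota_in_homs g\<pi>] .
  have "(x \<star> \<pi> l) \<star> (\<iota> l \<star> (g \<star> \<pi> j)) = x \<star> (\<pi> l \<star> (\<iota> l \<star> (g \<star> \<pi> j)))"
    by (rule compo_assoc[OF x(1) pi_in_homs a])
  also have "\<dots> = (x \<star> g) \<star> \<pi> j"
    using prj_compo_inj[OF T_dsum UNIV_I UNIV_I g\<pi>, of l] compo_assoc[OF x(1) assms(2) pi_in_homs] by simp
  finally have "(x \<star> g) \<star> \<pi> j \<in> N" using N x(2) a unfolding submodule_G_iff by metis
  then show ?thesis using compo_in_homs[OF x(1) assms(2)] by (simp add: sub_comp_def)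
qed

lemma sub_value_subspace: "vs.subspace (sub_value N M X)"
proof -
  have "vs.subspace {x \<in> homs C X M. x \<star> g \<in> sub_comp N M j}" if "g \<in> homs C (Ti j) X" for j g
    by (rule vp.linear_on_sub_vimage_subspace[OF homs_subspace compo_linear_left[OF that] sub_comp_subspace])
  then have "vs.subspace (homs C X M \<inter>
      (\<Inter>q \<in> (SIGMA j:UNIV. homs C (Ti j) X). {x \<in> homs C X M. x \<star> snd q \<in> sub_comp N M (fst q)}))"
    by (intro vs.subspace_inter homs_subspace vs.subspace_Int) auto
  moreover have "sub_value N M X = homs C X M \<inter>
      (\<Inter>q \<in> (SIGMA j:UNIV. homs C (Ti j) X). {x \<in> homs C X M. x \<star> snd q \<in> sub_comp N M (fst q)})"
    by (auto simp: sub_value_def)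
  ultimately show ?thesis by simp
qed

lemma sub_value_fin: "finite_dim_sub (smul C) (sub_value N M X)"
  by (rule vs.finite_dim_sub_subset[OF fin_homs sub_value_subspace]) (auto simp: sub_value_def)

text \<open>Since \<open>sub_value\<close> is tested on all maps from the \<open>Ti\<close>, a
  decomposition of \<open>X\<close> decomposes it as well, with one copy of the j-th component for
  each copy of \<open>Ti j\<close>.\<close>

lemma dim_sub_value:
  assumes "add_class C Ti X a"
  shows "vs.dim (sub_value N M X) = (\<Sum>j\<in>UNIV. a j * vs.dim (sub_comp N M j))"
proof -
  let ?I = "{(j, r). r < a j}"
  obtain emb prj where D: "dsum_maps ?I (\<lambda>p. Ti (fst p)) X emb prj" using add_classE[OF assms] .
  note h = dsum_maps_in_homs[OF D]
  have "vs.dim (sub_value N M X) = (\<Sum>q\<in>?I. vs.dim (sub_comp N M (fst q)))"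
  proof (rule vs.dim_direct_sum[OF finite_mult_index sub_value_fin sub_comp_subspace,
        where \<phi> = "\<lambda>q x. x \<star> emb q" and \<psi> = "\<lambda>q x. x \<star> prj q"])
    fix q assume q: "q \<in> ?I"
    show "linear_on_sub (smul C) (smul C) (sub_value N M X) (\<lambda>x. x \<star> emb q) \<and>
        (\<lambda>x. x \<star> emb q) ` sub_value N M X \<subseteq> sub_comp N M (fst q)"
    proof
      show "linear_on_sub (smul C) (smul C) (sub_value N M X) (\<lambda>x. x \<star> emb q)"
        by (rule linear_on_sub_subset[OF compo_linear_left[OF h(1)[OF q]]]) (auto simp: sub_value_def)
      show "(\<lambda>x. x \<star> emb q) ` sub_value N M X \<subseteq> sub_comp N M (fst q)"
        using h(1)[OF q] by (auto simp: sub_value_def)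
    qed
    show "linear_on_sub (smul C) (smul C) (sub_comp N M (fst q)) (\<lambda>x. x \<star> prj q) \<and>
        (\<lambda>x. x \<star> prj q) ` sub_comp N M (fst q) \<subseteq> sub_value N M X"
    proof
      show "linear_on_sub (smul C) (smul C) (sub_comp N M (fst q)) (\<lambda>x. x \<star> prj q)"
        by (rule linear_on_sub_subset[OF compo_linear_left[OF h(2)[OF q]]]) (auto simp: sub_comp_def)
      show "(\<lambda>x. x \<star> prj q) ` sub_comp N M (fst q) \<subseteq> sub_value N M X"
      proof (rule image_subsetI)
        fix x assume x: "x \<in> sub_comp N M (fst q)"
        then have xh: "x \<in> homs C (Ti (fst q)) M" by (simp add: sub_comp_def)
        have "(x \<star> prj q) \<star> g \<in> sub_comp N M j" if g: "g \<in> homs C (Ti j) X" for j g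
          using sub_comp_compo[OF x compo_in_homs[OF h(2)[OF q] g]] compo_assoc[OF xh h(2)[OF q] g] by simp
        then show "x \<star> prj q \<in> sub_value N M X"
          using compo_in_homs[OF xh h(2)[OF q]] by (simp add: sub_value_def)
      qed
    qed
  next
    fix q r x assume "q \<in> ?I" "r \<in> ?I" "x \<in> sub_comp N M (fst r)"
    then show "(x \<star> prj r) \<star> emb q = (if q = r then x else 0)"
      using compo_prj_inj[OF D, of r q x M] by (auto simp: sub_comp_def)
  next
    fix x assume "x \<in> sub_value N M X"
    then have "x \<in> homs C X M" by (simp add: sub_value_def)
    then show "(\<Sum>q\<in>?I. (x \<star> emb q) \<star> prj q) = x" by (rule dsum_decomp_source[OF D])
  qed
  then show ?thesis using sum_mult_index[where a = a and h = "\<lambda>j. vs.dim (sub_comp N M j)"] by simp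
qed

text \<open>Pullback along \<open>c\<close> preserves the subfunctor, and what it kills lies in the
  kernel on all of Hom(Y, M).\<close>

lemma dim_sub_value_le:
  assumes c: "c \<in> homs C X Y"
  shows "vs.dim (sub_value N M Y) \<le> vs.dim (sub_value N M X) + vs.dim {g \<in> homs C Y M. g \<star> c = 0}"
proof -
  let ?f = "\<lambda>x. x \<star> c"
  have sub: "sub_value N M Y \<subseteq> homs C Y M" by (auto simp: sub_value_def)
  have lin: "linear_on_sub (smul C) (smul C) (sub_value N M Y) ?f"
    by (rule linear_on_sub_subset[OF compo_linear_left[OF c] sub])
  have "?f ` sub_value N M Y \<subseteq> sub_value N M X"
  proof (rule image_subsetI)
    fix x assume x: "x \<in> sub_value N M Y"
    then have xh: "x \<in> homs C Y M" by (simp add: sub_value_def)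
    have "(x \<star> c) \<star> g \<in> sub_comp N M j" if g: "g \<in> homs C (Ti j) X" for j g
      using x compo_in_homs[OF c g] compo_assoc[OF xh c g] by (simp add: sub_value_def)
    then show "x \<star> c \<in> sub_value N M X" using compo_in_homs[OF xh c] by (simp add: sub_value_def)
  qed
  then have "vs.dim (?f ` sub_value N M Y) \<le> vs.dim (sub_value N M X)"
    using vs.finite_dim_sub_dim_mono[OF sub_value_fin]
      vp.linear_on_sub_image_subspace[OF sub_value_subspace lin] by blast
  moreover have "vs.dim {x \<in> sub_value N M Y. x \<star> c = 0} \<le> vs.dim {g \<in> homs C Y M. g \<star> c = 0}"
  proof (rule vs.finite_dim_sub_dim_mono)
    have ker: "vs.subspace {g \<in> V. g \<star> c = 0}" if "vs.subspace V" "linear_on_sub (smul C) (smul C) V ?f" for V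
      using vp.linear_on_sub_vimage_subspace[OF that vs.subspace_single_0] by simp
    show "vs.subspace {x \<in> sub_value N M Y. x \<star> c = 0}" by (rule ker[OF sub_value_subspace lin])
    show "finite_dim_sub (smul C) {g \<in> homs C Y M. g \<star> c = 0}"
      by (rule vs.finite_dim_sub_subset[OF fin_homs ker[OF homs_subspace compo_linear_left[OF c]]]) blast
  qed (use sub in blast)
  ultimately show ?thesis using vp.rank_nullity(2)[OF sub_value_fin lin] by simp
qed

end

end

lemma (in exchange_triangles) coind_bound:
  assumes "submodule C T (functor_G C T M) N"
  shows "- int (vs.dim (homs C (Ti i) M)) \<le>
    - coind C Ti M i + (\<Sum>j\<in>UNIV. int (vs.dim (sub_comp N M j)) * (int (b j) - int (b' j)))"
proof -
  have "(\<Sum>j\<in>UNIV. int (vs.dim (sub_comp N M j)) * (int (b j) - int (b' j))) =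
      int (vs.dim (sub_value N M B)) - int (vs.dim (sub_value N M B'))"
    by (simp add: dim_sub_value[OF assms B_add] dim_sub_value[OF assms B'_add] algebra_simps sum_subtractf)
  then show ?thesis
    using dim_sub_value_le[OF assms \<beta>\<gamma>_in_homs] coind_le[of M] by linarith
qed

section \<open>Modules over the endomorphism algebra\<close>

lemma (in vector_space) dim_codim_one:
  assumes "finite_dim_sub scale A" "subspace U" "U \<subseteq> A" "x \<in> A" "x \<notin> U"
    and "\<And>a. a \<in> A \<Longrightarrow> \<exists>c. a - scale c x \<in> U"
  shows "dim A = dim U + 1"
proof -
  obtain D where D: "finite D" "D \<subseteq> U" "independent D" "span D = U" "card D = dim U"
    by (rule finite_dim_sub_basis_empty[OF finite_dim_sub_subset[OF assms(1-3)]])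
  have x: "x \<notin> span D" using D(4) assms(5) by simp
  then have ind: "independent (insert x D)" using D(3) by (rule independent_insertI)
  have "insert x D \<subseteq> A" using D(2) assms(3,4) by blast
  moreover have "A \<subseteq> span (insert x D)" using assms(6) D(4) by (auto simp: span_insert)
  ultimately have "card (insert x D) = dim A" using ind by (rule basis_card_eq_dim)
  moreover have "x \<notin> D" using x span_base by blast
  ultimately show ?thesis using D(1,5) by simp
qed

context tilting_category
begin

section \<open>Matrix entries and residue characters of End(T)\<close>

definition entry :: "'n \<Rightarrow> 'n \<Rightarrow> 'v \<Rightarrow> 'v" where
  "entry l m a = \<pi> l \<star> (a \<star> \<iota> m)"

text \<open>The character by which End(T) acts on the one-dimensional simple module S_l; see
  \<open>mact_S\<close>.\<close>

definition chiT :: "'n \<Rightarrow> 'v \<Rightarrow> 'k" where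
  "chiT l a = chi (Ti l) (entry l l a)"

text \<open>The Jacobson radical of End(T), in the guise of the common kernel of its
  characters.\<close>

definition radT :: "'v set" where
  "radT = {a \<in> homs C T T. \<forall>l. chiT l a = 0}"

lemma entry_in_homs: "a \<in> homs C T T \<Longrightarrow> entry l m a \<in> homs C (Ti m) (Ti l)"
  unfolding entry_def using compo_in_homs iota_in_homs pi_in_homs by blast

lemma entry_linear: "linear_on_sub (smul C) (smul C) (homs C T T) (entry l m)"
  unfolding linear_on_sub_def entry_def
  using compo_add_left[OF iota_in_homs] compo_add_right[OF pi_in_homs] compo_smul_left[OF iota_in_homs]
    compo_smul_right[OF pi_in_homs] compo_in_homs[OF _ iota_in_homs] by metis

lemma entry_compo:
  assumes "a \<in> homs C T T" "e \<in> homs C T T"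
  shows "entry l m (a \<star> e) = (\<Sum>q\<in>UNIV. entry l q a \<star> entry q m e)"
proof -
  have e: "e \<star> \<iota> m \<in> homs C (Ti m) T" using compo_in_homs[OF assms(2) iota_in_homs] .
  have pe: "\<pi> q \<star> (e \<star> \<iota> m) \<in> homs C (Ti m) (Ti q)" for q using compo_in_homs[OF pi_in_homs e] .
  have pa: "\<pi> l \<star> a \<in> homs C T (Ti l)" using compo_in_homs[OF pi_in_homs assms(1)] .
  have "entry l m (a \<star> e) = (\<pi> l \<star> a) \<star> (e \<star> \<iota> m)"
    unfolding entry_def using compo_assoc[OF assms iota_in_homs] compo_assoc[OF pi_in_homs assms(1) e] by simp
  also have "\<dots> = (\<pi> l \<star> a) \<star> (\<Sum>q\<in>UNIV. \<iota> q \<star> (\<pi> q \<star> (e \<star> \<iota> m)))"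
    using dsum_decomp_target[OF T_dsum e] by simp
  also have "\<dots> = (\<Sum>q\<in>UNIV. (\<pi> l \<star> a) \<star> (\<iota> q \<star> (\<pi> q \<star> (e \<star> \<iota> m))))"
    by (rule compo_sum_right[OF pa]) (rule compo_in_homs[OF iota_in_homs pe])
  also have "\<dots> = (\<Sum>q\<in>UNIV. entry l q a \<star> entry q m e)"
    unfolding entry_def
    using compo_assoc[OF pa iota_in_homs pe] compo_assoc[OF pi_in_homs assms(1) iota_in_homs] by simp
  finally show ?thesis .
qed

lemma chi_Ti_through: "\<lbrakk>l \<noteq> j; f \<in> homs C (Ti j) (Ti l); g \<in> homs C (Ti l) (Ti j)\<rbrakk> \<Longrightarrow> chi (Ti j) (g \<star> f) = 0"
  using chi_through_other[OF Ti_indecomposable Ti_indecomposable Ti_not_isomorphic] by metis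

text \<open>In the matrix product every term through some T_q with q different from l has residue 0,
  and the residue is multiplicative on the remaining term.\<close>

lemma chiT_compo:
  assumes "a \<in> homs C T T" "e \<in> homs C T T"
  shows "chiT l (a \<star> e) = chiT l a * chiT l e"
proof -
  have q: "entry l q a \<star> entry q l e \<in> homs C (Ti l) (Ti l)" for q
    using compo_in_homs entry_in_homs assms by blast
  have "chiT l (a \<star> e) = (\<Sum>q\<in>UNIV. chi (Ti l) (entry l q a \<star> entry q l e))"
    unfolding chiT_def entry_compo[OF assms]
    by (rule vk.linear_on_sub_sum[OF homs_subspace chi_linear[OF Ti_indecomposable] q])
  also have "\<dots> = (\<Sum>q\<in>UNIV. if q = l then chiT l a * chiT l e else 0)"
  proof (rule sum.cong[OF refl])
    fix q
    show "chi (Ti l) (entry l q a \<star> entry q l e) = (if q = l then chiT l a * chiT l e else 0)"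
    proof (cases "q = l")
      case True
      then show ?thesis
        using chi_compo[OF Ti_indecomposable entry_in_homs[OF assms(2)] entry_in_homs[OF assms(1)]]
        by (simp add: chiT_def)
    next
      case False
      then show ?thesis
        using chi_Ti_through[OF False entry_in_homs[OF assms(2)] entry_in_homs[OF assms(1)]] by simp
    qed
  qed
  finally show ?thesis by simp
qed

lemma chiT_linear: "linear_on_sub (smul C) (*) (homs C T T) (chiT l)"
  unfolding linear_on_sub_def chiT_def
  using linear_on_sub_add[OF entry_linear] linear_on_sub_scale[OF entry_linear] entry_in_homs
    chi_add[OF Ti_indecomposable] chi_smul[OF Ti_indecomposable] by simp

lemma entry_compo_iota_pi:
  "g \<in> homs C (Ti q) (Ti r) \<Longrightarrow> entry l m (\<iota> r \<star> (g \<star> \<pi> q)) = (if l = r \<and> m = q then g else 0)"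
proof -
  assume g: "g \<in> homs C (Ti q) (Ti r)"
  have g\<pi>: "g \<star> \<pi> q \<in> homs C T (Ti r)" using compo_in_homs[OF g pi_in_homs] .
  have "entry l m (\<iota> r \<star> (g \<star> \<pi> q)) = \<pi> l \<star> (\<iota> r \<star> ((g \<star> \<pi> q) \<star> \<iota> m))"
    unfolding entry_def using compo_assoc[OF iota_in_homs g\<pi> iota_in_homs] by simp
  also have "(g \<star> \<pi> q) \<star> \<iota> m = (if q = m then g else 0)"
    using compo_prj_inj[OF T_dsum UNIV_I UNIV_I g] by simp
  also have "\<pi> l \<star> (\<iota> r \<star> (if q = m then g else 0)) = (if l = r \<and> m = q then g else 0)"
    using prj_compo_inj[OF T_dsum UNIV_I UNIV_I g, of l] compo_zero_right[OF iota_in_homs[of r]]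
      compo_zero_right[OF pi_in_homs[of l]] by auto
  finally show ?thesis .
qed

lemma iota_compo_pi_in_homs: "g \<in> homs C (Ti q) (Ti r) \<Longrightarrow> \<iota> r \<star> (g \<star> \<pi> q) \<in> homs C T T"
  using compo_in_homs[OF iota_in_homs compo_in_homs[OF _ pi_in_homs]] .

lemma radT_entry: "a \<in> radT \<Longrightarrow> entry l m a \<in> rad m l"
  using entry_in_homs[of a l m] by (auto simp: radT_def rad_def chiT_def)

lemma radT_in_homs: "a \<in> radT \<Longrightarrow> a \<in> homs C T T"
  by (simp add: radT_def)

text \<open>Decomposing \<open>a\<close> into the rows of its matrix puts it in the form required by
  \<open>quasi_regular\<close>: each row is a radical map into an indecomposable object.\<close>

lemma radT_right_inverse:
  assumes "a \<in> radT"
  shows "\<exists>u\<in>homs C T T. (ident C T - a) \<star> u = ident C T"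
proof -
  note a = radT_in_homs[OF assms]
  have "\<exists>u\<in>homs C T T. (ident C T - (\<Sum>q\<in>UNIV. \<iota> q \<star> (\<pi> q \<star> a))) \<star> u = ident C T"
  proof (rule quasi_regular[where F = Ti and g = \<iota> and h = "\<lambda>q. \<pi> q \<star> a"])
    fix q k assume k: "k \<in> homs C (Ti q) T"
    have pa: "\<pi> q \<star> a \<in> homs C T (Ti q)" using compo_in_homs[OF pi_in_homs a] .
    have pk: "\<pi> l \<star> k \<in> homs C (Ti q) (Ti l)" for l using compo_in_homs[OF pi_in_homs k] .
    have "(\<pi> q \<star> a) \<star> k = (\<pi> q \<star> a) \<star> (\<Sum>l\<in>UNIV. \<iota> l \<star> (\<pi> l \<star> k))"
      using dsum_decomp_target[OF T_dsum k] by simp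
    also have "\<dots> = (\<Sum>l\<in>UNIV. (\<pi> q \<star> a) \<star> (\<iota> l \<star> (\<pi> l \<star> k)))"
      by (rule compo_sum_right[OF pa]) (rule compo_in_homs[OF iota_in_homs pk])
    also have "\<dots> = (\<Sum>l\<in>UNIV. entry q l a \<star> (\<pi> l \<star> k))"
      unfolding entry_def using compo_assoc[OF pa iota_in_homs pk] compo_assoc[OF pi_in_homs a iota_in_homs]
      by simp
    also have "\<dots> \<in> rad q q"
      by (rule vs.subspace_sum[OF rad_subspace]) (rule rad_compo_right[OF pk radT_entry[OF assms]])
    finally have "(\<pi> q \<star> a) \<star> k \<in> rad q q" .
    then have "(\<pi> q \<star> a) \<star> k \<in> homs C (Ti q) (Ti q)" "chi (Ti q) ((\<pi> q \<star> a) \<star> k) = 0"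
      by (simp_all add: rad_def)
    then show "iso_mor C (Ti q) (Ti q) (ident C (Ti q) - (\<pi> q \<star> a) \<star> k)"
      using not_iso_ident_minus[OF Ti_indecomposable] chi_eq_0_iff[OF Ti_indecomposable] by blast
  qed (use iota_in_homs compo_in_homs[OF pi_in_homs a] in auto)
  then show ?thesis using dsum_decomp_target[OF T_dsum a] by simp
qed

subsection \<open>Composition factors of submodules of \<open>GM\<close>\<close>

abbreviation G :: "'o \<Rightarrow> 'v rmod" where
  "G M \<equiv> functor_G C T M"

lemma restr_G_simps [simp]:
  "mcar (restr_mod (G M) F) = F" "mact (restr_mod (G M) F) x a = x \<star> a"
  "restr_mod (restr_mod (G M) F) K = restr_mod (G M) K" "mcar (G M) = homs C T M"
  "mact (G M) x a = x \<star> a"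
  by (simp_all add: restr_mod_def functor_G_def)

lemma restr_G_whole: "restr_mod (G M) (homs C T M) = G M"
  by (simp add: restr_mod_def functor_G_def)

lemma submodule_G_whole: "submodule C T (G M) (homs C T M)"
  using homs_subspace compo_in_homs by (auto simp: submodule_G_iff)

lemma submodule_restr_iff:
  assumes "submodule C T (G M) F"
  shows "submodule C T (restr_mod (G M) F) K \<longleftrightarrow> submodule C T (G M) K \<and> K \<subseteq> F"
  using assms by (auto simp: submodule_def)

lemma maximal_submodule_restr:
  assumes "submodule C T (G M) F" "maximal_submodule C T (restr_mod (G M) F) K"
  shows "submodule C T (G M) K" "K \<subseteq> F" "K \<noteq> F"
    "\<And>K'. \<lbrakk>submodule C T (G M) K'; K' \<subseteq> F; K \<subseteq> K'\<rbrakk> \<Longrightarrow> K' = K \<or> K' = F"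
  using assms by (auto simp: maximal_submodule_def submodule_restr_iff)

text \<open>Nakayama's lemma for a simple quotient \<open>F/K\<close>.\<close>

lemma maximal_submodule_radT:
  assumes F: "submodule C T (G M) F" and K: "maximal_submodule C T (restr_mod (G M) F) K"
    and x: "x \<in> F" and a: "a \<in> radT"
  shows "x \<star> a \<in> K"
proof (rule ccontr)
  assume *: "x \<star> a \<notin> K"
  note Kf = maximal_submodule_restr[OF F K]
  have Ks: "vs.subspace K" "\<And>x a. \<lbrakk>x \<in> K; a \<in> homs C T T\<rbrakk> \<Longrightarrow> x \<star> a \<in> K"
    using Kf(1) by (auto simp: submodule_G_iff)
  have Fs: "vs.subspace F" "\<And>x a. \<lbrakk>x \<in> F; a \<in> homs C T T\<rbrakk> \<Longrightarrow> x \<star> a \<in> F" "F \<subseteq> homs C T M"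
    using F by (auto simp: submodule_G_iff)
  have xh: "x \<in> homs C T M" using x Fs(3) by blast
  have rT: "vs.subspace radT"
  proof (rule vs.subspaceI)
    show "0 \<in> radT"
      using vk.linear_on_sub_0[OF homs_subspace chiT_linear] by (simp add: radT_def)
  qed (auto simp: radT_def add_in_homs smul_in_homs linear_on_sub_add[OF chiT_linear]
      linear_on_sub_scale[OF chiT_linear])
  let ?X = "(\<lambda>a. x \<star> a) ` radT"
  have linX: "linear_on_sub (smul C) (smul C) radT (\<lambda>a. x \<star> a)"
    by (rule linear_on_sub_subset[OF compo_linear_right[OF xh]]) (auto simp: radT_def)
  have X: "vs.subspace ?X" by (rule vp.linear_on_sub_image_subspace[OF rT linX])
  \<comment> \<open>This submodule lies strictly above \<open>K\<close>, so it is all of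
    \<open>F\<close>. Then x = k + x f with \<open>f\<close> radical, and inverting 1 - f puts
    \<open>x\<close> into \<open>K\<close>.\<close>
  let ?K = "{k + y |k y. k \<in> K \<and> y \<in> ?X}"
  have "submodule C T (G M) ?K"
    unfolding submodule_G_iff
  proof (intro conjI ballI)
    show "vs.subspace ?K" by (rule vs.subspace_sums[OF Ks(1) X])
    show "?K \<subseteq> homs C T M"
      using Kf(2) Fs(3) compo_in_homs[OF xh radT_in_homs] by (auto intro!: add_in_homs)
    fix z e assume z: "z \<in> ?K" and e: "e \<in> homs C T T"
    then obtain k f where kf: "k \<in> K" "f \<in> radT" "z = k + x \<star> f" by blast
    note fh = radT_in_homs[OF kf(2)]
    have kh: "k \<in> homs C T M" using kf(1) Kf(2) Fs(3) by blast
    have "z \<star> e = k \<star> e + x \<star> (f \<star> e)"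
      using kf(3) compo_add_left[OF e kh compo_in_homs[OF xh fh]] compo_assoc[OF xh fh e] by simp
    moreover have "f \<star> e \<in> radT"
      using kf(2) compo_in_homs[OF fh e] chiT_compo[OF fh e] by (simp add: radT_def)
    ultimately show "z \<star> e \<in> ?K" using Ks(2)[OF kf(1) e] by blast
  qed
  moreover have "?K \<subseteq> F"
    using Kf(2) Fs(2)[OF x radT_in_homs] by (auto intro!: vs.subspace_add[OF Fs(1)])
  moreover have "K \<subseteq> ?K" using vs.subspace_0[OF X] by force
  moreover have "?K \<noteq> K" using * a vs.subspace_0[OF Ks(1)] by force
  ultimately have "?K = F" using Kf(4) by blast
  then have xK: "x \<in> ?K" using x by simp
  have ex: "\<exists>k\<in>K. \<exists>f\<in>radT. z = k + x \<star> f" if "z \<in> ?K" for z using that by blast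
  from ex[OF xK] obtain k f where kf: "k \<in> K" "f \<in> radT" "x = k + x \<star> f" by (elim bexE) (rule that)
  note fh = radT_in_homs[OF kf(2)]
  obtain u where u: "u \<in> homs C T T" "(ident C T - f) \<star> u = ident C T"
    using radT_right_inverse[OF kf(2)] by blast
  have d: "ident C T - f \<in> homs C T T" using diff_in_homs[OF ident_in_homs fh] .
  have "x \<star> (ident C T - f) = k"
  proof -
    have "k = x - x \<star> f" by (simp only: eq_diff_eq kf(3)[symmetric])
    then show ?thesis using compo_diff_right[OF xh ident_in_homs fh] ident_right[OF xh] by simp
  qed
  then have "x = k \<star> u" using compo_assoc[OF xh d u(1)] u(2) ident_right[OF xh] by simp
  then have "x \<in> K" using Ks(2)[OF kf(1) u(1)] by simp
  then show False using Ks(2) radT_in_homs[OF a] * by blast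
qed

end

locale tilting_simples = tilting_category C T Ti \<iota> \<pi> t
  for C :: "('k::alg_closed_field, 'o, 'v::ab_group_add, 'm) tricat_scheme" (structure)
    and T :: 'o and Ti :: "'n::finite \<Rightarrow> 'o" and \<iota> \<pi> t +
  fixes S :: "'n \<Rightarrow> 'v rmod"
  assumes S_top: "is_top C T (S j) (functor_G C T (Ti j))"
begin

text \<open>An endomorphism of \<open>T\<close> that factors through \<open>\<iota> j\<close> has a
  single nonzero row, so only its j-th diagonal residue could survive.\<close>

lemma radT_proj_iota:
  assumes f: "f \<in> homs C T (Ti j)" "chi (Ti j) (f \<star> \<iota> j) = 0"
  shows "\<iota> j \<star> f \<in> radT"
proof -
  have "entry l l (\<iota> j \<star> f) = (if l = j then f \<star> \<iota> j else 0)" for l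
    unfolding entry_def
    using compo_assoc[OF iota_in_homs f(1) iota_in_homs] prj_compo_inj[OF T_dsum UNIV_I UNIV_I
        compo_in_homs[OF f(1) iota_in_homs]] by auto
  then have "chiT l (\<iota> j \<star> f) = 0" for l
    using f(2) chi_zero[OF Ti_indecomposable] by (auto simp: chiT_def)
  then show ?thesis using compo_in_homs[OF iota_in_homs f(1)] by (simp add: radT_def)
qed

text \<open>The space \<open>?R\<close> has codimension one, with a complement spanned by the
  generator \<open>\<pi> j\<close>, and is therefore a maximal submodule. As every other maximal
  submodule contains it, the intersection is \<open>?R\<close> itself.\<close>

lemma rad_mod_G_Ti: "rad_mod C T (G (Ti j)) = {f \<in> homs C T (Ti j). chi (Ti j) (f \<star> \<iota> j) = 0}"
proof -
  let ?R = "{f \<in> homs C T (Ti j). chi (Ti j) (f \<star> \<iota> j) = 0}"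
  have lin: "linear_on_sub (smul C) (*) (homs C T (Ti j)) (\<lambda>f. chi (Ti j) (f \<star> \<iota> j))"
    unfolding linear_on_sub_def
    using compo_add_left[OF iota_in_homs] compo_smul_left[OF iota_in_homs] compo_in_homs[OF _ iota_in_homs]
      chi_add[OF Ti_indecomposable] chi_smul[OF Ti_indecomposable] by simp
  have pi: "chi (Ti j) (\<pi> j \<star> \<iota> j) = 1"
    using dsum_maps_prj_inj[OF T_dsum UNIV_I UNIV_I, of j j] chi_ident[OF Ti_indecomposable] by simp
  have sub: "submodule C T (G (Ti j)) ?R"
    unfolding submodule_G_iff
  proof (intro conjI ballI)
    have eq: "?R = {f \<in> homs C T (Ti j). chi (Ti j) (f \<star> \<iota> j) \<in> {0}}" by simp
    show "vs.subspace ?R"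
      unfolding eq by (rule vk.linear_on_sub_vimage_subspace[OF homs_subspace lin vk.vs2.subspace_single_0])
    fix f a assume f: "f \<in> ?R" and a: "a \<in> homs C T T"
    then have fh: "f \<in> homs C T (Ti j)" and c: "\<iota> j \<star> f \<in> radT" using radT_proj_iota by auto
    have "chiT j ((\<iota> j \<star> f) \<star> a) = 0"
      using chiT_compo[OF radT_in_homs[OF c] a, of j] c by (simp add: radT_def)
    moreover have "entry j j ((\<iota> j \<star> f) \<star> a) = (f \<star> a) \<star> \<iota> j"
      unfolding entry_def
      using compo_assoc[OF iota_in_homs fh a] compo_assoc[OF iota_in_homs compo_in_homs[OF fh a] iota_in_homs]
        prj_compo_inj[OF T_dsum UNIV_I UNIV_I compo_in_homs[OF compo_in_homs[OF fh a] iota_in_homs], of j]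
      by simp
    ultimately show "f \<star> a \<in> ?R" using compo_in_homs[OF fh a] by (simp add: chiT_def)
  qed blast
  have "maximal_submodule C T (G (Ti j)) ?R"
    unfolding maximal_submodule_def
  proof (intro conjI allI impI)
    show "?R \<noteq> mcar (G (Ti j))"
    proof
      assume "?R = mcar (G (Ti j))"
      then have "\<pi> j \<in> ?R" using pi_in_homs[of j] restr_G_simps(4) by blast
      then show False using pi by simp
    qed
    fix K assume K: "submodule C T (G (Ti j)) K \<and> ?R \<subseteq> K"
    have Ks: "vs.subspace K" "K \<subseteq> homs C T (Ti j)" "\<And>x a. \<lbrakk>x \<in> K; a \<in> homs C T T\<rbrakk> \<Longrightarrow> x \<star> a \<in> K"
      using K by (auto simp: submodule_G_iff)
    show "K = ?R \<or> K = mcar (G (Ti j))"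
    proof (cases "K \<subseteq> ?R")
      case False
      then obtain f where f: "f \<in> K" "chi (Ti j) (f \<star> \<iota> j) \<noteq> 0" using Ks(2) by blast
      let ?c = "chi (Ti j) (f \<star> \<iota> j)"
      have fh: "f \<in> homs C T (Ti j)" using f(1) Ks(2) by blast
      note cp = smul_in_homs[OF pi_in_homs[of j], of ?c]
      have "f - smul C ?c (\<pi> j) \<in> ?R"
        using diff_in_homs[OF fh cp] vk.linear_on_sub_diff[OF homs_subspace lin fh cp]
          linear_on_sub_scale[OF lin pi_in_homs] pi by simp
      then have "f - (f - smul C ?c (\<pi> j)) \<in> K" using K f(1) vs.subspace_diff[OF Ks(1)] by blast
      then have "smul C ?c (\<pi> j) \<in> K" by simp
      then have "smul C (inverse ?c) (smul C ?c (\<pi> j)) \<in> K" by (rule vs.subspace_scale[OF Ks(1)])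
      then have pK: "\<pi> j \<in> K" using f(2) by simp
      have "g \<in> K" if "g \<in> homs C T (Ti j)" for g
        using Ks(3)[OF pK compo_in_homs[OF iota_in_homs that]] prj_compo_inj[OF T_dsum UNIV_I UNIV_I that, of j]
        by simp
      then show ?thesis using Ks(2) by auto
    qed (use K in blast)
  qed (rule sub)
  \<comment> \<open>Such an element f arises from the generator \<open>\<pi> j\<close> by the action
    of \<open>\<iota> j \<star> f\<close>, which is radical, so Nakayama's lemma applies.\<close>
  moreover have "?R \<subseteq> K" if K: "maximal_submodule C T (G (Ti j)) K" for K
  proof
    fix f assume f: "f \<in> ?R"
    have "\<pi> j \<star> (\<iota> j \<star> f) \<in> K"
      by (rule maximal_submodule_radT[OF submodule_G_whole _ pi_in_homs])
        (use K f radT_proj_iota restr_G_whole in simp_all)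
    then show "f \<in> K" using prj_compo_inj[OF T_dsum UNIV_I UNIV_I, of f T j j] f by simp
  qed
  ultimately show ?thesis unfolding rad_mod_def by auto
qed

lemma S_module: "right_module C T (S j)"
  using S_top[of j] by (simp add: is_top_def)

text \<open>The module \<open>S j\<close> is given only up to isomorphism, as a quotient of Hom(T,
  T_j). The image of \<open>\<pi> j\<close> spans it because modulo the radical every map is a
  multiple of \<open>\<pi> j\<close>.\<close>

lemma S_generator:
  "\<exists>v. v \<noteq> 0 \<and> mcar (S j) = range (\<lambda>c. smul C c v) \<and> (\<forall>a\<in>homs C T T. mact (S j) v a = smul C (chiT j a) v)"
proof -
  let ?R = "{f \<in> homs C T (Ti j). chi (Ti j) (f \<star> \<iota> j) = 0}"
  obtain \<phi> where \<phi>: "\<phi> \<in> mod_hom C T (G (Ti j)) (S j)" "\<phi> ` homs C T (Ti j) = mcar (S j)"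
      "{x \<in> homs C T (Ti j). \<phi> x = 0} = ?R"
    using S_top[of j] unfolding is_top_def quotient_iso_def rad_mod_G_Ti by auto
  have lin: "linear_on_sub (smul C) (smul C) (homs C T (Ti j)) \<phi>"
    and act: "\<And>x a. \<lbrakk>x \<in> homs C T (Ti j); a \<in> homs C T T\<rbrakk> \<Longrightarrow> \<phi> (x \<star> a) = mact (S j) (\<phi> x) a"
    using \<phi>(1) by (auto simp: mod_hom_def)
  have linc: "linear_on_sub (smul C) (*) (homs C T (Ti j)) (\<lambda>f. chi (Ti j) (f \<star> \<iota> j))"
    unfolding linear_on_sub_def
    using compo_add_left[OF iota_in_homs] compo_smul_left[OF iota_in_homs] compo_in_homs[OF _ iota_in_homs]
      chi_add[OF Ti_indecomposable] chi_smul[OF Ti_indecomposable] by simp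
  have pi: "chi (Ti j) (\<pi> j \<star> \<iota> j) = 1"
    using dsum_maps_prj_inj[OF T_dsum UNIV_I UNIV_I, of j j] chi_ident[OF Ti_indecomposable] by simp
  let ?v = "\<phi> (\<pi> j)"
  have val: "\<phi> f = smul C (chi (Ti j) (f \<star> \<iota> j)) ?v" if f: "f \<in> homs C T (Ti j)" for f
  proof -
    let ?c = "chi (Ti j) (f \<star> \<iota> j)"
    note cp = smul_in_homs[OF pi_in_homs[of j], of ?c]
    have "f - smul C ?c (\<pi> j) \<in> ?R"
      using diff_in_homs[OF f cp] vk.linear_on_sub_diff[OF homs_subspace linc f cp]
        linear_on_sub_scale[OF linc pi_in_homs] pi by simp
    then have "\<phi> (f - smul C ?c (\<pi> j)) = 0" using \<phi>(3) by blast
    then show ?thesis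
      using vp.linear_on_sub_diff[OF homs_subspace lin f cp] linear_on_sub_scale[OF lin pi_in_homs] by simp
  qed
  have "\<pi> j \<notin> ?R" using pi by simp
  then have "?v \<noteq> 0" using \<phi>(3) pi_in_homs[of j] by blast
  moreover have "mcar (S j) = range (\<lambda>c. smul C c ?v)"
  proof (intro equalityI subsetI)
    fix y assume "y \<in> range (\<lambda>c. smul C c ?v)"
    then obtain c where "y = \<phi> (smul C c (\<pi> j))" using linear_on_sub_scale[OF lin pi_in_homs] by auto
    then show "y \<in> mcar (S j)" using \<phi>(2) smul_in_homs[OF pi_in_homs] by blast
  next
    fix y assume "y \<in> mcar (S j)"
    then obtain f where "f \<in> homs C T (Ti j)" "y = \<phi> f" using \<phi>(2) by blast
    then show "y \<in> range (\<lambda>c. smul C c ?v)" using val by blast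
  qed
  moreover have "mact (S j) ?v a = smul C (chiT j a) ?v" if a: "a \<in> homs C T T" for a
    using act[OF pi_in_homs a] val[OF compo_in_homs[OF pi_in_homs a]] compo_assoc[OF pi_in_homs a iota_in_homs]
    by (simp add: chiT_def entry_def)
  ultimately show ?thesis by blast
qed

definition gen :: "'n \<Rightarrow> 'v" where
  "gen j = (SOME v. v \<noteq> 0 \<and> mcar (S j) = range (\<lambda>c. smul C c v) \<and>
     (\<forall>a\<in>homs C T T. mact (S j) v a = smul C (chiT j a) v))"

lemma gen:
  shows gen_nonzero: "gen j \<noteq> 0" and mcar_S: "mcar (S j) = range (\<lambda>c. smul C c (gen j))"
    and mact_gen: "a \<in> homs C T T \<Longrightarrow> mact (S j) (gen j) a = smul C (chiT j a) (gen j)"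
  using someI_ex[OF S_generator[of j], folded gen_def] by blast+

lemma gen_in_S: "smul C c (gen j) \<in> mcar (S j)"
  unfolding mcar_S by blast

lemma mact_S:
  assumes "a \<in> homs C T T" "x \<in> mcar (S j)"
  shows "mact (S j) x a = smul C (chiT j a) x"
proof -
  obtain c where c: "x = smul C c (gen j)" using assms(2) mcar_S by blast
  have "gen j \<in> mcar (S j)" using gen_in_S[of 1] by simp
  then have "mact (S j) (smul C c (gen j)) a = smul C c (mact (S j) (gen j) a)"
    using S_module[of j] assms(1) unfolding right_module_def linear_on_sub_def by blast
  then show ?thesis using mact_gen[OF assms(1)] by (simp add: c mult.commute)
qed

lemma idem_in_homs: "\<iota> l \<star> \<pi> l \<in> homs C T T"
  using compo_in_homs iota_in_homs pi_in_homs by blast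

lemma chiT_idem: "chiT j (\<iota> l \<star> \<pi> l) = (if j = l then 1 else 0)"
proof -
  have "entry j j (\<iota> l \<star> \<pi> l) = (if j = l then ident C (Ti l) else 0)"
    using entry_compo_iota_pi[OF ident_in_homs, of j j l] ident_left[OF pi_in_homs] by simp
  then show ?thesis
    using chi_ident[OF Ti_indecomposable] chi_zero[OF Ti_indecomposable] by (simp add: chiT_def)
qed

text \<open>A simple quotient F/K is spanned by the class of an element with a single component l,
  and radical elements act on it by zero, so End(T) acts by the character of S_l. Both claims are
  read off from this one class.\<close>

lemma simple_quotient:
  assumes F: "submodule C T (G M) F" and K: "maximal_submodule C T (restr_mod (G M) F) K"
  shows "\<exists>l. (\<forall>j. vs.dim (sub_comp F M j) = vs.dim (sub_comp K M j) + (if j = l then 1 else 0)) \<and>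
    (\<forall>j. quotient_iso C T (restr_mod (G M) F) K (S j) \<longleftrightarrow> j = l)"
proof -
  note Kf = maximal_submodule_restr[OF F K]
  have Ks: "vs.subspace K" "\<And>x a. \<lbrakk>x \<in> K; a \<in> homs C T T\<rbrakk> \<Longrightarrow> x \<star> a \<in> K"
    using Kf(1) by (auto simp: submodule_G_iff)
  have Fs: "vs.subspace F" "\<And>x a. \<lbrakk>x \<in> F; a \<in> homs C T T\<rbrakk> \<Longrightarrow> x \<star> a \<in> F" "F \<subseteq> homs C T M"
    using F by (auto simp: submodule_G_iff)
  obtain y where y: "y \<in> F" "y \<notin> K" using Kf(2,3) by blast
  have yh: "y \<in> homs C T M" using y(1) Fs(3) by blast
  have "\<exists>l. (y \<star> \<iota> l) \<star> \<pi> l \<notin> K"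
  proof (rule ccontr)
    assume "\<not> ?thesis"
    then have "(y \<star> \<iota> l) \<star> \<pi> l \<in> K" for l by blast
    then have "(\<Sum>l\<in>UNIV. (y \<star> \<iota> l) \<star> \<pi> l) \<in> K" by (rule vs.subspace_sum[OF Ks(1)])
    then show False using dsum_decomp_source[OF T_dsum yh] y(2) by simp
  qed
  then obtain l where l: "(y \<star> \<iota> l) \<star> \<pi> l \<notin> K" ..
  define x0 where "x0 = y \<star> \<iota> l"
  define x where "x = x0 \<star> \<pi> l"
  have x0: "x0 \<in> homs C (Ti l) M" using compo_in_homs[OF yh iota_in_homs] by (simp add: x0_def)
  have xh: "x \<in> homs C T M" using compo_in_homs[OF x0 pi_in_homs] by (simp add: x_def)
  have xK: "x \<notin> K" using l by (simp add: x_def x0_def)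
  have "x = y \<star> (\<iota> l \<star> \<pi> l)"
    using compo_assoc[OF yh iota_in_homs pi_in_homs] by (simp add: x_def x0_def)
  then have xF: "x \<in> F" using Fs(2)[OF y(1) idem_in_homs] by simp
  have xe: "x \<star> (\<iota> l \<star> e) = x0 \<star> e" if "e \<in> homs C W (Ti l)" for e W
    using compo_assoc[OF x0 pi_in_homs compo_in_homs[OF iota_in_homs that]]
      prj_compo_inj[OF T_dsum UNIV_I UNIV_I that, of l] by (simp add: x_def)
  \<comment> \<open>The difference between \<open>a\<close> and its residue acts on \<open>x\<close>
    through a radical map T -> T_l, and Nakayama's lemma puts the result into
    \<open>K\<close>.\<close>
  have xa: "x \<star> a - smul C (chiT l a) x \<in> K" if a: "a \<in> homs C T T" for a
  proof -
    let ?f = "\<pi> l \<star> a - smul C (chiT l a) (\<pi> l)"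
    have pa: "\<pi> l \<star> a \<in> homs C T (Ti l)" using compo_in_homs[OF pi_in_homs a] .
    note cp = smul_in_homs[OF pi_in_homs[of l], of "chiT l a"]
    have f: "?f \<in> homs C T (Ti l)" using diff_in_homs[OF pa cp] .
    have pi: "\<pi> l \<star> \<iota> l = ident C (Ti l)" using dsum_maps_prj_inj[OF T_dsum UNIV_I UNIV_I, of l l] by simp
    have "?f \<star> \<iota> l = entry l l a - smul C (chiT l a) (ident C (Ti l))"
      using compo_diff_left[OF iota_in_homs pa cp] compo_smul_left[OF iota_in_homs pi_in_homs] pi
        compo_assoc[OF pi_in_homs a iota_in_homs] by (simp add: entry_def)
    then have "chi (Ti l) (?f \<star> \<iota> l) = 0"
      using chi_decomp[OF Ti_indecomposable entry_in_homs[OF a]] by (simp add: chiT_def)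
    then have "x \<star> (\<iota> l \<star> ?f) \<in> K" using maximal_submodule_radT[OF F K xF radT_proj_iota[OF f]] by blast
    also have "x \<star> (\<iota> l \<star> ?f) = x \<star> a - smul C (chiT l a) x"
      using xe[OF f] compo_diff_right[OF x0 pa cp] compo_assoc[OF x0 pi_in_homs a]
        compo_smul_right[OF x0 pi_in_homs] by (simp add: x_def)
    finally show ?thesis .
  qed
  \<comment> \<open>By \<open>xa\<close> the sum of \<open>K\<close> and the line of
    \<open>x\<close> is a submodule, hence equal to \<open>F\<close> by maximality.\<close>
  have gen: "\<exists>c. z - smul C c x \<in> K" if z: "z \<in> F" for z
  proof -
    let ?K = "{k + w |k w. k \<in> K \<and> w \<in> range (\<lambda>c. smul C c x)}"
    have X: "vs.subspace (range (\<lambda>c. smul C c x))" using vs.subspace_span[of "{x}"] by (simp add: vs.span_singleton)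
    have "submodule C T (G M) ?K"
      unfolding submodule_G_iff
    proof (intro conjI ballI)
      show "vs.subspace ?K" by (rule vs.subspace_sums[OF Ks(1) X])
      show "?K \<subseteq> homs C T M" using Kf(2) Fs(3) smul_in_homs[OF xh] by (auto intro!: add_in_homs)
      fix w e assume w: "w \<in> ?K" and e: "e \<in> homs C T T"
      then obtain k c where kc: "k \<in> K" "w = k + smul C c x" by blast
      have kh: "k \<in> homs C T M" using kc(1) Kf(2) Fs(3) by blast
      have "w \<star> e = (k \<star> e + smul C c (x \<star> e - smul C (chiT l e) x)) + smul C (c * chiT l e) x"
        using kc(2) compo_add_left[OF e kh smul_in_homs[OF xh]] compo_smul_left[OF e xh]
        by (simp add: vs.scale_right_diff_distrib)
      moreover have "k \<star> e + smul C c (x \<star> e - smul C (chiT l e) x) \<in> K"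
        using Ks(2)[OF kc(1) e] xa[OF e] vs.subspace_add[OF Ks(1)] vs.subspace_scale[OF Ks(1)] by blast
      ultimately show "w \<star> e \<in> ?K" by blast
    qed
    moreover have "?K \<subseteq> F"
      using Kf(2) vs.subspace_scale[OF Fs(1) xF] by (auto intro!: vs.subspace_add[OF Fs(1)])
    moreover have "K \<subseteq> ?K" using vs.subspace_0[OF X] by force
    moreover have "x = 0 + smul C 1 x" by simp
    then have "x \<in> ?K" using vs.subspace_0[OF Ks(1)] by blast
    then have "?K \<noteq> K" using xK by blast
    ultimately have "?K = F" using Kf(4) by blast
    then obtain k c where "k \<in> K" "z = k + smul C c x" using z by blast
    then show ?thesis by (intro exI[of _ c]) simp
  qed
  have coef_unique: "c = c'" if "z - smul C c x \<in> K" "z - smul C c' x \<in> K" for z c c'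
  proof (rule ccontr)
    assume "c \<noteq> c'"
    have "(z - smul C c' x) - (z - smul C c x) \<in> K" by (rule vs.subspace_diff[OF Ks(1) that(2,1)])
    then have "smul C (c - c') x \<in> K" by (simp add: vs.scale_left_diff_distrib)
    then have "smul C (inverse (c - c')) (smul C (c - c') x) \<in> K" by (rule vs.subspace_scale[OF Ks(1)])
    then show False using xK \<open>c \<noteq> c'\<close> by simp
  qed
  \<comment> \<open>The coordinate of \<open>z\<close> modulo \<open>K\<close> with respect to the
    class of \<open>x\<close>; it gives the isomorphism of F/K with S_l.\<close>
  define co where "co z = (THE c. z - smul C c x \<in> K)" for z
  have co: "z - smul C (co z) x \<in> K" if z: "z \<in> F" for z
    unfolding co_def
  proof (rule theI')
    show "\<exists>!c. z - smul C c x \<in> K" using gen[OF z] coef_unique by blast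
  qed
  have coI: "co z = c" if "z \<in> F" "z - smul C c x \<in> K" for z c
    using coef_unique[OF co[OF that(1)] that(2)] .
  have dims: "vs.dim (sub_comp F M j) = vs.dim (sub_comp K M j) + (if j = l then 1 else 0)" for j
  proof (cases "j = l")
    case True
    have "vs.dim (sub_comp F M l) = vs.dim (sub_comp K M l) + 1"
    proof (rule vs.dim_codim_one[OF sub_comp_fin[OF F] sub_comp_subspace[OF Kf(1)]])
      show "sub_comp K M l \<subseteq> sub_comp F M l" using Kf(2) by (auto simp: sub_comp_def)
      show "x0 \<in> sub_comp F M l" using x0 xF by (simp add: sub_comp_def x_def)
      show "x0 \<notin> sub_comp K M l" using xK by (simp add: sub_comp_def x_def)
      fix z assume "z \<in> sub_comp F M l"
      then have z: "z \<in> homs C (Ti l) M" "z \<star> \<pi> l \<in> F" by (auto simp: sub_comp_def)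
      obtain c where c: "z \<star> \<pi> l - smul C c x \<in> K" using gen[OF z(2)] by blast
      have "(z - smul C c x0) \<star> \<pi> l = z \<star> \<pi> l - smul C c x"
        using compo_diff_left[OF pi_in_homs z(1) smul_in_homs[OF x0]] compo_smul_left[OF pi_in_homs x0]
        by (simp add: x_def)
      then show "\<exists>c. z - smul C c x0 \<in> sub_comp K M l"
        using c diff_in_homs[OF z(1) smul_in_homs[OF x0]] by (intro exI[of _ c]) (simp add: sub_comp_def)
    qed
    then show ?thesis using True by simp
  next
    case False
    have "sub_comp F M j \<subseteq> sub_comp K M j"
    proof
      fix z assume "z \<in> sub_comp F M j"
      then have z: "z \<in> homs C (Ti j) M" "z \<star> \<pi> j \<in> F" by (auto simp: sub_comp_def)
      note zh = compo_in_homs[OF z(1) pi_in_homs]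
      obtain c where c: "z \<star> \<pi> j - smul C c x \<in> K" using gen[OF z(2)] by blast
      have "(z \<star> \<pi> j) \<star> (\<iota> j \<star> \<pi> j) = z \<star> \<pi> j"
        using compo_assoc[OF z(1) pi_in_homs idem_in_homs] prj_compo_inj[OF T_dsum UNIV_I UNIV_I pi_in_homs, of j]
        by simp
      moreover have "x \<star> (\<iota> j \<star> \<pi> j) = 0"
        using compo_assoc[OF x0 pi_in_homs idem_in_homs] prj_compo_inj[OF T_dsum UNIV_I UNIV_I pi_in_homs, of l j]
          False compo_zero_right[OF x0] by (simp add: x_def)
      ultimately have "(z \<star> \<pi> j - smul C c x) \<star> (\<iota> j \<star> \<pi> j) = z \<star> \<pi> j"
        using compo_diff_left[OF idem_in_homs zh smul_in_homs[OF xh]] compo_smul_left[OF idem_in_homs xh]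
        by simp
      then have "z \<star> \<pi> j \<in> K" using Ks(2)[OF c idem_in_homs[of j]] by simp
      then show "z \<in> sub_comp K M j" using z(1) by (simp add: sub_comp_def)
    qed
    moreover have "sub_comp K M j \<subseteq> sub_comp F M j" using Kf(2) by (auto simp: sub_comp_def)
    ultimately have "sub_comp F M j = sub_comp K M j" by blast
    then show ?thesis using False by simp
  qed
  \<comment> \<open>The idempotent of T_l fixes \<open>x\<close> but acts by zero on S_j for j
    different from l, so such a quotient map would kill \<open>x\<close>.\<close>
  have "j = l" if q: "quotient_iso C T (restr_mod (G M) F) K (S j)" for j
  proof (rule ccontr)
    assume "j \<noteq> l"
    obtain f where f: "f \<in> mod_hom C T (restr_mod (G M) F) (S j)" "{x \<in> F. f x = 0} = K"
      using q by (auto simp: quotient_iso_def)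
    have "f (x \<star> (\<iota> l \<star> \<pi> l)) = mact (S j) (f x) (\<iota> l \<star> \<pi> l)" "f x \<in> mcar (S j)"
      using f(1) xF idem_in_homs by (auto simp: mod_hom_def)
    then have "f x = 0"
      using mact_S[OF idem_in_homs] chiT_idem[of j l] \<open>j \<noteq> l\<close> xe[OF pi_in_homs] by (simp add: x_def)
    then show False using f(2) xF xK by blast
  qed
  moreover have "quotient_iso C T (restr_mod (G M) F) K (S l)"
  proof -
    define f where "f z = (if z \<in> F then smul C (co z) (gen l) else 0)" for z
    have fF: "f z = smul C (co z) (gen l)" if "z \<in> F" for z using that by (simp add: f_def)
    have co_add: "co (z + w) = co z + co w" if "z \<in> F" "w \<in> F" for z w
    proof (rule coI[OF vs.subspace_add[OF Fs(1) that]])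
      have "(z - smul C (co z) x) + (w - smul C (co w) x) \<in> K"
        using vs.subspace_add[OF Ks(1) co co] that by blast
      then show "z + w - smul C (co z + co w) x \<in> K" by (simp add: vs.scale_left_distrib algebra_simps)
    qed
    have co_scale: "co (smul C c z) = c * co z" if "z \<in> F" for c z
    proof (rule coI[OF vs.subspace_scale[OF Fs(1) that]])
      have "smul C c (z - smul C (co z) x) \<in> K" using vs.subspace_scale[OF Ks(1) co[OF that]] .
      then show "smul C c z - smul C (c * co z) x \<in> K" by (simp add: vs.scale_right_diff_distrib)
    qed
    have co_act: "co (z \<star> a) = chiT l a * co z" if "z \<in> F" "a \<in> homs C T T" for z a
    proof (rule coI[OF Fs(2)[OF that]])
      have zh: "z \<in> homs C T M" using that(1) Fs(3) by blast
      have "(z - smul C (co z) x) \<star> a + smul C (co z) (x \<star> a - smul C (chiT l a) x) \<in> K"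
        using vs.subspace_add[OF Ks(1) Ks(2)[OF co[OF that(1)] that(2)] vs.subspace_scale[OF Ks(1) xa[OF that(2)]]] .
      then show "z \<star> a - smul C (chiT l a * co z) x \<in> K"
        using compo_diff_left[OF that(2) zh smul_in_homs[OF xh]] compo_smul_left[OF that(2) xh]
        by (simp add: vs.scale_right_diff_distrib mult.commute)
    qed
    have lin: "linear_on_sub (smul C) (smul C) F f"
      unfolding linear_on_sub_def
      by (simp add: fF co_add co_scale vs.subspace_add[OF Fs(1)] vs.subspace_scale[OF Fs(1)] vs.scale_left_distrib)
    have act: "f (z \<star> a) = mact (S l) (f z) a" if "z \<in> F" "a \<in> homs C T T" for z a
      using fF[OF that(1)] fF[OF Fs(2)[OF that]] co_act[OF that] mact_S[OF that(2) gen_in_S] by simp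
    have im: "f ` F \<subseteq> mcar (S l)" using fF gen_in_S by auto
    have hom: "f \<in> mod_hom C T (restr_mod (G M) F) (S l)"
    proof -
      have "\<forall>z\<in>F. \<forall>a\<in>homs C T T. f (z \<star> a) = mact (S l) (f z) a" using act by blast
      moreover have "\<forall>z. z \<notin> F \<longrightarrow> f z = 0" by (simp add: f_def)
      ultimately show ?thesis
        unfolding mod_hom_def restr_G_simps using lin im by (intro CollectI conjI)
    qed
    have "y \<in> f ` F" if y: "y \<in> mcar (S l)" for y
    proof -
      obtain c where c: "y = smul C c (gen l)" using y mcar_S by blast
      have cx: "smul C c x \<in> F" using vs.subspace_scale[OF Fs(1) xF] .
      have "co (smul C c x) = c" by (rule coI[OF cx]) (simp add: vs.subspace_0[OF Ks(1)])
      then have "f (smul C c x) = y" using c fF[OF cx] by simp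
      then show ?thesis using cx by blast
    qed
    then have im': "f ` F = mcar (S l)" using im by blast
    have "{z \<in> F. f z = 0} = K"
    proof (intro equalityI subsetI)
      fix z assume "z \<in> {z \<in> F. f z = 0}"
      then have "z \<in> F" "co z = 0" using fF gen_nonzero[of l] by auto
      then show "z \<in> K" using co[of z] by simp
    next
      fix z assume z: "z \<in> K"
      then have zF: "z \<in> F" using Kf(2) by blast
      have "co z = 0" by (rule coI[OF zF]) (use z in simp)
      then show "z \<in> {z \<in> F. f z = 0}" using fF[OF zF] zF by simp
    qed
    then show ?thesis unfolding quotient_iso_def restr_G_simps using hom im' by blast
  qed
  ultimately show ?thesis using dims by blast
qed

section \<open>Composition series and dimension vectors\<close>

lemma comp_series_exists:
  assumes "submodule C T (G M) N"
  shows "\<exists>r F. comp_series C T (restr_mod (G M) N) r F"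
  using assms
proof (induction "vs.dim N" arbitrary: N rule: less_induct)
  case less
  have Ns: "vs.subspace N" "N \<subseteq> homs C T M" using less.prems by (auto simp: submodule_G_iff)
  have finN: "finite_dim_sub (smul C) N" by (rule vs.finite_dim_sub_subset[OF fin_homs Ns])
  have zero: "submodule C T (G M) {0}"
    using compo_zero_left by (auto simp: submodule_G_iff vs.subspace_single_0)
  show ?case
  proof (cases "N = {0}")
    case True
    then have "comp_series C T (restr_mod (G M) N) 0 (\<lambda>_. {0})"
      using zero submodule_restr_iff[OF less.prems] by (simp add: comp_series_def)
    then show ?thesis by blast
  next
    case False
    let ?P = "\<lambda>K. submodule C T (G M) K \<and> K \<subseteq> N \<and> K \<noteq> N"
    have dim_mono: "vs.dim K \<le> vs.dim N" if "?P K" for K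
      using that vs.finite_dim_sub_dim_mono[OF finN] by (auto simp: submodule_G_iff)
    have P0: "?P {0}" using zero False vs.subspace_0[OF Ns(1)] by blast
    \<comment> \<open>A proper submodule of greatest dimension is maximal; dimensions are bounded by
      that of \<open>N\<close>.\<close>
    obtain K where K: "?P K" and max: "\<And>K'. ?P K' \<Longrightarrow> vs.dim K' \<le> vs.dim K"
      using ex_has_greatest_nat[of ?P "{0}" vs.dim "Suc (vs.dim N)"] P0 dim_mono by (metis (mono_tags) le_imp_less_Suc less_imp_le)
    have Ks: "vs.subspace K" using K by (simp add: submodule_G_iff)
    have max_sub: "maximal_submodule C T (restr_mod (G M) N) K"
      unfolding maximal_submodule_def submodule_restr_iff[OF less.prems] restr_G_simps
    proof (intro conjI allI impI)
      fix K' assume K': "(submodule C T (G M) K' \<and> K' \<subseteq> N) \<and> K \<subseteq> K'"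
      show "K' = K \<or> K' = N"
      proof (cases "K' = N")
        case False
        then have P: "?P K'" using K' by blast
        have "finite_dim_sub (smul C) K'"
          using vs.finite_dim_sub_subset[OF finN] K' by (simp add: submodule_G_iff)
        then have "K = K'" by (rule vs.finite_dim_sub_dim_eq) (use Ks K' max[OF P] in auto)
        then show ?thesis by simp
      qed simp
    qed (use K in auto)
    have "vs.dim K < vs.dim N"
    proof (rule ccontr)
      assume "\<not> ?thesis"
      then have "K = N" by (intro vs.finite_dim_sub_dim_eq[OF finN Ks]) (use K in auto)
      then show False using K by blast
    qed
    then obtain r F where F: "comp_series C T (restr_mod (G M) K) r F" using less.hyps K by blast
    let ?F = "F(Suc r := N)"
    have "comp_series C T (restr_mod (G M) N) (Suc r) ?F"
      unfolding comp_series_def restr_G_simps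
    proof (intro conjI allI impI)
      show "?F 0 = {0}" using F by (simp add: comp_series_def)
      show "?F (Suc r) = N" by simp
      fix q assume q: "q \<le> Suc r"
      show "submodule C T (restr_mod (G M) N) (?F q)"
      proof (cases "q = Suc r")
        case True
        then show ?thesis using less.prems submodule_restr_iff[OF less.prems] by simp
      next
        case False
        then have "submodule C T (restr_mod (G M) K) (F q)" using F q by (simp add: comp_series_def)
        then have "submodule C T (G M) (F q) \<and> F q \<subseteq> N" using submodule_restr_iff K by blast
        then show ?thesis using False submodule_restr_iff[OF less.prems] by simp
      qed
    next
      fix q assume q: "q < Suc r"
      show "maximal_submodule C T (restr_mod (G M) (?F (Suc q))) (?F q)"
      proof (cases "q = r")
        case True
        then show ?thesis using F max_sub by (simp add: comp_series_def)
      next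
        case False
        then show ?thesis using F q by (simp add: comp_series_def)
      qed
    qed
    then show ?thesis by blast
  qed
qed

text \<open>By \<open>simple_quotient\<close> every step enlarges exactly one component, by one
  dimension, and the index of this component is the isomorphism type of the factor.\<close>

lemma comp_series_count:
  assumes N: "submodule C T (G M) N" and F: "comp_series C T (restr_mod (G M) N) r F" and "q \<le> r"
  shows "vs.dim (sub_comp (F q) M j) =
    card {p. p < q \<and> quotient_iso C T (restr_mod (G M) (F (Suc p))) (F p) (S j)}"
  using \<open>q \<le> r\<close>
proof (induction q)
  case 0
  have "x = 0" if x: "x \<in> homs C (Ti j) M" "x \<star> \<pi> j = 0" for x
    using compo_prj_inj[OF T_dsum UNIV_I UNIV_I x(1), of j] x(2) compo_zero_left[OF iota_in_homs[of j]] by simp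
  then have "sub_comp {0} M j = {0}"
    using compo_zero_left[OF pi_in_homs[of j]] by (auto simp: sub_comp_def)
  then show ?case using F by (simp add: comp_series_def)
next
  case (Suc q)
  let ?Q = "\<lambda>p. quotient_iso C T (restr_mod (G M) (F (Suc p))) (F p) (S j)"
  have "submodule C T (G M) (F (Suc q))"
    using F Suc.prems submodule_restr_iff[OF N] by (auto simp: comp_series_def)
  moreover have "maximal_submodule C T (restr_mod (G M) (F (Suc q))) (F q)"
    using F Suc.prems by (simp add: comp_series_def)
  ultimately obtain l where
    "\<forall>j. vs.dim (sub_comp (F (Suc q)) M j) = vs.dim (sub_comp (F q) M j) + (if j = l then 1 else 0)"
    "\<forall>j. quotient_iso C T (restr_mod (G M) (F (Suc q))) (F q) (S j) \<longleftrightarrow> j = l"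
    using simple_quotient by blast
  then have "vs.dim (sub_comp (F (Suc q)) M j) = vs.dim (sub_comp (F q) M j) + (if ?Q q then 1 else 0)"
    by simp
  also have "\<dots> = card {p. p < q \<and> ?Q p} + (if ?Q q then 1 else 0)" using Suc by simp
  also have "\<dots> = card {p. p < Suc q \<and> ?Q p}"
  proof (cases "?Q q")
    case True
    then have "{p. p < Suc q \<and> ?Q p} = insert q {p. p < q \<and> ?Q p}" by auto
    then show ?thesis using True by simp
  next
    case False
    then have "{p. p < Suc q \<and> ?Q p} = {p. p < q \<and> ?Q p}" using less_Suc_eq by auto
    then show ?thesis using False by simp
  qed
  finally show ?case .
qed

text \<open>The count along a composition series equals a quantity that does not refer to the
  series, which makes the definite description in \<open>dim_vec\<close> meaningful.\<close>

lemma dim_vec_submodule: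
  assumes N: "submodule C T (G M) N"
  shows "dim_vec C T S (restr_mod (G M) N) j = vs.dim (sub_comp N M j)"
  unfolding dim_vec_def
proof (rule the_equality)
  have count: "vs.dim (sub_comp N M j) = card {q. q < r \<and>
      quotient_iso C T (restr_mod (restr_mod (G M) N) (F (Suc q))) (F q) (S j)}"
    if F: "comp_series C T (restr_mod (G M) N) r F" for r F
    using comp_series_count[OF N F, of r j] F by (simp add: comp_series_def)
  show "\<exists>r F. comp_series C T (restr_mod (G M) N) r F \<and> vs.dim (sub_comp N M j) = card {q. q < r \<and>
      quotient_iso C T (restr_mod (restr_mod (G M) N) (F (Suc q))) (F q) (S j)}"
  proof -
    obtain r F where F: "comp_series C T (restr_mod (G M) N) r F" using comp_series_exists[OF N] by blast
    show ?thesis by (intro exI conjI, rule F, rule count[OF F])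
  qed
  show "m = vs.dim (sub_comp N M j)" if m: "\<exists>r F. comp_series C T (restr_mod (G M) N) r F \<and> m = card {q. q < r \<and>
      quotient_iso C T (restr_mod (restr_mod (G M) N) (F (Suc q))) (F q) (S j)}" for m
  proof -
    obtain r F where "comp_series C T (restr_mod (G M) N) r F" "m = card {q. q < r \<and>
      quotient_iso C T (restr_mod (restr_mod (G M) N) (F (Suc q))) (F q) (S j)}" using m by blast
    then show ?thesis using count by simp
  qed
qed

lemma dim_vec_G: "dim_vec C T S (G M) j = vs.dim (homs C (Ti j) M)"
proof -
  have "sub_comp (homs C T M) M j = homs C (Ti j) M"
    using compo_in_homs[OF _ pi_in_homs] by (auto simp: sub_comp_def)
  then show ?thesis
    using dim_vec_submodule[OF submodule_G_whole, of M j] by (simp add: restr_G_whole)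
qed

end

section \<open>Extensions between simple modules\<close>

text \<open>Naming pointwise scaling allows it to be iterated: functions of two arguments, such as
  cocycles, are covered by applying it twice.\<close>

definition fun_scale :: "('k \<Rightarrow> 'b \<Rightarrow> 'b) \<Rightarrow> 'k \<Rightarrow> ('a \<Rightarrow> 'b) \<Rightarrow> 'a \<Rightarrow> 'b" where
  "fun_scale sc c f = (\<lambda>x. sc c (f x))"

lemma fun_scale_apply [simp]: "fun_scale sc c f x = sc c (f x)"
  by (simp add: fun_scale_def)

lemma vector_space_fun_scale:
  assumes "vector_space sc"
  shows "vector_space (fun_scale sc)"
  unfolding fun_scale_def[abs_def] by (rule vector_space_fun[OF assms])

lemma inner_derivation_identity: "c * (p * q - r * s) = c * (p - r) * q + r * (c * (q - s))"
  for c p q r s :: "'k::field"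
  by (simp add: algebra_simps)

text \<open>Functionals are normalised to be 0 outside \<open>A\<close>, so that functions with
  equal restrictions coincide and the dual has the right dimension.\<close>

definition dual_space :: "('k::field \<Rightarrow> 'v::ab_group_add \<Rightarrow> 'v) \<Rightarrow> 'v set \<Rightarrow> ('v \<Rightarrow> 'k) set" where
  "dual_space sc A = {\<phi>. linear_on_sub sc (*) A \<phi> \<and> (\<forall>x. x \<notin> A \<longrightarrow> \<phi> x = 0)}"

lemma (in vector_space) dual_space_subspace:
  assumes "subspace A"
  shows "module.subspace (fun_scale (*)) (dual_space scale A)"
proof -
  interpret f: vector_space "fun_scale (*) :: 'a \<Rightarrow> ('b \<Rightarrow> 'a) \<Rightarrow> 'b \<Rightarrow> 'a"
    by (rule vector_space_fun_scale[OF vector_space_field])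
  show ?thesis
    by (rule f.subspaceI) (simp_all add: dual_space_def linear_on_sub_def algebra_simps)
qed

lemma (in vector_space) dual_space_fin:
  assumes A: "finite_dim_sub scale A"
  shows "finite_dim_sub (fun_scale (*)) (dual_space scale A)"
proof -
  interpret f: vector_space "fun_scale (*) :: 'a \<Rightarrow> ('b \<Rightarrow> 'a) \<Rightarrow> 'b \<Rightarrow> 'a"
    by (rule vector_space_fun_scale[OF vector_space_field])
  interpret k: vector_space_pair scale "(*) :: 'a \<Rightarrow> 'a \<Rightarrow> 'a"
    using vector_space_field by (simp add: vector_space_pair_def vector_space_axioms)
  note As = finite_dim_sub_subspace[OF A]
  obtain D where D: "finite D" "D \<subseteq> A" "independent D" "span D = A" "card D = dim A"
    by (rule finite_dim_sub_basis_empty[OF A])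
  define \<phi> where "\<phi> b x = (if x \<in> A then representation D x b else 0)" for b x
  have \<phi>: "\<phi> b \<in> dual_space scale A" for b
    using D(3,4) subspace_add[OF As] subspace_scale[OF As]
    by (simp add: dual_space_def linear_on_sub_def \<phi>_def representation_add representation_scale)
  have eq: "\<psi> = (\<Sum>b\<in>D. fun_scale (*) (\<psi> b) (\<phi> b))" if \<psi>D: "\<psi> \<in> dual_space scale A" for \<psi>
  proof
    fix x
    have \<psi>: "linear_on_sub scale (*) A \<psi>" "x \<notin> A \<Longrightarrow> \<psi> x = 0"
      using \<psi>D by (auto simp: dual_space_def)
    show "\<psi> x = (\<Sum>b\<in>D. fun_scale (*) (\<psi> b) (\<phi> b)) x"
    proof (cases "x \<in> A")
      case True
      have D': "b \<in> A" if "b \<in> D" for b using that D(2) by blast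
      have "x = (\<Sum>b\<in>D. scale (representation D x b) b)"
        using sum_representation_eq[OF D(3) _ D(1) subset_refl] True D(4) by simp
      then have "\<psi> x = \<psi> (\<Sum>b\<in>D. scale (representation D x b) b)" by (rule arg_cong)
      also have "\<dots> = (\<Sum>b\<in>D. \<psi> (scale (representation D x b) b))"
        by (rule k.linear_on_sub_sum[OF As \<psi>(1)]) (rule subspace_scale[OF As D'])
      also have "\<dots> = (\<Sum>b\<in>D. \<psi> b * \<phi> b x)"
      proof (rule sum.cong[OF refl])
        fix b assume "b \<in> D"
        then show "\<psi> (scale (representation D x b) b) = \<psi> b * \<phi> b x"
          using linear_on_sub_scale[OF \<psi>(1) D'] True by (simp add: \<phi>_def mult.commute)
      qed
      finally show ?thesis by (simp add: sum_apply)
    qed (simp add: \<psi>(2) sum_apply \<phi>_def)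
  qed
  have "dual_space scale A = f.span (\<phi> ` D)"
  proof
    show "f.span (\<phi> ` D) \<subseteq> dual_space scale A"
      by (rule f.span_minimal[OF _ dual_space_subspace[OF As]]) (use \<phi> in blast)
    show "dual_space scale A \<subseteq> f.span (\<phi> ` D)"
    proof
      fix \<psi> assume \<psi>: "\<psi> \<in> dual_space scale A"
      have "(\<Sum>b\<in>D. fun_scale (*) (\<psi> b) (\<phi> b)) \<in> f.span (\<phi> ` D)"
        by (rule f.span_sum, rule f.span_scale, rule f.span_base, rule imageI)
      then show "\<psi> \<in> f.span (\<phi> ` D)" using eq[OF \<psi>] by simp
    qed
  qed
  then show ?thesis using f.finite_dim_subI[of "\<phi> ` D"] D(1) by simp
qed

context tilting_category
begin

declare vk.vs2.scale_scale [simp del]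

text \<open>The square of the radical. Its codimension in \<open>rad j l\<close> is the number of
  arrows between j and l in the quiver of End(T).\<close>

definition rad2 :: "'n \<Rightarrow> 'n \<Rightarrow> 'v set" where
  "rad2 j l = vs.span (\<Union>m. {g \<star> f |g f. f \<in> rad j m \<and> g \<in> rad m l})"

lemma rad2_subspace: "vs.subspace (rad2 j l)"
  by (simp add: rad2_def)

lemma rad2_I: "\<lbrakk>f \<in> rad j m; g \<in> rad m l\<rbrakk> \<Longrightarrow> g \<star> f \<in> rad2 j l"
  unfolding rad2_def by (rule vs.span_base) blast

lemma rad2_subset:
  assumes "vs.subspace A" "\<And>m f g. \<lbrakk>f \<in> rad j m; g \<in> rad m l\<rbrakk> \<Longrightarrow> g \<star> f \<in> A"
  shows "rad2 j l \<subseteq> A"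
  unfolding rad2_def by (rule vs.span_minimal) (use assms in auto)

lemma rad2_subset_rad: "rad2 j l \<subseteq> rad j l"
  by (rule rad2_subset[OF rad_subspace]) (rule rad_compo_left[OF _ rad_in_homs])

text \<open>A one-cocycle on the one-dimensional modules \<open>S\<^sub>i\<close>, \<open>S\<^sub>j\<close> amounts to a skew derivation of the algebra
  into the field, a coboundary to an inner one.\<close>

definition derivations :: "'n \<Rightarrow> 'n \<Rightarrow> ('v \<Rightarrow> 'k) set" where
  "derivations i j = {\<delta> \<in> dual_space (smul C) (homs C T T).
     \<forall>a\<in>homs C T T. \<forall>e\<in>homs C T T. \<delta> (a \<star> e) = \<delta> a * chiT j e + chiT i a * \<delta> e}"

definition inner_derivation :: "'n \<Rightarrow> 'n \<Rightarrow> 'k \<Rightarrow> 'v \<Rightarrow> 'k" where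
  "inner_derivation i j c a = (if a \<in> homs C T T then c * (chiT j a - chiT i a) else 0)"

interpretation f: vector_space "fun_scale (*) :: 'k \<Rightarrow> ('v \<Rightarrow> 'k) \<Rightarrow> 'v \<Rightarrow> 'k"
  by (rule vector_space_fun_scale[OF vector_space_field])

lemma derivations_iff:
  "\<delta> \<in> derivations i j \<longleftrightarrow> \<delta> \<in> dual_space (smul C) (homs C T T) \<and>
    (\<forall>a\<in>homs C T T. \<forall>e\<in>homs C T T. \<delta> (a \<star> e) = \<delta> a * chiT j e + chiT i a * \<delta> e)"
  by (simp add: derivations_def)

lemma derivationsD:
  assumes "\<delta> \<in> derivations i j"
  shows "\<delta> \<in> dual_space (smul C) (homs C T T)"
    and "\<lbrakk>a \<in> homs C T T; e \<in> homs C T T\<rbrakk> \<Longrightarrow> \<delta> (a \<star> e) = \<delta> a * chiT j e + chiT i a * \<delta> e"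
  using assms derivations_iff by blast+

lemma derivations_subspace: "f.subspace (derivations i j)"
proof (rule f.subspaceI)
  note sub = vs.dual_space_subspace[OF homs_subspace, of T T]
  show "0 \<in> derivations i j"
    unfolding derivations_iff using f.subspace_0[OF sub] by simp
  fix \<delta> assume \<delta>: "\<delta> \<in> derivations i j"
  note d = derivationsD[OF \<delta>]
  show "fun_scale (*) c \<delta> \<in> derivations i j" for c
    unfolding derivations_iff
  proof (intro conjI ballI)
    show "fun_scale (*) c \<delta> \<in> dual_space (smul C) (homs C T T)" by (rule f.subspace_scale[OF sub d(1)])
    fix a e assume ae: "a \<in> homs C T T" "e \<in> homs C T T"
    show "fun_scale (*) c \<delta> (a \<star> e) = fun_scale (*) c \<delta> a * chiT j e + chiT i a * fun_scale (*) c \<delta> e"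
      unfolding fun_scale_apply d(2)[OF ae] by (simp only: distrib_left distrib_right mult_ac add_ac)
  qed
  fix \<delta>' assume \<delta>': "\<delta>' \<in> derivations i j"
  note d' = derivationsD[OF \<delta>']
  show "\<delta> + \<delta>' \<in> derivations i j"
    unfolding derivations_iff
  proof (intro conjI ballI)
    show "\<delta> + \<delta>' \<in> dual_space (smul C) (homs C T T)" by (rule f.subspace_add[OF sub d(1) d'(1)])
    fix a e assume ae: "a \<in> homs C T T" "e \<in> homs C T T"
    show "(\<delta> + \<delta>') (a \<star> e) = (\<delta> + \<delta>') a * chiT j e + chiT i a * (\<delta> + \<delta>') e"
      unfolding plus_fun_apply d(2)[OF ae] d'(2)[OF ae] by (simp only: distrib_left distrib_right mult_ac add_ac)
  qed
qed

lemma derivations_fin: "finite_dim_sub (fun_scale (*)) (derivations i j)"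
  by (rule f.finite_dim_sub_subset[OF vs.dual_space_fin[OF fin_homs] derivations_subspace])
    (use derivationsD(1) in blast)

lemma inner_derivation: "inner_derivation i j c \<in> derivations i j"
  unfolding derivations_iff
proof (intro conjI ballI)
  show "inner_derivation i j c \<in> dual_space (smul C) (homs C T T)"
    unfolding dual_space_def linear_on_sub_def
    by (simp add: inner_derivation_def add_in_homs smul_in_homs linear_on_sub_add[OF chiT_linear]
        linear_on_sub_scale[OF chiT_linear] right_diff_distrib distrib_left)
  fix a e assume a: "a \<in> homs C T T" and e: "e \<in> homs C T T"
  show "inner_derivation i j c (a \<star> e) =
      inner_derivation i j c a * chiT j e + chiT i a * inner_derivation i j c e"
    by (simp only: inner_derivation_def a e compo_in_homs[OF a e] chiT_compo[OF a e] if_True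
        inner_derivation_identity)
qed

lemma chiT_ident: "chiT l (ident C T) = 1"
proof -
  have "entry l l (ident C T) = ident C (Ti l)"
    using ident_left[OF iota_in_homs] dsum_maps_prj_inj[OF T_dsum UNIV_I UNIV_I, of l l] by (simp add: entry_def)
  then show ?thesis using chi_ident[OF Ti_indecomposable] by (simp add: chiT_def)
qed

lemma chiT_rad:
  assumes "f \<in> rad q r"
  shows "chiT l (\<iota> r \<star> (f \<star> \<pi> q)) = 0"
  using entry_compo_iota_pi[OF rad_in_homs[OF assms], of l l] assms chi_zero[OF Ti_indecomposable]
  by (auto simp: chiT_def rad_def)

context
  fixes i j :: 'n
begin

text \<open>Evaluation of a derivation on the block of End(T) from T_j to T_i. The two radicals are
  the inner derivations and \<open>rad2\<close>, which makes Ext^1(S_i, S_j) dual to rad modulo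
  rad2.\<close>

abbreviation pairing :: "('v \<Rightarrow> 'k) \<Rightarrow> 'v \<Rightarrow> 'k" where
  "pairing \<delta> f \<equiv> \<delta> (\<iota> i \<star> (f \<star> \<pi> j))"

lemma iota_compo_pi_linear:
  "linear_on_sub (smul C) (smul C) (homs C (Ti j) (Ti i)) (\<lambda>f. \<iota> i \<star> (f \<star> \<pi> j))"
  unfolding linear_on_sub_def
  using compo_add_left[OF pi_in_homs] compo_add_right[OF iota_in_homs] compo_smul_left[OF pi_in_homs]
    compo_smul_right[OF iota_in_homs] compo_in_homs[OF _ pi_in_homs] by metis

lemma pairing_linear:
  assumes "\<delta> \<in> derivations i j"
  shows "linear_on_sub (smul C) (*) (rad j i) (pairing \<delta>)"
proof -
  have "linear_on_sub (smul C) (*) (homs C T T) \<delta>"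
    using assms by (simp add: derivations_def dual_space_def)
  then have "linear_on_sub (smul C) (*) (homs C (Ti j) (Ti i)) (pairing \<delta>)"
    using iota_compo_pi_linear iota_compo_pi_in_homs unfolding linear_on_sub_def by simp
  then show ?thesis by (rule linear_on_sub_subset[OF _ rad_subset])
qed

text \<open>Expand an endomorphism by the idempotents \<open>E l\<close> on both sides. Outside the
  block from T_j to T_i the Leibniz rule reduces each contribution to a residue times a value of
  \<open>\<delta>\<close> on some \<open>E l\<close>, and the block itself contributes nothing. So
  \<open>\<delta>\<close> is a combination of two characters, and vanishing at the identity makes
  the coefficients opposite.\<close>

lemma pairing_left_radical:
  "{\<delta> \<in> derivations i j. \<forall>f\<in>rad j i. pairing \<delta> f = 0} = range (inner_derivation i j)"
proof (intro equalityI subsetI)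
  fix \<delta> assume "\<delta> \<in> range (inner_derivation i j)"
  then obtain c where c: "\<delta> = inner_derivation i j c" by blast
  have "pairing \<delta> f = 0" if "f \<in> rad j i" for f
    using chiT_rad[OF that] by (simp add: c inner_derivation_def)
  then show "\<delta> \<in> {\<delta> \<in> derivations i j. \<forall>f\<in>rad j i. pairing \<delta> f = 0}" using c inner_derivation by simp
next
  fix \<delta> assume "\<delta> \<in> {\<delta> \<in> derivations i j. \<forall>f\<in>rad j i. pairing \<delta> f = 0}"
  then have \<delta>: "\<delta> \<in> derivations i j" and rad0: "\<And>f. f \<in> rad j i \<Longrightarrow> pairing \<delta> f = 0" by auto
  have lin: "linear_on_sub (smul C) (*) (homs C T T) \<delta>"
    and der: "\<And>a e. \<lbrakk>a \<in> homs C T T; e \<in> homs C T T\<rbrakk> \<Longrightarrow> \<delta> (a \<star> e) = \<delta> a * chiT j e + chiT i a * \<delta> e"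
    and out: "\<And>a. a \<notin> homs C T T \<Longrightarrow> \<delta> a = 0"
    using \<delta> by (auto simp: derivations_def dual_space_def)
  define E where "E l = \<iota> l \<star> \<pi> l" for l
  have E: "E l \<in> homs C T T" for l
    unfolding E_def using compo_in_homs[OF iota_in_homs pi_in_homs] .
  have E_alt: "E l = \<iota> l \<star> (ident C (Ti l) \<star> \<pi> l)" for l
    by (simp add: E_def ident_left[OF pi_in_homs])
  have chiE: "chiT l (E m) = (if l = m then 1 else 0)" for l m
    using entry_compo_iota_pi[OF ident_in_homs, of l l m] chi_ident[OF Ti_indecomposable]
      chi_zero[OF Ti_indecomposable] by (simp add: chiT_def E_alt)
  have EE: "E l \<star> E l = E l" for l
    using compo_assoc[OF iota_in_homs pi_in_homs E, of l l] prj_compo_inj[OF T_dsum UNIV_I UNIV_I pi_in_homs, of l l]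
    by (simp add: E_def)
  have sumE: "(\<Sum>l\<in>UNIV. E l) = ident C T" using T_dsum by (simp add: dsum_maps_def E_def)
  \<comment> \<open>For i = j a map in the block also has a scalar part, on which
    \<open>\<delta>\<close> vanishes because \<open>E j\<close> is an idempotent of residue
    1.\<close>
  have homs0: "pairing \<delta> f = 0" if f: "f \<in> homs C (Ti j) (Ti i)" for f
  proof (cases "i = j")
    case True
    then obtain g where g: "g \<in> rad j j" "f = smul C (chi (Ti j) f) (ident C (Ti j)) + g"
      using chi_decomp_Ti f by metis
    have "\<delta> (E j) = \<delta> (E j) + \<delta> (E j)" using der[OF E E, of j j] EE chiE True by simp
    then have "\<delta> (E j) = 0" by (simp only: add_cancel_right_right)
    moreover have "\<iota> i \<star> (f \<star> \<pi> j) = smul C (chi (Ti j) f) (E j) + \<iota> i \<star> (g \<star> \<pi> j)"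
    proof -
      note idh = ident_in_homs[of "Ti j"] and gh = rad_in_homs[OF g(1)]
      have "\<iota> j \<star> ((smul C (chi (Ti j) f) (ident C (Ti j)) + g) \<star> \<pi> j) =
          smul C (chi (Ti j) f) (\<iota> j \<star> (ident C (Ti j) \<star> \<pi> j)) + \<iota> j \<star> (g \<star> \<pi> j)"
        using compo_add_left[OF pi_in_homs smul_in_homs[OF idh] gh] compo_smul_left[OF pi_in_homs idh]
          compo_add_right[OF iota_in_homs smul_in_homs[OF compo_in_homs[OF idh pi_in_homs]] compo_in_homs[OF gh pi_in_homs]]
          compo_smul_right[OF iota_in_homs compo_in_homs[OF idh pi_in_homs]] by simp
      then show ?thesis using g(2) True by (simp add: E_alt)
    qed
    moreover have "\<delta> (\<iota> i \<star> (g \<star> \<pi> j)) = 0" using rad0 g(1) True by simp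
    ultimately show ?thesis
      using linear_on_sub_add[OF lin smul_in_homs[OF E] iota_compo_pi_in_homs[OF rad_in_homs]] g(1) True
        linear_on_sub_scale[OF lin E] by simp
  next
    case False
    then show ?thesis using rad0 f by (simp add: rad_def)
  qed
  \<comment> \<open>The contributions of the rows other than i; \<open>\<tau>\<close> collects those
    of the columns other than j.\<close>
  define \<sigma> where "\<sigma> = (\<Sum>l\<in>UNIV - {i}. \<delta> (E l))"
  define \<tau> where "\<tau> = (\<Sum>m\<in>UNIV - {j}. \<delta> (E m))"
  have val: "\<delta> x = chiT j x * \<sigma> + chiT i x * \<tau>" if x: "x \<in> homs C T T" for x
  proof -
    have Ex: "E l \<star> x \<in> homs C T T" for l using compo_in_homs[OF E x] .
    have ExE: "(E l \<star> x) \<star> E m \<in> homs C T T" for l m using compo_in_homs[OF Ex E] .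
    have "x = (\<Sum>l\<in>UNIV. E l \<star> x)"
      using compo_sum_left[where I = UNIV and g = E, OF x E] sumE ident_left[OF x] by simp
    then have "\<delta> x = (\<Sum>l\<in>UNIV. \<delta> (E l \<star> x))"
      using vk.linear_on_sub_sum[OF homs_subspace lin, of UNIV "\<lambda>l. E l \<star> x"] Ex by simp
    also have "\<dots> = \<delta> (E i \<star> x) + (\<Sum>l\<in>UNIV - {i}. \<delta> (E l \<star> x))" by (simp add: sum.remove[of UNIV i])
    also have "(\<Sum>l\<in>UNIV - {i}. \<delta> (E l \<star> x)) = (\<Sum>l\<in>UNIV - {i}. \<delta> (E l) * chiT j x)"
      by (rule sum.cong[OF refl]) (use der[OF E x] chiE in auto)
    also have "\<dots> = chiT j x * \<sigma>" by (simp add: \<sigma>_def sum_distrib_left mult.commute)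
    also have "\<delta> (E i \<star> x) = (\<Sum>m\<in>UNIV. \<delta> ((E i \<star> x) \<star> E m))"
    proof -
      have "E i \<star> x = (\<Sum>m\<in>UNIV. (E i \<star> x) \<star> E m)"
        using compo_sum_right[where I = UNIV and f = E, OF Ex E] sumE ident_right[OF Ex] by simp
      then show ?thesis
        using vk.linear_on_sub_sum[OF homs_subspace lin, of UNIV "\<lambda>m. (E i \<star> x) \<star> E m"] ExE by simp
    qed
    also have "\<dots> = \<delta> ((E i \<star> x) \<star> E j) + (\<Sum>m\<in>UNIV - {j}. \<delta> ((E i \<star> x) \<star> E m))"
      by (simp add: sum.remove[of UNIV j])
    also have "(\<Sum>m\<in>UNIV - {j}. \<delta> ((E i \<star> x) \<star> E m)) = (\<Sum>m\<in>UNIV - {j}. chiT i x * \<delta> (E m))"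
      by (rule sum.cong[OF refl]) (use der[OF Ex E] chiE chiT_compo[OF E x] in auto)
    also have "\<dots> = chiT i x * \<tau>" by (simp add: \<tau>_def sum_distrib_left)
    also have "(E i \<star> x) \<star> E j = \<iota> i \<star> (entry i j x \<star> \<pi> j)"
    proof -
      have px: "\<pi> i \<star> x \<in> homs C T (Ti i)" using compo_in_homs[OF pi_in_homs x] .
      have "(E i \<star> x) \<star> E j = \<iota> i \<star> ((\<pi> i \<star> x) \<star> E j)"
        using compo_assoc[OF iota_in_homs pi_in_homs x] compo_assoc[OF iota_in_homs px E] by (simp add: E_def)
      also have "(\<pi> i \<star> x) \<star> E j = entry i j x \<star> \<pi> j"
        using compo_assoc[OF px iota_in_homs pi_in_homs] compo_assoc[OF pi_in_homs x iota_in_homs]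
        by (simp add: E_def entry_def)
      finally show ?thesis .
    qed
    finally show ?thesis using homs0[OF entry_in_homs[OF x]] by simp
  qed
  have id: "ident C T \<in> homs C T T" by (rule ident_in_homs)
  have "\<delta> (ident C T) = \<delta> (ident C T) + \<delta> (ident C T)"
    using der[OF id id] ident_left[OF id] chiT_ident by simp
  then have "\<sigma> + \<tau> = 0" using val[OF id] chiT_ident by (simp add: add.commute)
  then have "\<tau> = - \<sigma>" by (simp add: eq_neg_iff_add_eq_0 add.commute)
  then have "\<delta> a = inner_derivation i j \<sigma> a" for a
    using val[of a] out[of a] by (simp add: inner_derivation_def distrib_left distrib_right left_diff_distrib right_diff_distrib mult_ac)
  then show "\<delta> \<in> range (inner_derivation i j)" by blast
qed

text \<open>A product of two radical maps is killed by the Leibniz rule, both characters being zero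
  on radical elements. If conversely \<open>f\<close> is outside \<open>rad2\<close>, a functional
  separating it from \<open>rad2\<close> induces a derivation with nonzero value at
  \<open>f\<close>.\<close>

lemma pairing_right_radical:
  "{f \<in> rad j i. \<forall>\<delta>\<in>derivations i j. pairing \<delta> f = 0} = rad2 j i"
proof (intro equalityI)
  show "rad2 j i \<subseteq> {f \<in> rad j i. \<forall>\<delta>\<in>derivations i j. pairing \<delta> f = 0}"
  proof (rule rad2_subset)
    show "vs.subspace {f \<in> rad j i. \<forall>\<delta>\<in>derivations i j. pairing \<delta> f = 0}"
    proof (rule vs.subspaceI)
      show "0 \<in> {f \<in> rad j i. \<forall>\<delta>\<in>derivations i j. pairing \<delta> f = 0}"
        using vk.linear_on_sub_0[OF rad_subspace pairing_linear] vs.subspace_0[OF rad_subspace] by simp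
    qed (auto simp: linear_on_sub_add[OF pairing_linear] linear_on_sub_scale[OF pairing_linear]
        vs.subspace_add[OF rad_subspace] vs.subspace_scale[OF rad_subspace])
  next
    fix m f g assume f: "f \<in> rad j m" and g: "g \<in> rad m i"
    note fh = rad_in_homs[OF f] and gh = rad_in_homs[OF g]
    have fp: "f \<star> \<pi> j \<in> homs C T (Ti m)" using compo_in_homs[OF fh pi_in_homs] .
    have "\<iota> i \<star> ((g \<star> f) \<star> \<pi> j) = (\<iota> i \<star> (g \<star> \<pi> m)) \<star> (\<iota> m \<star> (f \<star> \<pi> j))"
      using compo_assoc[OF gh fh pi_in_homs] compo_assoc[OF iota_in_homs compo_in_homs[OF gh pi_in_homs]
          compo_in_homs[OF iota_in_homs fp]] compo_assoc[OF gh pi_in_homs compo_in_homs[OF iota_in_homs fp]]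
        prj_compo_inj[OF T_dsum UNIV_I UNIV_I fp, of m] by simp
    then have "pairing \<delta> (g \<star> f) = 0" if "\<delta> \<in> derivations i j" for \<delta>
      using that iota_compo_pi_in_homs[OF fh] iota_compo_pi_in_homs[OF gh] chiT_rad[OF f] chiT_rad[OF g]
      by (simp add: derivations_def)
    then show "g \<star> f \<in> {f \<in> rad j i. \<forall>\<delta>\<in>derivations i j. pairing \<delta> f = 0}"
      using rad_compo_left[OF f gh] by simp
  qed
  show "{f \<in> rad j i. \<forall>\<delta>\<in>derivations i j. pairing \<delta> f = 0} \<subseteq> rad2 j i"
  proof (rule subsetI, rule ccontr)
    fix f assume f: "f \<in> {f \<in> rad j i. \<forall>\<delta>\<in>derivations i j. pairing \<delta> f = 0}" and "f \<notin> rad2 j i"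
    then have fr: "f \<in> rad j i" by simp
    obtain \<phi> where \<phi>: "linear_on_sub (smul C) (*) (rad j i) \<phi>" "\<And>u. u \<in> rad2 j i \<Longrightarrow> \<phi> u = 0" "\<phi> f = 1"
      by (rule vs.separating_functional[OF rad_subspace rad2_subspace rad2_subset_rad fr \<open>f \<notin> rad2 j i\<close>])
        (rule that)
    \<comment> \<open>The radical part of a matrix entry. In the block from T_j to T_i it satisfies
      a Leibniz rule modulo \<open>rad2\<close>, which is why composing it with
      \<open>\<phi>\<close> yields a derivation.\<close>
    define \<rho> where "\<rho> l m y = entry l m y - (if l = m then smul C (chiT l y) (ident C (Ti l)) else 0)"
      for l m y
    have \<rho>: "\<rho> l m y \<in> rad m l" if "y \<in> homs C T T" for l m y
      using entry_in_homs[OF that, of l m] chi_decomp[OF Ti_indecomposable entry_in_homs[OF that]]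
        diff_in_homs[OF entry_in_homs[OF that] smul_in_homs[OF ident_in_homs]]
      by (auto simp: \<rho>_def rad_def chiT_def)
    have \<rho>_add: "\<rho> l m (y + z) = \<rho> l m y + \<rho> l m z" if "y \<in> homs C T T" "z \<in> homs C T T" for l m y z
      using linear_on_sub_add[OF entry_linear that] linear_on_sub_add[OF chiT_linear that]
      by (simp add: \<rho>_def vs.scale_left_distrib)
    have \<rho>_scale: "\<rho> l m (smul C c y) = smul C c (\<rho> l m y)" if "y \<in> homs C T T" for l m c y
      using linear_on_sub_scale[OF entry_linear that] linear_on_sub_scale[OF chiT_linear that]
      by (simp add: \<rho>_def vs.scale_right_diff_distrib)
    have \<rho>_compo: "\<rho> i j (a \<star> e) =
        (\<Sum>q\<in>UNIV. \<rho> i q a \<star> \<rho> q j e) + (smul C (chiT j e) (\<rho> i j a) + smul C (chiT i a) (\<rho> i j e))"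
      if a: "a \<in> homs C T T" and e: "e \<in> homs C T T" for a e
    proof -
      \<comment> \<open>Both factors are split into radical and scalar part. The product of the
        radical parts lies in \<open>rad2\<close>; a scalar part occurs only for q = i or q =
        j.\<close>
      have "entry i q a \<star> entry q j e = \<rho> i q a \<star> \<rho> q j e
          + (if q = j then smul C (chiT j e) (\<rho> i j a) else 0)
          + (if q = i then smul C (chiT i a) (\<rho> i j e) else 0)
          + (if q = i then (if i = j then smul C (chiT i a * chiT j e) (ident C (Ti i)) else 0) else 0)" for q
      proof -
        define A where "A = (if i = q then smul C (chiT i a) (ident C (Ti i)) else 0)"
        define B where "B = (if q = j then smul C (chiT q e) (ident C (Ti q)) else 0)"
        have A: "A \<in> homs C (Ti q) (Ti i)" using smul_in_homs[OF ident_in_homs] by (auto simp: A_def)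
        have B: "B \<in> homs C (Ti j) (Ti q)" using smul_in_homs[OF ident_in_homs] by (auto simp: B_def)
        note ra = rad_in_homs[OF \<rho>[OF a, of i q]] and re = rad_in_homs[OF \<rho>[OF e, of q j]]
        have "entry i q a = \<rho> i q a + A" "entry q j e = \<rho> q j e + B"
          by (simp_all add: \<rho>_def A_def B_def)
        then have "entry i q a \<star> entry q j e = \<rho> i q a \<star> \<rho> q j e + \<rho> i q a \<star> B + A \<star> \<rho> q j e + A \<star> B"
          using compo_add_left[OF add_in_homs[OF re B] ra A] compo_add_right[OF ra re B] compo_add_right[OF A re B]
          by simp
        moreover have "\<rho> i q a \<star> B = (if q = j then smul C (chiT j e) (\<rho> i j a) else 0)"
          using compo_smul_right[OF ra ident_in_homs] ident_right[OF ra] compo_zero_right[OF ra] by (auto simp: B_def)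
        moreover have "A \<star> \<rho> q j e = (if q = i then smul C (chiT i a) (\<rho> i j e) else 0)"
          using compo_smul_left[OF re ident_in_homs] ident_left[OF re] compo_zero_left[OF re] by (auto simp: A_def)
        moreover have "A \<star> B = (if q = i \<and> i = j then smul C (chiT i a * chiT j e) (ident C (Ti i)) else 0)"
        proof (cases "q = i \<and> i = j")
          case True
          then have A': "A = smul C (chiT i a) (ident C (Ti q))"
            and B': "B = smul C (chiT j e) (ident C (Ti i))" by (auto simp: A_def B_def)
          have "A \<star> B = smul C (chiT i a) (ident C (Ti q) \<star> B)"
            unfolding A' by (rule compo_smul_left[OF B ident_in_homs])
          also have "\<dots> = smul C (chiT i a * chiT j e) (ident C (Ti i))"
            by (subst ident_left[OF B], subst B', rule vs.scale_scale)
          finally show ?thesis unfolding if_P[OF True] .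
        next
          case False
          then have "A = 0 \<or> B = 0" by (auto simp: A_def B_def)
          then have "A \<star> B = 0" using compo_zero_left[OF B] compo_zero_right[OF A] by metis
          then show ?thesis unfolding if_not_P[OF False] .
        qed
        ultimately show ?thesis by simp
      qed
      note entries = this
      have "entry i j (a \<star> e) = (\<Sum>q\<in>UNIV. \<rho> i q a \<star> \<rho> q j e) + smul C (chiT j e) (\<rho> i j a)
          + smul C (chiT i a) (\<rho> i j e) + (if i = j then smul C (chiT i a * chiT j e) (ident C (Ti i)) else 0)"
        unfolding entry_compo[OF that] entries
        by (simp only: sum.distrib sum.delta[OF finite[of UNIV]] UNIV_I if_True)
      then show ?thesis by (simp add: \<rho>_def chiT_compo[OF that])
    qed
    define \<delta> where "\<delta> y = (if y \<in> homs C T T then \<phi> (\<rho> i j y) else 0)" for y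
    have "\<delta> \<in> derivations i j"
      unfolding derivations_def
    proof (intro CollectI conjI ballI)
      show "\<delta> \<in> dual_space (smul C) (homs C T T)"
        using \<rho>_add \<rho>_scale linear_on_sub_add[OF \<phi>(1) \<rho> \<rho>] linear_on_sub_scale[OF \<phi>(1) \<rho>]
        by (auto simp: dual_space_def linear_on_sub_def \<delta>_def add_in_homs smul_in_homs)
      fix a e assume a: "a \<in> homs C T T" and e: "e \<in> homs C T T"
      have sum2: "(\<Sum>q\<in>UNIV. \<rho> i q a \<star> \<rho> q j e) \<in> rad2 j i"
        by (rule vs.subspace_sum[OF rad2_subspace]) (rule rad2_I[OF \<rho>[OF e] \<rho>[OF a]])
      note s1 = vs.subspace_scale[OF rad_subspace \<rho>[OF a, of i j], of "chiT j e"]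
        and s2 = vs.subspace_scale[OF rad_subspace \<rho>[OF e, of i j], of "chiT i a"]
      have "\<phi> (\<rho> i j (a \<star> e)) = \<phi> (\<rho> i j a) * chiT j e + chiT i a * \<phi> (\<rho> i j e)"
        unfolding \<rho>_compo[OF a e]
        using linear_on_sub_add[OF \<phi>(1) subsetD[OF rad2_subset_rad sum2] vs.subspace_add[OF rad_subspace s1 s2]]
          linear_on_sub_add[OF \<phi>(1) s1 s2] linear_on_sub_scale[OF \<phi>(1) \<rho>[OF a]]
          linear_on_sub_scale[OF \<phi>(1) \<rho>[OF e]] \<phi>(2)[OF sum2] by (simp add: mult.commute)
      then show "\<delta> (a \<star> e) = \<delta> a * chiT j e + chiT i a * \<delta> e"
        using a e compo_in_homs[OF a e] by (simp add: \<delta>_def)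
    qed
    then have "pairing \<delta> f = 0" using f by blast
    moreover have "\<rho> i j (\<iota> i \<star> (f \<star> \<pi> j)) = f"
      using entry_compo_iota_pi[OF rad_in_homs[OF fr], of i j] chiT_rad[OF fr, of i]
      by (cases "i = j") (simp_all add: \<rho>_def)
    ultimately show False
      using \<phi>(3) iota_compo_pi_in_homs[OF rad_in_homs[OF fr]] by (simp add: \<delta>_def)
  qed
qed

lemma dim_derivations:
  "int (f.dim (derivations i j)) - int (f.dim (range (inner_derivation i j))) =
    int (vs.dim (rad j i)) - int (vs.dim (rad2 j i))"
proof -
  interpret q: vector_space_pair "fun_scale (*) :: 'k \<Rightarrow> ('v \<Rightarrow> 'k) \<Rightarrow> 'v \<Rightarrow> 'k" "smul C" by unfold_locales
  have "vs.dim (rad j i) + f.dim {\<delta> \<in> derivations i j. \<forall>f\<in>rad j i. pairing \<delta> f = 0} =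
      vs.dim {f \<in> rad j i. \<forall>\<delta>\<in>derivations i j. pairing \<delta> f = 0} + f.dim (derivations i j)"
    by (rule q.pairing_dim[OF derivations_fin rad_fin _ pairing_linear]) (simp_all add: linear_on_sub_def)
  then show ?thesis unfolding pairing_left_radical pairing_right_radical by linarith
qed

end

end

context tilting_simples
begin

section \<open>Cocycles and homomorphisms between simple modules\<close>

definition coef :: "'n \<Rightarrow> 'v \<Rightarrow> 'k" where
  "coef j x = (THE c. x = smul C c (gen j))"

lemma coef_gen: "coef j (smul C c (gen j)) = c"
  unfolding coef_def by (rule the_equality) (use gen_nonzero in auto)

lemma coef_eq: "x \<in> mcar (S j) \<Longrightarrow> smul C (coef j x) (gen j) = x"
  using coef_gen by (auto simp: mcar_S)

lemma coef_linear: "linear_on_sub (smul C) (*) (mcar (S j)) (coef j)"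
  unfolding linear_on_sub_def mcar_S
  by (auto simp: coef_gen simp flip: vs.scale_left_distrib)

lemma S_add: "\<lbrakk>x \<in> mcar (S j); y \<in> mcar (S j)\<rbrakk> \<Longrightarrow> x + y \<in> mcar (S j)"
  using gen_in_S by (auto simp: mcar_S simp flip: vs.scale_left_distrib)

lemma S_scale: "x \<in> mcar (S j) \<Longrightarrow> smul C c x \<in> mcar (S j)"
  by (auto simp: mcar_S)

lemma gen_in: "gen j \<in> mcar (S j)"
  using gen_in_S[of 1 j] by simp

definition cocycle_of :: "'n \<Rightarrow> 'n \<Rightarrow> ('v \<Rightarrow> 'k) \<Rightarrow> 'v \<Rightarrow> 'v \<Rightarrow> 'v" where
  "cocycle_of i j \<delta> x a =
    (if x \<in> mcar (S i) \<and> a \<in> homs C T T then smul C (coef i x * \<delta> a) (gen j) else 0)"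

lemma cocycle_of_in:
  "\<lbrakk>x \<in> mcar (S i); a \<in> homs C T T\<rbrakk> \<Longrightarrow> cocycle_of i j \<delta> x a = smul C (coef i x * \<delta> a) (gen j)"
  by (simp add: cocycle_of_def)

text \<open>On one-dimensional modules a cocycle is determined by its values at the generator of
  \<open>S i\<close>; their coordinate in \<open>S j\<close> is the derivation.\<close>

lemma ext_cocycles_eq: "ext_cocycles C T (S i) (S j) = cocycle_of i j ` derivations i j"
proof (intro equalityI subsetI)
  fix c assume "c \<in> cocycle_of i j ` derivations i j"
  then obtain \<delta> where \<delta>: "\<delta> \<in> derivations i j" and c: "c = cocycle_of i j \<delta>" by blast
  have lin: "linear_on_sub (smul C) (*) (homs C T T) \<delta>"
    and der: "\<And>a e. \<lbrakk>a \<in> homs C T T; e \<in> homs C T T\<rbrakk> \<Longrightarrow> \<delta> (a \<star> e) = \<delta> a * chiT j e + chiT i a * \<delta> e"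
    using \<delta> by (auto simp: derivations_def dual_space_def)
  show "c \<in> ext_cocycles C T (S i) (S j)"
    unfolding ext_cocycles_def
  proof (intro CollectI conjI ballI allI impI)
    fix x a assume "x \<in> mcar (S i)" "a \<in> homs C T T"
    then show "c x a \<in> mcar (S j)" by (simp add: c cocycle_of_in gen_in_S)
  next
    fix a assume a: "a \<in> homs C T T"
    show "linear_on_sub (smul C) (smul C) (mcar (S i)) (\<lambda>x. c x a)"
      unfolding linear_on_sub_def
      by (simp add: c cocycle_of_in a S_add S_scale linear_on_sub_add[OF coef_linear]
          linear_on_sub_scale[OF coef_linear] algebra_simps vs.scale_left_distrib)
  next
    fix x assume x: "x \<in> mcar (S i)"
    show "linear_on_sub (smul C) (smul C) (homs C T T) (c x)"
      unfolding linear_on_sub_def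
      by (simp add: c cocycle_of_in x add_in_homs smul_in_homs linear_on_sub_add[OF lin]
          linear_on_sub_scale[OF lin] algebra_simps vs.scale_left_distrib)
  next
    fix x a e assume x: "x \<in> mcar (S i)" and a: "a \<in> homs C T T" and e: "e \<in> homs C T T"
    show "c x (a \<star> e) = mact (S j) (c x a) e + c (mact (S i) x a) e"
      by (simp add: c cocycle_of_in x a e compo_in_homs[OF a e] mact_S S_scale gen_in_S der
          linear_on_sub_scale[OF coef_linear] algebra_simps flip: vs.scale_left_distrib)
  next
    fix x a assume "x \<notin> mcar (S i) \<or> a \<notin> homs C T T"
    then show "c x a = 0" by (auto simp: c cocycle_of_def)
  qed
next
  fix c assume c: "c \<in> ext_cocycles C T (S i) (S j)"
  have in_S: "\<And>x a. \<lbrakk>x \<in> mcar (S i); a \<in> homs C T T\<rbrakk> \<Longrightarrow> c x a \<in> mcar (S j)"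
    and lin1: "\<And>a. a \<in> homs C T T \<Longrightarrow> linear_on_sub (smul C) (smul C) (mcar (S i)) (\<lambda>x. c x a)"
    and lin2: "\<And>x. x \<in> mcar (S i) \<Longrightarrow> linear_on_sub (smul C) (smul C) (homs C T T) (c x)"
    and coc: "\<And>x a e. \<lbrakk>x \<in> mcar (S i); a \<in> homs C T T; e \<in> homs C T T\<rbrakk> \<Longrightarrow>
      c x (a \<star> e) = mact (S j) (c x a) e + c (mact (S i) x a) e"
    and out: "\<And>x a. x \<notin> mcar (S i) \<or> a \<notin> homs C T T \<Longrightarrow> c x a = 0"
    using c unfolding ext_cocycles_def by blast+
  define \<delta> where "\<delta> a = (if a \<in> homs C T T then coef j (c (gen i) a) else 0)" for a
  have "\<delta> \<in> derivations i j"
    unfolding derivations_def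
  proof (intro CollectI conjI ballI)
    show "\<delta> \<in> dual_space (smul C) (homs C T T)"
      by (simp add: dual_space_def linear_on_sub_def \<delta>_def add_in_homs smul_in_homs
          linear_on_sub_add[OF lin2[OF gen_in]] linear_on_sub_scale[OF lin2[OF gen_in]]
          linear_on_sub_add[OF coef_linear] linear_on_sub_scale[OF coef_linear] in_S gen_in)
    fix a e assume a: "a \<in> homs C T T" and e: "e \<in> homs C T T"
    have "c (gen i) (a \<star> e) = smul C (chiT j e) (c (gen i) a) + smul C (chiT i a) (c (gen i) e)"
      using coc[OF gen_in a e] mact_S[OF e in_S[OF gen_in a]] mact_S[OF a gen_in]
        linear_on_sub_scale[OF lin1[OF e] gen_in] by simp
    then show "\<delta> (a \<star> e) = \<delta> a * chiT j e + chiT i a * \<delta> e"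
      using a e compo_in_homs[OF a e] in_S[OF gen_in a] in_S[OF gen_in e]
      by (simp add: \<delta>_def linear_on_sub_add[OF coef_linear] linear_on_sub_scale[OF coef_linear] S_scale
          mult.commute)
  qed
  moreover have "c x a = cocycle_of i j \<delta> x a" for x a
  proof (cases "x \<in> mcar (S i) \<and> a \<in> homs C T T")
    case True
    then have "c x a = c (smul C (coef i x) (gen i)) a" by (simp add: coef_eq)
    also have "\<dots> = smul C (coef i x) (c (gen i) a)"
      using linear_on_sub_scale[OF lin1 gen_in] True by blast
    also have "\<dots> = smul C (coef i x) (smul C (coef j (c (gen i) a)) (gen j))"
      using coef_eq in_S[OF gen_in] True by simp
    finally show ?thesis using True by (simp add: cocycle_of_in \<delta>_def)
  qed (auto simp: cocycle_of_def out)
  then have "c = cocycle_of i j \<delta>" by blast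
  ultimately show "c \<in> cocycle_of i j ` derivations i j" by blast
qed

text \<open>A linear map between the lines \<open>S i\<close> and \<open>S j\<close> is a scalar,
  and this scalar is the parameter of the inner derivation.\<close>

lemma ext_coboundaries_eq:
  "ext_coboundaries C T (S i) (S j) = cocycle_of i j ` range (inner_derivation i j)"
proof (intro equalityI subsetI)
  fix c assume "c \<in> ext_coboundaries C T (S i) (S j)"
  then obtain h where lin: "linear_on_sub (smul C) (smul C) (mcar (S i)) h" and im: "h ` mcar (S i) \<subseteq> mcar (S j)"
    and c: "c = (\<lambda>x a. if x \<in> mcar (S i) \<and> a \<in> homs C T T then mact (S j) (h x) a - h (mact (S i) x a) else 0)"
    by (auto simp: ext_coboundaries_def)
  have hg: "h (gen i) \<in> mcar (S j)" using im gen_in by blast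
  have h: "h x = smul C (coef i x * coef j (h (gen i))) (gen j)" if "x \<in> mcar (S i)" for x
    using linear_on_sub_scale[OF lin gen_in, of "coef i x"] coef_eq[OF that] coef_eq[OF hg] by (simp flip: vs.scale_scale)
  have "c x a = cocycle_of i j (inner_derivation i j (coef j (h (gen i)))) x a" for x a
  proof (cases "x \<in> mcar (S i) \<and> a \<in> homs C T T")
    case True
    then have x: "x \<in> mcar (S i)" and a: "a \<in> homs C T T" by auto
    have hx: "h x \<in> mcar (S j)" using im x by blast
    have "c x a = smul C (chiT j a) (h x) - smul C (chiT i a) (h x)"
      using mact_S[OF a hx] mact_S[OF a x] linear_on_sub_scale[OF lin x] x a by (simp add: c)
    then show ?thesis
      using x a h[OF x] by (simp add: cocycle_of_in inner_derivation_def algebra_simps vs.scale_left_diff_distrib)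
  qed (auto simp: c cocycle_of_def)
  then have "c = cocycle_of i j (inner_derivation i j (coef j (h (gen i))))" by blast
  then show "c \<in> cocycle_of i j ` range (inner_derivation i j)" by blast
next
  fix c assume "c \<in> cocycle_of i j ` range (inner_derivation i j)"
  then obtain \<mu> where c: "c = cocycle_of i j (inner_derivation i j \<mu>)" by blast
  define h where "h x = smul C (coef i x * \<mu>) (gen j)" for x
  have lin: "linear_on_sub (smul C) (smul C) (mcar (S i)) h"
    by (simp add: linear_on_sub_def h_def linear_on_sub_add[OF coef_linear] linear_on_sub_scale[OF coef_linear]
        algebra_simps vs.scale_left_distrib)
  have "c x a = (if x \<in> mcar (S i) \<and> a \<in> homs C T T then mact (S j) (h x) a - h (mact (S i) x a) else 0)" for x a
  proof (cases "x \<in> mcar (S i) \<and> a \<in> homs C T T")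
    case True
    then have x: "x \<in> mcar (S i)" and a: "a \<in> homs C T T" by auto
    have hx: "h x \<in> mcar (S j)" using gen_in_S by (simp add: h_def)
    show ?thesis
      using mact_S[OF a hx] mact_S[OF a x] linear_on_sub_scale[OF lin x] x a
      by (simp add: c cocycle_of_in inner_derivation_def h_def algebra_simps vs.scale_left_diff_distrib)
  qed (auto simp: c cocycle_of_def)
  then have "c = (\<lambda>x a. if x \<in> mcar (S i) \<and> a \<in> homs C T T then mact (S j) (h x) a - h (mact (S i) x a) else 0)"
    by blast
  moreover have "h ` mcar (S i) \<subseteq> mcar (S j)" using gen_in_S by (auto simp: h_def)
  ultimately show "c \<in> ext_coboundaries C T (S i) (S j)" using lin unfolding ext_coboundaries_def by blast
qed

text \<open>The map \<open>cocycle_of i j\<close> is linear and injective on derivations, so the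
  dimensions of cocycles and coboundaries are those compared in
  \<open>dim_derivations\<close>.\<close>

lemma dim_ext1_simples: "dim_ext1 C T (S i) (S j) = int (vs.dim (rad j i)) - int (vs.dim (rad2 j i))"
proof -
  interpret f: vector_space "fun_scale (*) :: 'k \<Rightarrow> ('v \<Rightarrow> 'k) \<Rightarrow> 'v \<Rightarrow> 'k"
    by (rule vector_space_fun_scale[OF vector_space_field])
  interpret g: vector_space "fun_scale (fun_scale (smul C)) :: 'k \<Rightarrow> ('v \<Rightarrow> 'v \<Rightarrow> 'v) \<Rightarrow> 'v \<Rightarrow> 'v \<Rightarrow> 'v"
    by (rule vector_space_fun_scale[OF vector_space_fun_scale[OF smul_vector_space]])
  interpret q: vector_space_pair "fun_scale (*) :: 'k \<Rightarrow> ('v \<Rightarrow> 'k) \<Rightarrow> 'v \<Rightarrow> 'k"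
    "fun_scale (fun_scale (smul C)) :: 'k \<Rightarrow> ('v \<Rightarrow> 'v \<Rightarrow> 'v) \<Rightarrow> 'v \<Rightarrow> 'v \<Rightarrow> 'v" by unfold_locales
  have lin: "linear_on_sub (fun_scale (*)) (fun_scale (fun_scale (smul C))) (derivations i j) (cocycle_of i j)"
    by (auto simp: linear_on_sub_def cocycle_of_def fun_eq_iff distrib_left distrib_right mult_ac vs.scale_left_distrib)
  have inj: "\<delta> = 0" if "\<delta> \<in> derivations i j" "cocycle_of i j \<delta> = 0" for \<delta>
  proof
    fix a
    have "cocycle_of i j \<delta> (gen i) a = 0" using that(2) by simp
    then have "\<delta> a = 0" if "a \<in> homs C T T"
      using that coef_gen[of i 1] gen_nonzero[of j] by (simp add: cocycle_of_in gen_in)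
    then show "\<delta> a = 0 a" using \<open>\<delta> \<in> derivations i j\<close> by (auto simp: derivations_def dual_space_def)
  qed
  have sub: "range (inner_derivation i j) \<subseteq> derivations i j" using inner_derivation by blast
  have "f.subspace (range (inner_derivation i j))"
  proof -
    have "range (inner_derivation i j) = range (\<lambda>c. fun_scale (*) c (inner_derivation i j 1))"
      by (rule image_cong[OF refl]) (auto simp: inner_derivation_def fun_eq_iff)
    then show ?thesis using f.subspace_span[of "{inner_derivation i j 1}"] by (simp add: f.span_singleton)
  qed
  then have fin: "finite_dim_sub (fun_scale (*)) (range (inner_derivation i j))"
    by (rule f.finite_dim_sub_subset[OF derivations_fin _ sub])
  have "g.dim (ext_cocycles C T (S i) (S j)) = f.dim (derivations i j)"
    unfolding ext_cocycles_eq by (rule q.dim_inj_image[OF derivations_fin lin inj])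
  moreover have "g.dim (ext_coboundaries C T (S i) (S j)) = f.dim (range (inner_derivation i j))"
    unfolding ext_coboundaries_eq
    by (rule q.dim_inj_image[OF fin linear_on_sub_subset[OF lin sub]]) (use inj sub in blast)
  moreover have eq: "(\<lambda>k c x a. smul C k (c x a)) = fun_scale (fun_scale (smul C))" by (intro ext) simp
  ultimately show ?thesis using dim_derivations[of i j] unfolding dim_ext1_def eq by simp
qed

text \<open>The idempotent of T_i acts as 1 on \<open>S i\<close> and as 0 on
  \<open>S j\<close>.\<close>

lemma dim_hom_simples:
  assumes "i \<noteq> j"
  shows "dim_hom C T (S i) (S j) = 0"
proof -
  interpret g: vector_space "fun_scale (smul C) :: 'k \<Rightarrow> ('v \<Rightarrow> 'v) \<Rightarrow> 'v \<Rightarrow> 'v"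
    by (rule vector_space_fun_scale[OF smul_vector_space])
  have "f = 0" if f: "f \<in> mod_hom C T (S i) (S j)" for f
  proof
    fix x
    show "f x = 0 x"
    proof (cases "x \<in> mcar (S i)")
      case True
      have "f (mact (S i) x (\<iota> i \<star> \<pi> i)) = mact (S j) (f x) (\<iota> i \<star> \<pi> i)" "f x \<in> mcar (S j)"
        using f True idem_in_homs by (auto simp: mod_hom_def)
      then show ?thesis using mact_S[OF idem_in_homs True] mact_S[OF idem_in_homs] chiT_idem assms by simp
    next
      case False
      then show ?thesis using f by (simp add: mod_hom_def)
    qed
  qed
  moreover have "mact (S j) 0 a = 0" if "a \<in> homs C T T" for a
    using mact_S[OF that, of 0 j] S_scale[OF gen_in, of 0 j] by simp
  then have "0 \<in> mod_hom C T (S i) (S j)"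
    using S_scale[OF gen_in, of 0 j] by (auto simp: mod_hom_def linear_on_sub_def)
  ultimately have "mod_hom C T (S i) (S j) = {0}" by blast
  moreover have eq: "(\<lambda>k f x. smul C k (f x)) = fun_scale (smul C)" by (intro ext) simp
  ultimately show ?thesis unfolding dim_hom_def eq by simp
qed

text \<open>The Hom terms vanish for i \<noteq> j, and for i = j everything cancels; only arrow
  counts remain.\<close>

lemma euler_form_a_simples:
  "euler_form_a C T (S i) (S j) =
    (int (vs.dim (rad i j)) - int (vs.dim (rad2 i j))) - (int (vs.dim (rad j i)) - int (vs.dim (rad2 j i)))"
  using dim_hom_simples[of i j] dim_hom_simples[of j i]
  by (cases "i = j") (simp_all add: euler_form_a_def euler_form_def dim_ext1_simples)

end

section \<open>Multiplicities in the exchange triangles\<close>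

context tilting_category
begin

text \<open>The radical of Hom(T_j, X), described through the residue pairing with Hom(X, T_j). This
  form refers to no decomposition of \<open>X\<close>, and \<open>rad_from\<close> is the other
  radical of the same pairing.\<close>

definition rad_into :: "'n \<Rightarrow> 'o \<Rightarrow> 'v set" where
  "rad_into j X = {g \<in> homs C (Ti j) X. \<forall>k\<in>homs C X (Ti j). chi (Ti j) (k \<star> g) = 0}"

definition rad_from :: "'o \<Rightarrow> 'n \<Rightarrow> 'v set" where
  "rad_from X j = {k \<in> homs C X (Ti j). \<forall>g\<in>homs C (Ti j) X. chi (Ti j) (k \<star> g) = 0}"

lemma chi_compo_linear_right:
  assumes "k \<in> homs C X (Ti j)"
  shows "linear_on_sub (smul C) (*) (homs C (Ti j) X) (\<lambda>g. chi (Ti j) (k \<star> g))"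
  unfolding linear_on_sub_def
  using compo_add_right[OF assms] compo_smul_right[OF assms] compo_in_homs[OF assms]
    chi_add[OF Ti_indecomposable] chi_smul[OF Ti_indecomposable] by simp

lemma chi_compo_linear_left:
  assumes "g \<in> homs C (Ti j) X"
  shows "linear_on_sub (smul C) (*) (homs C X (Ti j)) (\<lambda>k. chi (Ti j) (k \<star> g))"
  unfolding linear_on_sub_def
  using compo_add_left[OF assms] compo_smul_left[OF assms] compo_in_homs[OF _ assms]
    chi_add[OF Ti_indecomposable] chi_smul[OF Ti_indecomposable] by simp

lemma rad_into_subspace: "vs.subspace (rad_into j X)"
proof (rule vs.subspaceI)
  show "0 \<in> rad_into j X"
    using vk.linear_on_sub_0[OF homs_subspace chi_compo_linear_right] by (simp add: rad_into_def)
qed (auto simp: rad_into_def add_in_homs smul_in_homs linear_on_sub_add[OF chi_compo_linear_right]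
    linear_on_sub_scale[OF chi_compo_linear_right])

lemma rad_from_subspace: "vs.subspace (rad_from X j)"
proof (rule vs.subspaceI)
  show "0 \<in> rad_from X j"
    using vk.linear_on_sub_0[OF homs_subspace chi_compo_linear_left] by (simp add: rad_from_def)
qed (auto simp: rad_from_def add_in_homs smul_in_homs linear_on_sub_add[OF chi_compo_linear_left]
    linear_on_sub_scale[OF chi_compo_linear_left])

lemma rad_into_fin: "finite_dim_sub (smul C) (rad_into j X)"
  by (rule vs.finite_dim_sub_subset[OF fin_homs rad_into_subspace]) (auto simp: rad_into_def)

lemma rad_into_I:
  assumes "h \<in> homs C (Ti m) X" "f \<in> rad j m"
  shows "h \<star> f \<in> rad_into j X"
proof -
  note f = rad_in_homs[OF assms(2)]
  have "chi (Ti j) (k \<star> (h \<star> f)) = 0" if k: "k \<in> homs C X (Ti j)" for k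
    using rad_compo_left[OF assms(2) compo_in_homs[OF k assms(1)]] compo_assoc[OF k assms(1) f]
    by (simp add: rad_def)
  then show ?thesis using compo_in_homs[OF assms(1) f] by (simp add: rad_into_def)
qed

lemma rad_from_I:
  assumes "g \<in> rad m j" "h \<in> homs C X (Ti m)"
  shows "g \<star> h \<in> rad_from X j"
proof -
  note g = rad_in_homs[OF assms(1)]
  have "chi (Ti j) ((g \<star> h) \<star> x) = 0" if x: "x \<in> homs C (Ti j) X" for x
    using rad_compo_right[OF compo_in_homs[OF assms(2) x] assms(1)] compo_assoc[OF g assms(2) x]
    by (simp add: rad_def)
  then show ?thesis using compo_in_homs[OF g assms(2)] by (simp add: rad_from_def)
qed

lemma rad_into_compo:
  assumes "g \<in> rad_into j X" "h \<in> homs C X (Ti m)"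
  shows "h \<star> g \<in> rad j m"
  using assms compo_in_homs[OF assms(2), of g "Ti j"] by (auto simp: rad_def rad_into_def)

lemma rad_from_compo:
  assumes "k \<in> rad_from X j" "h \<in> homs C (Ti m) X"
  shows "k \<star> h \<in> rad m j"
  using assms compo_in_homs[OF _ assms(2), of k "Ti j"] by (auto simp: rad_def rad_from_def)

lemma dim_homs_Ti: "vs.dim (homs C (Ti j) (Ti l)) = vs.dim (rad j l) + (if l = j then 1 else 0)"
proof (cases "l = j")
  case True
  have "vs.dim (homs C (Ti j) (Ti j)) = vs.dim (rad j j) + 1"
  proof (rule vs.dim_codim_one[OF fin_homs rad_subspace rad_subset ident_in_homs])
    show "ident C (Ti j) \<notin> rad j j" using chi_ident[OF Ti_indecomposable] by (simp add: rad_def)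
    fix f assume f: "f \<in> homs C (Ti j) (Ti j)"
    show "\<exists>c. f - smul C c (ident C (Ti j)) \<in> rad j j"
      using chi_decomp[OF Ti_indecomposable f] diff_in_homs[OF f smul_in_homs[OF ident_in_homs]]
      by (auto simp: rad_def)
  qed
  then show ?thesis using True by simp
next
  case False
  then have "rad j l = homs C (Ti j) (Ti l)" by (auto simp: rad_def)
  then show ?thesis using False by simp
qed

text \<open>Modulo radicals, each copy of T_j in \<open>X\<close> contributes one dimension to
  Hom(T_j, X) and the other summands contribute none.\<close>

lemma dim_rad_into:
  assumes "add_class C Ti X a"
  shows "vs.dim (homs C (Ti j) X) = vs.dim (rad_into j X) + a j"
proof -
  let ?I = "{(j, r). r < a j}"
  obtain emb prj where D: "dsum_maps ?I (\<lambda>p. Ti (fst p)) X emb prj" using add_classE[OF assms] .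
  note h = dsum_maps_in_homs[OF D]
  have "vs.dim (homs C (Ti j) X) = (\<Sum>q\<in>?I. vs.dim (homs C (Ti j) (Ti (fst q))))"
  proof (rule vs.dim_direct_sum[OF finite_mult_index fin_homs homs_subspace,
        where \<phi> = "\<lambda>q x. prj q \<star> x" and \<psi> = "\<lambda>q x. emb q \<star> x"])
    fix q assume q: "q \<in> ?I"
    show "linear_on_sub (smul C) (smul C) (homs C (Ti j) X) (\<lambda>x. prj q \<star> x) \<and>
        (\<lambda>x. prj q \<star> x) ` homs C (Ti j) X \<subseteq> homs C (Ti j) (Ti (fst q))"
      using compo_linear_right[OF h(2)[OF q]] compo_in_homs[OF h(2)[OF q]] by blast
    show "linear_on_sub (smul C) (smul C) (homs C (Ti j) (Ti (fst q))) (\<lambda>x. emb q \<star> x) \<and>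
        (\<lambda>x. emb q \<star> x) ` homs C (Ti j) (Ti (fst q)) \<subseteq> homs C (Ti j) X"
      using compo_linear_right[OF h(1)[OF q]] compo_in_homs[OF h(1)[OF q]] by blast
  next
    fix q r x assume "q \<in> ?I" "r \<in> ?I" "x \<in> homs C (Ti j) (Ti (fst r))"
    then show "prj q \<star> (emb r \<star> x) = (if q = r then x else 0)" using prj_compo_inj[OF D] by blast
  next
    fix x assume "x \<in> homs C (Ti j) X"
    then show "(\<Sum>q\<in>?I. emb q \<star> (prj q \<star> x)) = x" by (rule dsum_decomp_target[OF D])
  qed
  moreover have "vs.dim (rad_into j X) = (\<Sum>q\<in>?I. vs.dim (rad j (fst q)))"
  proof (rule vs.dim_direct_sum[OF finite_mult_index rad_into_fin rad_subspace,
        where \<phi> = "\<lambda>q x. prj q \<star> x" and \<psi> = "\<lambda>q x. emb q \<star> x"])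
    fix q assume q: "q \<in> ?I"
    show "linear_on_sub (smul C) (smul C) (rad_into j X) (\<lambda>x. prj q \<star> x) \<and>
        (\<lambda>x. prj q \<star> x) ` rad_into j X \<subseteq> rad j (fst q)"
    proof
      show "linear_on_sub (smul C) (smul C) (rad_into j X) (\<lambda>x. prj q \<star> x)"
        by (rule linear_on_sub_subset[OF compo_linear_right[OF h(2)[OF q]]]) (auto simp: rad_into_def)
    qed (rule image_subsetI, rule rad_into_compo[OF _ h(2)[OF q]])
    show "linear_on_sub (smul C) (smul C) (rad j (fst q)) (\<lambda>x. emb q \<star> x) \<and>
        (\<lambda>x. emb q \<star> x) ` rad j (fst q) \<subseteq> rad_into j X"
    proof
      show "linear_on_sub (smul C) (smul C) (rad j (fst q)) (\<lambda>x. emb q \<star> x)"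
        by (rule linear_on_sub_subset[OF compo_linear_right[OF h(1)[OF q]] rad_subset])
    qed (rule image_subsetI, rule rad_into_I[OF h(1)[OF q]])
  next
    fix q r x assume "q \<in> ?I" "r \<in> ?I" "x \<in> rad j (fst r)"
    then show "prj q \<star> (emb r \<star> x) = (if q = r then x else 0)"
      using prj_compo_inj[OF D _ _ rad_in_homs] by blast
  next
    fix x assume "x \<in> rad_into j X"
    then have "x \<in> homs C (Ti j) X" by (simp add: rad_into_def)
    then show "(\<Sum>q\<in>?I. emb q \<star> (prj q \<star> x)) = x" by (rule dsum_decomp_target[OF D])
  qed
  moreover have "(\<Sum>q\<in>?I. vs.dim (homs C (Ti j) (Ti (fst q)))) =
      (\<Sum>q\<in>?I. vs.dim (rad j (fst q))) + (\<Sum>q\<in>?I. if fst q = j then 1 else 0)"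
    by (simp only: dim_homs_Ti sum.distrib)
  moreover have "(\<Sum>q\<in>?I. if fst q = j then 1 else 0 :: nat) = a j"
  proof -
    have "(\<Sum>q\<in>?I. if fst q = j then 1 else 0 :: nat) = (\<Sum>l\<in>UNIV. of_nat (a l) * (if l = j then 1 else 0))"
      using sum_mult_index[where a = a and h = "\<lambda>l. if l = j then 1 else 0 :: nat"] .
    also have "\<dots> = (\<Sum>l\<in>UNIV. if l = j then a l else 0)" by (rule sum.cong) auto
    finally show ?thesis by simp
  qed
  ultimately show ?thesis by simp
qed

text \<open>The two radicals of a pairing have equal codimension, so the count for
  \<open>rad_into\<close> carries over.\<close>

lemma dim_rad_from:
  assumes "add_class C Ti X a"
  shows "vs.dim (homs C X (Ti j)) = vs.dim (rad_from X j) + a j"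
proof -
  have "vs.dim (homs C (Ti j) X) + vs.dim {k \<in> homs C X (Ti j). \<forall>g\<in>homs C (Ti j) X. chi (Ti j) (k \<star> g) = 0} =
      vs.dim {g \<in> homs C (Ti j) X. \<forall>k\<in>homs C X (Ti j). chi (Ti j) (k \<star> g) = 0} + vs.dim (homs C X (Ti j))"
    by (rule vp.pairing_dim[OF fin_homs fin_homs chi_compo_linear_left chi_compo_linear_right])
  then show ?thesis
    using dim_rad_into[OF assms, of j] by (simp add: rad_into_def rad_from_def)
qed

end

text \<open>Both sides differ from \<open>b j\<close> and \<open>b' j\<close> by the rank of the pairing \<open>(k, g) \<mapsto> \<chi>(k (\<beta>\<gamma>) g)\<close> on
  \<open>Hom(B', T\<^sub>j) \<times> Hom(T\<^sub>j, B)\<close>, which vanishes for minimal triangles.\<close>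

lemma (in exchange_triangles) multiplicity_difference:
  "int (b j) - int (b' j) = (int (vs.dim (rad i j)) - int (vs.dim (rad2 i j)))
    - (int (vs.dim (rad j i)) - int (vs.dim (rad2 j i)))"
proof -
  let ?c = "\<beta> \<star> \<gamma>" and ?\<chi> = "chi (Ti j)"
  let ?P = "homs C (Ti j) B" and ?P' = "homs C (Ti j) B'"
  let ?K = "homs C B (Ti j)" and ?K' = "homs C B' (Ti j)"
  \<comment> \<open>Maps whose composite with \<open>d\<close> or \<open>s\<close> lies in the
    square of the radical; their codimension in the full Hom spaces is that of \<open>rad2\<close>
    in the radical.\<close>
  let ?Q' = "{g \<in> ?P'. d \<star> g \<in> rad2 j i}" and ?Q = "{k \<in> ?K. k \<star> s \<in> rad2 i j}"
  let ?L = "{k \<in> ?K'. \<forall>g\<in>?P. ?\<chi> (k \<star> (?c \<star> g)) = 0}"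
  let ?R = "{g \<in> ?P. \<forall>k\<in>?K'. ?\<chi> (k \<star> (?c \<star> g)) = 0}"
  note c = \<beta>\<gamma>_in_homs and dh = sink_in_homs(2) and sh = source_in_homs(1)
  obtain emb' prj' where D': "dsum_maps {(j, r). r < b' j} (\<lambda>p. Ti (fst p)) B' emb' prj'"
    using add_classE[OF B'_add] .
  obtain emb prj where D: "dsum_maps {(j, r). r < b j} (\<lambda>p. Ti (fst p)) B emb prj"
    using add_classE[OF B_add] .
  note h' = dsum_maps_in_homs[OF D'] and h = dsum_maps_in_homs[OF D]
  have linQ': "vs.subspace ?Q'"
    by (rule vp.linear_on_sub_vimage_subspace[OF homs_subspace compo_linear_right[OF dh] rad2_subspace])
  have finQ': "finite_dim_sub (smul C) ?Q'" by (rule vs.finite_dim_sub_subset[OF fin_homs linQ']) blast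
  have linQ: "vs.subspace ?Q"
    by (rule vp.linear_on_sub_vimage_subspace[OF homs_subspace compo_linear_left[OF sh] rad2_subspace])
  have finQ: "finite_dim_sub (smul C) ?Q" by (rule vs.finite_dim_sub_subset[OF fin_homs linQ]) blast
  have dimQ': "vs.dim ?P' + vs.dim (rad2 j i) = vs.dim ?Q' + vs.dim (rad j i)"
    using vp.dim_vimage[OF fin_homs compo_linear_right[OF dh] rad2_subspace, of j i "Ti j"] rad2_subset_rad
    by (simp add: sink_image)
  have dimQ: "vs.dim ?K + vs.dim (rad2 i j) = vs.dim ?Q + vs.dim (rad i j)"
    using vp.dim_vimage[OF fin_homs compo_linear_left[OF sh] rad2_subspace, of i j "Ti j"] rad2_subset_rad
    by (simp add: source_image)
  have into_Q': "rad_into j B' \<subseteq> ?Q'"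
  proof
    fix g assume g: "g \<in> rad_into j B'"
    then have gh: "g \<in> ?P'" by (simp add: rad_into_def)
    have "d \<star> g = (\<Sum>q\<in>{(j, r). r < b' j}. ((d \<star> emb' q) \<star> prj' q) \<star> g)"
      using dsum_decomp_source[OF D' dh] compo_sum_left[OF gh, of "{(j, r). r < b' j}" "\<lambda>q. (d \<star> emb' q) \<star> prj' q" "Ti i"]
        compo_in_homs[OF compo_in_homs[OF dh h'(1)] h'(2)] by simp
    also have "\<dots> = (\<Sum>q\<in>{(j, r). r < b' j}. (d \<star> emb' q) \<star> (prj' q \<star> g))"
      by (rule sum.cong[OF refl]) (rule compo_assoc[OF compo_in_homs[OF dh h'(1)] h'(2) gh])
    also have "\<dots> \<in> rad2 j i"
    proof (rule vs.subspace_sum[OF rad2_subspace])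
      fix q assume q: "q \<in> {(j, r). r < b' j}"
      have "d \<star> emb' q \<in> rad (fst q) i" using sink_image[of "fst q"] h'(1)[OF q] by blast
      then show "(d \<star> emb' q) \<star> (prj' q \<star> g) \<in> rad2 j i" by (rule rad2_I[OF rad_into_compo[OF g h'(2)[OF q]]])
    qed
    finally show "g \<in> ?Q'" using gh by simp
  qed
  have from_Q: "rad_from B j \<subseteq> ?Q"
  proof
    fix k assume k: "k \<in> rad_from B j"
    then have kh: "k \<in> ?K" by (simp add: rad_from_def)
    have "k \<star> s = (\<Sum>q\<in>{(j, r). r < b j}. k \<star> (emb q \<star> (prj q \<star> s)))"
      using dsum_decomp_target[OF D sh] compo_sum_right[OF kh, of "{(j, r). r < b j}" "\<lambda>q. emb q \<star> (prj q \<star> s)" "Ti i"]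
        compo_in_homs[OF h(1) compo_in_homs[OF h(2) sh]] by simp
    also have "\<dots> = (\<Sum>q\<in>{(j, r). r < b j}. (k \<star> emb q) \<star> (prj q \<star> s))"
      by (rule sum.cong[OF refl]) (rule compo_assoc[OF kh h(1) compo_in_homs[OF h(2) sh], symmetric])
    also have "\<dots> \<in> rad2 i j"
    proof (rule vs.subspace_sum[OF rad2_subspace])
      fix q assume q: "q \<in> {(j, r). r < b j}"
      have "prj q \<star> s \<in> rad i (fst q)" using source_image[of "fst q"] h(2)[OF q] by blast
      then show "(k \<star> emb q) \<star> (prj q \<star> s) \<in> rad2 i j" by (rule rad2_I) (rule rad_from_compo[OF k h(1)[OF q]])
    qed
    finally show "k \<in> ?Q" using kh by simp
  qed
  \<comment> \<open>Composites of \<open>d\<close> with radical maps already cover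
    \<open>rad2 j i\<close>, and by \<open>sink_kernel\<close> the maps killed by \<open>d\<close>
    factor through \<open>?c\<close>.\<close>
  have Q'_decomp: "\<exists>g1\<in>rad_into j B'. \<exists>g2\<in>?P. g = g1 + ?c \<star> g2" if g: "g \<in> ?Q'" for g
  proof -
    have "rad2 j i \<subseteq> (\<lambda>g. d \<star> g) ` rad_into j B'"
    proof (rule rad2_subset)
      have "linear_on_sub (smul C) (smul C) (rad_into j B') (\<lambda>g. d \<star> g)"
        by (rule linear_on_sub_subset[OF compo_linear_right[OF dh]]) (auto simp: rad_into_def)
      then show "vs.subspace ((\<lambda>g. d \<star> g) ` rad_into j B')"
        by (rule vp.linear_on_sub_image_subspace[OF rad_into_subspace])
      fix m f f' assume f: "f \<in> rad j m" and f': "f' \<in> rad m i"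
      then obtain x where x: "x \<in> homs C (Ti m) B'" "f' = d \<star> x" using sink_image[of m] by blast
      then show "f' \<star> f \<in> (\<lambda>g. d \<star> g) ` rad_into j B'"
        using compo_assoc[OF dh x(1) rad_in_homs[OF f]] rad_into_I[OF x(1) f] by blast
    qed
    then obtain g1 where g1: "g1 \<in> rad_into j B'" "d \<star> g = d \<star> g1" using g by blast
    have gh: "g \<in> ?P'" "g1 \<in> ?P'" using g g1(1) by (auto simp: rad_into_def)
    have "d \<star> (g - g1) = 0" using compo_diff_right[OF dh gh] g1(2) by simp
    then obtain g2 where "g2 \<in> ?P" "?c \<star> g2 = g - g1" using sink_kernel diff_in_homs[OF gh] by blast
    then show ?thesis by (intro bexI[OF _ g1(1)] bexI[of _ g2]) simp_all
  qed
  have Q_decomp: "\<exists>k1\<in>rad_from B j. \<exists>k2\<in>?K'. k = k1 + k2 \<star> ?c" if k: "k \<in> ?Q" for k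
  proof -
    have "rad2 i j \<subseteq> (\<lambda>k. k \<star> s) ` rad_from B j"
    proof (rule rad2_subset)
      have "linear_on_sub (smul C) (smul C) (rad_from B j) (\<lambda>k. k \<star> s)"
        by (rule linear_on_sub_subset[OF compo_linear_left[OF sh]]) (auto simp: rad_from_def)
      then show "vs.subspace ((\<lambda>k. k \<star> s) ` rad_from B j)"
        by (rule vp.linear_on_sub_image_subspace[OF rad_from_subspace])
      fix m f f' assume f: "f \<in> rad i m" and f': "f' \<in> rad m j"
      then obtain x where x: "x \<in> homs C B (Ti m)" "f = x \<star> s" using source_image[of m] by blast
      then show "f' \<star> f \<in> (\<lambda>k. k \<star> s) ` rad_from B j"
        using compo_assoc[OF rad_in_homs[OF f'] x(1) sh] rad_from_I[OF f' x(1)] by (metis imageI)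
    qed
    then obtain k1 where k1: "k1 \<in> rad_from B j" "k \<star> s = k1 \<star> s" using k by blast
    have kh: "k \<in> ?K" "k1 \<in> ?K" using k k1(1) by (auto simp: rad_from_def)
    have "(k - k1) \<star> s = 0" using compo_diff_left[OF sh kh] k1(2) by simp
    then obtain k2 where "k2 \<in> ?K'" "k2 \<star> ?c = k - k1" using source_kernel diff_in_homs[OF kh] by blast
    then show ?thesis by (intro bexI[OF _ k1(1)] bexI[of _ k2]) simp_all
  qed
  have radQ': "{g \<in> ?Q'. \<forall>k\<in>?K'. ?\<chi> (k \<star> g) = 0} = rad_into j B'"
    using into_Q' by (auto simp: rad_into_def)
  have radQ: "{k \<in> ?Q. \<forall>g\<in>?P. ?\<chi> (k \<star> g) = 0} = rad_from B j"
    using from_Q by (auto simp: rad_from_def)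
  \<comment> \<open>Radical summands pair to zero with everything, so orthogonality to
    \<open>?Q'\<close> need only be tested on maps through \<open>?c\<close>.\<close>
  have leftQ': "{k \<in> ?K'. \<forall>g\<in>?Q'. ?\<chi> (k \<star> g) = 0} = ?L"
  proof (intro equalityI subsetI)
    fix k assume k: "k \<in> {k \<in> ?K'. \<forall>g\<in>?Q'. ?\<chi> (k \<star> g) = 0}"
    have "?c \<star> g \<in> ?Q'" if g: "g \<in> ?P" for g
      using compo_in_homs[OF c g] compo_assoc[OF dh c g] d_\<beta>\<gamma> compo_zero_left[OF g]
        vs.subspace_0[OF rad2_subspace] by simp
    then show "k \<in> ?L" using k by simp
  next
    fix k assume "k \<in> ?L"
    then have k: "k \<in> ?K'" "\<And>g. g \<in> ?P \<Longrightarrow> ?\<chi> (k \<star> (?c \<star> g)) = 0" by auto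
    have "?\<chi> (k \<star> g) = 0" if g: "g \<in> ?Q'" for g
    proof -
      obtain g1 g2 where g12: "g1 \<in> rad_into j B'" "g2 \<in> ?P" "g = g1 + ?c \<star> g2" using Q'_decomp[OF g] by blast
      have "g1 \<in> ?P'" "?\<chi> (k \<star> g1) = 0" using g12(1) k(1) by (auto simp: rad_into_def)
      then show ?thesis
        using linear_on_sub_add[OF chi_compo_linear_right[OF k(1)] _ compo_in_homs[OF c g12(2)]] k(2)[OF g12(2)]
          g12(3) by simp
    qed
    then show "k \<in> {k \<in> ?K'. \<forall>g\<in>?Q'. ?\<chi> (k \<star> g) = 0}" using k(1) by blast
  qed
  have rightQ: "{g \<in> ?P. \<forall>k\<in>?Q. ?\<chi> (k \<star> g) = 0} = ?R"
  proof (intro equalityI subsetI)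
    fix g assume g: "g \<in> {g \<in> ?P. \<forall>k\<in>?Q. ?\<chi> (k \<star> g) = 0}"
    have "?\<chi> (k \<star> (?c \<star> g)) = 0" if k: "k \<in> ?K'" for k
    proof -
      have "k \<star> ?c \<in> ?Q"
        using compo_in_homs[OF k c] compo_assoc[OF k c sh] \<beta>\<gamma>_s compo_zero_right[OF k]
          vs.subspace_0[OF rad2_subspace] by simp
      then show ?thesis using g compo_assoc[OF k c, of g "Ti j"] by auto
    qed
    then show "g \<in> ?R" using g by blast
  next
    fix g assume "g \<in> ?R"
    then have g: "g \<in> ?P" "\<And>k. k \<in> ?K' \<Longrightarrow> ?\<chi> (k \<star> (?c \<star> g)) = 0" by auto
    have "?\<chi> (k \<star> g) = 0" if k: "k \<in> ?Q" for k
    proof -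
      obtain k1 k2 where k12: "k1 \<in> rad_from B j" "k2 \<in> ?K'" "k = k1 + k2 \<star> ?c" using Q_decomp[OF k] by blast
      have k1: "k1 \<in> ?K" "?\<chi> (k1 \<star> g) = 0" using k12(1) g(1) by (auto simp: rad_from_def)
      have "?\<chi> ((k2 \<star> ?c) \<star> g) = 0" using g(2)[OF k12(2)] compo_assoc[OF k12(2) c g(1)] by simp
      then show ?thesis
        using linear_on_sub_add[OF chi_compo_linear_left[OF g(1)] k1(1) compo_in_homs[OF k12(2) c]] k1(2)
          k12(3) by simp
    qed
    then show "g \<in> {g \<in> ?P. \<forall>k\<in>?Q. ?\<chi> (k \<star> g) = 0}" using g(1) by blast
  qed
  \<comment> \<open>Three pairings are counted: \<open>?K'\<close> with \<open>?Q'\<close>,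
    \<open>?Q\<close> with \<open>?P\<close>, and \<open>?K'\<close> with \<open>?P\<close> through
    \<open>?c\<close>. The first shares the radical \<open>?L\<close> with the third, the second
    shares \<open>?R\<close>, so all three have the same rank.\<close>
  have "vs.dim ?Q' + vs.dim {k \<in> ?K'. \<forall>g\<in>?Q'. ?\<chi> (k \<star> g) = 0} =
      vs.dim {g \<in> ?Q'. \<forall>k\<in>?K'. ?\<chi> (k \<star> g) = 0} + vs.dim ?K'"
  proof (rule vp.pairing_dim[OF fin_homs finQ'])
    fix g assume "g \<in> ?Q'"
    then show "linear_on_sub (smul C) (*) ?K' (\<lambda>k. ?\<chi> (k \<star> g))" using chi_compo_linear_left by blast
  next
    fix k assume "k \<in> ?K'"
    then show "linear_on_sub (smul C) (*) ?Q' (\<lambda>g. ?\<chi> (k \<star> g))"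
      by (rule linear_on_sub_subset[OF chi_compo_linear_right]) blast
  qed
  then have 1: "vs.dim ?Q' + vs.dim ?L = vs.dim (rad_into j B') + vs.dim ?K'"
    unfolding leftQ' radQ' .
  have "vs.dim ?P + vs.dim {k \<in> ?Q. \<forall>g\<in>?P. ?\<chi> (k \<star> g) = 0} =
      vs.dim {g \<in> ?P. \<forall>k\<in>?Q. ?\<chi> (k \<star> g) = 0} + vs.dim ?Q"
  proof (rule vp.pairing_dim[OF finQ fin_homs])
    fix g assume "g \<in> ?P"
    then show "linear_on_sub (smul C) (*) ?Q (\<lambda>k. ?\<chi> (k \<star> g))"
      by (rule linear_on_sub_subset[OF chi_compo_linear_left]) blast
  next
    fix k assume "k \<in> ?Q"
    then show "linear_on_sub (smul C) (*) ?P (\<lambda>g. ?\<chi> (k \<star> g))" using chi_compo_linear_right by blast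
  qed
  then have 2: "vs.dim ?P + vs.dim (rad_from B j) = vs.dim ?R + vs.dim ?Q"
    unfolding rightQ radQ .
  have 3: "vs.dim ?P + vs.dim ?L = vs.dim ?R + vs.dim ?K'"
  proof (rule vp.pairing_dim[OF fin_homs fin_homs])
    fix g assume g: "g \<in> ?P"
    show "linear_on_sub (smul C) (*) ?K' (\<lambda>k. ?\<chi> (k \<star> (?c \<star> g)))"
      by (rule chi_compo_linear_left[OF compo_in_homs[OF c g]])
  next
    fix k assume k: "k \<in> ?K'"
    show "linear_on_sub (smul C) (*) ?P (\<lambda>g. ?\<chi> (k \<star> (?c \<star> g)))"
      unfolding linear_on_sub_def
      using compo_add_right[OF c] compo_smul_right[OF c] compo_in_homs[OF c]
        linear_on_sub_add[OF chi_compo_linear_right[OF k]] linear_on_sub_scale[OF chi_compo_linear_right[OF k]]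
      by simp
  qed
  \<comment> \<open>With r the common rank, \<open>b' j\<close> is r plus the codimension of
    \<open>rad2 j i\<close> in \<open>rad j i\<close>, and \<open>b j\<close> is r plus that of
    \<open>rad2 i j\<close> in \<open>rad i j\<close>.\<close>
  show ?thesis
    using 1 2 3 dimQ dimQ' dim_rad_into[OF B'_add, of j] dim_rad_from[OF B_add, of j] by linarith
qed

section \<open>Exponents of the cluster character\<close>

lemma denom_exponent_le:
  assumes "\<And>a. a \<in> Poly_Mapping.keys P \<Longrightarrow> 0 \<le> a i + int m"
  shows "denom_exponent P i \<le> m"
  unfolding denom_exponent_def by (rule Least_le) (use assms in blast)

text \<open>Euler characteristics enter only as coefficients. They can make terms vanish but create
  no new exponents, so every exponent stems from an actual submodule, whichever function
  \<open>eul\<close> is used.\<close>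

lemma keys_cluster_char:
  assumes "a \<in> Poly_Mapping.keys (cluster_char eul C T Ti S M)"
  shows "\<exists>N. submodule C T (functor_G C T M) N \<and>
    a = (\<lambda>i. - coind C Ti M i + euler_form_K0 C T S i (dim_vec C T S (restr_mod (functor_G C T M) N)))"
proof -
  let ?E = "{e. submod_grass C T S (functor_G C T M) e \<noteq> {}}"
  let ?s = "\<lambda>e. Poly_Mapping.single (\<lambda>i. euler_form_K0 C T S i e)
    (eul (grass_space (smul C) (submod_grass C T S (functor_G C T M) e)))"
  obtain a1 a2 where a: "a = a1 + a2"
      "a1 \<in> Poly_Mapping.keys (Poly_Mapping.single (\<lambda>i. - coind C Ti M i) (1::int))"
      "a2 \<in> Poly_Mapping.keys (\<Sum>e\<in>?E. ?s e)"
    using assms keys_mult unfolding cluster_char_def by blast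
  have a1: "a1 = (\<lambda>i. - coind C Ti M i)" using a(2) by (simp split: if_splits)
  obtain e where e: "e \<in> ?E" "a2 \<in> Poly_Mapping.keys (?s e)"
    using a(3) Poly_Mapping.keys_sum[of ?s ?E] by blast
  have "a2 = (\<lambda>i. euler_form_K0 C T S i e)" using e(2) by (simp split: if_splits)
  then have "a = (\<lambda>i. - coind C Ti M i + euler_form_K0 C T S i e)"
    using a(1) a1 by (simp add: fun_eq_iff)
  moreover obtain N where "submodule C T (functor_G C T M) N"
    and N: "dim_vec C T S (restr_mod (functor_G C T M) N) = e"
    using e(1) by (auto simp: submod_grass_def)
  ultimately show ?thesis unfolding N[symmetric] by blast
qed

theorem proposition6p8:
  fixes C :: "('k::alg_closed_field, 'o, 'v::ab_group_add) tricat"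
    and T M :: 'o
    and Ti :: "'n::finite \<Rightarrow> 'o"
    and S :: "'n \<Rightarrow> 'v rmod"
    and i :: 'n
  assumes "triangulated_category C"
    and "hom_finite C"
    and "split_idempotents C"
    and "two_calabi_yau C"
    and "cluster_tilting C T"
    and "is_dsum C UNIV Ti T"
    and "\<And>j. indecomposable C (Ti j)"
    and "\<And>j j'. j \<noteq> j' \<Longrightarrow> \<not> isomorphic C (Ti j) (Ti j')"
    and "\<And>j. is_top C T (S j) (functor_G C T (Ti j))"
  shows "(\<forall>N. submodule C T (functor_G C T M) N \<longrightarrow>
            - coind C Ti M i
              + euler_form_K0 C T S i (dim_vec C T S (restr_mod (functor_G C T M) N))
            \<ge> - int (dim_vec C T S (functor_G C T M) i)) \<and>
         (\<forall>l. prime l \<and> of_nat l \<noteq> (0::'k) \<longrightarrow>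
            denom_exponent (cluster_char (ladic_euler l) C T Ti S M) i
            \<le> dim_vec C T S (functor_G C T M) i) \<and>
         (\<forall>\<sigma> :: 'k \<Rightarrow> complex. complex_iso \<sigma> \<longrightarrow>
            denom_exponent (cluster_char (top_euler \<sigma>) C T Ti S M) i
            \<le> dim_vec C T S (functor_G C T M) i)"
proof -
  interpret tri: triangulated_category C by (rule assms(1))
  obtain \<iota> \<pi> where T_dsum: "tri.dsum_maps UNIV Ti T \<iota> \<pi>"
    using assms(6) tri.is_dsum_iff by blast
  have S2: "(susp C ^^ 2) X = susp C (susp C X)" for X by (simp add: numeral_2_eq_2)
  obtain t where t:
    "\<forall>X. linear_on_sub (smul C) (*) (homs C X (susp C (susp C X))) (t X)"
    "\<forall>X Y. \<forall>f\<in>homs C Y (susp C (susp C X)). (\<forall>g\<in>homs C X Y. t X (f \<star>\<^bsub>C\<^esub> g) = 0) \<longrightarrow> f = 0"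
    "\<forall>X Y. \<forall>g\<in>homs C X Y. (\<forall>f\<in>homs C Y (susp C (susp C X)). t X (f \<star>\<^bsub>C\<^esub> g) = 0) \<longrightarrow> g = 0"
    using assms(4)[unfolded two_calabi_yau_def S2] by (elim exE conjE) (rule that)
  have fin: "hom_finite_category C"
    using assms(2,3) tri.linear_category_axioms
    by (simp add: hom_finite_category_def hom_finite_category_axioms_def)
  have rigid: "homs C T (susp C T) = {0}"
    and tilting: "\<And>X. homs C T (susp C X) = {0} \<Longrightarrow> in_add C T X"
    using assms(5) by (auto simp: cluster_tilting_def)
  have "tilting_category C T Ti \<iota> \<pi> t"
  proof (intro tilting_category.intro tilting_category_axioms.intro)
    fix X Y f assume "f \<in> homs C Y (susp C (susp C X))" "\<And>g. g \<in> homs C X Y \<Longrightarrow> t X (f \<star>\<^bsub>C\<^esub> g) = 0"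
    then show "f = 0" using t(2) by blast
  next
    fix X Y g assume "g \<in> homs C X Y" "\<And>f. f \<in> homs C Y (susp C (susp C X)) \<Longrightarrow> t X (f \<star>\<^bsub>C\<^esub> g) = 0"
    then show "g = 0" using t(3) by blast
  qed (use assms(1,7,8) fin T_dsum rigid tilting t(1) in simp_all)
  then have "tilting_simples C T Ti \<iota> \<pi> t S"
    using assms(9) by (simp add: tilting_simples_def tilting_simples_axioms_def)
  then interpret tilting_simples C T Ti \<iota> \<pi> t S .
  obtain B' b' U \<beta> d p where "sink_triangle C T Ti \<iota> \<pi> t i B' b' U \<beta> d p"
    using sink_triangle_exists[of i] by blast
  then interpret sink: sink_triangle C T Ti \<iota> \<pi> t i B' b' U \<beta> d p .
  obtain B b s \<gamma> \<epsilon> where "exchange_triangles C T Ti \<iota> \<pi> t i B' b' U \<beta> d p B b s \<gamma> \<epsilon>"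
    using sink.exchange_triangles_exist by blast
  then interpret ex: exchange_triangles C T Ti \<iota> \<pi> t i B' b' U \<beta> d p B b s \<gamma> \<epsilon> .
  have bound: "- int (dim_vec C T S (functor_G C T M) i) \<le>
      - coind C Ti M i + euler_form_K0 C T S i (dim_vec C T S (restr_mod (functor_G C T M) N))"
    if N: "submodule C T (functor_G C T M) N" for N
    using ex.coind_bound[OF N]
    by (simp add: euler_form_K0_def dim_vec_submodule[OF N] dim_vec_G ex.multiplicity_difference
        euler_form_a_simples)
  \<comment> \<open>Stated for arbitrary \<open>eul\<close>, this serves the l-adic and the
    topological version together.\<close>
  have "denom_exponent (cluster_char eul C T Ti S M) i \<le> dim_vec C T S (functor_G C T M) i" for eul
  proof (rule denom_exponent_le)
    fix a assume "a \<in> Poly_Mapping.keys (cluster_char eul C T Ti S M)"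
    from keys_cluster_char[OF this] obtain N where "submodule C T (functor_G C T M) N"
      "a = (\<lambda>i. - coind C Ti M i + euler_form_K0 C T S i (dim_vec C T S (restr_mod (functor_G C T M) N)))"
      by (elim exE conjE) (rule that)
    then show "0 \<le> a i + int (dim_vec C T S (functor_G C T M) i)" using bound[of N] by simp
  qed
  then show ?thesis using bound by simp
qed

end
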